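(* Let $p:(0,\infty)\to\mathbb{R}$ be a continuous function for which there are $\overline{\lambda}>0$, $c>0$ and $\beta>0$ such that $p$ is increasing on $[\overline{\lambda},\infty)$ and $|p(\lambda)-p(\lambda')|\ge c|\lambda-\lambda'|^\beta$ for all $\lambda,\lambda'\ge\overline{\lambda}$. Let $\chi$ be a continuous real-valued function on $X$ and let $H=p(-\Delta)+[\chi]$. Let $\{\lambda_j\}$ be an increasing sequence of $6$-series eigenvalues of $-\Delta$, with $\lambda_j$ of generation of birth $j$, such that the separation between $\lambda_j$ and the next higher and next lower eigenvalues of $-\Delta$ grows exponentially in $j$. For $j$ large, let $\nu_1^j,\dots,\nu_{d_j}^j$ be the eigenvalues of $H$ in the $p(\lambda_j)$ cluster and let $$\Psi_j=\frac{1}{d_j}\sum_{i=1}^{d_j}\delta_{\nu_i^j-p(\lambda_j)}$$ be the characteristic measure of the cluster. Then the sequence $\{\Psi_j\}$ converges weakly to the measure $\Psi_0$ (the pullback of $\mu$ under $\chi$) defined by $$\langle\Psi_0,f\rangle=\int_X f(\chi(x))\,d\mu(x)$$ for all continuous functions $f$ on $[\min\chi,\max\chi]$; that is, $\langle \Psi_j,f\rangle\to\langle\Psi_0,f\rangle$ for all such $f$.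
   Context: The Sierpinski gasket and its Laplacian. $X\subset\mathbb{R}^2$ is the Sierpinski gasket: the unique nonempty compact set with $X=\bigcup_{j=1}^3F_j(X)$, where $F_j(x)=\frac12(x-a_j)+a_j$ and $a_1,a_2,a_3$ are non-collinear. For a word $w=w_1\cdots w_N$ in $\{1,2,3\}$, $F_w=F_{w_1}\circ\cdots\circ F_{w_N}$, and $F_w(X)$ is called an $N$-cell; $\mu$ is the unique Borel probability measure on $X$ giving each $N$-cell measure $3^{-N}$. Let $V_0=\{a_1,a_2,a_3\}$, $V_m=\bigcup_jF_j(V_{m-1})$, and $x\sim_m y$ if $x\neq y$ both lie in $F_w(V_0)$ for some word $w$ of length $m$. $\mathcal{E}$ is the standard self-similar symmetric resistance form $\mathcal{E}(u,u)=\lim_m(5/3)^m\sum_{x\sim_m y}(u(x)-u(y))^2$ (sum over unordered edges), with domain $\mathcal{F}\subset C(X)$. $\Delta$ is the Dirichlet Laplacian: the negative definite self-adjoint operator on $L^2(\mu)$ determined by $\mathcal{E}(u,v)=\int(-\Delta u)v\,d\mu$ for all $v\in\mathcal{F}$ with $v(a_1)=v(a_2)=v(a_3)=0$ (for $u\in\mathcal F$ also vanishing at the $a_j$). The spectrum $\operatorname{sp}(-\Delta)\subset(0,\infty)$ consists of eigenvalues of finite multiplicity accumulating only at $\infty$, with an orthonormal basis of real eigenfunctions of $L^2(\mu)$. Series and generation of birth (spectral decimation). Every eigenvalue $\lambda$ of $-\Delta$ is $\lambda=\frac32\lim_{m\to\infty}5^m\lambda^{(m)}$ for a unique sequence $(\lambda^{(m)})_{m\ge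 j}$, $j\ge1$, with $\lambda^{(j)}\in\{2,5,6\}$ (value $2$ only if $j=1$, value $6$ only if $j\ge2$), $\lambda^{(m)}(5-\lambda^{(m)})=\lambda^{(m-1)}$ and $\lambda^{(m)}\notin\{2,5,6\}$ for $m>j$, the smaller root being taken for all but finitely many $m$. Then $\lambda$ is called a $2$-, $5$- or $6$-series eigenvalue according to the value of $\lambda^{(j)}$, and $j$ is its generation of birth. The eigenspace of a $6$-series eigenvalue of generation of birth $j\ge2$ has dimension $(3^j-3)/2$. For the given sequence, $E_j$ is the eigenspace of $\lambda_j$ and $d_j=\dim E_j=(3^j-3)/2$. Conventions. $[\chi]$ is multiplication by $\chi$ on $L^2(\mu)$; $p(-\Delta)$ is defined by the functional calculus, $p(-\Delta)\varphi=p(\lambda)\varphi$ for an eigenfunction $\varphi$ of $-\Delta$ with eigenvalue $\lambda$. "Grows exponentially" means that there are $a>0$ and $b>1$ with $|\lambda-\lambda_j|\ge ab^j$ for all $\lambda\in\operatorname{sp}(-\Delta)\setminus\{\lambda_j\}$. For all large $j$ the part of the spectrum of $H$ lying in $[p(\lambda_j)+\min\chi,\,p(\lambda_j)+\max\chi]$ consists of exactly $d_j$ eigenvalues $\nu_1^j,\dots,\nu_{d_j}^j$ (counted with multiplicity); this is called the $p(\lambda_j)$ cluster of $H$. $\delta_t$ is the unit point mass at $t$. *)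

theory Defs
  imports "HOL-Probability.Probability_Measure"
begin

section \<open>Unbounded operators on a real L2 space\<close>

text \<open>
  An element of L2 is represented by a square-integrable function, and equality in L2 is equality
  almost everywhere. A possibly unbounded operator is represented by its graph:
  \<open>T u g\<close> means that \<open>u\<close> is in the domain of \<open>T\<close> and that \<open>T u = g\<close> in L2. All operators below
  are self-adjoint with real coefficients, so real scalars are enough for spectra and
  multiplicities.
\<close>

type_synonym 'a l2_op = "('a \<Rightarrow> real) \<Rightarrow> ('a \<Rightarrow> real) \<Rightarrow> bool"

definition L2 :: "'a measure \<Rightarrow> ('a \<Rightarrow> real) set" where
  "L2 M = {f \<in> borel_measurable M. integrable M (\<lambda>x. (f x)\<^sup>2)}"

definition L2_inner :: "'a measure \<Rightarrow> ('a \<Rightarrow> real) \<Rightarrow> ('a \<Rightarrow> real) \<Rightarrow> real" where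
  "L2_inner M f g = (\<integral>x. f x * g x \<partial>M)"

definition L2_norm :: "'a measure \<Rightarrow> ('a \<Rightarrow> real) \<Rightarrow> real" where
  "L2_norm M f = sqrt (\<integral>x. (f x)\<^sup>2 \<partial>M)"

text \<open>\<open>L2_has_dim M V n\<close>: modulo null functions, the subspace \<open>V\<close> has a basis of \<open>n\<close> elements.\<close>

definition L2_has_dim :: "'a measure \<Rightarrow> ('a \<Rightarrow> real) set \<Rightarrow> nat \<Rightarrow> bool" where
  "L2_has_dim M V n \<longleftrightarrow>
     (\<exists>e :: nat \<Rightarrow> 'a \<Rightarrow> real.
        (\<forall>i<n. e i \<in> V) \<and>
        (\<forall>c :: nat \<Rightarrow> real. (AE x in M. (\<Sum>i<n. c i * e i x) = 0) \<longrightarrow> (\<forall>i<n. c i = 0)) \<and>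
        (\<forall>u\<in>V. \<exists>c :: nat \<Rightarrow> real. AE x in M. u x = (\<Sum>i<n. c i * e i x)))"

definition L2_dim :: "'a measure \<Rightarrow> ('a \<Rightarrow> real) set \<Rightarrow> nat" where
  "L2_dim M V = (THE n. L2_has_dim M V n)"

definition eigenspace :: "'a measure \<Rightarrow> 'a l2_op \<Rightarrow> real \<Rightarrow> ('a \<Rightarrow> real) set" where
  "eigenspace M T z = {u \<in> L2 M. T u (\<lambda>x. z * u x)}"

definition multiplicity_of :: "'a measure \<Rightarrow> 'a l2_op \<Rightarrow> real \<Rightarrow> nat" where
  "multiplicity_of M T z = L2_dim M (eigenspace M T z)"

definition is_eigenvalue :: "'a measure \<Rightarrow> 'a l2_op \<Rightarrow> real \<Rightarrow> bool" where
  "is_eigenvalue M T z \<longleftrightarrow> (\<exists>u\<in>eigenspace M T z. \<not> (AE x in M. u x = 0))"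

text \<open>\<open>z\<close> is in the resolvent set iff \<open>T - z\<close> is a bijection from the domain of \<open>T\<close> onto L2
  with bounded inverse; the first conjunct contains injectivity.\<close>

definition resolvent_set :: "'a measure \<Rightarrow> 'a l2_op \<Rightarrow> real set" where
  "resolvent_set M T =
     {z. (\<exists>C. \<forall>u g. T u g \<longrightarrow> L2_norm M u \<le> C * L2_norm M (\<lambda>x. g x - z * u x)) \<and>
         (\<forall>f\<in>L2 M. \<exists>u g. T u g \<and> (AE x in M. g x - z * u x = f x))}"

definition spectrum :: "'a measure \<Rightarrow> 'a l2_op \<Rightarrow> real set" where
  "spectrum M T = - resolvent_set M T"

definition orthonormal_eigenbasis ::
    "'a measure \<Rightarrow> 'a l2_op \<Rightarrow> (nat \<Rightarrow> 'a \<Rightarrow> real) \<Rightarrow> (nat \<Rightarrow> real) \<Rightarrow> bool" where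
  "orthonormal_eigenbasis M T \<phi> l \<longleftrightarrow>
     (\<forall>n. \<phi> n \<in> eigenspace M T (l n)) \<and>
     (\<forall>m n. L2_inner M (\<phi> m) (\<phi> n) = (if m = n then 1 else 0)) \<and>
     (\<forall>f\<in>L2 M. (\<lambda>N. L2_norm M (\<lambda>x. f x - (\<Sum>n<N. L2_inner M f (\<phi> n) * \<phi> n x)))
                  \<longlonglongrightarrow> 0)"

text \<open>Functional calculus for an operator with an orthonormal eigenbasis:
  \<open>p(T) u = (\<Sum>n. p (l n) \<langle>u, \<phi> n\<rangle> \<phi> n)\<close>, with domain the \<open>u\<close> for which the series converges
  in L2. The result does not depend on the eigenbasis.\<close>

definition fun_calc :: "'a measure \<Rightarrow> (real \<Rightarrow> real) \<Rightarrow> 'a l2_op \<Rightarrow> 'a l2_op" where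
  "fun_calc M p T u g \<longleftrightarrow>
     u \<in> L2 M \<and> g \<in> L2 M \<and>
     (\<exists>\<phi> l. orthonormal_eigenbasis M T \<phi> l \<and>
        (\<lambda>N. L2_norm M (\<lambda>x. g x - (\<Sum>n<N. p (l n) * L2_inner M u (\<phi> n) * \<phi> n x)))
          \<longlonglongrightarrow> 0)"

definition add_potential :: "'a measure \<Rightarrow> 'a l2_op \<Rightarrow> ('a \<Rightarrow> real) \<Rightarrow> 'a l2_op" where
  "add_potential M T chi u g \<longleftrightarrow>
     g \<in> L2 M \<and> (\<exists>h. T u h \<and> (AE x in M. g x = h x + chi x * u x))"


section \<open>The Sierpinski gasket and its Dirichlet Laplacian\<close>

text \<open>The boundary points are \<open>a 1, a 2, a 3\<close>; other values of \<open>a\<close> are irrelevant.\<close>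

definition F_map :: "(nat \<Rightarrow> real^2) \<Rightarrow> nat \<Rightarrow> real^2 \<Rightarrow> real^2" where
  "F_map a j x = (1/2) *\<^sub>R (x - a j) + a j"

definition F_word :: "(nat \<Rightarrow> real^2) \<Rightarrow> nat list \<Rightarrow> real^2 \<Rightarrow> real^2" where
  "F_word a w = foldr (\<lambda>j g. F_map a j \<circ> g) w id"

definition words :: "nat list set" where
  "words = {w. set w \<subseteq> {1..3}}"

definition is_gasket :: "(nat \<Rightarrow> real^2) \<Rightarrow> (real^2) set \<Rightarrow> bool" where
  "is_gasket a X \<longleftrightarrow> compact X \<and> X \<noteq> {} \<and> X = (\<Union>j\<in>{1..3}. F_map a j ` X)"

definition is_gasket_measure ::
    "(nat \<Rightarrow> real^2) \<Rightarrow> (real^2) set \<Rightarrow> (real^2) measure \<Rightarrow> bool" where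
  "is_gasket_measure a X \<mu> \<longleftrightarrow>
     prob_space \<mu> \<and> sets \<mu> = sets (restrict_space borel X) \<and>
     (\<forall>w\<in>words. measure \<mu> (F_word a w ` X) = 1 / 3 ^ length w)"

definition adjacent :: "(nat \<Rightarrow> real^2) \<Rightarrow> nat \<Rightarrow> ((real^2) \<times> (real^2)) set" where
  "adjacent a m =
     {(x, y). x \<noteq> y \<and>
        (\<exists>w\<in>words. length w = m \<and> x \<in> F_word a w ` a ` {1..3} \<and> y \<in> F_word a w ` a ` {1..3})}"

text \<open>The sum over ordered pairs counts every edge twice, hence the factor \<open>1/2\<close>.\<close>

definition graph_energy ::
    "(nat \<Rightarrow> real^2) \<Rightarrow> nat \<Rightarrow> (real^2 \<Rightarrow> real) \<Rightarrow> (real^2 \<Rightarrow> real) \<Rightarrow> real" where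
  "graph_energy a m u v =
     (5/3) ^ m * ((\<Sum>(x, y)\<in>adjacent a m. (u x - u y) * (v x - v y)) / 2)"

definition energy_domain :: "(nat \<Rightarrow> real^2) \<Rightarrow> (real^2) set \<Rightarrow> (real^2 \<Rightarrow> real) set" where
  "energy_domain a X = {u. continuous_on X u \<and> convergent (\<lambda>m. graph_energy a m u u)}"

definition energy ::
    "(nat \<Rightarrow> real^2) \<Rightarrow> (real^2 \<Rightarrow> real) \<Rightarrow> (real^2 \<Rightarrow> real) \<Rightarrow> real" where
  "energy a u v = lim (\<lambda>m. graph_energy a m u v)"

definition energy_domain0 :: "(nat \<Rightarrow> real^2) \<Rightarrow> (real^2) set \<Rightarrow> (real^2 \<Rightarrow> real) set" where
  "energy_domain0 a X = {u \<in> energy_domain a X. \<forall>j\<in>{1..3}. u (a j) = 0}"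

text \<open>The operator \<open>-\<Delta>\<close>. Since \<open>u\<close> stands for its class in L2, the form is evaluated at the
  representative \<open>u'\<close> that is continuous on \<open>X\<close>.\<close>

definition neg_laplacian ::
    "(nat \<Rightarrow> real^2) \<Rightarrow> (real^2) set \<Rightarrow> (real^2) measure \<Rightarrow> (real^2) l2_op" where
  "neg_laplacian a X \<mu> u f \<longleftrightarrow>
     u \<in> L2 \<mu> \<and> f \<in> L2 \<mu> \<and>
     (\<exists>u'\<in>energy_domain0 a X. (AE x in \<mu>. u x = u' x) \<and>
        (\<forall>v\<in>energy_domain0 a X. energy a u' v = (\<integral>x. f x * v x \<partial>\<mu>)))"


section \<open>Spectral decimation\<close>

text \<open>Only the values \<open>l m\<close> with \<open>m \<ge> j\<close> matter. The last conjunct says that the smaller root of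
  \<open>t (5 - t) = l (m - 1)\<close> is taken for all but finitely many \<open>m\<close>.\<close>

definition decimation_sequence :: "nat \<Rightarrow> (nat \<Rightarrow> real) \<Rightarrow> bool" where
  "decimation_sequence j l \<longleftrightarrow>
     j \<ge> 1 \<and> l j \<in> {2, 5, 6} \<and> (l j = 2 \<longrightarrow> j = 1) \<and> (l j = 6 \<longrightarrow> j \<ge> 2) \<and>
     (\<forall>m>j. l m * (5 - l m) = l (m - 1) \<and> l m \<notin> {2, 5, 6}) \<and>
     (\<forall>\<^sub>F m in sequentially. l m = (5 - sqrt (25 - 4 * l (m - 1))) / 2)"

definition six_series_eigenvalue ::
    "(nat \<Rightarrow> real^2) \<Rightarrow> (real^2) set \<Rightarrow> (real^2) measure \<Rightarrow> nat \<Rightarrow> real \<Rightarrow> bool" where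
  "six_series_eigenvalue a X \<mu> j z \<longleftrightarrow>
     is_eigenvalue \<mu> (neg_laplacian a X \<mu>) z \<and>
     (\<exists>l. decimation_sequence j l \<and> l j = 6 \<and> (\<lambda>m. 3/2 * (5 ^ m * l m)) \<longlonglongrightarrow> z)"


section \<open>Clusters\<close>

definition schrodinger_op ::
    "(nat \<Rightarrow> real^2) \<Rightarrow> (real^2) set \<Rightarrow> (real^2) measure \<Rightarrow> (real \<Rightarrow> real) \<Rightarrow> (real^2 \<Rightarrow> real)
     \<Rightarrow> (real^2) l2_op" where
  "schrodinger_op a X \<mu> p chi = add_potential \<mu> (fun_calc \<mu> p (neg_laplacian a X \<mu>)) chi"

definition range_interval :: "('a \<Rightarrow> real) \<Rightarrow> 'a set \<Rightarrow> real set" where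
  "range_interval chi X = {(INF x\<in>X. chi x)..(SUP x\<in>X. chi x)}"

text \<open>The part of the spectrum of \<open>T\<close> in \<open>I\<close> consists of exactly the \<open>d\<close> eigenvalues
  \<open>\<nu> 1, \<dots>, \<nu> d\<close>, counted with multiplicity.\<close>

definition enumerates_spectrum_in ::
    "'a measure \<Rightarrow> 'a l2_op \<Rightarrow> real set \<Rightarrow> nat \<Rightarrow> (nat \<Rightarrow> real) \<Rightarrow> bool" where
  "enumerates_spectrum_in M T I d \<nu> \<longleftrightarrow>
     spectrum M T \<inter> I = \<nu> ` {1..d} \<and>
     (\<forall>z\<in>\<nu> ` {1..d}. is_eigenvalue M T z \<and>
        L2_has_dim M (eigenspace M T z) (card {i \<in> {1..d}. \<nu> i = z}))"

definition is_cluster ::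
    "(nat \<Rightarrow> real^2) \<Rightarrow> (real^2) set \<Rightarrow> (real^2) measure \<Rightarrow> (real \<Rightarrow> real) \<Rightarrow> (real^2 \<Rightarrow> real)
     \<Rightarrow> real \<Rightarrow> nat \<Rightarrow> (nat \<Rightarrow> real) \<Rightarrow> bool" where
  "is_cluster a X \<mu> p chi z d \<nu> \<longleftrightarrow>
     enumerates_spectrum_in \<mu> (schrodinger_op a X \<mu> p chi)
       {p z + (INF x\<in>X. chi x)..p z + (SUP x\<in>X. chi x)} d \<nu>"

text \<open>\<open>(1/d) (\<Sum>i=1..d. \<delta> (\<nu> i - c))\<close>, as a Borel measure on the set \<open>I\<close>, which has to contain
  the points \<open>\<nu> i - c\<close>. It lives on \<open>I\<close> and not on the line because the test functions are
  only continuous on \<open>I\<close>.\<close>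

definition characteristic_measure ::
    "real set \<Rightarrow> nat \<Rightarrow> (nat \<Rightarrow> real) \<Rightarrow> real \<Rightarrow> real measure" where
  "characteristic_measure I d \<nu> c =
     distr (uniform_count_measure {1..d}) (restrict_space borel I) (\<lambda>i. \<nu> i - c)"

end

theory Submission
  imports Defs "HOL-Probability.Weak_Convergence" "HOL-Library.Diagonal_Subsequence"
begin

text \<open>
  Each eigenspace of a 6-series eigenvalue of birth \<open>j\<close> is almost entirely made of eigenfunctions
  supported in single \<open>N\<close>-cells, as \<open>j \<rightarrow> \<infinity>\<close> with \<open>N\<close> fixed. Indeed an eigenfunction splits into its
  restrictions to the \<open>N\<close>-cells as soon as finitely many linear conditions at the corners of the
  cells hold, and their number depends on \<open>N\<close> only; by self-similarity all cells carry the same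
  number of localized eigenfunctions. The multiplicities tend to infinity because explicit functions
  obtained from the extension algorithm of spectral decimation, started at level \<open>j\<close> with the value 6,
  give one eigenfunction in every \<open>(j - 2)\<close>-cell.

  If \<open>u\<close> is a combination of eigenfunctions localized in cells on which \<open>\<chi>\<close> lies in \<open>[s - r, s + r]\<close>, then
  \<open>\<parallel>(H - p(\<lambda>\<^sub>j) - s) u\<parallel> \<le> r \<parallel>u\<parallel>\<close>, so \<open>u\<close> cannot be orthogonal to all eigenfunctions of \<open>H\<close> with
  eigenvalue in \<open>p(\<lambda>\<^sub>j) + [s - r, s + r]\<close>. Counting dimensions bounds the number of these eigenvalues
  from below by the number of localized eigenfunctions. In the limit the mass of every interval is
  at least its \<open>\<Psi>\<^sub>0\<close>-mass, and as all measures have total mass 1 this forces weak convergence.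
  The same argument, with the roles of \<open>H\<close> and \<open>p(-\<Delta>)\<close> exchanged and the growing gaps, shows that the
  cluster has exactly \<open>d\<^sub>j\<close> elements.
\<close>

section \<open>Square-integrable functions\<close>

text \<open>The obstacle is extension by zero. A Dirichlet eigenfunction of a cell, extended by
  zero, is an eigenfunction of the gasket only if its normal derivatives vanish at the corners too.
  Both conditions are put into weak form: the function vanishes at the corners and satisfies the
  eigenvalue equation against the whole form domain \<open>Fdom\<close>, not only against
  \<open>Fdom0\<close> (see \<open>neumann\<close>, \<open>local_space\<close>). One level down, the
  energy scales by 5/3 and the measure by 1/3, so eigenvalues are multiplied by 5; three corner
  values and three weak normal derivatives per \<open>N\<close>-cell cost at most
  \<open>6 * 3 ^ N\<close> dimensions, for every \<open>j\<close>. Since \<open>spectrum\<close> is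
  defined by the resolvent, clusters can be counted only after H has been diagonalized. One theorem
  on nonnegative forms with compact embedding serves twice, for the energy and for a shifted form of
  H. Afterwards operators are seen only through their coefficients in an eigenbasis, and each
  comparison of eigenvalue counts combines Parseval's identity with a homogeneous linear system
  having more unknowns than equations.\<close>

lemma L2_measurable [measurable_dest]: "f \<in> L2 M \<Longrightarrow> f \<in> borel_measurable M"
  by (simp add: L2_def)

lemma L2_integrable_square: "f \<in> L2 M \<Longrightarrow> integrable M (\<lambda>x. (f x)\<^sup>2)"
  by (simp add: L2_def)

lemma L2_integrable_mult:
  assumes "f \<in> L2 M" "g \<in> L2 M"
  shows "integrable M (\<lambda>x. f x * g x)"
proof (rule Bochner_Integration.integrable_bound)
  show "integrable M (\<lambda>x. (f x)\<^sup>2 + (g x)\<^sup>2)"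
    using assms by (intro Bochner_Integration.integrable_add L2_integrable_square)
  show "(\<lambda>x. f x * g x) \<in> borel_measurable M"
    using assms[THEN L2_measurable] by measurable
  show "AE x in M. norm (f x * g x) \<le> norm ((f x)\<^sup>2 + (g x)\<^sup>2)"
  proof (intro AE_I2)
    fix x
    have "0 \<le> (\<bar>f x\<bar> - \<bar>g x\<bar>)\<^sup>2" by simp
    then have "2 * (\<bar>f x\<bar> * \<bar>g x\<bar>) \<le> (f x)\<^sup>2 + (g x)\<^sup>2"
      by (simp add: power2_diff)
    moreover have "0 \<le> \<bar>f x\<bar> * \<bar>g x\<bar>" by simp
    ultimately show "norm (f x * g x) \<le> norm ((f x)\<^sup>2 + (g x)\<^sup>2)"
      unfolding real_norm_def abs_mult by linarith
  qed
qed

lemma L2_add: "f \<in> L2 M \<Longrightarrow> g \<in> L2 M \<Longrightarrow> (\<lambda>x. f x + g x) \<in> L2 M"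
  using L2_integrable_mult[of f M g]
  by (auto simp: L2_def power2_sum mult.assoc)

lemma L2_scale: "f \<in> L2 M \<Longrightarrow> (\<lambda>x. c * f x) \<in> L2 M"
  by (auto simp: L2_def power_mult_distrib)

lemma L2_diff: "f \<in> L2 M \<Longrightarrow> g \<in> L2 M \<Longrightarrow> (\<lambda>x. f x - g x) \<in> L2 M"
  using L2_add[OF _ L2_scale[of g M "-1"]] by simp

lemma L2_zero: "(\<lambda>x. 0) \<in> L2 M"
  by (simp add: L2_def)

lemma L2_sum:
  assumes "\<And>i. i \<in> A \<Longrightarrow> f i \<in> L2 M"
  shows "(\<lambda>x. \<Sum>i\<in>A. c i * f i x) \<in> L2 M"
  using assms
proof (induction A rule: infinite_finite_induct)
  case (insert i A)
  then show ?case using L2_add[OF L2_scale[of "f i" M "c i"], of "\<lambda>x. \<Sum>i\<in>A. c i * f i x"] by simp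
qed (auto intro: L2_zero)

lemma L2_bounded_mult:
  assumes [measurable]: "g \<in> borel_measurable M" and b: "AE x in M. \<bar>g x\<bar> \<le> B" and f: "f \<in> L2 M"
  shows "(\<lambda>x. g x * f x) \<in> L2 M"
proof -
  note [measurable] = L2_measurable[OF f]
  have "integrable M (\<lambda>x. (g x * f x)\<^sup>2)"
  proof (rule Bochner_Integration.integrable_bound)
    show "integrable M (\<lambda>x. B\<^sup>2 * (f x)\<^sup>2)" using f by (simp add: L2_integrable_square)
    show "AE x in M. norm ((g x * f x)\<^sup>2) \<le> norm (B\<^sup>2 * (f x)\<^sup>2)"
      using b
    proof eventually_elim
      case (elim x)
      then have "(g x)\<^sup>2 \<le> B\<^sup>2" by (simp add: abs_le_square_iff[symmetric])
      then show ?case by (simp add: power_mult_distrib mult_right_mono)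
    qed
  qed simp
  then show ?thesis by (simp add: L2_def)
qed

lemma (in finite_measure) L2_bounded:
  assumes "g \<in> borel_measurable M" "AE x in M. \<bar>g x\<bar> \<le> B"
  shows "g \<in> L2 M"
  using L2_bounded_mult[OF assms, of "\<lambda>_. 1"] by (simp add: L2_def)

section \<open>Inner product, norm and their limits on square-integrable functions\<close>

lemma L2_inner_commute: "L2_inner M f g = L2_inner M g f"
  by (simp add: L2_inner_def mult.commute)

lemma L2_inner_add_left:
  "f \<in> L2 M \<Longrightarrow> g \<in> L2 M \<Longrightarrow> h \<in> L2 M \<Longrightarrow>
    L2_inner M (\<lambda>x. f x + g x) h = L2_inner M f h + L2_inner M g h"
  by (simp add: L2_inner_def distrib_right L2_integrable_mult)

lemma L2_inner_diff_left:
  "f \<in> L2 M \<Longrightarrow> g \<in> L2 M \<Longrightarrow> h \<in> L2 M \<Longrightarrow>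
    L2_inner M (\<lambda>x. f x - g x) h = L2_inner M f h - L2_inner M g h"
  by (simp add: L2_inner_def left_diff_distrib L2_integrable_mult)

lemma L2_inner_scale_left: "L2_inner M (\<lambda>x. c * f x) h = c * L2_inner M f h"
  by (simp add: L2_inner_def mult.assoc)

lemma L2_inner_sum_left:
  assumes "\<And>i. i \<in> A \<Longrightarrow> f i \<in> L2 M" "h \<in> L2 M"
  shows "L2_inner M (\<lambda>x. \<Sum>i\<in>A. c i * f i x) h = (\<Sum>i\<in>A. c i * L2_inner M (f i) h)"
  using assms
  by (simp add: L2_inner_def sum_distrib_right mult.assoc L2_integrable_mult)

lemma L2_inner_add_right:
  "f \<in> L2 M \<Longrightarrow> g \<in> L2 M \<Longrightarrow> h \<in> L2 M \<Longrightarrow>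
    L2_inner M h (\<lambda>x. f x + g x) = L2_inner M h f + L2_inner M h g"
  by (subst (1 2 3) L2_inner_commute) (rule L2_inner_add_left)

lemma L2_inner_diff_right:
  "f \<in> L2 M \<Longrightarrow> g \<in> L2 M \<Longrightarrow> h \<in> L2 M \<Longrightarrow>
    L2_inner M h (\<lambda>x. f x - g x) = L2_inner M h f - L2_inner M h g"
  by (subst (1 2 3) L2_inner_commute) (rule L2_inner_diff_left)

lemma L2_inner_scale_right: "L2_inner M h (\<lambda>x. c * f x) = c * L2_inner M h f"
  by (subst (1 2) L2_inner_commute) (rule L2_inner_scale_left)

lemma L2_inner_sum_right:
  assumes "\<And>i. i \<in> A \<Longrightarrow> f i \<in> L2 M" "h \<in> L2 M"
  shows "L2_inner M h (\<lambda>x. \<Sum>i\<in>A. c i * f i x) = (\<Sum>i\<in>A. c i * L2_inner M h (f i))"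
  using L2_inner_sum_left[OF assms] by (simp add: L2_inner_commute[of M h])

lemma L2_inner_AE_cong:
  assumes "AE x in M. f x = f' x" "AE x in M. g x = g' x"
    and "f \<in> L2 M" "g \<in> L2 M" "f' \<in> L2 M" "g' \<in> L2 M"
  shows "L2_inner M f g = L2_inner M f' g'"
  unfolding L2_inner_def
  by (rule integral_cong_AE) (use assms in \<open>auto intro: borel_measurable_times L2_measurable\<close>)

lemma L2_inner_self_nonneg: "0 \<le> L2_inner M f f"
  by (simp add: L2_inner_def)

lemma L2_norm_power2: "(L2_norm M f)\<^sup>2 = L2_inner M f f"
  by (simp add: L2_norm_def L2_inner_def power2_eq_square)

lemma L2_norm_eq_sqrt: "L2_norm M f = sqrt (L2_inner M f f)"
  by (simp add: L2_norm_def L2_inner_def power2_eq_square)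

lemma L2_norm_nonneg: "0 \<le> L2_norm M f"
  by (simp add: L2_norm_def)

lemma L2_inner_self_eq_0_iff:
  assumes "f \<in> L2 M"
  shows "L2_inner M f f = 0 \<longleftrightarrow> (AE x in M. f x = 0)"
  using integral_nonneg_eq_0_iff_AE[OF L2_integrable_square[OF assms]]
  by (simp add: L2_inner_def power2_eq_square)

lemma L2_norm_minus_commute: "L2_norm M (\<lambda>x. f x - g x) = L2_norm M (\<lambda>x. g x - f x)"
  by (simp add: L2_norm_def power2_commute)

lemma L2_norm_scale: "L2_norm M (\<lambda>x. c * f x) = \<bar>c\<bar> * L2_norm M f"
  by (simp add: L2_norm_def power_mult_distrib real_sqrt_mult)

lemma L2_inner_square_add:
  assumes "f \<in> L2 M" "g \<in> L2 M"
  shows "L2_inner M (\<lambda>x. f x + c * g x) (\<lambda>x. f x + c * g x)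
    = L2_inner M f f + 2 * c * L2_inner M f g + c\<^sup>2 * L2_inner M g g"
  using assms
  by (simp add: L2_inner_add_left L2_inner_add_right L2_add L2_scale L2_inner_scale_left
      L2_inner_scale_right L2_inner_commute[of M g f] power2_eq_square algebra_simps)

text \<open>This gives Cauchy-Schwarz from the square of \<open>f + t g\<close>. With
  \<open>a = 0\<close> it forces \<open>b = 0\<close>, which is how the Euler-Lagrange equation of a
  constrained minimizer is read off in \<open>eigenbasis\<close>. The sign of \<open>c\<close> is
  derived, not assumed.\<close>

lemma discriminant_nonneg_form:
  fixes a b c :: real
  assumes "\<And>t. 0 \<le> a + 2 * t * b + t\<^sup>2 * c"
  shows "b\<^sup>2 \<le> a * c"
proof (cases "c = 0")
  case True
  have "b = 0"
  proof (rule ccontr)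
    assume "b \<noteq> 0"
    then show False using assms[of "- (a + 1) / (2 * b)"] True by (simp add: field_simps)
  qed
  then show ?thesis using True by simp
next
  case False
  have "0 \<le> a + 2 * (- b / c) * b + (- b / c)\<^sup>2 * c" by (rule assms)
  also have "\<dots> = a - b\<^sup>2 / c" using False by (simp add: field_simps power2_eq_square)
  finally have *: "b\<^sup>2 / c \<le> a" by simp
  have "0 < c"
  proof (rule ccontr)
    assume "\<not> 0 < c"
    then have c: "c < 0" using False by simp
    \<comment> \<open>For \<open>c < 0\<close> the quadratic must become negative: this
      \<open>t\<close> is at least 1 and makes \<open>2 * b + t * c\<close> smaller than
      \<open>- \<bar>a\<bar>\<close>.\<close>
    define t where "t = 1 + (\<bar>a\<bar> + 1 + 2 * \<bar>b\<bar>) / \<bar>c\<bar>"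
    have t1: "t \<ge> 1" by (simp add: t_def)
    have tc: "t * c = c - (\<bar>a\<bar> + 1 + 2 * \<bar>b\<bar>)" using c by (simp add: t_def field_simps)
    have "a + 2 * t * b + t\<^sup>2 * c = a + t * (2 * b + t * c)"
      by (simp add: power2_eq_square algebra_simps)
    also have "\<dots> \<le> a + 1 * (2 * b + t * c)"
      using mult_right_mono_neg[OF t1, of "2 * b + t * c"] c unfolding tc by linarith
    also have "\<dots> < 0" using c abs_ge_self[of a] abs_ge_self[of b] unfolding tc by simp
    finally show False using assms[of t] by linarith
  qed
  then show ?thesis using * by (simp add: field_simps)
qed

lemma L2_Cauchy_Schwarz:
  assumes "f \<in> L2 M" "g \<in> L2 M"
  shows "\<bar>L2_inner M f g\<bar> \<le> L2_norm M f * L2_norm M g"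
proof -
  have "(L2_inner M f g)\<^sup>2 \<le> L2_inner M f f * L2_inner M g g"
  proof (rule discriminant_nonneg_form)
    fix t
    show "0 \<le> L2_inner M f f + 2 * t * L2_inner M f g + t\<^sup>2 * L2_inner M g g"
      using L2_inner_self_nonneg[of M "\<lambda>x. f x + t * g x"] L2_inner_square_add[OF assms] by simp
  qed
  then show ?thesis
    by (metis L2_norm_eq_sqrt real_sqrt_abs real_sqrt_le_iff real_sqrt_mult)
qed

lemma L2_norm_triangle:
  assumes "f \<in> L2 M" "g \<in> L2 M"
  shows "L2_norm M (\<lambda>x. f x + g x) \<le> L2_norm M f + L2_norm M g"
proof (rule power2_le_imp_le)
  have "(L2_norm M (\<lambda>x. f x + g x))\<^sup>2 = (L2_norm M f)\<^sup>2 + 2 * L2_inner M f g + (L2_norm M g)\<^sup>2"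
    using L2_inner_square_add[OF assms, of 1] by (simp add: L2_norm_power2)
  also have "\<dots> \<le> (L2_norm M f + L2_norm M g)\<^sup>2"
    using L2_Cauchy_Schwarz[OF assms] by (simp add: power2_sum)
  finally show "(L2_norm M (\<lambda>x. f x + g x))\<^sup>2 \<le> (L2_norm M f + L2_norm M g)\<^sup>2" .
qed (simp add: L2_norm_nonneg)

lemma L2_norm_diff_triangle:
  assumes "f \<in> L2 M" "g \<in> L2 M" "h \<in> L2 M"
  shows "L2_norm M (\<lambda>x. f x - h x) \<le> L2_norm M (\<lambda>x. f x - g x) + L2_norm M (\<lambda>x. g x - h x)"
  using L2_norm_triangle[OF L2_diff[OF assms(1,2)] L2_diff[OF assms(2,3)]] by simp

text \<open>The bound on \<open>g\<close> is required only where \<open>f\<close> is nonzero, so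
  that a potential may be estimated on the cells carrying a localized function alone.\<close>

lemma L2_norm_bounded_mult:
  assumes "g \<in> borel_measurable M" "AE x in M. f x = 0 \<or> \<bar>g x\<bar> \<le> B" "f \<in> L2 M"
    and "(\<lambda>x. g x * f x) \<in> L2 M"
  shows "L2_inner M (\<lambda>x. g x * f x) (\<lambda>x. g x * f x) \<le> B\<^sup>2 * L2_inner M f f"
proof -
  have "(\<integral>x. (g x * f x)\<^sup>2 \<partial>M) \<le> (\<integral>x. B\<^sup>2 * (f x)\<^sup>2 \<partial>M)"
  proof (rule integral_mono_AE)
    show "AE x in M. (g x * f x)\<^sup>2 \<le> B\<^sup>2 * (f x)\<^sup>2"
      using assms(2)
    proof eventually_elim
      case (elim x)
      then show ?case
      proof
        assume "\<bar>g x\<bar> \<le> B"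
        then have "(g x)\<^sup>2 \<le> B\<^sup>2" by (simp add: abs_le_square_iff[symmetric])
        then show ?thesis by (simp add: power_mult_distrib mult_right_mono)
      qed simp
    qed
  qed (use assms in \<open>auto intro: L2_integrable_square\<close>)
  then show ?thesis by (simp add: L2_inner_def power2_eq_square)
qed

lemma L2_cong_AE_norm:
  assumes "AE x in M. f x = g x" "f \<in> L2 M" "g \<in> L2 M"
  shows "L2_norm M f = L2_norm M g"
  using L2_inner_AE_cong[OF assms(1,1) assms(2,2,3,3)] by (simp add: L2_norm_eq_sqrt)

lemma L2_tendsto_inner:
  assumes "\<And>n. f n \<in> L2 M" "g \<in> L2 M" "h \<in> L2 M"
    and lim: "(\<lambda>n. L2_norm M (\<lambda>x. f n x - g x)) \<longlonglongrightarrow> 0"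
  shows "(\<lambda>n. L2_inner M (f n) h) \<longlonglongrightarrow> L2_inner M g h"
proof -
  have "(\<lambda>n. L2_inner M (f n) h - L2_inner M g h) \<longlonglongrightarrow> 0"
  proof (rule Lim_null_comparison)
    show "\<forall>\<^sub>F n in sequentially. norm (L2_inner M (f n) h - L2_inner M g h)
        \<le> L2_norm M (\<lambda>x. f n x - g x) * L2_norm M h"
      using L2_Cauchy_Schwarz[OF L2_diff[OF assms(1,2)] assms(3)] assms
      by (simp add: L2_inner_diff_left)
    show "(\<lambda>n. L2_norm M (\<lambda>x. f n x - g x) * L2_norm M h) \<longlonglongrightarrow> 0"
      using tendsto_mult_right[OF lim, of "L2_norm M h"] by simp
  qed
  then show ?thesis by (simp add: LIM_zero_iff)
qed

lemma L2_tendsto_norm: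
  assumes "\<And>n. f n \<in> L2 M" "g \<in> L2 M"
    and lim: "(\<lambda>n. L2_norm M (\<lambda>x. f n x - g x)) \<longlonglongrightarrow> 0"
  shows "(\<lambda>n. L2_norm M (f n)) \<longlonglongrightarrow> L2_norm M g"
proof -
  have "(\<lambda>n. L2_norm M (f n) - L2_norm M g) \<longlonglongrightarrow> 0"
  proof (rule Lim_null_comparison[OF _ lim])
    have "\<bar>L2_norm M (f n) - L2_norm M g\<bar> \<le> L2_norm M (\<lambda>x. f n x - g x)" for n
      using L2_norm_diff_triangle[OF assms(1)[of n] assms(2) L2_zero]
        L2_norm_diff_triangle[OF assms(2) assms(1)[of n] L2_zero]
        L2_norm_minus_commute[of M "f n" g] by simp
    then show "\<forall>\<^sub>F n in sequentially.
        norm (L2_norm M (f n) - L2_norm M g) \<le> L2_norm M (\<lambda>x. f n x - g x)" by simp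
  qed
  then show ?thesis by (simp add: LIM_zero_iff)
qed

text \<open>On a finite measure space Cauchy in L2 implies Cauchy in L1, by Cauchy-Schwarz against
  1; an L1-Cauchy sequence has a subsequence converging almost everywhere, and Fatou's lemma along
  it carries the L2 estimates to the limit.\<close>

lemma (in finite_measure) L2_complete:
  assumes L2: "\<And>n. f n \<in> L2 M"
    and Cauchy: "\<And>e. e > 0 \<Longrightarrow> \<exists>N. \<forall>m\<ge>N. \<forall>n\<ge>N. L2_norm M (\<lambda>x. f m x - f n x) < e"
  obtains g where "g \<in> L2 M" "(\<lambda>n. L2_norm M (\<lambda>x. f n x - g x)) \<longlonglongrightarrow> 0"
proof -
  note [measurable] = L2[THEN L2_measurable]
  have one: "(\<lambda>x. 1) \<in> L2 M" by (simp add: L2_def)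
  have int: "integrable M (f n)" for n
    using L2_integrable_mult[OF L2[of n] one] by simp
  \<comment> \<open>The summand 1 keeps \<open>K\<close> positive even if \<open>M\<close> is the
    zero measure.\<close>
  define K where "K = L2_norm M (\<lambda>x. 1) + 1"
  have K: "K > 0" using L2_norm_nonneg[of M "\<lambda>x. 1"] by (simp add: K_def)
  have L1: "(LINT x|M. norm (f m x - f n x)) \<le> L2_norm M (\<lambda>x. f m x - f n x) * K" for m n
  proof -
    have a: "(\<lambda>x. \<bar>f m x - f n x\<bar>) \<in> L2 M"
      using L2_diff[OF L2[of m] L2[of n]] by (auto simp: L2_def)
    have "(LINT x|M. norm (f m x - f n x)) \<le> L2_norm M (\<lambda>x. \<bar>f m x - f n x\<bar>) * L2_norm M (\<lambda>x. 1)"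
      using L2_Cauchy_Schwarz[OF a one] by (simp add: L2_inner_def)
    also have "L2_norm M (\<lambda>x. \<bar>f m x - f n x\<bar>) = L2_norm M (\<lambda>x. f m x - f n x)"
      by (simp add: L2_norm_def)
    also have "L2_norm M (\<lambda>x. f m x - f n x) * L2_norm M (\<lambda>x. 1) \<le> L2_norm M (\<lambda>x. f m x - f n x) * K"
      by (intro mult_left_mono) (auto simp: K_def L2_norm_nonneg)
    finally show ?thesis .
  qed
  have "\<exists>N. \<forall>i\<ge>N. \<forall>j\<ge>N. (LINT x|M. norm (f i x - f j x)) < e" if "e > 0" for e
  proof -
    obtain N where N: "\<And>m n. m \<ge> N \<Longrightarrow> n \<ge> N \<Longrightarrow> L2_norm M (\<lambda>x. f m x - f n x) < e / K"
      using Cauchy[of "e / K"] \<open>e > 0\<close> K by (metis divide_pos_pos)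
    have "(LINT x|M. norm (f i x - f j x)) < e" if "i \<ge> N" "j \<ge> N" for i j
      using L1[of i j] N[OF that] K by (smt (verit) pos_less_divide_eq)
    then show ?thesis by blast
  qed
  from cauchy_L1_AE_cauchy_subseq[OF int this]
  obtain r where r: "strict_mono r" and "AE x in M. Cauchy (\<lambda>i. f (r i) x)" by metis
  then have conv: "AE x in M. convergent (\<lambda>i. f (r i) x)"
    by (simp add: Cauchy_convergent_iff)
  define g where "g x = lim (\<lambda>i. f (r i) x)" for x
  have [measurable]: "g \<in> borel_measurable M" unfolding g_def by measurable
  have lim: "AE x in M. (\<lambda>i. f (r i) x) \<longlonglongrightarrow> g x"
    using conv by eventually_elim (simp add: g_def convergent_LIMSEQ_iff)
  have Fatou: "(\<integral>\<^sup>+x. ennreal ((f n x - g x)\<^sup>2) \<partial>M) \<le> ennreal (e\<^sup>2)"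
    if e: "e > 0" and N: "\<And>m. m \<ge> N \<Longrightarrow> L2_norm M (\<lambda>x. f n x - f m x) < e" for e n N
  proof -
    have "(\<integral>\<^sup>+x. ennreal ((f n x - g x)\<^sup>2) \<partial>M)
        = (\<integral>\<^sup>+x. liminf (\<lambda>i. ennreal ((f n x - f (r i) x)\<^sup>2)) \<partial>M)"
    proof (rule nn_integral_cong_AE, use lim in eventually_elim)
      case (elim x)
      have "(\<lambda>i. ennreal ((f n x - f (r i) x)\<^sup>2)) \<longlonglongrightarrow> ennreal ((f n x - g x)\<^sup>2)"
        by (intro tendsto_intros tendsto_ennrealI elim)
      from lim_imp_Liminf[OF sequentially_bot this] show ?case by (rule sym)
    qed
    also have "\<dots> \<le> liminf (\<lambda>i. \<integral>\<^sup>+x. ennreal ((f n x - f (r i) x)\<^sup>2) \<partial>M)"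
      by (rule nn_integral_liminf) measurable
    also have "\<dots> \<le> ennreal (e\<^sup>2)"
    proof (rule Liminf_le)
      show "\<forall>\<^sub>F i in sequentially. (\<integral>\<^sup>+x. ennreal ((f n x - f (r i) x)\<^sup>2) \<partial>M) \<le> ennreal (e\<^sup>2)"
        using eventually_ge_at_top[of N]
      proof eventually_elim
        case (elim i)
        then have "r i \<ge> N" using seq_suble[OF r, of i] by simp
        have "(\<integral>\<^sup>+x. ennreal ((f n x - f (r i) x)\<^sup>2) \<partial>M) = ennreal (\<integral>x. (f n x - f (r i) x)\<^sup>2 \<partial>M)"
          by (intro nn_integral_eq_integral L2_integrable_square L2_diff L2) auto
        also have "(\<integral>x. (f n x - f (r i) x)\<^sup>2 \<partial>M) = (L2_norm M (\<lambda>x. f n x - f (r i) x))\<^sup>2"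
          by (simp add: L2_norm_def)
        also have "ennreal \<dots> \<le> ennreal (e\<^sup>2)"
          using N[OF \<open>r i \<ge> N\<close>] e by (intro ennreal_leI power_mono) (auto simp: L2_norm_nonneg)
        finally show ?case .
      qed
    qed simp
    finally show ?thesis .
  qed
  have diffL2: "(\<lambda>x. f n x - g x) \<in> L2 M"
    if e: "e > 0" and N: "\<And>m. m \<ge> N \<Longrightarrow> L2_norm M (\<lambda>x. f n x - f m x) < e" for e n N
    using le_less_trans[OF Fatou[OF e N]] by (simp add: L2_def integrable_iff_bounded)
  have small: "L2_norm M (\<lambda>x. f n x - g x) \<le> e"
    if e: "e > 0" and N: "\<And>m. m \<ge> N \<Longrightarrow> L2_norm M (\<lambda>x. f n x - f m x) < e" for e n N
  proof -
    have "ennreal (\<integral>x. (f n x - g x)\<^sup>2 \<partial>M) = (\<integral>\<^sup>+x. ennreal ((f n x - g x)\<^sup>2) \<partial>M)"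
      using diffL2[OF e N] by (intro nn_integral_eq_integral[symmetric] L2_integrable_square) auto
    also have "\<dots> \<le> ennreal (e\<^sup>2)" by (rule Fatou[OF e N])
    finally have "(\<integral>x. (f n x - g x)\<^sup>2 \<partial>M) \<le> e\<^sup>2" by (simp add: ennreal_le_iff)
    then show ?thesis using e by (simp add: L2_norm_def real_le_lsqrt)
  qed
  show ?thesis
  proof
    obtain N where N: "\<And>m n. m \<ge> N \<Longrightarrow> n \<ge> N \<Longrightarrow> L2_norm M (\<lambda>x. f m x - f n x) < 1"
      using Cauchy[of 1] by auto
    then have "(\<lambda>x. f N x - g x) \<in> L2 M" by (intro diffL2[of 1 N N]) auto
    from L2_diff[OF L2[of N] this] show "g \<in> L2 M" by simp
    show "(\<lambda>n. L2_norm M (\<lambda>x. f n x - g x)) \<longlonglongrightarrow> 0"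
    proof (rule LIMSEQ_I)
      fix e :: real assume "e > 0"
      then obtain N where N: "\<And>m n. m \<ge> N \<Longrightarrow> n \<ge> N \<Longrightarrow> L2_norm M (\<lambda>x. f m x - f n x) < e / 2"
        using Cauchy[of "e / 2"] by auto
      have "L2_norm M (\<lambda>x. f n x - g x) \<le> e / 2" if "n \<ge> N" for n
        using N that \<open>e > 0\<close> by (intro small[of "e / 2" N]) auto
      then show "\<exists>no. \<forall>n\<ge>no. norm (L2_norm M (\<lambda>x. f n x - g x) - 0) < e"
        using \<open>e > 0\<close> by (intro exI[of _ N]) (force simp: L2_norm_nonneg)
    qed
  qed
qed

section \<open>Dimensions modulo null functions\<close>

text \<open>Every comparison of dimensions below reduces to this. The proof is Gaussian elimination:
  equation \<open>k\<close> and a pivot unknown \<open>p\<close> with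
  \<open>A p k \<noteq> 0\<close> are removed together.\<close>

lemma homogeneous_system_nontrivial_solution:
  fixes A :: "'i \<Rightarrow> 'k \<Rightarrow> real"
  assumes "finite I" "finite K" "card K < card I"
  obtains c where "\<exists>i\<in>I. c i \<noteq> 0" "\<And>k. k \<in> K \<Longrightarrow> (\<Sum>i\<in>I. c i * A i k) = 0"
proof -
  have "\<exists>c. (\<exists>i\<in>I. c i \<noteq> 0) \<and> (\<forall>k\<in>K. (\<Sum>i\<in>I. c i * A i k) = 0)"
    using assms(2,1,3)
  proof (induction K arbitrary: I A rule: finite_induct)
    case empty
    then have "I \<noteq> {}" by auto
    then show ?case by (intro exI[of _ "\<lambda>_. 1"]) auto
  next
    case (insert k K)
    show ?case
    proof (cases "\<forall>i\<in>I. A i k = 0")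
      case True
      have "card K < card I" using insert.prems insert.hyps by simp
      from insert.IH[OF insert.prems(1) this, of A] True show ?thesis by auto
    next
      case False
      then obtain p where p: "p \<in> I" "A p k \<noteq> 0" by auto
      let ?B = "\<lambda>i k'. A i k' - A i k / A p k * A p k'"
      have "card K < card (I - {p})" using insert.prems insert.hyps p by simp
      from insert.IH[of "I - {p}" ?B] this obtain c where
        c: "\<exists>i\<in>I - {p}. c i \<noteq> 0" "\<forall>k\<in>K. (\<Sum>i\<in>I - {p}. c i * ?B i k) = 0"
        using insert.prems(1) by auto
      \<comment> \<open>\<open>S\<close> is what the other unknowns contribute to the pivot
        equation; \<open>c'\<close> solves that equation for the unknown \<open>p\<close>.\<close>
      define S where "S = (\<Sum>i\<in>I - {p}. c i * A i k)"
      define c' where "c' = c(p := - S / A p k)"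
      have split: "(\<Sum>i\<in>I. c' i * A i k') = - S / A p k * A p k' + (\<Sum>i\<in>I - {p}. c i * A i k')" for k'
        using sum.remove[OF insert.prems(1) p(1), of "\<lambda>i. c' i * A i k'"] by (simp add: c'_def)
      have "(\<Sum>i\<in>I. c' i * A i k) = 0"
        using p by (simp add: split S_def)
      moreover have "(\<Sum>i\<in>I. c' i * A i k') = 0" if "k' \<in> K" for k'
      proof -
        have "(\<Sum>i\<in>I - {p}. c i * ?B i k') = (\<Sum>i\<in>I - {p}. c i * A i k') - S / A p k * A p k'"
          by (simp add: S_def sum_subtractf sum_distrib_right sum_divide_distrib right_diff_distrib mult.assoc)
        then show ?thesis using c(2) that by (simp add: split)
      qed
      moreover have "\<exists>i\<in>I. c' i \<noteq> 0" using c(1) by (auto simp: c'_def)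
      ultimately show ?thesis by auto
    qed
  qed
  then show ?thesis using that by blast
qed

text \<open>Expanding \<open>m\<close> independent elements in \<open>n < m\<close> spanning ones
  and solving \<open>n\<close> equations in \<open>m\<close> unknowns would give a nontrivial
  relation. Uniqueness of the dimension makes \<open>L2_dim\<close>, a definite description,
  usable.\<close>

lemma L2_has_dim_le:
  assumes "L2_has_dim M V m" "L2_has_dim M V n"
  shows "m \<le> n"
proof (rule ccontr)
  assume "\<not> m \<le> n"
  obtain e where e: "\<forall>i<m. e i \<in> V"
      "\<forall>c :: nat \<Rightarrow> real. (AE x in M. (\<Sum>i<m. c i * e i x) = 0) \<longrightarrow> (\<forall>i<m. c i = 0)"
    using assms(1) unfolding L2_has_dim_def by blast
  obtain e' where e': "\<forall>u\<in>V. \<exists>c :: nat \<Rightarrow> real. AE x in M. u x = (\<Sum>k<n. c k * e' k x)"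
    using assms(2) unfolding L2_has_dim_def by blast
  have "\<forall>i. \<exists>c :: nat \<Rightarrow> real. i < m \<longrightarrow> (AE x in M. e i x = (\<Sum>k<n. c k * e' k x))"
    using e(1) e' by blast
  then obtain A :: "nat \<Rightarrow> nat \<Rightarrow> real"
    where A: "\<And>i. i < m \<Longrightarrow> AE x in M. e i x = (\<Sum>k<n. A i k * e' k x)" by metis
  obtain c where c: "\<exists>i\<in>{..<m}. c i \<noteq> 0" "\<And>k. k \<in> {..<n} \<Longrightarrow> (\<Sum>i<m. c i * A i k) = 0"
    using homogeneous_system_nontrivial_solution[of "{..<m}" "{..<n}" A] \<open>\<not> m \<le> n\<close> by auto
  have "AE x in M. \<forall>i\<in>{..<m}. e i x = (\<Sum>k<n. A i k * e' k x)"
    by (rule AE_finite_allI) (auto intro: A)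
  then have "AE x in M. (\<Sum>i<m. c i * e i x) = 0"
  proof eventually_elim
    case (elim x)
    have "(\<Sum>i<m. c i * e i x) = (\<Sum>i<m. \<Sum>k<n. c i * A i k * e' k x)"
      using elim by (simp add: sum_distrib_left mult.assoc)
    also have "\<dots> = (\<Sum>k<n. (\<Sum>i<m. c i * A i k) * e' k x)"
      by (subst sum.swap) (simp add: sum_distrib_right)
    finally show ?case using c(2) by simp
  qed
  then show False using e(2) c(1) by auto
qed

lemma L2_has_dim_unique: "L2_has_dim M V m \<Longrightarrow> L2_has_dim M V n \<Longrightarrow> m = n"
  using L2_has_dim_le by (metis le_antisym)

lemma L2_dim_eq: "L2_has_dim M V n \<Longrightarrow> L2_dim M V = n"
  unfolding L2_dim_def using L2_has_dim_unique by blast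

section \<open>Orthonormal sequences\<close>

locale orthonormal_sequence = finite_measure M
  for M :: "'a measure" and \<phi> :: "nat \<Rightarrow> 'a \<Rightarrow> real" +
  assumes in_L2: "\<And>n. \<phi> n \<in> L2 M"
    and orthonormal: "\<And>m n. L2_inner M (\<phi> m) (\<phi> n) = (if m = n then 1 else 0)"
begin

abbreviation coef :: "('a \<Rightarrow> real) \<Rightarrow> nat \<Rightarrow> real" where
  "coef f n \<equiv> L2_inner M f (\<phi> n)"

lemma coef_sum:
  assumes "finite A"
  shows "coef (\<lambda>x. \<Sum>i\<in>A. c i * \<phi> i x) n = (if n \<in> A then c n else 0)"
proof -
  have "coef (\<lambda>x. \<Sum>i\<in>A. c i * \<phi> i x) n = (\<Sum>i\<in>A. if i = n then c i else 0)"
    by (subst L2_inner_sum_left) (auto simp: in_L2 orthonormal intro!: sum.cong)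
  then show ?thesis using assms by simp
qed

lemma inner_sum_sum:
  assumes "finite A"
  shows "L2_inner M (\<lambda>x. \<Sum>i\<in>A. c i * \<phi> i x) (\<lambda>x. \<Sum>i\<in>A. c i * \<phi> i x) = (\<Sum>i\<in>A. (c i)\<^sup>2)"
  by (subst L2_inner_sum_right)
    (auto simp: in_L2 L2_sum coef_sum[OF assms] power2_eq_square intro!: sum.cong)

lemma inner_diff_partial_sum:
  assumes f: "f \<in> L2 M"
  shows "L2_inner M (\<lambda>x. f x - (\<Sum>n<N. coef f n * \<phi> n x)) (\<lambda>x. f x - (\<Sum>n<N. coef f n * \<phi> n x))
    = L2_inner M f f - (\<Sum>n<N. (coef f n)\<^sup>2)"
proof -
  let ?s = "\<lambda>x. \<Sum>n<N. coef f n * \<phi> n x"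
  have s: "?s \<in> L2 M" by (intro L2_sum in_L2)
  have fs: "L2_inner M f ?s = (\<Sum>n<N. (coef f n)\<^sup>2)"
    by (subst L2_inner_sum_right) (auto simp: in_L2 f power2_eq_square)
  have "L2_inner M (\<lambda>x. f x + (-1) * ?s x) (\<lambda>x. f x + (-1) * ?s x)
      = L2_inner M f f - (\<Sum>n<N. (coef f n)\<^sup>2)"
    by (simp only: L2_inner_square_add[OF f s] fs inner_sum_sum[OF finite_lessThan]) simp
  then show ?thesis by simp
qed

lemma Bessel: "f \<in> L2 M \<Longrightarrow> (\<Sum>n<N. (coef f n)\<^sup>2) \<le> L2_inner M f f"
  using inner_diff_partial_sum[of f N]
    L2_inner_self_nonneg[of M "\<lambda>x. f x - (\<Sum>n<N. coef f n * \<phi> n x)"] by simp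

lemma summable_coef_square: "f \<in> L2 M \<Longrightarrow> summable (\<lambda>n. (coef f n)\<^sup>2)"
  by (rule summableI_nonneg_bounded[OF _ Bessel]) auto

lemma Riesz_Fischer:
  assumes "summable (\<lambda>n. (c n)\<^sup>2)"
  obtains g where "g \<in> L2 M" "\<And>n. coef g n = c n"
    "(\<lambda>N. L2_norm M (\<lambda>x. g x - (\<Sum>n<N. c n * \<phi> n x))) \<longlonglongrightarrow> 0"
proof -
  define s where "s N x = (\<Sum>n<N. c n * \<phi> n x)" for N x
  have s: "s N \<in> L2 M" for N unfolding s_def by (intro L2_sum in_L2)
  have diff: "(L2_norm M (\<lambda>x. s m x - s n x))\<^sup>2 = (\<Sum>i = n..<m. (c i)\<^sup>2)" if "n \<le> m" for m n
  proof -
    have "s m x - s n x = (\<Sum>i = n..<m. c i * \<phi> i x)" for x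
    proof -
      have "{..<m} = {..<n} \<union> {n..<m}" using that by auto
      moreover have "{..<n} \<inter> {n..<m} = {}" by auto
      ultimately show ?thesis unfolding s_def by (simp add: sum.union_disjoint)
    qed
    then show ?thesis by (simp add: L2_norm_power2 inner_sum_sum)
  qed
  have Cauchy: "\<exists>N. \<forall>m\<ge>N. \<forall>n\<ge>N. L2_norm M (\<lambda>x. s m x - s n x) < e" if "e > 0" for e
  proof -
    have "e\<^sup>2 > 0" using that by simp
    then obtain N where N: "\<And>n m. n \<ge> N \<Longrightarrow> \<bar>\<Sum>i = n..<m. (c i)\<^sup>2\<bar> < e\<^sup>2"
      using assms unfolding summable_Cauchy real_norm_def by meson
    have *: "L2_norm M (\<lambda>x. s m x - s n x) < e" if "n \<ge> N" "m \<ge> n" for m n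
      by (rule power_less_imp_less_base[of _ 2])
        (use diff[OF \<open>m \<ge> n\<close>] N[OF \<open>n \<ge> N\<close>, of m] \<open>e > 0\<close> in auto)
    show ?thesis
    proof (intro exI[of _ N] allI impI)
      fix m n assume "N \<le> m" "N \<le> n"
      then show "L2_norm M (\<lambda>x. s m x - s n x) < e"
        using *[of n m] *[of m n] L2_norm_minus_commute[of M "s m" "s n"] by (cases "m \<le> n") auto
    qed
  qed
  obtain g where g: "g \<in> L2 M" "(\<lambda>n. L2_norm M (\<lambda>x. s n x - g x)) \<longlonglongrightarrow> 0"
    using L2_complete[of s, OF s Cauchy] by blast
  show ?thesis
  proof
    show "g \<in> L2 M" by (rule g)
    show "(\<lambda>N. L2_norm M (\<lambda>x. g x - (\<Sum>n<N. c n * \<phi> n x))) \<longlonglongrightarrow> 0"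
      using g(2) by (simp add: s_def L2_norm_minus_commute)
    fix n
    have "(\<lambda>N. coef (s N) n) \<longlonglongrightarrow> coef g n"
      by (rule L2_tendsto_inner[OF s g(1) in_L2 g(2)])
    moreover have "(\<lambda>N. coef (s N) n) \<longlonglongrightarrow> c n"
    proof (rule tendsto_eventually)
      show "\<forall>\<^sub>F N in sequentially. coef (s N) n = c n"
        using eventually_gt_at_top[of n]
        by eventually_elim (simp add: s_def[abs_def] coef_sum)
    qed
    ultimately show "coef g n = c n" by (rule LIMSEQ_unique)
  qed
qed

text \<open>The Riesz-Fischer sum of the Fourier series of \<open>f\<close> has the same
  coefficients as \<open>f\<close>, so their difference is orthogonal to every
  \<open>\<phi> n\<close>, hence null.\<close>

lemma complete_if_total:
  assumes total: "\<And>f. f \<in> L2 M \<Longrightarrow> (\<And>n. coef f n = 0) \<Longrightarrow> AE x in M. f x = 0"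
    and f: "f \<in> L2 M"
  shows "(\<lambda>N. L2_norm M (\<lambda>x. f x - (\<Sum>n<N. coef f n * \<phi> n x))) \<longlonglongrightarrow> 0"
proof -
  obtain g where g: "g \<in> L2 M" "\<And>n. coef g n = coef f n"
      "(\<lambda>N. L2_norm M (\<lambda>x. g x - (\<Sum>n<N. coef f n * \<phi> n x))) \<longlonglongrightarrow> 0"
    using Riesz_Fischer[OF summable_coef_square[OF f]] by blast
  have "AE x in M. f x - g x = 0"
    by (rule total) (use f g in \<open>auto simp: L2_inner_diff_left in_L2 intro: L2_diff\<close>)
  then have "L2_norm M (\<lambda>x. f x - (\<Sum>n<N. coef f n * \<phi> n x))
      = L2_norm M (\<lambda>x. g x - (\<Sum>n<N. coef f n * \<phi> n x))" for N
    by (intro L2_cong_AE_norm L2_diff L2_sum in_L2 f g) auto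
  then show ?thesis using g(3) by simp
qed

end

locale complete_orthonormal_sequence = orthonormal_sequence +
  assumes complete: "\<And>f. f \<in> L2 M \<Longrightarrow>
    (\<lambda>N. L2_norm M (\<lambda>x. f x - (\<Sum>n<N. coef f n * \<phi> n x))) \<longlonglongrightarrow> 0"
begin

lemma Parseval:
  assumes f: "f \<in> L2 M" and g: "g \<in> L2 M"
  shows "(\<lambda>n. coef f n * coef g n) sums L2_inner M f g"
proof -
  have "(\<lambda>N. L2_inner M (\<lambda>x. \<Sum>n<N. coef f n * \<phi> n x) g) \<longlonglongrightarrow> L2_inner M f g"
    using complete[OF f]
    by (intro L2_tendsto_inner L2_sum in_L2 f g) (simp add: L2_norm_minus_commute)
  moreover have "L2_inner M (\<lambda>x. \<Sum>n<N. coef f n * \<phi> n x) g = (\<Sum>n<N. coef f n * coef g n)" for N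
    by (subst L2_inner_sum_left) (auto simp: in_L2 g L2_inner_commute[of M g])
  ultimately show ?thesis by (simp add: sums_def)
qed

lemma Parseval_square: "f \<in> L2 M \<Longrightarrow> (\<lambda>n. (coef f n)\<^sup>2) sums L2_inner M f f"
  using Parseval[of f f] by (simp add: power2_eq_square)

lemma null_if_coef_0:
  assumes "f \<in> L2 M" "\<And>n. coef f n = 0"
  shows "AE x in M. f x = 0"
proof -
  have "L2_inner M f f = 0"
    using Parseval_square[OF assms(1)] assms(2) by (simp add: sums_iff)
  then show ?thesis using assms(1) by (simp add: L2_inner_self_eq_0_iff)
qed

lemma AE_eq_if_coef_eq:
  assumes "f \<in> L2 M" "g \<in> L2 M" "\<And>n. coef f n = coef g n"
  shows "AE x in M. f x = g x"
  using null_if_coef_0[of "\<lambda>x. f x - g x"] assms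
  by (simp add: L2_diff L2_inner_diff_left in_L2)

lemma inner_le_if_coef_le:
  assumes "f \<in> L2 M" "g \<in> L2 M" "\<And>n. (coef f n)\<^sup>2 \<le> K * (coef g n)\<^sup>2"
  shows "L2_inner M f f \<le> K * L2_inner M g g"
  using sums_le[OF assms(3) Parseval_square[OF assms(1)] sums_mult[OF Parseval_square[OF assms(2)]]] .

text \<open>One strict coefficient makes the whole inequality strict. The contradiction in
  \<open>card_localized_le\<close> rests on this, since the estimate from above there is not
  strict.\<close>

lemma inner_less_if_coef_less:
  assumes "f \<in> L2 M" "g \<in> L2 M" "\<And>n. (coef f n)\<^sup>2 \<le> K * (coef g n)\<^sup>2"
    and "(coef f m)\<^sup>2 < K * (coef g m)\<^sup>2"
  shows "L2_inner M f f < K * L2_inner M g g"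
proof -
  note f = Parseval_square[OF assms(1)] and g = sums_mult[OF Parseval_square[OF assms(2)], of K]
  have "0 < (\<Sum>n. K * (coef g n)\<^sup>2 - (coef f n)\<^sup>2)"
    using sums_diff[OF g f] assms(3,4) by (intro suminf_pos2[of _ m]) (auto simp: sums_iff)
  then show ?thesis using sums_diff[OF g f] by (simp add: sums_iff)
qed

end

section \<open>Operators with discrete spectrum\<close>

text \<open>\<open>op_coef\<close> says that T acts on its domain as multiplication by
  \<open>l\<close> on coefficients; with \<open>op_eigenfunction\<close> and
  \<open>op_linear\<close> this determines all eigenspaces. That every pair of functions related in
  this way belongs to T is the additional axiom of \<open>maximal_diagonal_operator\<close>, which
  provides the surjectivity in the resolvent set.\<close>

locale diagonal_operator = complete_orthonormal_sequence +
  fixes T :: "'a l2_op" and l :: "nat \<Rightarrow> real"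
  assumes op_L2: "T u g \<Longrightarrow> u \<in> L2 M \<and> g \<in> L2 M"
    and op_coef: "T u g \<Longrightarrow> coef g n = l n * coef u n"
    and op_eigenfunction: "T (\<phi> n) (\<lambda>x. l n * \<phi> n x)"
    and op_linear: "T u g \<Longrightarrow> T v h \<Longrightarrow> T (\<lambda>x. u x + c * v x) (\<lambda>x. g x + c * h x)"
    and eigenvalues_at_top: "filterlim l at_top sequentially"
begin

lemma finite_eigenvalues_le: "finite {n. l n \<le> C}"
proof -
  obtain N where "\<And>n. n \<ge> N \<Longrightarrow> l n > C"
    using eigenvalues_at_top unfolding filterlim_at_top_dense eventually_sequentially by blast
  then have "{n. l n \<le> C} \<subseteq> {..<N}" by (auto simp: not_less[symmetric])
  then show ?thesis by (rule finite_subset) simp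
qed

lemma finite_eigenvalues_in: "finite {n. l n \<in> {a..b}}"
  by (rule finite_subset[OF _ finite_eigenvalues_le[of b]]) auto

lemma finite_eigenvalues_eq: "finite {n. l n = z}"
  by (rule finite_subset[OF _ finite_eigenvalues_le[of z]]) auto

lemma op_zero: "T (\<lambda>x. 0) (\<lambda>x. 0)"
  using op_linear[OF op_eigenfunction op_eigenfunction, of 0 "-1" 0] by simp

lemma op_sum:
  assumes "finite A"
  shows "T (\<lambda>x. \<Sum>n\<in>A. c n * \<phi> n x) (\<lambda>x. \<Sum>n\<in>A. c n * (l n * \<phi> n x))"
  using assms
proof (induction A rule: finite_induct)
  case empty
  then show ?case using op_zero by simp
next
  case (insert n A)
  from op_linear[OF insert.IH op_eigenfunction, of "c n" n] insert.hyps show ?case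
    by (simp add: add.commute)
qed

lemma eigenspace_sum:
  assumes "finite A" "\<And>n. n \<in> A \<Longrightarrow> l n = z"
  shows "(\<lambda>x. \<Sum>n\<in>A. c n * \<phi> n x) \<in> eigenspace M T z"
proof -
  have "(\<lambda>x. \<Sum>n\<in>A. c n * (l n * \<phi> n x)) = (\<lambda>x. z * (\<Sum>n\<in>A. c n * \<phi> n x))"
    using assms(2) by (simp add: sum_distrib_left algebra_simps)
  then show ?thesis
    using op_sum[OF assms(1), of c] op_L2 by (auto simp: eigenspace_def)
qed

lemma eigenspace_coef:
  assumes "u \<in> eigenspace M T z" "l n \<noteq> z"
  shows "coef u n = 0"
proof -
  have "coef (\<lambda>x. z * u x) n = l n * coef u n"
    using assms(1) by (intro op_coef) (simp add: eigenspace_def)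
  then show ?thesis using assms(2) by (simp add: L2_inner_scale_left)
qed

lemma eigenspace_expansion:
  assumes u: "u \<in> eigenspace M T z"
  shows "AE x in M. u x = (\<Sum>n | l n = z. coef u n * \<phi> n x)"
proof (rule AE_eq_if_coef_eq)
  show "u \<in> L2 M" using u by (simp add: eigenspace_def)
  show "(\<lambda>x. \<Sum>n | l n = z. coef u n * \<phi> n x) \<in> L2 M" by (intro L2_sum in_L2)
  show "coef u n = coef (\<lambda>x. \<Sum>n | l n = z. coef u n * \<phi> n x) n" for n
    using eigenspace_coef[OF u, of n] by (simp add: coef_sum finite_eigenvalues_eq)
qed

lemma eigenspace_has_dim: "L2_has_dim M (eigenspace M T z) (card {n. l n = z})"
proof -
  let ?K = "{n. l n = z}"
  obtain b where b: "bij_betw b {..<card ?K} ?K"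
    using ex_bij_betw_nat_finite[OF finite_eigenvalues_eq[of z]] by (auto simp: atLeast0LessThan)
  have sum_b: "(\<Sum>n\<in>?K. c n * \<phi> n x) = (\<Sum>i<card ?K. c (b i) * \<phi> (b i) x)" for c x
    by (rule sum.reindex_bij_betw[OF b, symmetric])
  have "\<phi> (b i) \<in> eigenspace M T z" if "i < card ?K" for i
    using eigenspace_sum[of "{b i}" z "\<lambda>_. 1"] bij_betwE[OF b] that by auto
  moreover have "c i = 0"
    if AE0: "AE x in M. (\<Sum>i<card ?K. c i * \<phi> (b i) x) = 0" and i: "i < card ?K" for c i
  proof -
    define c' where "c' n = c (the_inv_into {..<card ?K} b n)" for n
    have c': "c' (b i) = c i" if "i < card ?K" for i
      using b that by (simp add: c'_def bij_betw_def the_inv_into_f_f)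
    let ?s = "\<lambda>x. \<Sum>n\<in>?K. c' n * \<phi> n x"
    have "?s \<in> L2 M" by (intro L2_sum in_L2)
    moreover have "AE x in M. ?s x = 0"
      using AE0 by (simp add: sum_b c')
    ultimately have "L2_inner M ?s ?s = 0" by (simp add: L2_inner_self_eq_0_iff)
    then have "\<forall>n\<in>?K. c' n = 0"
      by (simp add: inner_sum_sum finite_eigenvalues_eq sum_nonneg_eq_0_iff)
    then show ?thesis using c'[OF i] bij_betwE[OF b] i by auto
  qed
  moreover have "\<exists>c. AE x in M. u x = (\<Sum>i<card ?K. c i * \<phi> (b i) x)"
    if "u \<in> eigenspace M T z" for u
    using eigenspace_expansion[OF that] by (intro exI[of _ "\<lambda>i. coef u (b i)"]) (simp add: sum_b)
  ultimately show ?thesis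
    unfolding L2_has_dim_def by (intro exI[of _ "\<lambda>i. \<phi> (b i)"]) blast
qed

lemma multiplicity_eq: "multiplicity_of M T z = card {n. l n = z}"
  unfolding multiplicity_of_def by (rule L2_dim_eq[OF eigenspace_has_dim])

lemma is_eigenvalue_iff: "is_eigenvalue M T z \<longleftrightarrow> z \<in> range l"
proof
  assume "is_eigenvalue M T z"
  then obtain u where u: "u \<in> eigenspace M T z" "\<not> (AE x in M. u x = 0)"
    unfolding is_eigenvalue_def by blast
  show "z \<in> range l"
  proof (rule ccontr)
    assume "z \<notin> range l"
    then have "{n. l n = z} = {}" by auto
    then show False using eigenspace_expansion[OF u(1)] u(2) by simp
  qed
next
  assume "z \<in> range l"
  then obtain n where n: "z = l n" by auto
  have "\<phi> n \<in> eigenspace M T z" using n in_L2 op_eigenfunction by (simp add: eigenspace_def)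
  moreover have "\<not> (AE x in M. \<phi> n x = 0)"
    using L2_inner_self_eq_0_iff[OF in_L2, of n] orthonormal[of n n] by simp
  ultimately show "is_eigenvalue M T z" unfolding is_eigenvalue_def by blast
qed

lemma eigenvalue_in_spectrum: "l n \<in> spectrum M T"
proof -
  have "\<not> (\<exists>C. \<forall>u g. T u g \<longrightarrow> L2_norm M u \<le> C * L2_norm M (\<lambda>x. g x - l n * u x))"
  proof
    assume "\<exists>C. \<forall>u g. T u g \<longrightarrow> L2_norm M u \<le> C * L2_norm M (\<lambda>x. g x - l n * u x)"
    then obtain C where "L2_norm M (\<phi> n) \<le> C * L2_norm M (\<lambda>x. l n * \<phi> n x - l n * \<phi> n x)"
      using op_eigenfunction by blast
    then show False using orthonormal[of n n] by (simp add: L2_norm_eq_sqrt) (simp add: L2_inner_def)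
  qed
  then show ?thesis by (simp add: spectrum_def resolvent_set_def)
qed

end

locale maximal_diagonal_operator = diagonal_operator +
  assumes op_maximal: "u \<in> L2 M \<Longrightarrow> g \<in> L2 M \<Longrightarrow> (\<And>n. coef g n = l n * coef u n) \<Longrightarrow> T u g"
begin

text \<open>As the eigenvalues tend to infinity, a number outside their range keeps a positive
  distance \<open>\<delta>\<close> from all of them; dividing coefficients by \<open>l n - z\<close>
  is then the bounded inverse.\<close>

lemma spectrum_eq: "spectrum M T = range l"
proof
  show "range l \<subseteq> spectrum M T" using eigenvalue_in_spectrum by auto
  show "spectrum M T \<subseteq> range l"
  proof
    fix z assume z: "z \<in> spectrum M T"
    show "z \<in> range l"
    proof (rule ccontr)
      assume z_notin: "z \<notin> range l"
      obtain \<delta> where \<delta>: "\<delta> > 0" "\<And>n. \<delta> \<le> \<bar>l n - z\<bar>"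
      proof -
        \<comment> \<open>Only finitely many eigenvalues lie below \<open>z + 1\<close>; all others
          are farther than 1 from \<open>z\<close>, which explains the element 1 of the finite
          set.\<close>
        let ?K = "{n. l n \<le> z + 1}"
        let ?S = "insert 1 ((\<lambda>n. \<bar>l n - z\<bar>) ` ?K)"
        have fin: "finite ?S" using finite_eigenvalues_le by simp
        have "Min ?S > 0" using fin z_notin by (subst Min_gr_iff) auto
        moreover have "Min ?S \<le> \<bar>l n - z\<bar>" for n
        proof (cases "n \<in> ?K")
          case True
          then show ?thesis using fin by (intro Min_le) auto
        next
          case False
          then have "1 \<le> \<bar>l n - z\<bar>" by simp
          moreover have "Min ?S \<le> 1" using fin by (intro Min_le) auto
          ultimately show ?thesis by linarith
        qed
        ultimately show ?thesis using that by blast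
      qed
      have "\<exists>C. \<forall>u g. T u g \<longrightarrow> L2_norm M u \<le> C * L2_norm M (\<lambda>x. g x - z * u x)"
      proof (intro exI allI impI)
        fix u g assume Tug: "T u g"
        note L2 = op_L2[OF Tug, THEN conjunct1] op_L2[OF Tug, THEN conjunct2]
        have d: "(\<lambda>x. g x - z * u x) \<in> L2 M" by (intro L2_diff L2_scale L2)
        have "L2_inner M u u
            \<le> (1 / \<delta>)\<^sup>2 * L2_inner M (\<lambda>x. g x - z * u x) (\<lambda>x. g x - z * u x)"
        proof (rule inner_le_if_coef_le[OF L2(1) d])
          fix n
          have "coef (\<lambda>x. g x - z * u x) n = (l n - z) * coef u n"
            using op_coef[OF Tug, of n]
            by (simp add: L2_inner_diff_left L2 L2_scale in_L2 L2_inner_scale_left algebra_simps)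
          then have "(coef (\<lambda>x. g x - z * u x) n)\<^sup>2 = (l n - z)\<^sup>2 * (coef u n)\<^sup>2"
            by (simp add: power_mult_distrib)
          moreover have "\<delta>\<^sup>2 \<le> (l n - z)\<^sup>2"
            using \<delta>(1) \<delta>(2)[of n] by (simp add: abs_le_square_iff[symmetric])
          then have "\<delta>\<^sup>2 * (coef u n)\<^sup>2 \<le> (l n - z)\<^sup>2 * (coef u n)\<^sup>2" by (rule mult_right_mono) simp
          ultimately show "(coef u n)\<^sup>2 \<le> (1 / \<delta>)\<^sup>2 * (coef (\<lambda>x. g x - z * u x) n)\<^sup>2"
            using \<delta>(1) by (simp add: power_divide pos_le_divide_eq mult.commute)
        qed
        then have "sqrt (L2_inner M u u)
            \<le> sqrt ((1 / \<delta>)\<^sup>2 * L2_inner M (\<lambda>x. g x - z * u x) (\<lambda>x. g x - z * u x))" by simp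
        then show "L2_norm M u \<le> 1 / \<delta> * L2_norm M (\<lambda>x. g x - z * u x)"
          using \<delta>(1) by (simp add: L2_norm_eq_sqrt real_sqrt_mult real_sqrt_divide)
      qed
      moreover have "\<exists>u g. T u g \<and> (AE x in M. g x - z * u x = f x)" if f: "f \<in> L2 M" for f
      proof -
        have "summable (\<lambda>n. (coef f n / (l n - z))\<^sup>2)"
        proof (rule summable_comparison_test)
          show "summable (\<lambda>n. (coef f n)\<^sup>2 * (1 / \<delta>\<^sup>2))"
            by (intro summable_mult2 summable_coef_square f)
          have "(coef f n / (l n - z))\<^sup>2 \<le> (coef f n)\<^sup>2 * (1 / \<delta>\<^sup>2)" for n
          proof -
            have "\<delta>\<^sup>2 \<le> (l n - z)\<^sup>2"
              using \<delta>(1) \<delta>(2)[of n] by (simp add: abs_le_square_iff[symmetric])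
            then have "(coef f n)\<^sup>2 / (l n - z)\<^sup>2 \<le> (coef f n)\<^sup>2 / \<delta>\<^sup>2"
              using \<delta>(1) by (intro divide_left_mono mult_pos_pos) (auto intro: less_le_trans[of 0 "\<delta>\<^sup>2"])
            then show ?thesis by (simp add: power_divide)
          qed
          then show "\<exists>N. \<forall>n\<ge>N. norm ((coef f n / (l n - z))\<^sup>2) \<le> (coef f n)\<^sup>2 * (1 / \<delta>\<^sup>2)" by simp
        qed
        from Riesz_Fischer[OF this] obtain u
          where u: "u \<in> L2 M" "\<And>n. coef u n = coef f n / (l n - z)" by blast
        have "T u (\<lambda>x. f x + z * u x)"
        proof (rule op_maximal)
          fix n
          have "l n - z \<noteq> 0" using z_notin by auto
          then show "coef (\<lambda>x. f x + z * u x) n = l n * coef u n"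
            by (simp add: L2_inner_add_left L2_inner_scale_left L2_scale f u in_L2 field_simps)
        qed (use f u in \<open>auto intro: L2_add L2_scale\<close>)
        then show ?thesis by (intro exI[of _ u] exI[of _ "\<lambda>x. f x + z * u x"]) simp
      qed
      ultimately have "z \<in> resolvent_set M T" by (simp add: resolvent_set_def)
      then show False using z by (simp add: spectrum_def)
    qed
  qed
qed

end

section \<open>Closed forms with compact embedding\<close>

text \<open>Closedness of the form enters through \<open>compact_embedding\<close>: the L2 limit
  lies in \<open>D\<close>, and any bound that eventually holds for the energies along the
  subsequence passes to it. This states lower semicontinuity without a liminf.
  \<open>dom_total\<close> expresses that \<open>D\<close> is dense.\<close>

locale compact_form = finite_measure M
  for M :: "'a measure" +
  fixes D :: "('a \<Rightarrow> real) set" and Q :: "('a \<Rightarrow> real) \<Rightarrow> ('a \<Rightarrow> real) \<Rightarrow> real"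
  assumes dom_L2: "u \<in> D \<Longrightarrow> u \<in> L2 M"
    and dom_linear: "u \<in> D \<Longrightarrow> v \<in> D \<Longrightarrow> (\<lambda>x. u x + c * v x) \<in> D"
    and form_commute: "u \<in> D \<Longrightarrow> v \<in> D \<Longrightarrow> Q u v = Q v u"
    and form_linear: "u \<in> D \<Longrightarrow> v \<in> D \<Longrightarrow> w \<in> D \<Longrightarrow> Q (\<lambda>x. u x + c * v x) w = Q u w + c * Q v w"
    and form_nonneg: "u \<in> D \<Longrightarrow> 0 \<le> Q u u"
    and compact_embedding:
      "(\<And>n. s n \<in> D) \<Longrightarrow> (\<And>n. Q (s n) (s n) \<le> C) \<Longrightarrow> (\<And>n. L2_inner M (s n) (s n) \<le> 1) \<Longrightarrow>
        \<exists>(r :: nat \<Rightarrow> nat) v. strict_mono r \<and> v \<in> D \<and> (\<lambda>n. L2_norm M (\<lambda>x. s (r n) x - v x)) \<longlonglongrightarrow> 0 \<and>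
          (\<forall>B. (\<forall>\<^sub>F n in sequentially. Q (s (r n)) (s (r n)) \<le> B) \<longrightarrow> Q v v \<le> B)"
    and dom_infinite:
      "\<exists>e :: nat \<Rightarrow> 'a \<Rightarrow> real. (\<forall>i<n. e i \<in> D) \<and>
        (\<forall>c :: nat \<Rightarrow> real. (AE x in M. (\<Sum>i<n. c i * e i x) = 0) \<longrightarrow> (\<forall>i<n. c i = 0))"
    and dom_total:
      "f \<in> L2 M \<Longrightarrow> (\<And>v. v \<in> D \<Longrightarrow> L2_inner M f v = 0) \<Longrightarrow> AE x in M. f x = 0"
begin

lemma dom_zero: "(\<lambda>x. 0) \<in> D"
proof -
  obtain e :: "nat \<Rightarrow> 'a \<Rightarrow> real" where "e 0 \<in> D" using dom_infinite[of 1] by auto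
  from dom_linear[OF this this, of "-1"] show ?thesis by simp
qed

lemma dom_scale: "u \<in> D \<Longrightarrow> (\<lambda>x. c * u x) \<in> D"
  using dom_linear[OF dom_zero, of u c] by simp

lemma dom_sum:
  assumes "finite A" "\<And>i. i \<in> A \<Longrightarrow> f i \<in> D"
  shows "(\<lambda>x. \<Sum>i\<in>A. c i * f i x) \<in> D"
  using assms
proof (induction A rule: finite_induct)
  case (insert i A)
  then show ?case using dom_linear[of "\<lambda>x. \<Sum>i\<in>A. c i * f i x" "f i" "c i"] by (simp add: add.commute)
qed (simp add: dom_zero)

lemma form_zero: "w \<in> D \<Longrightarrow> Q (\<lambda>x. 0) w = 0"
  using form_linear[OF dom_zero dom_zero, of w 1] by simp

lemma form_scale: "u \<in> D \<Longrightarrow> w \<in> D \<Longrightarrow> Q (\<lambda>x. c * u x) w = c * Q u w"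
  using form_linear[OF dom_zero, of u w c] by (simp add: form_zero)

lemma form_sum:
  assumes "finite A" "\<And>i. i \<in> A \<Longrightarrow> f i \<in> D" "w \<in> D"
  shows "Q (\<lambda>x. \<Sum>i\<in>A. c i * f i x) w = (\<Sum>i\<in>A. c i * Q (f i) w)"
  using assms
proof (induction A rule: finite_induct)
  case (insert i A)
  then show ?case
    using form_linear[OF dom_sum[OF insert.hyps(1), of f c], of "f i" w "c i"] by (simp add: add.commute)
qed (simp add: form_zero)

lemma form_square_add:
  assumes "u \<in> D" "v \<in> D"
  shows "Q (\<lambda>x. u x + c * v x) (\<lambda>x. u x + c * v x) = Q u u + 2 * c * Q u v + c\<^sup>2 * Q v v"
proof -
  have uv: "(\<lambda>x. u x + c * v x) \<in> D" by (intro dom_linear assms)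
  have "Q u (\<lambda>x. u x + c * v x) = Q u u + c * Q v u" "Q v (\<lambda>x. u x + c * v x) = Q u v + c * Q v v"
    using assms by (simp_all add: form_commute[OF _ uv] form_linear)
  then show ?thesis
    using form_linear[OF assms uv] form_commute[OF assms] by (simp add: power2_eq_square algebra_simps)
qed

text \<open>Direct method: norm and orthogonality constraints pass to the L2 limit of a minimizing
  sequence on the unit sphere, and lower semicontinuity makes the limit a minimizer. The minimum
  property is stated in homogeneous form, for \<open>w\<close> of any norm.\<close>

lemma constrained_minimizer:
  fixes n :: nat
  assumes \<phi>: "\<And>i. i < n \<Longrightarrow> \<phi> i \<in> D"
  obtains u where "u \<in> D" "\<And>i. i < n \<Longrightarrow> L2_inner M u (\<phi> i) = 0" "L2_inner M u u = 1"
    "\<And>w. w \<in> D \<Longrightarrow> (\<And>i. i < n \<Longrightarrow> L2_inner M w (\<phi> i) = 0) \<Longrightarrow> Q u u * L2_inner M w w \<le> Q w w"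
proof -
  define S where "S = {u \<in> D. (\<forall>i<n. L2_inner M u (\<phi> i) = 0) \<and> L2_inner M u u = 1}"
  define c where "c w = 1 / L2_norm M w" for w
  have c: "(c w)\<^sup>2 * L2_inner M w w = 1" if "L2_inner M w w \<noteq> 0" for w
    using that by (simp add: c_def L2_norm_power2 power_divide)
  have normalize: "(\<lambda>x. c w * w x) \<in> S"
    if w: "w \<in> D" "\<And>i. i < n \<Longrightarrow> L2_inner M w (\<phi> i) = 0" "L2_inner M w w \<noteq> 0" for w
    using w(1,2) c[OF w(3)]
    by (auto simp: S_def dom_scale L2_inner_scale_left L2_inner_scale_right power2_eq_square mult.assoc)
  \<comment> \<open>Among the combinations of \<open>Suc n\<close> independent elements of
    \<open>D\<close> there is a nonzero one meeting the \<open>n\<close> linear constraints.\<close>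
  have "S \<noteq> {}"
  proof -
    obtain e where e: "\<And>i. i < Suc n \<Longrightarrow> e i \<in> D"
      "\<And>c i. AE x in M. (\<Sum>i<Suc n. c i * e i x) = 0 \<Longrightarrow> i < Suc n \<Longrightarrow> c i = (0 :: real)"
      using dom_infinite[of "Suc n"] by metis
    obtain c :: "nat \<Rightarrow> real" where c: "\<exists>i\<in>{..<Suc n}. c i \<noteq> 0"
        "\<And>k. k \<in> {..<n} \<Longrightarrow> (\<Sum>i<Suc n. c i * L2_inner M (e i) (\<phi> k)) = 0"
      using homogeneous_system_nontrivial_solution[of "{..<Suc n}" "{..<n}" "\<lambda>i k. L2_inner M (e i) (\<phi> k)"]
      by auto
    let ?w = "\<lambda>x. \<Sum>i<Suc n. c i * e i x"
    have D: "?w \<in> D" using e(1) by (intro dom_sum) auto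
    have "L2_inner M ?w ?w \<noteq> 0"
      using c(1) e(2)[of c] L2_inner_self_eq_0_iff[OF dom_L2[OF D]] by blast
    moreover have "L2_inner M ?w (\<phi> k) = 0" if "k < n" for k
      using c(2)[of k] that e(1) \<phi> by (subst L2_inner_sum_left) (auto intro: dom_L2)
    ultimately show ?thesis using normalize[OF D] by auto
  qed
  define m where "m = (INF u\<in>S. Q u u)"
  have bdd: "bdd_below ((\<lambda>u. Q u u) ` S)"
    by (rule bdd_belowI2[of _ 0]) (auto simp: S_def form_nonneg)
  have "\<exists>u\<in>S. Q u u < m + 1 / real (Suc k)" for k
    using cInf_lessD[of "(\<lambda>u. Q u u) ` S" "m + 1 / real (Suc k)"] \<open>S \<noteq> {}\<close>
    unfolding m_def by auto
  then obtain w where w: "\<And>k. w k \<in> S" "\<And>k. Q (w k) (w k) < m + 1 / real (Suc k)" by metis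
  have wD: "w k \<in> D" for k using w(1) by (auto simp: S_def)
  have bound: "Q (w k) (w k) \<le> m + 1" for k
  proof -
    have "1 / real (Suc k) \<le> 1" by simp
    then show ?thesis using w(2)[of k] by linarith
  qed
  have "L2_inner M (w k) (w k) \<le> 1" for k using w(1)[of k] by (simp add: S_def)
  from compact_embedding[of w, OF wD bound this] obtain r u where r: "strict_mono r" and u: "u \<in> D"
    and lim: "(\<lambda>k. L2_norm M (\<lambda>x. w (r k) x - u x)) \<longlonglongrightarrow> 0"
    and lsc: "\<And>B. \<forall>\<^sub>F k in sequentially. Q (w (r k)) (w (r k)) \<le> B \<Longrightarrow> Q u u \<le> B" by blast
  note wL2 = dom_L2[OF wD]
  have u0: "L2_inner M u (\<phi> i) = 0" if "i < n" for i
  proof -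
    have "(\<lambda>k. L2_inner M (w (r k)) (\<phi> i)) \<longlonglongrightarrow> L2_inner M u (\<phi> i)"
      by (rule L2_tendsto_inner[OF wL2 dom_L2[OF u] dom_L2[OF \<phi>[OF that]] lim])
    moreover have "(\<lambda>k. L2_inner M (w (r k)) (\<phi> i)) = (\<lambda>k. 0)"
      using w(1) that by (auto simp: S_def)
    ultimately show ?thesis using LIMSEQ_unique tendsto_const by metis
  qed
  have u1: "L2_inner M u u = 1"
  proof -
    have "(\<lambda>k. L2_norm M (w (r k))) \<longlonglongrightarrow> L2_norm M u"
      by (rule L2_tendsto_norm[OF wL2 dom_L2[OF u] lim])
    moreover have "(\<lambda>k. L2_norm M (w (r k))) = (\<lambda>k. 1)"
      using w(1) by (auto simp: S_def L2_norm_eq_sqrt)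
    ultimately have "L2_norm M u = 1" using LIMSEQ_unique tendsto_const by metis
    then show ?thesis using L2_norm_power2[of M u] by simp
  qed
  have "Q u u \<le> m"
  proof (rule field_le_epsilon)
    fix e :: real assume "e > 0"
    then obtain N where N: "1 / real (Suc N) < e" using nat_approx_posE by blast
    show "Q u u \<le> m + e"
    proof (rule lsc)
      show "\<forall>\<^sub>F k in sequentially. Q (w (r k)) (w (r k)) \<le> m + e"
        using eventually_ge_at_top[of N]
      proof eventually_elim
        case (elim k)
        then have "N \<le> r k" using seq_suble[OF r, of k] by simp
        then have "1 / real (Suc (r k)) \<le> 1 / real (Suc N)" by (simp add: field_simps)
        then show ?case using w(2)[of "r k"] N by linarith
      qed
    qed
  qed
  moreover have "m * L2_inner M w w \<le> Q w w"
    if w: "w \<in> D" "\<And>i. i < n \<Longrightarrow> L2_inner M w (\<phi> i) = 0" for w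
  proof (cases "L2_inner M w w = 0")
    case True
    then show ?thesis using form_nonneg[OF w(1)] by simp
  next
    case False
    let ?v = "\<lambda>x. c w * w x"
    have pos: "L2_inner M w w > 0" using False L2_inner_self_nonneg[of M w] by linarith
    have "m \<le> Q ?v ?v"
      unfolding m_def by (rule cINF_lower[OF bdd normalize[OF w False]])
    also have "\<dots> = (c w)\<^sup>2 * Q w w"
    proof -
      have v: "?v \<in> D" by (intro dom_scale w)
      have "Q ?v ?v = c w * Q w ?v" by (rule form_scale[OF w(1) v])
      also have "Q w ?v = c w * Q w w"
        using form_scale[OF w(1,1)] form_commute[OF w(1) v] by simp
      finally show ?thesis by (simp add: power2_eq_square)
    qed
    finally have "m * L2_inner M w w \<le> (c w)\<^sup>2 * Q w w * L2_inner M w w"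
      using pos by (intro mult_right_mono) auto
    also have "\<dots> = ((c w)\<^sup>2 * L2_inner M w w) * Q w w" by (simp only: mult_ac)
    finally show ?thesis using c[OF False] by simp
  qed
  then have "Q u u * L2_inner M w w \<le> Q w w"
    if "w \<in> D" "\<And>i. i < n \<Longrightarrow> L2_inner M w (\<phi> i) = 0" for w
    using that mult_right_mono[OF \<open>Q u u \<le> m\<close> L2_inner_self_nonneg[of M w]] by fastforce
  ultimately show ?thesis using that[of u] u u0 u1 by blast
qed

text \<open>The eigenfunctions are successive minimizers, each orthogonal to its predecessors.
  Compactness makes \<open>l\<close> tend to infinity, and this growth in turn gives
  completeness.\<close>

theorem eigenbasis:
  obtains \<phi> l where "\<And>n. \<phi> n \<in> D" "complete_orthonormal_sequence M \<phi>"
    "\<And>n v. v \<in> D \<Longrightarrow> Q (\<phi> n) v = l n * L2_inner M (\<phi> n) v"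
    "filterlim l at_top sequentially"
proof -
  define P where "P \<phi> n u \<longleftrightarrow> u \<in> D \<and> (\<forall>i<n. L2_inner M u (\<phi> i) = 0) \<and> L2_inner M u u = 1 \<and>
      (\<forall>w\<in>D. (\<forall>i<n. L2_inner M w (\<phi> i) = 0) \<longrightarrow> Q u u * L2_inner M w w \<le> Q w w)"
    for \<phi> :: "nat \<Rightarrow> 'a \<Rightarrow> real" and n u
  have "\<exists>\<phi>. \<forall>n. P \<phi> n (\<phi> n)"
  proof (rule dependent_wellorder_choice)
    show "P f n u = P g n u" if "\<And>i. i < n \<Longrightarrow> f i = g i" for f g n u
      using that unfolding P_def by auto
    show "\<exists>u. P f n u" if "\<And>i. i < n \<Longrightarrow> P f i (f i)" for n f
    proof -
      have "f i \<in> D" if "i < n" for i using \<open>\<And>i. i < n \<Longrightarrow> P f i (f i)\<close>[OF that] by (simp add: P_def)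
      from constrained_minimizer[of n f, OF this] show ?thesis unfolding P_def by metis
    qed
  qed
  then obtain \<phi> where P: "\<And>n. P \<phi> n (\<phi> n)" by blast
  define l where "l n = Q (\<phi> n) (\<phi> n)" for n
  have D: "\<phi> n \<in> D" and norm1: "L2_inner M (\<phi> n) (\<phi> n) = 1" for n
    using P[of n] by (auto simp: P_def)
  have min: "l n * L2_inner M w w \<le> Q w w"
    if "w \<in> D" "\<And>i. i < n \<Longrightarrow> L2_inner M w (\<phi> i) = 0" for n w
    using P[of n] that by (auto simp: P_def l_def)
  have ortho: "L2_inner M (\<phi> m) (\<phi> n) = (if m = n then 1 else 0)" for m n
    using P[of m] P[of n] L2_inner_commute[of M "\<phi> m" "\<phi> n"]
    by (cases m n rule: linorder_cases) (auto simp: P_def)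
  interpret orthonormal_sequence M \<phi>
    by unfold_locales (auto simp: ortho dom_L2 D)
  let ?rest = "\<lambda>v n x. v x - (\<Sum>i<n. coef v i * \<phi> i x)"
  have rest_D: "?rest v n \<in> D" if "v \<in> D" for v n
    using dom_linear[OF that dom_sum[of "{..<n}" \<phi> "coef v"], of "-1"] D by simp
  have coef_rest: "coef (?rest v n) i = 0" if "v \<in> D" "i < n" for v n i
  proof -
    have "coef (?rest v n) i = coef v i - coef (\<lambda>x. \<Sum>i<n. coef v i * \<phi> i x) i"
      by (rule L2_inner_diff_left) (auto intro: dom_L2 L2_sum in_L2 that)
    then show ?thesis using that by (simp add: coef_sum)
  qed
  have form_rest: "Q (?rest v n) w = Q v w - (\<Sum>i<n. coef v i * Q (\<phi> i) w)" if "v \<in> D" "w \<in> D" for v n w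
  proof -
    have s: "(\<lambda>x. \<Sum>i<n. coef v i * \<phi> i x) \<in> D" using D by (intro dom_sum) auto
    have "Q (\<lambda>x. v x + (-1) * (\<Sum>i<n. coef v i * \<phi> i x)) w
        = Q v w + (-1) * Q (\<lambda>x. \<Sum>i<n. coef v i * \<phi> i x) w"
      by (rule form_linear[OF that(1) s that(2)])
    then show ?thesis using form_sum[of "{..<n}" \<phi> w "coef v"] D that by simp
  qed
  have eigen: "Q (\<phi> n) v = l n * L2_inner M (\<phi> n) v" if "v \<in> D" for n v
    using that
  proof (induction n arbitrary: v rule: less_induct)
    case (less n)
    let ?w = "?rest v n"
    have w: "?w \<in> D" "\<And>i. i < n \<Longrightarrow> coef ?w i = 0"
      using rest_D coef_rest less.prems by auto
    \<comment> \<open>\<open>\<phi> n + t ?w\<close> satisfies the constraints for every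
      \<open>t\<close>, so the Rayleigh inequality is a nonnegative quadratic in \<open>t\<close>
      without constant term; its linear coefficient must vanish.\<close>
    have "(Q (\<phi> n) ?w - l n * L2_inner M (\<phi> n) ?w)\<^sup>2 \<le> 0 * (Q ?w ?w - l n * L2_inner M ?w ?w)"
    proof (rule discriminant_nonneg_form)
      fix t :: real
      let ?u = "\<lambda>x. \<phi> n x + t * ?w x"
      have "?u \<in> D" by (intro dom_linear D w)
      moreover have "coef ?u i = 0" if "i < n" for i
        using that w by (simp add: L2_inner_add_left L2_inner_scale_left L2_scale dom_L2 D ortho)
      ultimately have "l n * L2_inner M ?u ?u \<le> Q ?u ?u" by (intro min)
      then show "0 \<le> 0 + 2 * t * (Q (\<phi> n) ?w - l n * L2_inner M (\<phi> n) ?w)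
          + t\<^sup>2 * (Q ?w ?w - l n * L2_inner M ?w ?w)"
        unfolding form_square_add[OF D w(1)] L2_inner_square_add[OF in_L2 dom_L2[OF w(1)]]
        by (simp add: norm1 l_def algebra_simps)
    qed
    then have *: "Q (\<phi> n) ?w = l n * L2_inner M (\<phi> n) ?w" by simp
    have "Q (\<phi> i) (\<phi> n) = 0" if "i < n" for i
      using less.IH[OF that D] that by (simp add: ortho)
    then have "Q (\<phi> n) v = Q (\<phi> n) ?w"
      using form_rest[OF less.prems D, of n n] form_commute[OF D] w less.prems by simp
    moreover have "L2_inner M (\<phi> n) ?w = L2_inner M (\<phi> n) v"
    proof -
      have "L2_inner M (\<phi> n) ?w = L2_inner M (\<phi> n) v - L2_inner M (\<phi> n) (\<lambda>x. \<Sum>i<n. coef v i * \<phi> i x)"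
        by (rule L2_inner_diff_right) (auto intro: dom_L2 L2_sum in_L2 less.prems)
      also have "L2_inner M (\<phi> n) (\<lambda>x. \<Sum>i<n. coef v i * \<phi> i x) = 0"
        by (subst L2_inner_commute) (simp add: coef_sum)
      finally show ?thesis by simp
    qed
    ultimately show ?case using * by simp
  qed
  have l_nonneg: "0 \<le> l n" for n unfolding l_def by (intro form_nonneg D)
  have at_top: "filterlim l at_top sequentially"
  proof -
    have "finite {n. l n \<le> C}" for C
    proof (rule ccontr)
      assume inf: "infinite {n. l n \<le> C}"
      \<comment> \<open>Infinitely many orthonormal functions of bounded energy would have, along a
        subsequence, an L2 limit of norm 1 orthogonal to all of them, hence to itself.\<close>
      define e where "e = enumerate {n. l n \<le> C}"
      have e: "strict_mono e" "\<And>k. l (e k) \<le> C"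
        using inf enumerate_in_set[OF inf] by (auto simp: e_def strict_mono_enumerate)
      obtain r v where r: "strict_mono r" and v: "v \<in> D"
        and lim: "(\<lambda>n. L2_norm M (\<lambda>x. \<phi> (e (r n)) x - v x)) \<longlonglongrightarrow> 0"
        using compact_embedding[of "\<lambda>k. \<phi> (e k)" C] D e(2) norm1 by (auto simp: l_def)
      have "coef v i = 0" for i
      proof -
        have "(\<lambda>n. L2_inner M (\<phi> (e (r n))) (\<phi> i)) \<longlonglongrightarrow> coef v i"
          by (rule L2_tendsto_inner[OF in_L2 dom_L2[OF v] in_L2 lim])
        moreover have "(\<lambda>n. L2_inner M (\<phi> (e (r n))) (\<phi> i)) \<longlonglongrightarrow> 0"
        proof (rule tendsto_eventually)
          show "\<forall>\<^sub>F n in sequentially. L2_inner M (\<phi> (e (r n))) (\<phi> i) = 0"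
            using eventually_gt_at_top[of i]
          proof eventually_elim
            case (elim n)
            then have "i < e (r n)" using seq_suble[OF r, of n] seq_suble[OF e(1), of "r n"] by simp
            then show ?case by (simp add: ortho)
          qed
        qed
        ultimately show ?thesis by (rule LIMSEQ_unique)
      qed
      then have "L2_inner M (\<phi> (e (r n))) v = 0" for n
        by (subst L2_inner_commute)
      moreover have "(\<lambda>n. L2_inner M (\<phi> (e (r n))) v) \<longlonglongrightarrow> L2_inner M v v"
        by (rule L2_tendsto_inner[OF in_L2 dom_L2[OF v] dom_L2[OF v] lim])
      ultimately have "L2_inner M v v = 0" using LIMSEQ_unique tendsto_const by (metis (no_types, lifting) ext)
      moreover have "(\<lambda>n. L2_norm M (\<phi> (e (r n)))) \<longlonglongrightarrow> L2_norm M v"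
        by (rule L2_tendsto_norm[OF in_L2 dom_L2[OF v] lim])
      then have "L2_norm M v = 1" by (simp add: L2_norm_eq_sqrt norm1 LIMSEQ_const_iff)
      ultimately show False by (simp add: L2_norm_eq_sqrt)
    qed
    then show ?thesis
      unfolding filterlim_at_top_dense eventually_sequentially
    proof (intro allI)
      fix C
      obtain N where "{n. l n \<le> C} \<subseteq> {..<N}"
        using finite_nat_bounded[OF \<open>finite {n. l n \<le> C}\<close>] by blast
      then show "\<exists>N. \<forall>n\<ge>N. C < l n" by (intro exI[of _ N]) (force simp: not_le[symmetric])
    qed
  qed
  have total: "AE x in M. f x = 0" if f: "f \<in> L2 M" "\<And>n. coef f n = 0" for f
  proof (rule dom_total[OF f(1)])
    fix v assume v: "v \<in> D"
    have "(\<lambda>n. L2_norm M (?rest v n)) \<longlonglongrightarrow> 0"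
    proof -
      \<comment> \<open>The remainder meets the constraints of the \<open>n\<close>-th minimization
        and its energy is at most that of \<open>v\<close>, so its squared norm is at most
        \<open>Q v v / l n\<close>.\<close>
      have le: "l n * L2_inner M (?rest v n) (?rest v n) \<le> Q v v" for n
      proof -
        let ?w = "?rest v n"
        have "l n * L2_inner M ?w ?w \<le> Q ?w ?w" using rest_D coef_rest v by (intro min) auto
        also have "Q ?w ?w = Q v ?w"
          using form_rest[OF v rest_D[OF v], of n n] eigen[OF rest_D[OF v]] coef_rest[OF v]
          by (simp add: L2_inner_commute[of M "\<phi> _"])
        also have "Q v ?w = Q v v - (\<Sum>i<n. coef v i * Q (\<phi> i) v)"
          using form_rest[OF v v] form_commute[OF v rest_D[OF v]] by simp
        also have "\<dots> = Q v v - (\<Sum>i<n. l i * (coef v i)\<^sup>2)"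
          by (simp add: eigen[OF v] L2_inner_commute[of M "\<phi> _"] power2_eq_square algebra_simps)
        also have "\<dots> \<le> Q v v" using l_nonneg by (simp add: sum_nonneg)
        finally show ?thesis .
      qed
      have "(\<lambda>n. Q v v * inverse (l n)) \<longlonglongrightarrow> Q v v * 0"
        by (intro tendsto_mult tendsto_const filterlim_compose[OF tendsto_inverse_0_at_top at_top])
           (simp add: filterlim_ident)
      then have "(\<lambda>n. Q v v * inverse (l n)) \<longlonglongrightarrow> 0" by simp
      then have "(\<lambda>n. L2_inner M (?rest v n) (?rest v n)) \<longlonglongrightarrow> 0"
      proof (rule tendsto_sandwich[OF _ _ tendsto_const, rotated 2])
        show "\<forall>\<^sub>F n in sequentially. 0 \<le> L2_inner M (?rest v n) (?rest v n)"
          by (simp add: L2_inner_self_nonneg)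
        have "\<forall>\<^sub>F n in sequentially. l n > 0"
          using at_top unfolding filterlim_at_top_dense by blast
        then show "\<forall>\<^sub>F n in sequentially. L2_inner M (?rest v n) (?rest v n) \<le> Q v v * inverse (l n)"
        proof eventually_elim
          case (elim n)
          then show ?case using le[of n] by (simp add: field_simps)
        qed
      qed
      then have "(\<lambda>n. sqrt (L2_inner M (?rest v n) (?rest v n))) \<longlonglongrightarrow> sqrt 0"
        by (rule tendsto_real_sqrt)
      then show ?thesis by (simp add: L2_norm_eq_sqrt)
    qed
    then have "(\<lambda>n. L2_inner M (\<lambda>x. \<Sum>i<n. coef v i * \<phi> i x) f) \<longlonglongrightarrow> L2_inner M v f"
      by (intro L2_tendsto_inner L2_sum in_L2 f dom_L2 v) (simp add: L2_norm_minus_commute)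
    moreover have "L2_inner M (\<lambda>x. \<Sum>i<n. coef v i * \<phi> i x) f = 0" for n
      using f by (subst L2_inner_sum_left) (auto simp: in_L2 L2_inner_commute[of M "\<phi> _"])
    ultimately have "L2_inner M v f = 0" by (simp add: LIMSEQ_const_iff)
    then show "L2_inner M f v = 0" by (simp add: L2_inner_commute)
  qed
  have "complete_orthonormal_sequence M \<phi>"
    by unfold_locales (rule complete_if_total[OF total])
  then show ?thesis using that D eigen at_top by blast
qed

end

section \<open>Functional calculus and bounded potentials\<close>

text \<open>Cantor's diagonal procedure, over a countable index type so that it serves both for
  Fourier coefficients and for values at points indexed by words.\<close>

lemma bounded_sequences_convergent_subseq:
  fixes f :: "nat \<Rightarrow> 'i :: countable \<Rightarrow> real"
  assumes "\<And>n i. \<bar>f n i\<bar> \<le> B i"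
  obtains r where "strict_mono r" "\<And>i. convergent (\<lambda>n. f (r n) i)"
proof -
  interpret subseqs "\<lambda>n s. convergent (\<lambda>k. f (s k) (from_nat n))"
  proof
    fix n :: nat and s :: "nat \<Rightarrow> nat"
    assume "strict_mono s"
    have "bounded (range (\<lambda>k. f (s k) (from_nat n)))"
      by (rule boundedI[of _ "B (from_nat n)"]) (auto simp: assms)
    from bounded_imp_convergent_subsequence[OF this]
    show "\<exists>r'. strict_mono r' \<and> convergent (\<lambda>k. f ((s \<circ> r') k) (from_nat n))"
      by (auto simp: o_def convergent_def)
  qed
  have "convergent (\<lambda>k. f (diagseq k) i)" for i
  proof -
    have "convergent (\<lambda>k. f ((diagseq \<circ> (+) (Suc (to_nat i))) k) (from_nat (to_nat i)))"
    proof (rule diagseq_holds)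
      fix n :: nat and r s :: "nat \<Rightarrow> nat"
      assume "strict_mono s" "convergent (\<lambda>k. f (r k) (from_nat n))"
      then show "convergent (\<lambda>k. f ((r \<circ> s) k) (from_nat n))"
        using convergent_subseq_convergent[of "\<lambda>k. f (r k) (from_nat n)" s] by (simp add: o_def)
    qed
    then have "convergent (\<lambda>k. f (diagseq (k + Suc (to_nat i))) i)"
      by (simp add: o_def add.commute)
    then show ?thesis
      by (rule iffD1[OF convergent_ignore_initial_segment[of "\<lambda>k. f (diagseq k) i"]])
  qed
  then show ?thesis using that subseq_diagseq by blast
qed

lemma (in diagonal_operator) orthonormal_eigenbasis: "orthonormal_eigenbasis M T \<phi> l"
  using complete orthonormal op_eigenfunction in_L2
  by (simp add: orthonormal_eigenbasis_def eigenspace_def)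

text \<open>\<open>fun_calc\<close> quantifies existentially over eigenbases, so its independence of
  the basis has to be shown. Two eigenfunctions from different bases that are not orthogonal have
  the same eigenvalue; Parseval in the second basis then moves \<open>p\<close> across.\<close>

lemma (in diagonal_operator) fun_calc_iff:
  "fun_calc M p T u g \<longleftrightarrow> u \<in> L2 M \<and> g \<in> L2 M \<and> (\<forall>n. coef g n = p (l n) * coef u n)"
proof (intro iffI conjI allI)
  assume *: "u \<in> L2 M \<and> g \<in> L2 M \<and> (\<forall>n. coef g n = p (l n) * coef u n)"
  then have "(\<lambda>N. L2_norm M (\<lambda>x. g x - (\<Sum>n<N. p (l n) * coef u n * \<phi> n x))) \<longlonglongrightarrow> 0"
    using complete[of g] by simp
  then show "fun_calc M p T u g"
    unfolding fun_calc_def using * orthonormal_eigenbasis by blast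
next
  assume fc: "fun_calc M p T u g"
  then show u: "u \<in> L2 M" and g: "g \<in> L2 M" by (auto simp: fun_calc_def)
  obtain \<phi>' l' where basis: "orthonormal_eigenbasis M T \<phi>' l'"
    and lim: "(\<lambda>N. L2_norm M (\<lambda>x. g x - (\<Sum>n<N. p (l' n) * L2_inner M u (\<phi>' n) * \<phi>' n x))) \<longlonglongrightarrow> 0"
    using fc unfolding fun_calc_def by blast
  interpret B: complete_orthonormal_sequence M \<phi>'
    using basis by unfold_locales (auto simp: orthonormal_eigenbasis_def eigenspace_def)
  have g': "B.coef g k = p (l' k) * B.coef u k" for k
  proof -
    let ?s = "\<lambda>N x. \<Sum>n<N. (p (l' n) * B.coef u n) * \<phi>' n x"
    have "(\<lambda>N. B.coef (?s N) k) \<longlonglongrightarrow> B.coef g k"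
      using lim by (intro L2_tendsto_inner L2_sum B.in_L2 g) (simp add: L2_norm_minus_commute)
    moreover have "(\<lambda>N. B.coef (?s N) k) \<longlonglongrightarrow> p (l' k) * B.coef u k"
    proof (rule tendsto_eventually)
      show "\<forall>\<^sub>F N in sequentially. B.coef (?s N) k = p (l' k) * B.coef u k"
        using eventually_gt_at_top[of k] by eventually_elim (simp add: B.coef_sum)
    qed
    ultimately show ?thesis by (rule LIMSEQ_unique)
  qed
  fix n
  have eq: "p (l' k) * B.coef (\<phi> n) k = p (l n) * B.coef (\<phi> n) k" for k
  proof -
    have "T (\<phi>' k) (\<lambda>x. l' k * \<phi>' k x)"
      using basis by (simp add: orthonormal_eigenbasis_def eigenspace_def)
    from op_coef[OF this, of n] have "l' k * coef (\<phi>' k) n = l n * coef (\<phi>' k) n"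
      by (simp add: L2_inner_scale_left)
    then show ?thesis by (auto simp: L2_inner_commute[of M "\<phi> n"])
  qed
  have "(\<lambda>k. B.coef g k * B.coef (\<phi> n) k) sums coef g n"
    by (rule B.Parseval[OF g in_L2])
  moreover have "B.coef g k * B.coef (\<phi> n) k = p (l n) * (B.coef u k * B.coef (\<phi> n) k)" for k
    using eq[of k] by (simp add: g' mult_ac)
  moreover have "(\<lambda>k. p (l n) * (B.coef u k * B.coef (\<phi> n) k)) sums (p (l n) * coef u n)"
    by (intro sums_mult B.Parseval u in_L2)
  ultimately show "coef g n = p (l n) * coef u n" by (simp add: sums_iff)
qed

section \<open>Bounded perturbations of an operator function\<close>

locale potential_perturbation = diagonal_operator +
  fixes p :: "real \<Rightarrow> real" and chi :: "'a \<Rightarrow> real" and m1 m2 :: real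
  assumes p_at_top: "filterlim (\<lambda>n. p (l n)) at_top sequentially"
    and chi_measurable [measurable]: "chi \<in> borel_measurable M"
    and chi_range: "x \<in> space M \<Longrightarrow> chi x \<in> {m1..m2}"
begin

abbreviation H :: "'a l2_op" where
  "H \<equiv> add_potential M (fun_calc M p T) chi"

lemma chi_mult_L2: "u \<in> L2 M \<Longrightarrow> (\<lambda>x. chi x * u x) \<in> L2 M"
  by (rule L2_bounded_mult[where B = "\<bar>m1\<bar> + \<bar>m2\<bar>"]) (auto intro!: AE_I2 dest!: chi_range)

lemma H_iff:
  "H u g \<longleftrightarrow> u \<in> L2 M \<and> g \<in> L2 M \<and> (\<forall>n. coef g n = p (l n) * coef u n + coef (\<lambda>x. chi x * u x) n)"
proof
  assume "H u g"
  then obtain h where g: "g \<in> L2 M" and h: "fun_calc M p T u h"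
    and AE: "AE x in M. g x = h x + chi x * u x"
    by (auto simp: add_potential_def)
  note h = h[unfolded fun_calc_iff]
  have "coef g n = coef (\<lambda>x. h x + chi x * u x) n" for n
    using AE g h by (intro L2_inner_AE_cong L2_add chi_mult_L2 in_L2) auto
  then show "u \<in> L2 M \<and> g \<in> L2 M \<and> (\<forall>n. coef g n = p (l n) * coef u n + coef (\<lambda>x. chi x * u x) n)"
    using g h by (simp add: L2_inner_add_left chi_mult_L2 in_L2)
next
  assume *: "u \<in> L2 M \<and> g \<in> L2 M \<and> (\<forall>n. coef g n = p (l n) * coef u n + coef (\<lambda>x. chi x * u x) n)"
  then have "fun_calc M p T u (\<lambda>x. g x - chi x * u x)"
    by (simp add: fun_calc_iff L2_diff chi_mult_L2 L2_inner_diff_left in_L2)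
  moreover have "AE x in M. g x = (g x - chi x * u x) + chi x * u x" by simp
  ultimately show "H u g" unfolding add_potential_def using * by blast
qed

lemma H_linear:
  assumes "H u g" "H v h"
  shows "H (\<lambda>x. u x + c * v x) (\<lambda>x. g x + c * h x)"
proof -
  note L2 = assms[unfolded H_iff, THEN conjunct1] assms[unfolded H_iff, THEN conjunct2, THEN conjunct1]
  have "coef (\<lambda>x. chi x * (u x + c * v x)) n
      = coef (\<lambda>x. chi x * u x) n + c * coef (\<lambda>x. chi x * v x) n" for n
  proof -
    have "(\<lambda>x. chi x * (u x + c * v x)) = (\<lambda>x. chi x * u x + c * (chi x * v x))"
      by (simp add: algebra_simps)
    then show ?thesis
      using L2 by (simp add: L2_inner_add_left L2_scale chi_mult_L2 in_L2 L2_inner_scale_left)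
  qed
  then show ?thesis
    using assms L2 unfolding H_iff
    by (simp add: L2_add L2_scale L2_inner_add_left in_L2 L2_inner_scale_left algebra_simps)
qed

lemma H_symmetric:
  assumes "H u g" "H v h"
  shows "L2_inner M g v = L2_inner M u h"
proof -
  note u = assms(1)[unfolded H_iff] and v = assms(2)[unfolded H_iff]
  have "(\<lambda>n. coef g n * coef v n - coef (\<lambda>x. chi x * u x) n * coef v n)
      sums (L2_inner M g v - L2_inner M (\<lambda>x. chi x * u x) v)"
    using u v by (intro sums_diff Parseval chi_mult_L2) auto
  moreover have "(\<lambda>n. coef u n * coef h n - coef u n * coef (\<lambda>x. chi x * v x) n)
      sums (L2_inner M u h - L2_inner M u (\<lambda>x. chi x * v x))"
    using u v by (intro sums_diff Parseval chi_mult_L2) auto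
  moreover have "coef g n * coef v n - coef (\<lambda>x. chi x * u x) n * coef v n
      = coef u n * coef h n - coef u n * coef (\<lambda>x. chi x * v x) n" for n
    using u v by (simp add: algebra_simps)
  moreover have "L2_inner M (\<lambda>x. chi x * u x) v = L2_inner M u (\<lambda>x. chi x * v x)"
    by (simp add: L2_inner_def mult_ac)
  ultimately show ?thesis by (simp add: sums_iff)
qed

text \<open>The form theorem is applied to the form of \<open>H + c0 - m1\<close>. Writing the
  shifted potential as the square of \<open>w\<close> keeps both parts of the form nonnegative, and
  the weights \<open>\<omega>\<close> tending to infinity make the embedding compact.\<close>

theorem H_eigenbasis:
  obtains \<psi> \<eta> where "maximal_diagonal_operator M \<psi> H \<eta>"
proof -
  obtain c0 where c0: "\<And>n. p (l n) + c0 \<ge> 1"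
  proof -
    obtain N where N: "\<And>n. n \<ge> N \<Longrightarrow> p (l n) \<ge> 0"
      using p_at_top unfolding filterlim_at_top eventually_sequentially by blast
    show ?thesis
    proof
      fix n
      \<comment> \<open>Only the finitely many indices below \<open>N\<close> can give negative
        values, and the sum of their absolute values compensates each of them.\<close>
      show "p (l n) + (1 + (\<Sum>i<N. \<bar>p (l i)\<bar>)) \<ge> 1"
      proof (cases "n < N")
        case True
        then have "\<bar>p (l n)\<bar> \<le> (\<Sum>i<N. \<bar>p (l i)\<bar>)"
          by (intro member_le_sum) auto
        then show ?thesis by linarith
      next
        case False
        then show ?thesis using N[of n] sum_nonneg[of "{..<N}" "\<lambda>i. \<bar>p (l i)\<bar>"] by simp
      qed
    qed
  qed
  define \<omega> where "\<omega> n = p (l n) + c0" for n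
  have \<omega>1: "\<omega> n \<ge> 1" for n using c0 by (simp add: \<omega>_def)
  have \<omega>0: "\<omega> n \<ge> 0" for n using \<omega>1[of n] by linarith
  have \<omega>_top: "filterlim \<omega> at_top sequentially"
    unfolding \<omega>_def by (rule filterlim_at_top_mono[OF filterlim_tendsto_add_at_top[OF tendsto_const[of c0] p_at_top]]) simp
  define w where "w x = sqrt (chi x - m1)" for x
  have [measurable]: "w \<in> borel_measurable M" unfolding w_def by measurable
  have w_square: "w x * w x = chi x - m1" if "x \<in> space M" for x
    using chi_range[OF that] by (simp add: w_def)
  have w_bound: "AE x in M. \<bar>w x\<bar> \<le> sqrt (m2 - m1)"
    by (rule AE_I2) (use chi_range in \<open>auto simp: w_def\<close>)
  have w_L2: "(\<lambda>x. w x * u x) \<in> L2 M" if "u \<in> L2 M" for u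
    by (rule L2_bounded_mult[OF _ w_bound that]) measurable
  have w_inner: "L2_inner M (\<lambda>x. w x * u x) (\<lambda>x. w x * v x) = L2_inner M (\<lambda>x. chi x * u x) v - m1 * L2_inner M u v"
    if "u \<in> L2 M" "v \<in> L2 M" for u v
  proof -
    have "L2_inner M (\<lambda>x. w x * u x) (\<lambda>x. w x * v x) = L2_inner M (\<lambda>x. chi x * u x - m1 * u x) v"
      unfolding L2_inner_def
    proof (rule Bochner_Integration.integral_cong)
      fix x assume "x \<in> space M"
      have "w x * u x * (w x * v x) = (w x * w x) * (u x * v x)" by (simp only: mult_ac)
      also have "\<dots> = (chi x * u x - m1 * u x) * v x"
        unfolding w_square[OF \<open>x \<in> space M\<close>] by (simp add: algebra_simps)
      finally show "w x * u x * (w x * v x) = (chi x * u x - m1 * u x) * v x" .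
    qed simp
    then show ?thesis
      using that by (simp add: L2_inner_diff_left chi_mult_L2 L2_scale L2_inner_scale_left)
  qed
  define D where "D = {u \<in> L2 M. summable (\<lambda>n. \<omega> n * (coef u n)\<^sup>2)}"
  define Q where "Q u v = (\<Sum>n. \<omega> n * (coef u n * coef v n)) + L2_inner M (\<lambda>x. w x * u x) (\<lambda>x. w x * v x)"
    for u v
  have D_L2: "u \<in> L2 M" and D_sum: "summable (\<lambda>n. \<omega> n * (coef u n)\<^sup>2)" if "u \<in> D" for u
    using that by (auto simp: D_def)
  have D_sum2: "summable (\<lambda>n. \<omega> n * (coef u n * coef v n))" if "u \<in> D" "v \<in> D" for u v
  proof (rule summable_comparison_test)
    show "summable (\<lambda>n. \<omega> n * (coef u n)\<^sup>2 + \<omega> n * (coef v n)\<^sup>2)"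
      by (intro summable_add D_sum that)
    have "norm (\<omega> n * (coef u n * coef v n)) \<le> \<omega> n * (coef u n)\<^sup>2 + \<omega> n * (coef v n)\<^sup>2" for n
    proof -
      have "0 \<le> (\<bar>coef u n\<bar> - \<bar>coef v n\<bar>)\<^sup>2" by simp
      then have "2 * (\<bar>coef u n\<bar> * \<bar>coef v n\<bar>) \<le> (coef u n)\<^sup>2 + (coef v n)\<^sup>2"
        by (simp add: power2_diff)
      moreover have "0 \<le> \<bar>coef u n\<bar> * \<bar>coef v n\<bar>" by simp
      ultimately have "\<bar>coef u n\<bar> * \<bar>coef v n\<bar> \<le> (coef u n)\<^sup>2 + (coef v n)\<^sup>2" by linarith
      then have "\<omega> n * (\<bar>coef u n\<bar> * \<bar>coef v n\<bar>) \<le> \<omega> n * ((coef u n)\<^sup>2 + (coef v n)\<^sup>2)"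
        by (rule mult_left_mono[OF _ \<omega>0])
      then show ?thesis using \<omega>0[of n] by (simp add: abs_mult distrib_left)
    qed
    then show "\<exists>N. \<forall>n\<ge>N. norm (\<omega> n * (coef u n * coef v n)) \<le> \<omega> n * (coef u n)\<^sup>2 + \<omega> n * (coef v n)\<^sup>2"
      by blast
  qed
  have \<phi>_D: "\<phi> k \<in> D" for k
  proof -
    have "summable (\<lambda>n. \<omega> n * (coef (\<phi> k) n)\<^sup>2)"
      by (rule summable_finite[of "{k}"]) (auto simp: orthonormal)
    then show ?thesis by (simp add: D_def in_L2)
  qed
  interpret Q: compact_form M D Q
  proof unfold_locales
    show "u \<in> L2 M" if "u \<in> D" for u using that by (rule D_L2)
    show lin: "(\<lambda>x. u x + c * v x) \<in> D" if "u \<in> D" "v \<in> D" for u v c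
    proof -
      have "\<omega> n * (coef (\<lambda>x. u x + c * v x) n)\<^sup>2
          = \<omega> n * (coef u n)\<^sup>2 + 2 * c * (\<omega> n * (coef u n * coef v n)) + c\<^sup>2 * (\<omega> n * (coef v n)\<^sup>2)" for n
        using that by (simp add: L2_inner_add_left L2_scale D_L2 in_L2 L2_inner_scale_left
            power2_eq_square algebra_simps)
      moreover have "summable (\<lambda>n. \<omega> n * (coef u n)\<^sup>2 + 2 * c * (\<omega> n * (coef u n * coef v n))
          + c\<^sup>2 * (\<omega> n * (coef v n)\<^sup>2))"
        by (intro summable_add summable_mult D_sum D_sum2 that)
      ultimately have "summable (\<lambda>n. \<omega> n * (coef (\<lambda>x. u x + c * v x) n)\<^sup>2)" by (simp only:)
      moreover have "(\<lambda>x. u x + c * v x) \<in> L2 M" by (intro L2_add L2_scale D_L2 that)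
      ultimately show ?thesis by (simp add: D_def)
    qed
    show "Q u v = Q v u" for u v
      unfolding Q_def L2_inner_commute[of M "\<lambda>x. w x * u x"] by (simp only: mult.commute[of "coef u _"])
    show "Q (\<lambda>x. u x + c * v x) z = Q u z + c * Q v z" if "u \<in> D" "v \<in> D" "z \<in> D" for u v z c
    proof -
      have "(\<Sum>n. \<omega> n * (coef (\<lambda>x. u x + c * v x) n * coef z n))
          = (\<Sum>n. \<omega> n * (coef u n * coef z n) + c * (\<omega> n * (coef v n * coef z n)))"
        using that by (simp add: L2_inner_add_left L2_scale D_L2 in_L2 L2_inner_scale_left algebra_simps)
      also have "\<dots> = (\<Sum>n. \<omega> n * (coef u n * coef z n)) + c * (\<Sum>n. \<omega> n * (coef v n * coef z n))"
        using suminf_add[OF D_sum2[OF that(1,3)] summable_mult[OF D_sum2[OF that(2,3)], of c]]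
          suminf_mult[OF D_sum2[OF that(2,3)], of c] by simp
      finally have 1: "(\<Sum>n. \<omega> n * (coef (\<lambda>x. u x + c * v x) n * coef z n)) = \<dots>" .
      have "(\<lambda>x. w x * (u x + c * v x)) = (\<lambda>x. w x * u x + c * (w x * v x))"
        by (simp add: algebra_simps)
      then have 2: "L2_inner M (\<lambda>x. w x * (u x + c * v x)) (\<lambda>x. w x * z x)
          = L2_inner M (\<lambda>x. w x * u x) (\<lambda>x. w x * z x) + c * L2_inner M (\<lambda>x. w x * v x) (\<lambda>x. w x * z x)"
        using that by (simp add: L2_inner_add_left L2_scale w_L2 D_L2 L2_inner_scale_left)
      show ?thesis unfolding Q_def 1 2 by (simp add: algebra_simps)
    qed
    show "0 \<le> Q u u" if "u \<in> D" for u
      unfolding Q_def using \<omega>0 D_sum2[OF that that]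
      by (intro add_nonneg_nonneg suminf_nonneg L2_inner_self_nonneg) auto
    show "\<exists>(r :: nat \<Rightarrow> nat) v. strict_mono r \<and> v \<in> D \<and> (\<lambda>n. L2_norm M (\<lambda>x. s (r n) x - v x)) \<longlonglongrightarrow> 0 \<and>
          (\<forall>B. (\<forall>\<^sub>F n in sequentially. Q (s (r n)) (s (r n)) \<le> B) \<longrightarrow> Q v v \<le> B)"
      if sD: "\<And>n. s n \<in> D" and sC: "\<And>n. Q (s n) (s n) \<le> C"
        and s1: "\<And>n. L2_inner M (s n) (s n) \<le> 1" for s C
    proof -
      note sL2 = D_L2[OF sD]
      have sC': "(\<Sum>i<N. \<omega> i * (coef (s n) i)\<^sup>2) + L2_inner M (\<lambda>x. w x * s n x) (\<lambda>x. w x * s n x)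
          \<le> Q (s n) (s n)" for n N
        unfolding Q_def power2_eq_square[symmetric]
        using sum_le_suminf[OF D_sum[OF sD], of "{..<N}" n] \<omega>0 by simp
      have "\<bar>coef (s n) i\<bar> \<le> 1" for n i
      proof -
        have "(coef (s n) i)\<^sup>2 \<le> (\<Sum>j<Suc i. (coef (s n) j)\<^sup>2)"
          by (rule member_le_sum) auto
        also have "\<dots> \<le> 1" using Bessel[OF sL2] s1 order_trans by blast
        finally show ?thesis by (simp add: abs_square_le_1)
      qed
      from bounded_sequences_convergent_subseq[of "\<lambda>n i. coef (s n) i" "\<lambda>_. 1", OF this]
      obtain r where r: "strict_mono r" and "\<And>i. convergent (\<lambda>n. coef (s (r n)) i)" by blast
      then obtain a where a: "\<And>i. (\<lambda>n. coef (s (r n)) i) \<longlonglongrightarrow> a i"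
        unfolding convergent_def by metis
      have aC: "(\<Sum>i<N. \<omega> i * (a i)\<^sup>2) \<le> C" for N
      proof (rule LIMSEQ_le_const2)
        show "(\<lambda>n. \<Sum>i<N. \<omega> i * (coef (s (r n)) i)\<^sup>2) \<longlonglongrightarrow> (\<Sum>i<N. \<omega> i * (a i)\<^sup>2)"
          by (intro tendsto_intros a)
        have "(\<Sum>i<N. \<omega> i * (coef (s (r n)) i)\<^sup>2) \<le> C" for n
          using sC'[of "r n" N] sC[of "r n"] L2_inner_self_nonneg[of M "\<lambda>x. w x * s (r n) x"] by linarith
        then show "\<exists>N'. \<forall>n\<ge>N'. (\<Sum>i<N. \<omega> i * (coef (s (r n)) i)\<^sup>2) \<le> C" by blast
      qed
      have asum: "summable (\<lambda>i. \<omega> i * (a i)\<^sup>2)"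
        by (rule summableI_nonneg_bounded[OF _ aC]) (simp add: \<omega>0)
      have "summable (\<lambda>i. (a i)\<^sup>2)"
      proof (rule summable_comparison_test[OF _ asum])
        have "norm ((a i)\<^sup>2) \<le> \<omega> i * (a i)\<^sup>2" for i
          using mult_right_mono[OF \<omega>1[of i], of "(a i)\<^sup>2"] by simp
        then show "\<exists>N. \<forall>i\<ge>N. norm ((a i)\<^sup>2) \<le> \<omega> i * (a i)\<^sup>2" by blast
      qed
      from Riesz_Fischer[OF this] obtain v where v: "v \<in> L2 M" "\<And>i. coef v i = a i" by blast
      have vD: "v \<in> D" using asum v by (simp add: D_def)
      let ?d = "\<lambda>n x. s (r n) x - v x"
      have dL2: "?d n \<in> L2 M" for n by (intro L2_diff sL2 v)
      have dcoef: "coef (?d n) i = coef (s (r n)) i - a i" for n i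
        using v by (simp add: L2_inner_diff_left sL2 in_L2)
      have C0: "C \<ge> 0" using aC[of 0] by simp
      have "(\<lambda>n. L2_inner M (?d n) (?d n)) \<longlonglongrightarrow> 0"
      proof (rule LIMSEQ_I)
        fix e :: real assume e: "e > 0"
        \<comment> \<open>The tail beyond \<open>N\<close>, where \<open>\<omega>\<close> is at
          least \<open>W\<close>, costs at most \<open>4 * C / W\<close>, and this \<open>W\<close>
          makes that smaller than \<open>e / 2\<close>; the first \<open>N\<close> coefficients
          converge.\<close>
        define W where "W = 8 * (C + 1) / e"
        have W: "W > 0" using e C0 by (simp add: W_def)
        obtain N where N: "\<And>i. i \<ge> N \<Longrightarrow> \<omega> i \<ge> W"
          using \<omega>_top unfolding filterlim_at_top eventually_sequentially by blast
        have bound: "L2_inner M (?d n) (?d n) \<le> (\<Sum>i<N. (coef (?d n) i)\<^sup>2) + 4 * C / W" for n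
        proof -
          have "(\<Sum>i<K. (coef (?d n) i)\<^sup>2) \<le> (\<Sum>i<N. (coef (?d n) i)\<^sup>2) + 4 * C / W" for K
          proof -
            have le: "(coef (?d n) i)\<^sup>2 \<le> (if i < N then (coef (?d n) i)\<^sup>2 else 0)
                + (2 * (\<omega> i * (coef (s (r n)) i)\<^sup>2) + 2 * (\<omega> i * (a i)\<^sup>2)) / W" for i
            proof (cases "i < N")
              case True
              then show ?thesis using \<omega>0[of i] W by simp
            next
              case False
              have "0 \<le> (coef (s (r n)) i + a i)\<^sup>2" by simp
              then have "(coef (?d n) i)\<^sup>2 \<le> 2 * (coef (s (r n)) i)\<^sup>2 + 2 * (a i)\<^sup>2"
                by (simp add: dcoef power2_diff power2_sum)
              then have "W * (coef (?d n) i)\<^sup>2 \<le> \<omega> i * (2 * (coef (s (r n)) i)\<^sup>2 + 2 * (a i)\<^sup>2)"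
                using N[of i] False W by (intro mult_mono) auto
              then show ?thesis using False W by (simp add: field_simps)
            qed
            have "(\<Sum>i<K. if i < N then (coef (?d n) i)\<^sup>2 else 0) \<le> (\<Sum>i<N. (coef (?d n) i)\<^sup>2)"
            proof -
              have "(\<Sum>i<K. if i < N then (coef (?d n) i)\<^sup>2 else 0) = (\<Sum>i\<in>{..<K} \<inter> {..<N}. (coef (?d n) i)\<^sup>2)"
                by (subst sum.inter_restrict) auto
              also have "\<dots> \<le> (\<Sum>i<N. (coef (?d n) i)\<^sup>2)" by (rule sum_mono2) auto
              finally show ?thesis .
            qed
            moreover have "(\<Sum>i<K. \<omega> i * (coef (s (r n)) i)\<^sup>2) \<le> C"
              using sC'[of "r n" K] sC[of "r n"] L2_inner_self_nonneg[of M "\<lambda>x. w x * s (r n) x"] by linarith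
            then have "(\<Sum>i<K. (2 * (\<omega> i * (coef (s (r n)) i)\<^sup>2) + 2 * (\<omega> i * (a i)\<^sup>2)) / W) \<le> 4 * C / W"
              using aC[of K] W
              by (simp add: sum_divide_distrib[symmetric] sum.distrib sum_distrib_left[symmetric] divide_right_mono)
            ultimately show ?thesis
              using sum_mono[OF le, of "\<lambda>i. i" "{..<K}"] unfolding sum.distrib by linarith
          qed
          from suminf_le_const[OF sums_summable[OF Parseval_square[OF dL2]] this] show ?thesis
            using sums_unique[OF Parseval_square[OF dL2[of n]]] by simp
        qed
        have "(\<lambda>n. \<Sum>i<N. (coef (?d n) i)\<^sup>2) \<longlonglongrightarrow> (\<Sum>i<N. (a i - a i)\<^sup>2)"
          unfolding dcoef by (intro tendsto_intros a)
        then have "(\<lambda>n. \<Sum>i<N. (coef (?d n) i)\<^sup>2) \<longlonglongrightarrow> 0" by simp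
        then obtain n0 where n0: "\<And>n. n \<ge> n0 \<Longrightarrow> norm ((\<Sum>i<N. (coef (?d n) i)\<^sup>2) - 0) < e / 2"
          using LIMSEQ_D[OF _ half_gt_zero[OF e]] by blast
        have "4 * C / W < e / 2"
          using e C0 by (simp add: W_def field_simps)
        then have "norm (L2_inner M (?d n) (?d n) - 0) < e" if "n \<ge> n0" for n
          using bound[of n] n0[OF that] L2_inner_self_nonneg[of M "?d n"] by simp
        then show "\<exists>n0. \<forall>n\<ge>n0. norm (L2_inner M (?d n) (?d n) - 0) < e" by blast
      qed
      then have lim: "(\<lambda>n. L2_norm M (?d n)) \<longlonglongrightarrow> 0"
        using tendsto_real_sqrt[of "\<lambda>n. L2_inner M (?d n) (?d n)" 0] by (simp add: L2_norm_eq_sqrt)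
      have wlim: "(\<lambda>n. L2_inner M (\<lambda>x. w x * s (r n) x) (\<lambda>x. w x * s (r n) x))
          \<longlonglongrightarrow> L2_inner M (\<lambda>x. w x * v x) (\<lambda>x. w x * v x)"
      proof -
        have "(\<lambda>n. L2_norm M (\<lambda>x. w x * s (r n) x - w x * v x)) \<longlonglongrightarrow> 0"
        proof (rule Lim_null_comparison)
          show "(\<lambda>n. sqrt (m2 - m1) * L2_norm M (?d n)) \<longlonglongrightarrow> 0"
            using tendsto_mult_left[OF lim, of "sqrt (m2 - m1)"] by simp
          show "\<forall>\<^sub>F n in sequentially. norm (L2_norm M (\<lambda>x. w x * s (r n) x - w x * v x)) \<le> sqrt (m2 - m1) * L2_norm M (?d n)"
          proof (intro always_eventually allI)
            fix n
            show "norm (L2_norm M (\<lambda>x. w x * s (r n) x - w x * v x)) \<le> sqrt (m2 - m1) * L2_norm M (?d n)"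
            proof (cases "space M = {}")
              case True
              then show ?thesis by (simp add: L2_norm_def Bochner_Integration.integral_empty)
            next
              case False
              then have m: "m1 \<le> m2" using chi_range by fastforce
              have "L2_inner M (\<lambda>x. w x * ?d n x) (\<lambda>x. w x * ?d n x) \<le> (sqrt (m2 - m1))\<^sup>2 * L2_inner M (?d n) (?d n)"
                using w_bound by (intro L2_norm_bounded_mult w_L2 dL2) auto
              then have "sqrt (L2_inner M (\<lambda>x. w x * ?d n x) (\<lambda>x. w x * ?d n x))
                  \<le> sqrt ((sqrt (m2 - m1))\<^sup>2 * L2_inner M (?d n) (?d n))" by (rule real_sqrt_le_mono)
              then show ?thesis
                using m by (simp add: L2_norm_eq_sqrt[symmetric] real_sqrt_mult right_diff_distrib L2_norm_nonneg)
            qed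
          qed
        qed
        from L2_tendsto_norm[OF w_L2[OF sL2] w_L2[OF v(1)] this] show ?thesis
          unfolding L2_norm_power2[symmetric] by (intro tendsto_power)
      qed
      have "Q v v \<le> B" if B: "\<forall>\<^sub>F n in sequentially. Q (s (r n)) (s (r n)) \<le> B" for B
      proof -
        \<comment> \<open>Lower semicontinuity: finite partial sums of the energy pass to the limit
          termwise, and \<open>N\<close> is then sent to infinity.\<close>
        have "(\<Sum>i<N. \<omega> i * (a i)\<^sup>2) + L2_inner M (\<lambda>x. w x * v x) (\<lambda>x. w x * v x) \<le> B" for N
        proof (rule tendsto_upperbound)
          show "(\<lambda>n. (\<Sum>i<N. \<omega> i * (coef (s (r n)) i)\<^sup>2)
              + L2_inner M (\<lambda>x. w x * s (r n) x) (\<lambda>x. w x * s (r n) x))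
              \<longlonglongrightarrow> (\<Sum>i<N. \<omega> i * (a i)\<^sup>2) + L2_inner M (\<lambda>x. w x * v x) (\<lambda>x. w x * v x)"
            by (intro tendsto_intros a wlim)
          show "\<forall>\<^sub>F n in sequentially. (\<Sum>i<N. \<omega> i * (coef (s (r n)) i)\<^sup>2)
              + L2_inner M (\<lambda>x. w x * s (r n) x) (\<lambda>x. w x * s (r n) x) \<le> B"
            using B by eventually_elim (use sC' order_trans in blast)
        qed simp
        then have "(\<Sum>i<N. \<omega> i * (a i)\<^sup>2) \<le> B - L2_inner M (\<lambda>x. w x * v x) (\<lambda>x. w x * v x)" for N
          by (simp add: algebra_simps)
        then have "(\<Sum>i. \<omega> i * (a i)\<^sup>2) \<le> B - L2_inner M (\<lambda>x. w x * v x) (\<lambda>x. w x * v x)"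
          by (rule suminf_le_const[OF asum])
        then show ?thesis using v(2) by (simp add: Q_def power2_eq_square)
      qed
      then show ?thesis using r vD lim by blast
    qed
    show "\<exists>e :: nat \<Rightarrow> 'a \<Rightarrow> real. (\<forall>i<n. e i \<in> D) \<and>
        (\<forall>c :: nat \<Rightarrow> real. (AE x in M. (\<Sum>i<n. c i * e i x) = 0) \<longrightarrow> (\<forall>i<n. c i = 0))" for n
    proof (intro exI[of _ \<phi>] conjI allI impI \<phi>_D)
      fix c :: "nat \<Rightarrow> real" and i
      assume AE0: "AE x in M. (\<Sum>i<n. c i * \<phi> i x) = 0" and i: "i < n"
      have "L2_inner M (\<lambda>x. \<Sum>i<n. c i * \<phi> i x) (\<lambda>x. \<Sum>i<n. c i * \<phi> i x) = 0"
        using AE0 by (subst L2_inner_self_eq_0_iff) (auto intro: L2_sum in_L2)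
      then show "c i = 0"
        using i by (simp add: inner_sum_sum sum_nonneg_eq_0_iff)
    qed
    show "AE x in M. f x = 0" if "f \<in> L2 M" "\<And>v. v \<in> D \<Longrightarrow> L2_inner M f v = 0" for f
      using that \<phi>_D by (intro null_if_coef_0) auto
  qed
  obtain \<psi> \<eta>' where \<psi>D: "\<And>k. \<psi> k \<in> D" and \<psi>: "complete_orthonormal_sequence M \<psi>"
    and eigen: "\<And>k v. v \<in> D \<Longrightarrow> Q (\<psi> k) v = \<eta>' k * L2_inner M (\<psi> k) v"
    and top: "filterlim \<eta>' at_top sequentially"
    using Q.eigenbasis by blast
  define \<eta> where "\<eta> k = \<eta>' k + (m1 - c0)" for k
  interpret \<psi>: complete_orthonormal_sequence M \<psi> by (rule \<psi>)
  have H\<psi>: "H (\<psi> k) (\<lambda>x. \<eta> k * \<psi> k x)" for k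
  proof -
    have "coef (\<lambda>x. \<eta> k * \<psi> k x) n = p (l n) * coef (\<psi> k) n + coef (\<lambda>x. chi x * \<psi> k x) n" for n
    proof -
      \<comment> \<open>Testing the weak equation with \<open>\<phi> n\<close> leaves a single term
        of the series and turns it into the coefficient form of H.\<close>
      have "(\<Sum>i. \<omega> i * (coef (\<psi> k) i * coef (\<phi> n) i)) = (\<Sum>i\<in>{n}. \<omega> i * (coef (\<psi> k) i * coef (\<phi> n) i))"
        by (rule suminf_finite) (auto simp: orthonormal)
      also have "\<dots> = \<omega> n * coef (\<psi> k) n" by (simp add: orthonormal)
      finally have "\<omega> n * coef (\<psi> k) n + (coef (\<lambda>x. chi x * \<psi> k x) n - m1 * coef (\<psi> k) n) = \<eta>' k * coef (\<psi> k) n"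
        using eigen[OF \<phi>_D, of k n] w_inner[OF \<psi>.in_L2 in_L2, of k n] by (simp add: Q_def)
      then show ?thesis unfolding L2_inner_scale_left by (simp add: \<eta>_def \<omega>_def algebra_simps)
    qed
    then show ?thesis by (simp add: H_iff \<psi>.in_L2 L2_scale)
  qed
  have coef_H: "\<psi>.coef g k = \<eta> k * \<psi>.coef u k" if "H u g" for u g k
    using H_symmetric[OF that H\<psi>[of k]] by (simp add: L2_inner_scale_right)
  have "maximal_diagonal_operator M \<psi> H \<eta>"
  proof unfold_locales
    show "u \<in> L2 M \<and> g \<in> L2 M" if "H u g" for u g using that by (simp add: H_iff)
    show "\<psi>.coef g n = \<eta> n * \<psi>.coef u n" if "H u g" for u g n using that by (rule coef_H)
    show "H (\<psi> n) (\<lambda>x. \<eta> n * \<psi> n x)" for n by (rule H\<psi>)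
    show "H (\<lambda>x. u x + c * v x) (\<lambda>x. g x + c * h x)" if "H u g" "H v h" for u g v h c
      using that by (rule H_linear)
    show "filterlim \<eta> at_top sequentially"
      unfolding \<eta>_def
      by (rule filterlim_at_top_mono[OF filterlim_tendsto_add_at_top[OF tendsto_const[of "m1 - c0"] top]]) simp
    show "H u g" if u: "u \<in> L2 M" and g: "g \<in> L2 M" and ug: "\<And>n. \<psi>.coef g n = \<eta> n * \<psi>.coef u n" for u g
      unfolding H_iff
    proof (intro conjI allI u g)
      fix n
      \<comment> \<open>In the eigenbasis \<open>\<psi>\<close> the pair \<open>u\<close>,
        \<open>g\<close> satisfies the adjoint relation against the whole domain of H; taking
        \<open>\<phi> n\<close> from that domain recovers the coefficients. This is
        self-adjointness.\<close>
      have "L2_inner M \<phi>' g = L2_inner M h u" if "H \<phi>' h" for \<phi>' h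
      proof -
        have L2: "\<phi>' \<in> L2 M" "h \<in> L2 M" using that by (auto simp: H_iff)
        have "(\<lambda>k. \<psi>.coef \<phi>' k * \<psi>.coef g k) sums L2_inner M \<phi>' g"
          by (rule \<psi>.Parseval[OF L2(1) g])
        moreover have "(\<lambda>k. \<psi>.coef h k * \<psi>.coef u k) sums L2_inner M h u"
          by (rule \<psi>.Parseval[OF L2(2) u])
        ultimately show ?thesis using coef_H[OF that] ug by (simp add: mult_ac sums_iff)
      qed
      moreover have "H (\<phi> n) (\<lambda>x. p (l n) * \<phi> n x + chi x * \<phi> n x)"
        by (simp add: H_iff in_L2 L2_add L2_scale chi_mult_L2 L2_inner_add_left L2_inner_scale_left orthonormal)
      ultimately have "coef g n = L2_inner M (\<lambda>x. p (l n) * \<phi> n x + chi x * \<phi> n x) u"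
        by (simp add: L2_inner_commute[of M g])
      also have "\<dots> = p (l n) * coef u n + coef (\<lambda>x. chi x * u x) n"
        using u by (simp add: L2_inner_add_left L2_scale chi_mult_L2 in_L2 L2_inner_scale_left
            L2_inner_commute[of M u]) (simp add: L2_inner_def mult_ac)
      finally show "coef g n = p (l n) * coef u n + coef (\<lambda>x. chi x * u x) n" .
    qed
  qed
  then show ?thesis by (rule that)
qed

end

section \<open>Counting eigenvalues in a cluster\<close>

lemma orthogonal_sum_square:
  assumes "finite I" "\<And>i. i \<in> I \<Longrightarrow> e i \<in> L2 M"
    and "\<And>i j. i \<in> I \<Longrightarrow> j \<in> I \<Longrightarrow> i \<noteq> j \<Longrightarrow> L2_inner M (e i) (e j) = 0"
  shows "L2_inner M (\<lambda>x. \<Sum>i\<in>I. c i * e i x) (\<lambda>x. \<Sum>i\<in>I. c i * e i x)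
    = (\<Sum>i\<in>I. (c i)\<^sup>2 * L2_inner M (e i) (e i))"
proof -
  have "L2_inner M (\<lambda>x. \<Sum>i\<in>I. c i * e i x) (\<lambda>x. \<Sum>i\<in>I. c i * e i x)
      = (\<Sum>i\<in>I. c i * (\<Sum>j\<in>I. c j * L2_inner M (e j) (e i)))"
    using assms by (simp add: L2_inner_sum_right L2_inner_sum_left L2_sum)
  also have "\<dots> = (\<Sum>i\<in>I. c i * (\<Sum>j\<in>I. if j = i then c i * L2_inner M (e i) (e i) else 0))"
    using assms(3) by (intro sum.cong refl arg_cong2[where f = "(*)"]) auto
  also have "\<dots> = (\<Sum>i\<in>I. (c i)\<^sup>2 * L2_inner M (e i) (e i))"
    using assms(1) by (simp add: power2_eq_square mult.assoc)
  finally show ?thesis .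
qed

lemma orthogonal_sum_pos:
  assumes "finite I" "\<And>i. i \<in> I \<Longrightarrow> e i \<in> L2 M"
    and "\<And>i j. i \<in> I \<Longrightarrow> j \<in> I \<Longrightarrow> i \<noteq> j \<Longrightarrow> L2_inner M (e i) (e j) = 0"
    and pos: "\<And>i. i \<in> I \<Longrightarrow> L2_inner M (e i) (e i) > 0" and c: "\<exists>i\<in>I. c i \<noteq> 0"
  shows "L2_inner M (\<lambda>x. \<Sum>i\<in>I. c i * e i x) (\<lambda>x. \<Sum>i\<in>I. c i * e i x) > 0"
proof -
  obtain i where "i \<in> I" "c i \<noteq> 0" using c by blast
  then have "(\<Sum>i\<in>I. (c i)\<^sup>2 * L2_inner M (e i) (e i)) > 0"
    using assms(1) pos by (intro sum_pos2[of I i]) (auto simp: L2_inner_self_nonneg zero_less_mult_iff)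
  then show ?thesis using orthogonal_sum_square[where c = c, OF assms(1-3)] by simp
qed

text \<open>Orthogonality replaces independence here because it is easy to check for functions
  placed in different cells.\<close>

lemma (in diagonal_operator) card_orthogonal_le:
  assumes I: "finite I" "\<And>i. i \<in> I \<Longrightarrow> e i \<in> eigenspace M T z"
    and orth: "\<And>i j. i \<in> I \<Longrightarrow> j \<in> I \<Longrightarrow> i \<noteq> j \<Longrightarrow> L2_inner M (e i) (e j) = 0"
    and pos: "\<And>i. i \<in> I \<Longrightarrow> L2_inner M (e i) (e i) > 0"
  shows "card I \<le> card {n. l n = z}"
proof (rule ccontr)
  assume "\<not> card I \<le> card {n. l n = z}"
  then obtain c where c: "\<exists>i\<in>I. c i \<noteq> 0" "\<And>n. n \<in> {n. l n = z} \<Longrightarrow> (\<Sum>i\<in>I. c i * coef (e i) n) = 0"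
    using homogeneous_system_nontrivial_solution[OF I(1) finite_eigenvalues_eq[of z], of "\<lambda>i n. coef (e i) n"] by auto
  have eL2: "e i \<in> L2 M" if "i \<in> I" for i using I(2)[OF that] by (simp add: eigenspace_def)
  let ?u = "\<lambda>x. \<Sum>i\<in>I. c i * e i x"
  have u: "?u \<in> L2 M" by (intro L2_sum eL2)
  have "coef ?u n = 0" for n
  proof -
    have "coef ?u n = (\<Sum>i\<in>I. c i * coef (e i) n)" by (rule L2_inner_sum_left) (auto simp: eL2 in_L2)
    then show ?thesis using c(2)[of n] eigenspace_coef[OF I(2), of _ n] by (cases "l n = z") auto
  qed
  from null_if_coef_0[OF u this] have "L2_inner M ?u ?u = 0" using u by (simp add: L2_inner_self_eq_0_iff)
  moreover have "L2_inner M ?u ?u > 0"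
    by (rule orthogonal_sum_pos[OF I(1) eL2 orth pos c(1)])
  ultimately show False by simp
qed

context potential_perturbation
begin

text \<open>All \<open>e i\<close> share the eigenvalue \<open>z\<close>, so on their combinations
  \<open>H - p z - s\<close> is multiplication by \<open>chi - s\<close>. With \<open>s\<close> the
  centre and \<open>r\<close> half the length of the interval this is at most \<open>r\<close> where
  the function lives, while coefficients belonging to eigenvalues outside the interval are
  multiplied by more than \<open>r\<close>.\<close>

lemma card_localized_le:
  assumes \<psi>: "maximal_diagonal_operator M \<psi> H \<eta>"
    and I: "finite I" "\<And>i. i \<in> I \<Longrightarrow> e i \<in> eigenspace M T z"
    and orth: "\<And>i j. i \<in> I \<Longrightarrow> j \<in> I \<Longrightarrow> i \<noteq> j \<Longrightarrow> L2_inner M (e i) (e j) = 0"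
    and pos: "\<And>i. i \<in> I \<Longrightarrow> L2_inner M (e i) (e i) > 0"
    and loc: "\<And>i. i \<in> I \<Longrightarrow> AE x in M. e i x = 0 \<or> chi x \<in> {s1..s2}"
  shows "card I \<le> card {k. \<eta> k \<in> {p z + s1..p z + s2}}"
proof (rule ccontr)
  interpret \<psi>: maximal_diagonal_operator M \<psi> H \<eta> by (rule \<psi>)
  let ?K = "{k. \<eta> k \<in> {p z + s1..p z + s2}}"
  assume "\<not> card I \<le> card ?K"
  then obtain c where c: "\<exists>i\<in>I. c i \<noteq> 0" "\<And>k. k \<in> ?K \<Longrightarrow> (\<Sum>i\<in>I. c i * L2_inner M (e i) (\<psi> k)) = 0"
    using homogeneous_system_nontrivial_solution[OF I(1) \<psi>.finite_eigenvalues_in[of "p z + s1" "p z + s2"],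
        of "\<lambda>i k. L2_inner M (e i) (\<psi> k)"] by auto
  have eL2: "e i \<in> L2 M" if "i \<in> I" for i using I(2)[OF that] by (simp add: eigenspace_def)
  define u where "u x = (\<Sum>i\<in>I. c i * e i x)" for x
  have u: "u \<in> L2 M" unfolding u_def[abs_def] by (intro L2_sum eL2)
  have uu: "L2_inner M u u > 0"
    unfolding u_def[abs_def] by (rule orthogonal_sum_pos[OF I(1) eL2 orth pos c(1)])
  have u_\<psi>: "\<psi>.coef u k = 0" if "k \<in> ?K" for k
    unfolding u_def[abs_def] using c(2)[OF that] by (subst L2_inner_sum_left) (auto simp: eL2 \<psi>.in_L2)
  have u_coef: "coef u n = 0" if "l n \<noteq> z" for n
    unfolding u_def[abs_def] using eigenspace_coef[OF I(2) that]
    by (subst L2_inner_sum_left) (auto simp: eL2 in_L2)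
  have u_loc: "AE x in M. u x = 0 \<or> chi x \<in> {s1..s2}"
  proof -
    have "AE x in M. \<forall>i\<in>I. e i x = 0 \<or> chi x \<in> {s1..s2}"
      using loc by (intro AE_finite_allI I(1)) auto
    then show ?thesis by eventually_elim (auto simp: u_def)
  qed
  have Hu: "H u (\<lambda>x. p z * u x + chi x * u x)"
    unfolding H_iff
  proof (intro conjI allI)
    fix n
    show "coef (\<lambda>x. p z * u x + chi x * u x) n = p (l n) * coef u n + coef (\<lambda>x. chi x * u x) n"
      using u_coef[of n] u by (cases "l n = z") (simp_all add: L2_inner_add_left L2_scale chi_mult_L2 in_L2 L2_inner_scale_left)
  qed (intro u L2_add L2_scale chi_mult_L2)+
  show False
  proof (cases "s1 \<le> s2")
    case False
    \<comment> \<open>An interval with \<open>s1 > s2\<close> admits no value of \<open>chi\<close>,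
      so \<open>u\<close> would be null.\<close>
    then have "AE x in M. u x = 0" using u_loc by simp
    then show False using uu u by (simp add: L2_inner_self_eq_0_iff[symmetric])
  next
    case True
    define s where "s = (s1 + s2) / 2"
    define r where "r = (s2 - s1) / 2"
    have r: "r \<ge> 0" using True by (simp add: r_def)
    define v where "v x = (chi x - s) * u x" for x
    have v_eq: "v = (\<lambda>x. (p z * u x + chi x * u x) - (p z + s) * u x)"
      by (auto simp: v_def algebra_simps)
    have v: "v \<in> L2 M" unfolding v_eq by (intro L2_diff L2_add L2_scale chi_mult_L2 u)
    have "\<psi>.coef v k = \<psi>.coef (\<lambda>x. p z * u x + chi x * u x) k - (p z + s) * \<psi>.coef u k" for k
      unfolding v_eq L2_inner_diff_left[OF L2_add[OF L2_scale[OF u] chi_mult_L2[OF u]] L2_scale[OF u] \<psi>.in_L2]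
      by (simp add: L2_inner_scale_left)
    then have v_\<psi>: "\<psi>.coef v k = (\<eta> k - p z - s) * \<psi>.coef u k" for k
      unfolding \<psi>.op_coef[OF Hu] by (simp add: algebra_simps)
    have vv: "L2_inner M v v \<le> r\<^sup>2 * L2_inner M u u"
      unfolding v_def[abs_def]
    proof (rule L2_norm_bounded_mult)
      show "AE x in M. u x = 0 \<or> \<bar>chi x - s\<bar> \<le> r"
        using u_loc by eventually_elim (auto simp: s_def r_def abs_le_iff field_simps)
    qed (use u v in \<open>auto simp: v_def[abs_def]\<close>)
    \<comment> \<open>Strict, as \<open>?K\<close> is cut out by a closed interval; together with
      one nonzero coefficient this contradicts \<open>vv\<close>.\<close>
    have gap: "r\<^sup>2 < (\<eta> k - p z - s)\<^sup>2" if "k \<notin> ?K" for k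
    proof -
      have "r < \<bar>\<eta> k - p z - s\<bar>"
        using that by (auto simp: s_def r_def abs_if field_simps)
      then show ?thesis using r by (metis abs_of_nonneg abs_le_square_iff not_le)
    qed
    obtain k0 where k0: "\<psi>.coef u k0 \<noteq> 0"
      using \<psi>.null_if_coef_0[OF u] uu L2_inner_self_eq_0_iff[OF u] by fastforce
    have le: "(\<psi>.coef (\<lambda>x. r * u x) k)\<^sup>2 \<le> 1 * (\<psi>.coef v k)\<^sup>2" for k
    proof (cases "k \<in> ?K")
      case True
      then show ?thesis using u_\<psi> by (simp add: L2_inner_scale_left)
    next
      case False
      from less_imp_le[OF gap[OF False]] show ?thesis
        by (simp add: L2_inner_scale_left v_\<psi> power_mult_distrib mult_right_mono)
    qed
    have "k0 \<notin> ?K" using k0 u_\<psi> by blast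
    from gap[OF this] have "(\<psi>.coef (\<lambda>x. r * u x) k0)\<^sup>2 < 1 * (\<psi>.coef v k0)\<^sup>2"
      using k0 by (simp add: L2_inner_scale_left v_\<psi> power_mult_distrib)
    from \<psi>.inner_less_if_coef_less[OF L2_scale[OF u] v le this]
    have "r\<^sup>2 * L2_inner M u u < L2_inner M v v"
      by (simp add: L2_inner_scale_left L2_inner_scale_right power2_eq_square mult.assoc)
    then show False using vv by simp
  qed
qed

text \<open>For the interval of all values of \<open>chi\<close> every eigenfunction counts as
  localized.\<close>

lemma card_cluster_ge:
  assumes "maximal_diagonal_operator M \<psi> H \<eta>"
  shows "card {n. l n = z} \<le> card {k. \<eta> k \<in> {p z + m1..p z + m2}}"
proof (rule card_localized_le[OF assms finite_eigenvalues_eq, of z \<phi>])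
  show "\<phi> i \<in> eigenspace M T z" if "i \<in> {n. l n = z}" for i
    using that op_eigenfunction[of i] in_L2 by (auto simp: eigenspace_def)
  show "AE x in M. \<phi> i x = 0 \<or> chi x \<in> {m1..m2}" for i
    by (rule AE_I2) (use chi_range in blast)
qed (auto simp: orthonormal)

text \<open>With too many cluster eigenfunctions some combination \<open>y\<close> of them is
  orthogonal to the eigenspace of \<open>z\<close>. Then \<open>(p(T) - p z) y = v1 - v2\<close>,
  where H and the potential each deviate from the centre by at most
  \<open>r = (m2 - m1) / 2\<close>; but every nonzero coefficient of \<open>y\<close> is multiplied
  by at least \<open>\<gamma> > 2 r\<close>.\<close>

lemma card_cluster_le:
  assumes \<psi>: "maximal_diagonal_operator M \<psi> H \<eta>"
    and gap: "\<And>n. l n \<noteq> z \<Longrightarrow> \<gamma> \<le> \<bar>p (l n) - p z\<bar>" and "m2 - m1 < \<gamma>" "m1 \<le> m2"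
  shows "card {k. \<eta> k \<in> {p z + m1..p z + m2}} \<le> card {n. l n = z}"
proof (rule ccontr)
  interpret \<psi>: maximal_diagonal_operator M \<psi> H \<eta> by (rule \<psi>)
  let ?K = "{k. \<eta> k \<in> {p z + m1..p z + m2}}"
  assume "\<not> card ?K \<le> card {n. l n = z}"
  then obtain c where c: "\<exists>k\<in>?K. c k \<noteq> 0" "\<And>n. n \<in> {n. l n = z} \<Longrightarrow> (\<Sum>k\<in>?K. c k * coef (\<psi> k) n) = 0"
    using homogeneous_system_nontrivial_solution[OF \<psi>.finite_eigenvalues_in[of "p z + m1" "p z + m2"]
        finite_eigenvalues_eq[of z], of "\<lambda>k n. coef (\<psi> k) n"] by auto
  have K: "finite ?K" by (rule \<psi>.finite_eigenvalues_in)
  define y where "y x = (\<Sum>k\<in>?K. c k * \<psi> k x)" for x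
  define g where "g x = (\<Sum>k\<in>?K. c k * (\<eta> k * \<psi> k x))" for x
  have Hy: "H y g" unfolding y_def[abs_def] g_def[abs_def] by (rule \<psi>.op_sum[OF K])
  note L2 = Hy[unfolded H_iff]
  have y: "y \<in> L2 M" and gL2: "g \<in> L2 M" using L2 by auto
  have yy: "L2_inner M y y > 0"
    unfolding y_def[abs_def] \<psi>.inner_sum_sum[OF K] using c(1) K by (metis (no_types, lifting) sum_pos2 zero_le_power2 zero_less_power2)
  have y_coef: "coef y n = 0" if "l n = z" for n
    unfolding y_def[abs_def] using c(2)[of n] that by (subst L2_inner_sum_left) (auto simp: \<psi>.in_L2 in_L2)
  define s where "s = (m1 + m2) / 2"
  define r where "r = (m2 - m1) / 2"
  have r: "r \<ge> 0" "2 * r < \<gamma>" using assms(3,4) by (auto simp: r_def)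
  define v1 where "v1 x = g x - (p z + s) * y x" for x
  define v2 where "v2 x = (chi x - s) * y x" for x
  have v2_eq: "v2 = (\<lambda>x. chi x * y x - s * y x)" by (auto simp: v2_def algebra_simps)
  have v1: "v1 \<in> L2 M" unfolding v1_def[abs_def] by (intro L2_diff L2_scale y gL2)
  have v2: "v2 \<in> L2 M" unfolding v2_eq by (intro L2_diff L2_scale chi_mult_L2 y)
  have "L2_inner M v1 v1 \<le> r\<^sup>2 * L2_inner M y y"
  proof (rule \<psi>.inner_le_if_coef_le[OF v1 y])
    fix k
    have "\<psi>.coef v1 k = \<psi>.coef g k - (p z + s) * \<psi>.coef y k"
      unfolding v1_def[abs_def]
      by (simp add: L2_inner_diff_left L2_scale y gL2 \<psi>.in_L2 L2_inner_scale_left)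
    then have v1_\<psi>: "\<psi>.coef v1 k = (\<eta> k - p z - s) * \<psi>.coef y k"
      using \<psi>.op_coef[OF Hy, of k] by (simp add: algebra_simps)
    show "(\<psi>.coef v1 k)\<^sup>2 \<le> r\<^sup>2 * (\<psi>.coef y k)\<^sup>2"
    proof (cases "k \<in> ?K")
      case True
      then have "\<bar>\<eta> k - p z - s\<bar> \<le> r" by (auto simp: s_def r_def abs_le_iff field_simps)
      then have "(\<eta> k - p z - s)\<^sup>2 \<le> r\<^sup>2" using r by (simp add: abs_le_square_iff[symmetric])
      then show ?thesis by (simp add: v1_\<psi> power_mult_distrib mult_right_mono)
    next
      case False
      then have "\<psi>.coef y k = 0" unfolding y_def[abs_def] \<psi>.coef_sum[OF K] by (rule if_not_P)
      then show ?thesis by (simp add: v1_\<psi>)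
    qed
  qed
  moreover have "L2_inner M v2 v2 \<le> r\<^sup>2 * L2_inner M y y"
    unfolding v2_def[abs_def]
  proof (rule L2_norm_bounded_mult)
    show "AE x in M. y x = 0 \<or> \<bar>chi x - s\<bar> \<le> r"
      by (intro AE_I2 disjI2) (use chi_range in \<open>fastforce simp: s_def r_def abs_le_iff field_simps\<close>)
  qed (use y v2 in \<open>auto simp: v2_def[abs_def]\<close>)
  ultimately have "L2_norm M v1 \<le> r * L2_norm M y" "L2_norm M v2 \<le> r * L2_norm M y"
    using real_sqrt_le_mono[of _ "r\<^sup>2 * L2_inner M y y"] r
    by (simp_all add: L2_norm_eq_sqrt real_sqrt_mult)
  then have "L2_norm M (\<lambda>x. v1 x - v2 x) \<le> 2 * r * L2_norm M y"
    using L2_norm_triangle[OF v1 L2_scale[OF v2, of "-1"]] unfolding L2_norm_scale by simp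
  also have "\<dots> < \<gamma> * L2_norm M y"
    using r yy by (intro mult_strict_right_mono) (auto simp: L2_norm_eq_sqrt)
  finally have less: "L2_norm M (\<lambda>x. v1 x - v2 x) < \<gamma> * L2_norm M y" .
  have \<gamma>: "\<gamma> > 0" using r by linarith
  have d: "(\<lambda>x. v1 x - v2 x) \<in> L2 M" by (intro L2_diff v1 v2)
  have "L2_inner M y y \<le> (1 / \<gamma>)\<^sup>2 * L2_inner M (\<lambda>x. v1 x - v2 x) (\<lambda>x. v1 x - v2 x)"
  proof (rule inner_le_if_coef_le[OF y d])
    fix n
    have d_coef: "coef (\<lambda>x. v1 x - v2 x) n = (p (l n) - p z) * coef y n"
    proof -
      have "coef v1 n = coef g n - (p z + s) * coef y n"
        unfolding v1_def[abs_def] L2_inner_diff_left[OF gL2 L2_scale[OF y] in_L2]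
        by (simp add: L2_inner_scale_left)
      moreover have "coef v2 n = coef (\<lambda>x. chi x * y x) n - s * coef y n"
        unfolding v2_eq L2_inner_diff_left[OF chi_mult_L2[OF y] L2_scale[OF y] in_L2]
        by (simp add: L2_inner_scale_left)
      ultimately show ?thesis
        using L2 unfolding L2_inner_diff_left[OF v1 v2 in_L2] by (simp add: algebra_simps)
    qed
    show "(coef y n)\<^sup>2 \<le> (1 / \<gamma>)\<^sup>2 * (coef (\<lambda>x. v1 x - v2 x) n)\<^sup>2"
    proof (cases "l n = z")
      case True
      then show ?thesis using y_coef by simp
    next
      case False
      have "\<gamma>\<^sup>2 \<le> (p (l n) - p z)\<^sup>2" using gap[OF False] \<gamma> by (simp add: abs_le_square_iff[symmetric])
      then have "\<gamma>\<^sup>2 * (coef y n)\<^sup>2 \<le> (p (l n) - p z)\<^sup>2 * (coef y n)\<^sup>2" by (rule mult_right_mono) simp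
      then show ?thesis unfolding d_coef using \<gamma> by (simp add: power_mult_distrib power_divide pos_le_divide_eq mult.commute)
    qed
  qed
  then have "(\<gamma> * L2_norm M y)\<^sup>2 \<le> (L2_norm M (\<lambda>x. v1 x - v2 x))\<^sup>2"
    using \<gamma> by (simp add: L2_norm_power2 power_mult_distrib power_divide pos_le_divide_eq mult.commute)
  then have "\<gamma> * L2_norm M y \<le> L2_norm M (\<lambda>x. v1 x - v2 x)"
    by (rule power2_le_imp_le) (rule L2_norm_nonneg)
  then show False using less by simp
qed

end

section \<open>Geometry of the gasket\<close>

text \<open>Keeps the index \<open>1\<close> from being rewritten to \<open>Suc 0\<close>.\<close>

declare One_nat_def [simp del]

lemma atLeastAtMost_1_3: "{1..3::nat} = {1, 2, 3}"
  by auto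

lemma sum_1_3: "(\<Sum>i\<in>{1..3::nat}. f i) = f 1 + f 2 + (f 3 :: real)"
  by (simp add: atLeastAtMost_1_3)

lemma F_map_fixed: "F_map a j (a j) = a j"
  by (simp add: F_map_def)

lemma F_map_swap: "F_map a i (a k) = F_map a k (a i)"
proof -
  have "F_map a i (a k) = (1/2) *\<^sub>R (a i + a k)" for i k
    by (simp add: F_map_def vec_eq_iff field_simps)
  then show ?thesis by (simp add: add.commute)
qed

lemma dist_F_map: "dist (F_map a j x) (F_map a j y) = dist x y / 2"
  by (simp add: F_map_def dist_norm flip: scaleR_diff_right)

section \<open>Inverse branches and finite words\<close>

definition F_inv :: "(nat \<Rightarrow> real^2) \<Rightarrow> nat \<Rightarrow> real^2 \<Rightarrow> real^2" where
  "F_inv a j x = 2 *\<^sub>R x - a j"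

lemma F_inv_F_map [simp]: "F_inv a j (F_map a j x) = x"
  by (simp add: F_inv_def F_map_def vec_eq_iff field_simps)

lemma F_map_eq_iff [simp]: "F_map a j x = F_map a j y \<longleftrightarrow> x = y"
  by (metis F_inv_F_map)

lemma continuous_on_F_map: "continuous_on S (F_map a j)"
  unfolding F_map_def by (intro continuous_intros)

lemma continuous_on_F_inv: "continuous_on S (F_inv a j)"
  unfolding F_inv_def by (intro continuous_intros)

lemma F_word_Nil [simp]: "F_word a [] = id"
  by (simp add: F_word_def)

lemma F_word_Cons [simp]: "F_word a (j # w) = F_map a j \<circ> F_word a w"
  by (simp add: F_word_def)

definition word_set :: "nat \<Rightarrow> nat list set" where
  "word_set m = {w \<in> words. length w = m}"

lemma word_set_0 [simp]: "word_set 0 = {[]}"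
  by (auto simp: word_set_def words_def)

lemma word_set_Suc: "word_set (Suc m) = (\<Union>j\<in>{1..3}. (#) j ` word_set m)"
proof (intro set_eqI iffI)
  fix w assume "w \<in> word_set (Suc m)"
  then show "w \<in> (\<Union>j\<in>{1..3}. (#) j ` word_set m)"
    by (cases w) (auto simp: word_set_def words_def)
qed (auto simp: word_set_def words_def)

lemma word_set_lists: "word_set m = {w. set w \<subseteq> {1..3} \<and> length w = m}"
  by (auto simp: word_set_def words_def)

lemma finite_word_set [simp]: "finite (word_set m)"
  unfolding word_set_lists by (rule finite_lists_length_eq) simp

lemma card_word_set: "card (word_set m) = 3 ^ m"
  unfolding word_set_lists by (subst card_lists_length_eq) auto

lemma sum_word_set_Suc:
  "(\<Sum>w\<in>word_set (Suc m). f w) = (\<Sum>j\<in>{1..3}. \<Sum>w\<in>word_set m. f (j # w) :: real)"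
proof -
  have "(\<Sum>w\<in>word_set (Suc m). f w) = (\<Sum>j\<in>{1..3}. \<Sum>w\<in>(#) j ` word_set m. f w)"
    unfolding word_set_Suc by (rule sum.UNION_disjoint) auto
  also have "\<dots> = (\<Sum>j\<in>{1..3}. \<Sum>w\<in>word_set m. f (j # w))"
    by (simp add: sum.reindex)
  finally show ?thesis .
qed

lemma dist_F_word: "dist (F_word a w x) (F_word a w y) = dist x y / 2 ^ length w"
  by (induction w) (auto simp: dist_F_map)

definition cross :: "real^2 \<Rightarrow> real^2 \<Rightarrow> real" where
  "cross u v = u $ 1 * v $ 2 - u $ 2 * v $ 1"

text \<open>Barycentric coordinates as ratios of signed areas.\<close>

definition bary :: "(nat \<Rightarrow> real^2) \<Rightarrow> nat \<Rightarrow> real^2 \<Rightarrow> real" where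
  "bary a i x = (if i = 1 then cross (a 2 - x) (a 3 - x) else if i = 2 then cross (a 3 - x) (a 1 - x)
     else cross (a 1 - x) (a 2 - x)) / cross (a 2 - a 1) (a 3 - a 1)"

locale gasket =
  fixes a :: "nat \<Rightarrow> real^2" and X :: "(real^2) set"
  assumes noncollinear: "\<not> collinear {a 1, a 2, a 3}"
    and gasket: "is_gasket a X"
begin

abbreviation I3 :: "nat set" where "I3 \<equiv> {1..3}"

abbreviation F :: "nat \<Rightarrow> real^2 \<Rightarrow> real^2" where "F \<equiv> F_map a"

lemma I3_cases: "i \<in> I3 \<longleftrightarrow> i = 1 \<or> i = 2 \<or> i = 3"
  by auto

lemma area_nonzero: "cross (a 2 - a 1) (a 3 - a 1) \<noteq> 0"
proof
  assume 0: "cross (a 2 - a 1) (a 3 - a 1) = 0"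
  define u where "u = a 2 - a 1"
  define v where "v = a 3 - a 1"
  have c: "u $ 1 * v $ 2 = u $ 2 * v $ 1" using 0 by (simp add: cross_def u_def v_def)
  have "collinear {0, u, v}"
  proof (cases "u = 0")
    case True
    then show ?thesis by (simp add: collinear_lemma)
  next
    case False
    have "\<exists>t. v = t *\<^sub>R u"
    proof (cases "u $ 1 = 0")
      case True
      then have "u $ 2 \<noteq> 0" using False by (auto simp: vec_eq_iff forall_2)
      then show ?thesis using True c
        by (intro exI[of _ "v $ 2 / u $ 2"]) (auto simp: vec_eq_iff forall_2)
    next
      case F: False
      then show ?thesis using c
        by (intro exI[of _ "v $ 1 / u $ 1"]) (auto simp: vec_eq_iff forall_2 field_simps)
    qed
    then show ?thesis by (auto simp: collinear_lemma)
  qed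
  then have "collinear {a 2, a 1, a 3}" unfolding u_def v_def
    by (rule iffD2[OF collinear_3, rotated]) (simp add: NO_MATCH_def)
  then show False using noncollinear by (simp add: insert_commute)
qed

section \<open>Barycentric coordinates\<close>

lemma bary_vertex:
  assumes "i \<in> I3" "k \<in> I3"
  shows "bary a i (a k) = (if i = k then 1 else 0)"
  using assms area_nonzero unfolding I3_cases
  by (auto simp: bary_def cross_def field_simps)

lemma sum_bary: "bary a 1 x + bary a 2 x + bary a 3 x = 1"
proof -
  have "cross (a 2 - x) (a 3 - x) + cross (a 3 - x) (a 1 - x) + cross (a 1 - x) (a 2 - x)
      = cross (a 2 - a 1) (a 3 - a 1)"
    by (simp add: cross_def algebra_simps)
  then show ?thesis using area_nonzero by (simp add: bary_def flip: add_divide_distrib)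
qed

lemma bary_F:
  assumes "i \<in> I3" "j \<in> I3"
  shows "bary a i (F j x) = (bary a i x + (if i = j then 1 else 0)) / 2"
proof -
  let ?A = "cross (a 2 - a 1) (a 3 - a 1)"
  \<comment> \<open>\<open>B\<close> clears the common denominator and leaves a polynomial
    identity.\<close>
  define B where "B i x = ?A * bary a i x" for i x
  have B: "B 1 x = cross (a 2 - x) (a 3 - x)" "B 2 x = cross (a 3 - x) (a 1 - x)"
      "B 3 x = cross (a 1 - x) (a 2 - x)" for x
    using area_nonzero by (auto simp: B_def bary_def)
  have F: "F k x $ n = (x $ n + a k $ n) / 2" for k n by (simp add: F_map_def field_simps)
  have *: "2 * B i (F j x) = B i x + (if i = j then ?A else 0)"
    using assms unfolding I3_cases
    by (elim disjE) (simp_all add: B cross_def F field_simps)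
  have inv: "bary a i y = B i y / ?A" for y using area_nonzero by (simp add: B_def)
  have "B i (F j x) = (B i x + (if i = j then ?A else 0)) / 2" using * by simp
  then show ?thesis
    unfolding inv using area_nonzero by (simp add: add_divide_distrib)
qed

lemma vertex_if_bary:
  assumes "k \<in> I3" "\<And>i. i \<in> I3 \<Longrightarrow> bary a i x = (if i = k then 1 else 0)"
  shows "x = a k"
proof -
  \<comment> \<open>The barycentric representation of \<open>y\<close> with the denominator cleared,
    a polynomial identity in the coordinates.\<close>
  have rep: "cross (a 2 - a 1) (a 3 - a 1) *\<^sub>R y = cross (a 2 - y) (a 3 - y) *\<^sub>R a 1
      + cross (a 3 - y) (a 1 - y) *\<^sub>R a 2 + cross (a 1 - y) (a 2 - y) *\<^sub>R a 3" for y
    by (simp add: vec_eq_iff forall_2 cross_def algebra_simps)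
  have "bary a i x = bary a i (a k)" if "i \<in> I3" for i
    using assms that by (simp add: bary_vertex)
  then have "bary a 1 x = bary a 1 (a k)" "bary a 2 x = bary a 2 (a k)" "bary a 3 x = bary a 3 (a k)"
    by auto
  then have "cross (a 2 - x) (a 3 - x) = cross (a 2 - a k) (a 3 - a k)"
    "cross (a 3 - x) (a 1 - x) = cross (a 3 - a k) (a 1 - a k)"
    "cross (a 1 - x) (a 2 - x) = cross (a 1 - a k) (a 2 - a k)"
    using area_nonzero by (auto simp: bary_def)
  then have "cross (a 2 - a 1) (a 3 - a 1) *\<^sub>R x = cross (a 2 - a 1) (a 3 - a 1) *\<^sub>R a k"
    using rep[of x] rep[of "a k"] by simp
  then show ?thesis using area_nonzero by simp
qed

lemma continuous_on_bary: "continuous_on S (bary a i)"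
proof -
  have "continuous_on S (\<lambda>x. cross (p - x) (q - x))" for p q
    unfolding cross_def by (intro continuous_intros)
  then show ?thesis
    unfolding bary_def
    by (cases "i = 1"; cases "i = 2") (auto intro!: continuous_on_divide continuous_on_const simp: area_nonzero)
qed

section \<open>Vertices and overlaps of the cells\<close>

lemma compact_X: "compact X" and X_nonempty: "X \<noteq> {}"
  and X_eq: "X = (\<Union>j\<in>I3. F j ` X)"
  using gasket by (auto simp: is_gasket_def)

lemma F_in_X: "j \<in> I3 \<Longrightarrow> x \<in> X \<Longrightarrow> F j x \<in> X"
  using X_eq by blast

lemma X_cases:
  assumes "x \<in> X"
  obtains j y where "j \<in> I3" "y \<in> X" "x = F j y"
  using assms X_eq by blast

text \<open>\<open>F j\<close> halves the distance to its fixed point \<open>a j\<close>, so the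
  point of \<open>X\<close> nearest to \<open>a j\<close> must be \<open>a j\<close> itself.\<close>

lemma vertex_in_X:
  assumes "j \<in> I3"
  shows "a j \<in> X"
proof -
  obtain y where y: "y \<in> X" "\<And>z. z \<in> X \<Longrightarrow> dist (a j) y \<le> dist (a j) z"
    using distance_attains_inf[OF compact_imp_closed[OF compact_X] X_nonempty] by blast
  have "dist (a j) y \<le> dist (a j) (F j y)" using y F_in_X assms by blast
  also have "\<dots> = dist (a j) y / 2" using dist_F_map[of a j "a j" y] by (simp add: F_map_fixed)
  finally have "a j = y" by simp
  then show ?thesis using y by simp
qed

text \<open>If the minimum over \<open>X\<close> is attained at \<open>y = F j z\<close>, it is at
  least half the value at \<open>z\<close>, hence at least half of itself.\<close>

lemma bary_nonneg:
  assumes "i \<in> I3" "x \<in> X"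
  shows "0 \<le> bary a i x"
proof -
  obtain y where y: "y \<in> X" "\<And>z. z \<in> X \<Longrightarrow> bary a i y \<le> bary a i z"
    using continuous_attains_inf[OF compact_X X_nonempty continuous_on_bary] by blast
  obtain j z where z: "j \<in> I3" "z \<in> X" "y = F j z" using X_cases[OF y(1)] .
  have "bary a i z / 2 \<le> bary a i y" using z assms(1) by (simp add: bary_F)
  then have "0 \<le> bary a i y" using y(2)[OF z(2)] by linarith
  then show ?thesis using y(2)[OF assms(2)] by linarith
qed

text \<open>Points of cell \<open>k\<close> have \<open>k\<close>-th coordinate at least 1/2. Pulled
  back along \<open>F i\<close> this gives \<open>bary a k y \<ge> 1\<close>, and since the
  coordinates are nonnegative with sum 1, \<open>y\<close> is the vertex \<open>a k\<close>.\<close>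

lemma cell_overlap:
  assumes "i \<in> I3" "k \<in> I3" "i \<noteq> k" "y \<in> X" "z \<in> X" "F i y = F k z"
  shows "y = a k"
proof (rule vertex_if_bary[OF assms(2)])
  have i: "(bary a i y + 1) / 2 = bary a i z / 2" and k: "bary a k y / 2 = (bary a k z + 1) / 2"
    using bary_F[OF assms(1,1), of y] bary_F[OF assms(1,2), of z] bary_F[OF assms(2,1), of y]
      bary_F[OF assms(2,2), of z] assms(3,6) by auto
  have nn: "0 \<le> bary a n y" "0 \<le> bary a n z" if "n \<in> I3" for n
    using that assms bary_nonneg by auto
  have "bary a k y \<ge> 1" using k nn(2)[OF assms(2)] by simp
  then show "bary a n y = (if n = k then 1 else 0)" if "n \<in> I3" for n
    using sum_bary[of y] nn(1)[of 1] nn(1)[of 2] nn(1)[of 3] that assms(2) unfolding I3_cases by auto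
qed

lemma vertex_eq_iff: "i \<in> I3 \<Longrightarrow> k \<in> I3 \<Longrightarrow> a i = a k \<longleftrightarrow> i = k"
  by (metis bary_vertex zero_neq_one)

text \<open>Meaningful only on \<open>X\<close>, and only if the \<open>u j\<close> agree at the points common to two cells.\<close>

definition glue :: "(nat \<Rightarrow> real^2 \<Rightarrow> real) \<Rightarrow> real^2 \<Rightarrow> real" where
  "glue u x = (let j = (SOME j. j \<in> I3 \<and> x \<in> F j ` X) in u j (F_inv a j x))"

text \<open>By \<open>cell_overlap\<close> two cells meet only at
  \<open>F i (a k) = F k (a i)\<close>, so agreement at these midpoints makes the choice of
  \<open>j\<close> in \<open>glue\<close> irrelevant.\<close>

lemma glue_F:
  assumes "\<And>i k. i \<in> I3 \<Longrightarrow> k \<in> I3 \<Longrightarrow> u i (a k) = u k (a i)" "j \<in> I3" "x \<in> X"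
  shows "glue u (F j x) = u j x"
proof -
  define i where "i = (SOME i. i \<in> I3 \<and> F j x \<in> F i ` X)"
  have "i \<in> I3 \<and> F j x \<in> F i ` X"
    unfolding i_def by (rule someI[of _ j]) (use assms in auto)
  then obtain y where i: "i \<in> I3" "y \<in> X" "F j x = F i y" by auto
  have "glue u (F j x) = u i y"
    unfolding glue_def Let_def i_def[symmetric] by (simp add: i(3))
  also have "\<dots> = u j x"
  proof (cases "i = j")
    case True
    then show ?thesis using i by simp
  next
    case False
    have "x = a i" by (rule cell_overlap[OF assms(2) i(1) False[symmetric] assms(3) i(2,3)])
    moreover have "y = a j" by (rule cell_overlap[OF i(1) assms(2) False i(2) assms(3) i(3)[symmetric]])
    ultimately show ?thesis using assms(1)[OF i(1) assms(2)] by simp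
  qed
  finally show ?thesis .
qed

lemma continuous_on_glued:
  assumes "\<And>j. j \<in> I3 \<Longrightarrow> continuous_on X (\<lambda>x. u (F j x))"
  shows "continuous_on X (u :: _ \<Rightarrow> real)"
proof -
  have "continuous_on (\<Union>j\<in>I3. F j ` X) u"
  proof (rule continuous_on_closed_Union)
    fix j assume j: "j \<in> I3"
    show "closed (F j ` X)"
      by (intro compact_imp_closed compact_continuous_image continuous_on_F_map compact_X)
    have "continuous_on (F j ` X) (\<lambda>y. u (F j (F_inv a j y)))"
      by (rule continuous_on_compose2[OF assms[OF j] continuous_on_F_inv]) auto
    then show "continuous_on (F j ` X) u"
      by (subst continuous_on_cong[OF refl, of _ _ "\<lambda>y. u (F j (F_inv a j y))"]) auto
  qed simp
  then show ?thesis using X_eq by simp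
qed

lemma continuous_on_comp_F: "continuous_on X u \<Longrightarrow> j \<in> I3 \<Longrightarrow> continuous_on X (\<lambda>x. u (F j x))"
  by (rule continuous_on_compose2[OF _ continuous_on_F_map]) (auto intro: F_in_X)

lemma F_word_in_X: "w \<in> words \<Longrightarrow> x \<in> X \<Longrightarrow> F_word a w x \<in> X"
  by (induction w) (auto simp: words_def intro!: F_in_X)

lemma cell_of:
  assumes "x \<in> X"
  obtains w y where "w \<in> word_set m" "y \<in> X" "x = F_word a w y"
proof -
  have "\<exists>w\<in>word_set m. \<exists>y\<in>X. x = F_word a w y" using assms
  proof (induction m arbitrary: x)
    case (Suc m)
    obtain j z where z: "j \<in> I3" "z \<in> X" "x = F j z" using X_cases[OF Suc.prems] .
    obtain w y where "w \<in> word_set m" "y \<in> X" "z = F_word a w y" using Suc.IH[OF z(2)] by blast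
    then show ?case using z by (intro bexI[of _ "j # w"] bexI[of _ y]) (auto simp: word_set_Suc)
  qed simp
  then show ?thesis using that by blast
qed

lemma cells_small:
  assumes "\<epsilon> > 0"
  obtains N where "\<And>m w x y. m \<ge> N \<Longrightarrow> w \<in> word_set m \<Longrightarrow> x \<in> X \<Longrightarrow> y \<in> X \<Longrightarrow>
    dist (F_word a w x) (F_word a w y) < \<epsilon>"
proof -
  obtain B where B: "\<And>x y. x \<in> X \<Longrightarrow> y \<in> X \<Longrightarrow> dist x y \<le> B"
    using compact_imp_bounded[OF compact_X] unfolding bounded_two_points by blast
  obtain N where N: "(B + 1) / \<epsilon> < 2 ^ N"
    using real_arch_pow[of 2 "(B + 1) / \<epsilon>"] by auto
  show ?thesis
  proof
    fix m w x y assume *: "m \<ge> N" "w \<in> word_set m" "x \<in> X" "y \<in> X"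
    have "(B + 1) / \<epsilon> < 2 ^ m"
      by (rule less_le_trans[OF N power_increasing[OF *(1)]]) simp
    then have "B + 1 < \<epsilon> * 2 ^ m" using assms by (simp add: field_simps)
    then have "dist x y < \<epsilon> * 2 ^ m" using B[OF *(3,4)] by linarith
    moreover have "length w = m" using *(2) by (simp add: word_set_def)
    ultimately show "dist (F_word a w x) (F_word a w y) < \<epsilon>" by (simp add: dist_F_word field_simps)
  qed
qed

lemma oscillation_small:
  fixes f :: "real^2 \<Rightarrow> real"
  assumes "continuous_on X f" "\<epsilon> > 0"
  obtains N where "\<And>m w x y. m \<ge> N \<Longrightarrow> w \<in> word_set m \<Longrightarrow> x \<in> X \<Longrightarrow> y \<in> X \<Longrightarrow>
    \<bar>f (F_word a w x) - f (F_word a w y)\<bar> < \<epsilon>"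
proof -
  obtain \<delta> where \<delta>: "\<delta> > 0" "\<And>x y. x \<in> X \<Longrightarrow> y \<in> X \<Longrightarrow> dist x y < \<delta> \<Longrightarrow> dist (f x) (f y) < \<epsilon>"
    using compact_uniformly_continuous[OF assms(1) compact_X] assms(2)
    unfolding uniformly_continuous_on_def by metis
  obtain N where N: "\<And>m w x y. m \<ge> N \<Longrightarrow> w \<in> word_set m \<Longrightarrow> x \<in> X \<Longrightarrow> y \<in> X \<Longrightarrow>
      dist (F_word a w x) (F_word a w y) < \<delta>"
    using cells_small[OF \<delta>(1)] by blast
  show ?thesis
  proof
    fix m w x y assume *: "m \<ge> N" "w \<in> word_set m" "x \<in> X" "y \<in> X"
    then have "w \<in> words" by (simp add: word_set_def)
    then show "\<bar>f (F_word a w x) - f (F_word a w y)\<bar> < \<epsilon>"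
      using \<delta>(2)[OF _ _ N[OF *]] * by (auto simp: F_word_in_X dist_real_def)
  qed
qed

end

section \<open>The self-similar measure\<close>

locale gasket_measure = gasket +
  fixes \<mu> :: "(real^2) measure"
  assumes measure_X: "is_gasket_measure a X \<mu>"

sublocale gasket_measure \<subseteq> prob_space \<mu>
  using measure_X by (simp add: is_gasket_measure_def)

context gasket_measure
begin

lemma sets_\<mu>: "sets \<mu> = sets (restrict_space borel X)"
  using measure_X by (simp add: is_gasket_measure_def)

lemma space_\<mu> [simp]: "space \<mu> = X"
  using sets_eq_imp_space_eq[OF sets_\<mu>] by (simp add: space_restrict_space)

lemma measurable_continuous:
  "continuous_on X f \<Longrightarrow> (f :: _ \<Rightarrow> real) \<in> borel_measurable \<mu>"
  using borel_measurable_continuous_on_restrict measurable_cong_sets[OF sets_\<mu> refl] by blast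

lemma bounded_continuous:
  assumes "continuous_on X f"
  obtains B where "B > 0" "\<And>x. x \<in> X \<Longrightarrow> \<bar>f x :: real\<bar> \<le> B"
proof -
  have "bounded (f ` X)"
    by (intro compact_imp_bounded compact_continuous_image assms compact_X)
  then show ?thesis using that unfolding bounded_pos by auto
qed

lemma continuous_L2: "continuous_on X f \<Longrightarrow> f \<in> L2 \<mu>"
  by (metis AE_I2 L2_bounded bounded_continuous measurable_continuous space_\<mu>)

lemma continuous_integrable:
  assumes "continuous_on X f"
  shows "integrable \<mu> (f :: _ \<Rightarrow> real)"
proof -
  obtain B where "\<And>x. x \<in> X \<Longrightarrow> \<bar>f x\<bar> \<le> B" using bounded_continuous[OF assms] by blast
  then show ?thesis
    by (intro integrable_const_bound[of _ B] AE_I2 measurable_continuous assms) auto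
qed

lemma cell_sets: "w \<in> words \<Longrightarrow> F_word a w ` X \<in> sets \<mu>"
proof -
  assume w: "w \<in> words"
  have "continuous_on X (F_word a w)"
  proof (induction w)
    case (Cons j w)
    then show ?case using continuous_on_compose[OF Cons.IH continuous_on_F_map[of _ a j]] by simp
  qed (simp add: id_def)
  then have "closed (F_word a w ` X)"
    by (intro compact_imp_closed compact_continuous_image compact_X)
  moreover have "F_word a w ` X \<subseteq> X" using F_word_in_X[OF w] by auto
  ultimately show ?thesis
    unfolding sets_\<mu> sets_restrict_space by (auto intro!: image_eqI[of _ _ "F_word a w ` X"])
qed

lemma measure_cell: "w \<in> word_set m \<Longrightarrow> measure \<mu> (F_word a w ` X) = 1 / 3 ^ m"
  using measure_X by (auto simp: is_gasket_measure_def word_set_def)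

lemma integrable_cell: "w \<in> word_set m \<Longrightarrow> integrable \<mu> (indicat_real (F_word a w ` X))"
  by (intro integrable_real_indicator cell_sets) (auto simp: emeasure_eq_measure word_set_def)

lemma integral_cell:
  assumes "w \<in> word_set m"
  shows "(\<integral>x. indicat_real (F_word a w ` X) x \<partial>\<mu>) = 1 / 3 ^ m"
proof -
  have "F_word a w ` X \<inter> X = F_word a w ` X"
    using assms F_word_in_X by (auto simp: word_set_def)
  then show ?thesis using measure_cell[OF assms] by simp
qed

text \<open>The cells cover \<open>X\<close> and their measures add up to 1, so the number of cells
  containing a point is at least 1 and has integral 1. Overlaps are thus seen to be null without
  being located.\<close>

lemma AE_one_cell: "AE x in \<mu>. (\<Sum>w\<in>word_set m. indicat_real (F_word a w ` X) x) = 1"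
proof -
  let ?s = "\<lambda>x. \<Sum>w\<in>word_set m. indicat_real (F_word a w ` X) x"
  have ge: "?s x - 1 \<ge> 0" if x: "x \<in> X" for x
  proof -
    obtain w y where w: "w \<in> word_set m" "y \<in> X" "x = F_word a w y" using cell_of[OF x] .
    have "indicat_real (F_word a w ` X) x \<le> ?s x"
      using w(1) by (intro member_le_sum) auto
    then show ?thesis using w by (simp add: indicator_def)
  qed
  have int: "integrable \<mu> ?s" by (intro Bochner_Integration.integrable_sum integrable_cell)
  have "(\<integral>x. ?s x \<partial>\<mu>) = (\<Sum>w\<in>word_set m. \<integral>x. indicat_real (F_word a w ` X) x \<partial>\<mu>)"
    by (rule Bochner_Integration.integral_sum[OF integrable_cell])
  also have "\<dots> = 1" by (simp add: integral_cell card_word_set del: Bochner_Integration.integral_indicator)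
  finally have "(\<integral>x. ?s x - 1 \<partial>\<mu>) = 0" using int prob_space by simp
  moreover have "integrable \<mu> (\<lambda>x. ?s x - 1)" using int by auto
  ultimately have "AE x in \<mu>. ?s x - 1 = 0"
    using ge by (subst (asm) integral_nonneg_eq_0_iff_AE) auto
  then show ?thesis by simp
qed

text \<open>Discrete approximation of \<open>\<mu>\<close> at level \<open>m\<close>: each cell
  gives weight \<open>1 / 3 ^ m\<close> to the mean over its corners, so a vertex common to two
  cells carries twice the weight of a boundary vertex. With these weights the graph eigenvalue
  equations become the weak equation in \<open>en_ext\<close>.\<close>

fun vertex_average :: "nat \<Rightarrow> (real^2 \<Rightarrow> real) \<Rightarrow> real" where
  "vertex_average 0 f = (\<Sum>i\<in>I3. f (a i)) / 3"
| "vertex_average (Suc m) f = (\<Sum>j\<in>I3. vertex_average m (\<lambda>x. f (F j x))) / 3"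

lemma vertex_average_words:
  "vertex_average m f = (\<Sum>w\<in>word_set m. vertex_average 0 (\<lambda>x. f (F_word a w x))) / 3 ^ m"
proof (induction m arbitrary: f)
  case (Suc m)
  show ?case
    unfolding vertex_average.simps(2) Suc.IH sum_word_set_Suc
    by (simp add: sum_divide_distrib)
qed simp

text \<open>Riemann sums over cells; through them identities for vertex values become identities for
  integrals.\<close>

lemma vertex_average_tendsto:
  assumes f: "continuous_on X f"
  shows "(\<lambda>m. vertex_average m f) \<longlonglongrightarrow> (\<integral>x. f x \<partial>\<mu>)"
proof (rule LIMSEQ_I)
  fix \<epsilon> :: real assume \<epsilon>: "\<epsilon> > 0"
  obtain N where N: "\<And>m w x y. m \<ge> N \<Longrightarrow> w \<in> word_set m \<Longrightarrow> x \<in> X \<Longrightarrow> y \<in> X \<Longrightarrow>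
      \<bar>f (F_word a w x) - f (F_word a w y)\<bar> < \<epsilon> / 2"
    using oscillation_small[OF f, of "\<epsilon> / 2"] \<epsilon> by auto
  have "norm (vertex_average m f - (\<integral>x. f x \<partial>\<mu>)) < \<epsilon>" if m: "m \<ge> N" for m
  proof -
    let ?I = "\<lambda>w. indicat_real (F_word a w ` X)"
    let ?v = "\<lambda>w. vertex_average 0 (\<lambda>x. f (F_word a w x))"
    have cs: "F_word a w ` X \<in> sets \<mu>" if "w \<in> word_set m" for w
      using that by (intro cell_sets) (simp add: word_set_def)
    note intI = integrable_cell[of _ m]
    have intf: "integrable \<mu> (\<lambda>x. ?I w x * f x)" if "w \<in> word_set m" for w
      using integrable_mult_indicator[OF cs[OF that] continuous_integrable[OF f]] by simp
    have "(\<integral>x. f x \<partial>\<mu>) = (\<integral>x. (\<Sum>w\<in>word_set m. ?I w x * f x) \<partial>\<mu>)"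
    proof (rule integral_cong_AE)
      show "AE x in \<mu>. f x = (\<Sum>w\<in>word_set m. ?I w x * f x)"
        using AE_one_cell[of m] by eventually_elim (simp flip: sum_distrib_right)
    qed (intro borel_measurable_sum borel_measurable_integrable intf measurable_continuous f; assumption)+
    also have "\<dots> = (\<Sum>w\<in>word_set m. \<integral>x. ?I w x * f x \<partial>\<mu>)"
      by (rule Bochner_Integration.integral_sum[OF intf])
    finally have int_f: "(\<integral>x. f x \<partial>\<mu>) = \<dots>" .
    have "vertex_average m f = (\<Sum>w\<in>word_set m. \<integral>x. ?I w x * ?v w \<partial>\<mu>)"
      unfolding vertex_average_words[of m] sum_divide_distrib
      by (intro sum.cong refl) (simp add: integral_cell del: Bochner_Integration.integral_indicator)
    then have "vertex_average m f - (\<integral>x. f x \<partial>\<mu>) = (\<Sum>w\<in>word_set m. \<integral>x. ?I w x * (?v w - f x) \<partial>\<mu>)"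
      unfolding int_f using intI intf
      by (simp add: right_diff_distrib sum_subtractf)
    also have "norm \<dots> \<le> (\<Sum>w\<in>word_set m. norm (\<integral>x. ?I w x * (?v w - f x) \<partial>\<mu>))"
      by (rule norm_sum)
    also have "\<dots> \<le> (\<Sum>w\<in>word_set m. \<epsilon> / 2 * (1 / 3 ^ m))"
    proof (rule sum_mono)
      fix w assume w: "w \<in> word_set m"
      have small: "\<bar>?v w - f x\<bar> \<le> \<epsilon> / 2" if x: "x \<in> F_word a w ` X" for x
      proof -
        obtain y where y: "y \<in> X" "x = F_word a w y" using x by auto
        have *: "f (F_word a w (a i)) - f x < \<epsilon> / 2 \<and> f x - f (F_word a w (a i)) < \<epsilon> / 2" if "i \<in> I3" for i
          using N[OF m w vertex_in_X[OF that] y(1)] unfolding y(2) by linarith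
        have "1 \<in> I3" "2 \<in> I3" "3 \<in> I3" by auto
        note * = this[THEN *]
        show ?thesis
          unfolding vertex_average.simps sum_1_3 abs_le_iff using * by (simp add: field_simps)
      qed
      have "norm (\<integral>x. ?I w x * (?v w - f x) \<partial>\<mu>) \<le> (\<integral>x. norm (?I w x * (?v w - f x)) \<partial>\<mu>)"
        by (rule integral_norm_bound)
      also have "\<dots> \<le> (\<integral>x. \<epsilon> / 2 * ?I w x \<partial>\<mu>)"
      proof (rule integral_mono)
        show "integrable \<mu> (\<lambda>x. norm (?I w x * (?v w - f x)))"
          unfolding right_diff_distrib using intI[OF w] intf[OF w] by auto
        show "integrable \<mu> (\<lambda>x. \<epsilon> / 2 * ?I w x)" using intI[OF w] by auto
        show "norm (?I w x * (?v w - f x)) \<le> \<epsilon> / 2 * ?I w x" for x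
          using small[of x] by (auto simp: indicator_def)
      qed
      also have "\<dots> = \<epsilon> / 2 * (1 / 3 ^ m)" by (simp add: integral_cell[OF w] del: Bochner_Integration.integral_indicator)
      finally show "norm (\<integral>x. ?I w x * (?v w - f x) \<partial>\<mu>) \<le> \<epsilon> / 2 * (1 / 3 ^ m)" .
    qed
    also have "\<dots> = \<epsilon> / 2" by (simp add: card_word_set)
    finally show ?thesis using \<epsilon> by linarith
  qed
  then show "\<exists>N. \<forall>m\<ge>N. norm (vertex_average m f - (\<integral>x. f x \<partial>\<mu>)) < \<epsilon>" by blast
qed

text \<open>\<open>\<mu>\<close> is given only by its values on cells. The recursion of
  \<open>vertex_average\<close> passes to the limit and yields self-similarity for continuous
  \<open>f\<close>.\<close>

lemma integral_self_similar:
  fixes f :: "real^2 \<Rightarrow> real"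
  assumes "continuous_on X f"
  shows "(\<integral>x. f x \<partial>\<mu>) = (\<Sum>j\<in>I3. \<integral>x. f (F j x) \<partial>\<mu>) / 3"
proof -
  have "(\<lambda>m. vertex_average (Suc m) f) \<longlonglongrightarrow> (\<integral>x. f x \<partial>\<mu>)"
    using vertex_average_tendsto[OF assms] by (rule LIMSEQ_Suc)
  moreover have "(\<lambda>m. vertex_average (Suc m) f) \<longlonglongrightarrow> (\<Sum>j\<in>I3. \<integral>x. f (F j x) \<partial>\<mu>) / 3"
    unfolding vertex_average.simps
    by (intro tendsto_intros vertex_average_tendsto continuous_on_comp_F assms) auto
  ultimately show ?thesis by (rule LIMSEQ_unique)
qed

lemma point_null:
  assumes "x \<in> X"
  shows "AE y in \<mu>. y \<noteq> x"
proof -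
  have x: "{x} \<in> sets \<mu>"
    unfolding sets_\<mu> sets_restrict_space using assms by (auto intro!: image_eqI[of _ _ "{x}"])
  have "measure \<mu> {x} \<le> (1 / 3) ^ m" for m
  proof -
    obtain w y where w: "w \<in> word_set m" "y \<in> X" "x = F_word a w y" using cell_of[OF assms] .
    have "measure \<mu> {x} \<le> measure \<mu> (F_word a w ` X)"
      using w by (intro finite_measure_mono cell_sets) (auto simp: word_set_def)
    then show ?thesis using measure_cell[OF w(1)] by (simp add: power_one_over)
  qed
  moreover have "(\<lambda>m. (1 / 3 :: real) ^ m) \<longlonglongrightarrow> 0" by (rule LIMSEQ_realpow_zero) auto
  ultimately have "measure \<mu> {x} \<le> 0" by (intro LIMSEQ_le_const) auto
  then have "emeasure \<mu> {x} = 0" by (simp add: emeasure_eq_measure measure_le_0_iff)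
  then show ?thesis using x by (intro AE_I[of _ _ "{x}"]) auto
qed

text \<open>Every point lies in arbitrarily small cells, and these have positive measure. This leads
  back from L2 classes to pointwise values, in particular at the corners of cells.\<close>

lemma continuous_AE_0:
  assumes f: "continuous_on X f" and AE: "AE x in \<mu>. f x = (0 :: real)" and x: "x \<in> X"
  shows "f x = 0"
proof (rule ccontr)
  assume "f x \<noteq> 0"
  then obtain N where N: "\<And>m w x' y. m \<ge> N \<Longrightarrow> w \<in> word_set m \<Longrightarrow> x' \<in> X \<Longrightarrow> y \<in> X \<Longrightarrow>
      \<bar>f (F_word a w x') - f (F_word a w y)\<bar> < \<bar>f x\<bar>"
    using oscillation_small[OF f, of "\<bar>f x\<bar>"] by auto
  obtain w y where w: "w \<in> word_set N" "y \<in> X" "x = F_word a w y" using cell_of[OF x] .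
  have nz: "f z \<noteq> 0" if "z \<in> F_word a w ` X" for z
    using N[OF order_refl w(1,2)] w(3) that by fastforce
  have cs: "F_word a w ` X \<in> sets \<mu>" using w by (intro cell_sets) (simp add: word_set_def)
  have "AE z in \<mu>. z \<notin> F_word a w ` X" using AE by eventually_elim (use nz in blast)
  then have "measure \<mu> (F_word a w ` X) = 0"
    using cs AE_iff_measurable[OF cs, of "\<lambda>z. z \<notin> F_word a w ` X"] sets.sets_into_space[OF cs]
    by (auto simp: measure_def Collect_conj_eq Int_absorb1 subset_eq)
  then show False using measure_cell[OF w(1)] by simp
qed

end

section \<open>The energy form\<close>

context gasket
begin

text \<open>Recursive form of \<open>graph_energy\<close>, with ordered pairs counted and halved at
  level 0. It makes statements on energies accessible to induction over levels.\<close>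

fun en :: "nat \<Rightarrow> (real^2 \<Rightarrow> real) \<Rightarrow> (real^2 \<Rightarrow> real) \<Rightarrow> real" where
  "en 0 u v = (\<Sum>i\<in>I3. \<Sum>k\<in>I3. (u (a i) - u (a k)) * (v (a i) - v (a k))) / 2"
| "en (Suc m) u v = 5 / 3 * (\<Sum>j\<in>I3. en m (\<lambda>x. u (F j x)) (\<lambda>x. v (F j x)))"

lemma adjacent_0: "adjacent a 0 = {(x, y). x \<noteq> y \<and> x \<in> a ` I3 \<and> y \<in> a ` I3}"
proof -
  have "(\<exists>w\<in>words. length w = 0 \<and> P w) \<longleftrightarrow> P []" for P
    by (auto simp: words_def)
  then show ?thesis unfolding adjacent_def conj_assoc by (simp only: F_word_Nil image_id id_apply)
qed

lemma adjacent_Suc: "adjacent a (Suc m) = (\<Union>j\<in>I3. (\<lambda>(x, y). (F j x, F j y)) ` adjacent a m)"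
proof -
  have W: "(\<exists>w\<in>words. length w = n \<and> P w) \<longleftrightarrow> (\<exists>w\<in>word_set n. P w)" for n P
    by (auto simp: word_set_def)
  have "(\<exists>w\<in>words. length w = Suc m \<and> P w) \<longleftrightarrow> (\<exists>j\<in>I3. \<exists>w\<in>words. length w = m \<and> P (j # w))" for P
    unfolding W word_set_Suc by blast
  then have "adjacent a (Suc m) = {(x, y). x \<noteq> y \<and> (\<exists>j\<in>I3. \<exists>w\<in>words. length w = m \<and>
      x \<in> F j ` F_word a w ` a ` I3 \<and> y \<in> F j ` F_word a w ` a ` I3)}"
    unfolding adjacent_def by (simp only: F_word_Cons image_comp comp_assoc)
  also have "\<dots> = (\<Union>j\<in>I3. (\<lambda>(x, y). (F j x, F j y)) ` adjacent a m)"
    unfolding adjacent_def by (auto simp: image_iff) (metis F_map_eq_iff atLeastAtMost_iff)+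
  finally show ?thesis .
qed

lemma adjacent_in_X: "(x, y) \<in> adjacent a m \<Longrightarrow> x \<in> X \<and> y \<in> X \<and> x \<noteq> y"
  unfolding adjacent_def using F_word_in_X vertex_in_X by auto

lemma finite_adjacent: "finite (adjacent a m)"
proof (induction m)
  case 0
  have "finite (a ` I3 \<times> a ` I3)" by simp
  then show ?case by (rule finite_subset[rotated]) (auto simp: adjacent_0)
qed (simp add: adjacent_Suc)

text \<open>The edge sets of the three subcells are disjoint: two cells share a single point, and an
  edge has two distinct ends.\<close>

lemma graph_energy_eq: "graph_energy a m u v = en m u v"
proof (induction m arbitrary: u v)
  case 0
  let ?f = "\<lambda>(x, y). (u x - u y) * (v x - v y)"
  have "(\<Sum>p\<in>adjacent a 0. ?f p) = (\<Sum>p\<in>a ` I3 \<times> a ` I3. ?f p)"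
    by (rule sum.mono_neutral_left) (auto simp: adjacent_0)
  also have "\<dots> = (\<Sum>x\<in>a ` I3. \<Sum>y\<in>a ` I3. ?f (x, y))"
    by (subst sum.cartesian_product) simp
  also have "\<dots> = (\<Sum>i\<in>I3. \<Sum>k\<in>I3. ?f (a i, a k))"
    using vertex_eq_iff by (simp add: sum.reindex inj_on_def)
  finally show ?case by (simp add: graph_energy_def)
next
  case (Suc m)
  let ?f = "\<lambda>(x, y). (u x - u y) * (v x - v y)"
  let ?F = "\<lambda>j (x, y). (F j x, F j y)"
  have "(\<Sum>p\<in>adjacent a (Suc m). ?f p) = (\<Sum>j\<in>I3. \<Sum>p\<in>?F j ` adjacent a m. ?f p)"
    unfolding adjacent_Suc
  proof (rule sum.UNION_disjoint)
    show "\<forall>i\<in>I3. \<forall>k\<in>I3. i \<noteq> k \<longrightarrow> ?F i ` adjacent a m \<inter> ?F k ` adjacent a m = {}"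
    proof (intro ballI impI, rule ccontr)
      fix i k assume ik: "i \<in> I3" "k \<in> I3" "i \<noteq> k" "?F i ` adjacent a m \<inter> ?F k ` adjacent a m \<noteq> {}"
      then obtain x y x' y' where *: "(x, y) \<in> adjacent a m" "(x', y') \<in> adjacent a m"
        "F i x = F k x'" "F i y = F k y'" by auto
      then have "x = a k" "y = a k"
        using adjacent_in_X cell_overlap[OF ik(1,2,3)] by blast+
      then show False using adjacent_in_X *(1) by blast
    qed
  qed (use finite_adjacent in auto)
  also have "\<dots> = (\<Sum>j\<in>I3. \<Sum>p\<in>adjacent a m. ?f (?F j p))"
    by (rule sum.cong[OF refl], subst sum.reindex) (auto simp: inj_on_def)
  finally have "(\<Sum>p\<in>adjacent a (Suc m). ?f p) = \<dots>" .
  then have "graph_energy a (Suc m) u v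
      = 5 / 3 * (\<Sum>j\<in>I3. graph_energy a m (\<lambda>x. u (F j x)) (\<lambda>x. v (F j x)))"
    unfolding graph_energy_def by (simp add: case_prod_beta sum_distrib_left sum_divide_distrib mult.assoc)
  then show ?case by (simp add: Suc.IH)
qed

lemma en_0: "en 0 u v = (u (a 1) - u (a 2)) * (v (a 1) - v (a 2)) + (u (a 1) - u (a 3)) * (v (a 1) - v (a 3))
    + (u (a 2) - u (a 3)) * (v (a 2) - v (a 3))"
  by (simp add: sum_1_3 field_simps)

lemma en_cong:
  assumes "\<And>x. x \<in> X \<Longrightarrow> u x = u' x" "\<And>x. x \<in> X \<Longrightarrow> v x = v' x"
  shows "en m u v = en m u' v'"
  using assms
proof (induction m arbitrary: u v u' v')
  case 0
  then show ?case using vertex_in_X by (auto intro!: sum.cong)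
next
  case (Suc m)
  show ?case unfolding en.simps
    by (intro arg_cong2[where f = "(*)"] refl sum.cong Suc.IH) (use Suc.prems F_in_X in auto)
qed

lemma en_commute: "en m u v = en m v u"
  by (induction m arbitrary: u v) (simp_all add: mult.commute)

lemma en_linear: "en m (\<lambda>x. u x + c * v x) w = en m u w + c * en m v w"
proof (induction m arbitrary: u v w)
  case 0
  show ?case unfolding en_0 by (simp add: algebra_simps)
next
  case (Suc m)
  show ?case by (simp add: Suc.IH sum.distrib distrib_left sum_distrib_left mult_ac)
qed

lemma en_square_add: "en m (\<lambda>x. u x + c * v x) (\<lambda>x. u x + c * v x) = en m u u + 2 * c * en m u v + c\<^sup>2 * en m v v"
proof -
  have "en m w (\<lambda>x. u x + c * v x) = en m w u + c * en m w v" for w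
    by (subst (1 2 3) en_commute) (rule en_linear)
  then show ?thesis by (simp add: en_linear en_commute[of m v u] power2_eq_square algebra_simps)
qed

lemma en_nonneg: "0 \<le> en m u u"
proof (induction m arbitrary: u)
  case 0
  show ?case unfolding en_0 by simp
qed (auto intro!: sum_nonneg mult_nonneg_nonneg)

text \<open>Completing squares around the harmonic values \<open>(2 q\<^sub>i + 2 q\<^sub>k + q\<^sub>n) / 5\<close> at the midpoints.\<close>

lemma en_0_le_1: "en 0 u u \<le> en (Suc 0) u u"
proof -
  define q1 q2 q3 where "q1 = u (a 1)" and "q2 = u (a 2)" and "q3 = u (a 3)"
  define m12 m13 m23 where "m12 = u (F 1 (a 2))" and "m13 = u (F 1 (a 3))" and "m23 = u (F 2 (a 3))"
  define d12 d13 d23 where "d12 = m12 - (2 * q1 + 2 * q2 + q3) / 5" and "d13 = m13 - (2 * q1 + 2 * q3 + q2) / 5"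
    and "d23 = m23 - (2 * q2 + 2 * q3 + q1) / 5"
  have v: "u (F 1 (a 1)) = q1" "u (F 2 (a 2)) = q2" "u (F 3 (a 3)) = q3" "u (F 1 (a 2)) = m12"
    "u (F 2 (a 1)) = m12" "u (F 1 (a 3)) = m13" "u (F 3 (a 1)) = m13" "u (F 2 (a 3)) = m23" "u (F 3 (a 2)) = m23"
    using F_map_swap[of a 1 2] F_map_swap[of a 1 3] F_map_swap[of a 2 3]
    by (simp_all add: q1_def q2_def q3_def m12_def m13_def m23_def F_map_fixed)
  have "en (Suc 0) u u - en 0 u u = 5 / 3 * (2 * (d12\<^sup>2 + d13\<^sup>2 + d23\<^sup>2) + (d12 - d13)\<^sup>2 + (d12 - d23)\<^sup>2 + (d13 - d23)\<^sup>2)"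
    unfolding en.simps(2) sum_1_3 en_0 v q1_def[symmetric] q2_def[symmetric] q3_def[symmetric]
      d12_def d13_def d23_def
    by (simp add: power2_eq_square field_simps)
  also have "\<dots> \<ge> 0" by simp
  finally show ?thesis by simp
qed

lemma en_le_Suc: "en m u u \<le> en (Suc m) u u"
proof (induction m arbitrary: u)
  case 0
  show ?case by (rule en_0_le_1)
next
  case (Suc m)
  show ?case
    unfolding en.simps(2)[of m u u] en.simps(2)[of "Suc m" u u]
    by (rule mult_left_mono[OF sum_mono[OF Suc.IH]]) simp
qed

lemma incseq_en: "incseq (\<lambda>m. en m u u)"
  by (rule incseq_SucI) (rule en_le_Suc)

section \<open>The limit form and its domain\<close>

abbreviation Fdom :: "(real^2 \<Rightarrow> real) set" where "Fdom \<equiv> energy_domain a X"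
abbreviation Fdom0 :: "(real^2 \<Rightarrow> real) set" where "Fdom0 \<equiv> energy_domain0 a X"

lemma Fdom_iff: "u \<in> Fdom \<longleftrightarrow> continuous_on X u \<and> (\<exists>C. \<forall>m. en m u u \<le> C)"
proof -
  have "convergent (\<lambda>m. en m u u) \<longleftrightarrow> (\<exists>C. \<forall>m. en m u u \<le> C)"
  proof
    assume "convergent (\<lambda>m. en m u u)"
    then obtain L where "(\<lambda>m. en m u u) \<longlonglongrightarrow> L" by (auto simp: convergent_def)
    from incseq_le[OF incseq_en this] show "\<exists>C. \<forall>m. en m u u \<le> C" by blast
  next
    assume "\<exists>C. \<forall>m. en m u u \<le> C"
    then obtain C where C: "\<forall>m. en m u u \<le> C" ..
    obtain L where "(\<lambda>m. en m u u) \<longlonglongrightarrow> L" using incseq_convergent[OF incseq_en C] by blast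
    then show "convergent (\<lambda>m. en m u u)" by (auto simp: convergent_def)
  qed
  then show ?thesis by (simp add: energy_domain_def graph_energy_eq)
qed

lemma Fdom_continuous: "u \<in> Fdom \<Longrightarrow> continuous_on X u"
  by (simp add: Fdom_iff)

lemma Fdom_linear:
  assumes "u \<in> Fdom" "v \<in> Fdom"
  shows "(\<lambda>x. u x + c * v x) \<in> Fdom"
proof -
  obtain A B where A: "\<And>m. en m u u \<le> A" and B: "\<And>m. en m v v \<le> B"
    using assms by (auto simp: Fdom_iff)
  have "en m (\<lambda>x. u x + c * v x) (\<lambda>x. u x + c * v x) \<le> 2 * A + 2 * c\<^sup>2 * B" for m
  proof -
    have "0 \<le> en m u u + 2 * (- c) * en m u v + (- c)\<^sup>2 * en m v v"
      using en_nonneg[of m "\<lambda>x. u x + (- c) * v x"] unfolding en_square_add .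
    then have "0 \<le> en m u u - 2 * c * en m u v + c\<^sup>2 * en m v v" by simp
    then have "en m (\<lambda>x. u x + c * v x) (\<lambda>x. u x + c * v x) \<le> 2 * en m u u + 2 * (c\<^sup>2 * en m v v)"
      unfolding en_square_add by linarith
    also have "\<dots> \<le> 2 * A + 2 * (c\<^sup>2 * B)"
      using A[of m] B[of m] by (intro add_mono mult_left_mono) auto
    finally show ?thesis by simp
  qed
  moreover have "continuous_on X (\<lambda>x. u x + c * v x)"
    by (intro continuous_intros Fdom_continuous assms)
  ultimately show ?thesis unfolding Fdom_iff by blast
qed

lemma en_tendsto_energy:
  assumes "u \<in> Fdom" "v \<in> Fdom"
  shows "(\<lambda>m. en m u v) \<longlonglongrightarrow> energy a u v"
proof -
  have conv: "convergent (\<lambda>m. en m w w)" if "w \<in> Fdom" for w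
    using that by (simp add: energy_domain_def graph_energy_eq)
  have "en m u v = 1 / 2 * (en m (\<lambda>x. u x + 1 * v x) (\<lambda>x. u x + 1 * v x) - en m u u - en m v v)" for m
    unfolding en_square_add by simp
  moreover have "convergent (\<lambda>m. 1 / 2 * (en m (\<lambda>x. u x + 1 * v x) (\<lambda>x. u x + 1 * v x) - en m u u - en m v v))"
    by (intro convergent_mult convergent_const convergent_diff conv Fdom_linear assms)
  ultimately have "convergent (\<lambda>m. en m u v)" by (simp only:)
  then show ?thesis by (simp add: energy_def graph_energy_eq convergent_LIMSEQ_iff)
qed

lemma energy_eqI:
  assumes "u \<in> Fdom" "v \<in> Fdom" "(\<lambda>m. en m u v) \<longlonglongrightarrow> L"
  shows "energy a u v = L"
  using LIMSEQ_unique[OF en_tendsto_energy[OF assms(1,2)] assms(3)] .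

lemma en_le_energy: "u \<in> Fdom \<Longrightarrow> en m u u \<le> energy a u u"
  by (rule incseq_le[OF incseq_en en_tendsto_energy])

lemma energy_le: "u \<in> Fdom \<Longrightarrow> (\<And>m. en m u u \<le> C) \<Longrightarrow> energy a u u \<le> C"
  by (rule LIMSEQ_le_const2[OF en_tendsto_energy]) auto

lemma energy_nonneg: "u \<in> Fdom \<Longrightarrow> 0 \<le> energy a u u"
  using en_le_energy[of u 0] en_nonneg[of 0 u] by linarith

lemma energy_commute: "energy a u v = energy a v u"
  by (simp add: energy_def graph_energy_eq en_commute[of _ u])

lemma energy_linear:
  assumes "u \<in> Fdom" "v \<in> Fdom" "w \<in> Fdom"
  shows "energy a (\<lambda>x. u x + c * v x) w = energy a u w + c * energy a v w"
  by (rule energy_eqI[OF Fdom_linear[OF assms(1,2)] assms(3)])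
    (unfold en_linear, intro tendsto_intros en_tendsto_energy assms)

lemma energy_linear_right:
  assumes "u \<in> Fdom" "v \<in> Fdom" "w \<in> Fdom"
  shows "energy a w (\<lambda>x. u x + c * v x) = energy a w u + c * energy a w v"
  by (subst (1 2 3) energy_commute) (rule energy_linear[OF assms])

lemma Fdom_cong:
  assumes "u \<in> Fdom" "\<And>x. x \<in> X \<Longrightarrow> v x = u x"
  shows "v \<in> Fdom"
  using assms en_cong[of v u v u] continuous_on_cong[of X X v u] by (auto simp: Fdom_iff)

lemma energy_cong:
  assumes "\<And>x. x \<in> X \<Longrightarrow> u x = u' x" "\<And>x. x \<in> X \<Longrightarrow> v x = v' x"
  shows "energy a u v = energy a u' v'"
  unfolding energy_def graph_energy_eq using en_cong[OF assms] by simp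

lemma Fdom_comp_F:
  assumes "u \<in> Fdom" "j \<in> I3"
  shows "(\<lambda>x. u (F j x)) \<in> Fdom"
proof -
  obtain C where C: "\<And>m. en m u u \<le> C" using assms(1) by (auto simp: Fdom_iff)
  have "en m (\<lambda>x. u (F j x)) (\<lambda>x. u (F j x)) \<le> 3 / 5 * C" for m
  proof -
    have "en m (\<lambda>x. u (F j x)) (\<lambda>x. u (F j x)) \<le> (\<Sum>j\<in>I3. en m (\<lambda>x. u (F j x)) (\<lambda>x. u (F j x)))"
      using assms(2) en_nonneg by (intro member_le_sum) auto
    then show ?thesis using C[of "Suc m"] by simp
  qed
  then show ?thesis
    using continuous_on_comp_F[OF Fdom_continuous[OF assms(1)] assms(2)] unfolding Fdom_iff by blast
qed

lemma Fdom_glued: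
  assumes "\<And>j. j \<in> I3 \<Longrightarrow> (\<lambda>x. u (F j x)) \<in> Fdom"
  shows "u \<in> Fdom"
proof -
  have "\<forall>j. \<exists>C. j \<in> I3 \<longrightarrow> (\<forall>m. en m (\<lambda>x. u (F j x)) (\<lambda>x. u (F j x)) \<le> C)"
    using assms by (auto simp: Fdom_iff)
  then obtain C where C: "\<And>j m. j \<in> I3 \<Longrightarrow> en m (\<lambda>x. u (F j x)) (\<lambda>x. u (F j x)) \<le> C j" by metis
  have "en (Suc m) u u \<le> 5 / 3 * (\<Sum>j\<in>I3. C j)" for m
    unfolding en.simps(2) using C by (intro mult_left_mono sum_mono) auto
  then have "en m u u \<le> 5 / 3 * (\<Sum>j\<in>I3. C j)" for m
    by (rule order_trans[OF en_le_Suc])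
  moreover have "continuous_on X u"
    by (rule continuous_on_glued) (rule Fdom_continuous[OF assms])
  ultimately show ?thesis unfolding Fdom_iff by blast
qed

lemma energy_self_similar:
  assumes "u \<in> Fdom" "v \<in> Fdom"
  shows "energy a u v = 5 / 3 * (\<Sum>j\<in>I3. energy a (\<lambda>x. u (F j x)) (\<lambda>x. v (F j x)))"
proof (rule energy_eqI[OF assms])
  have "(\<lambda>m. en (Suc m) u v) \<longlonglongrightarrow> 5 / 3 * (\<Sum>j\<in>I3. energy a (\<lambda>x. u (F j x)) (\<lambda>x. v (F j x)))"
    unfolding en.simps(2) by (intro tendsto_intros en_tendsto_energy Fdom_comp_F assms)
  then show "(\<lambda>m. en m u v) \<longlonglongrightarrow> 5 / 3 * (\<Sum>j\<in>I3. energy a (\<lambda>x. u (F j x)) (\<lambda>x. v (F j x)))"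
    by (rule LIMSEQ_imp_Suc)
qed

text \<open>Since \<open>3 / 5 \<le> (4 / 5)\<^sup>2\<close>, the restriction to a cell scales the root of the energy by at most \<open>4 / 5\<close>.\<close>

lemma en_comp_F_le:
  assumes "\<And>m. en m u u \<le> C\<^sup>2" "j \<in> I3"
  shows "en m (\<lambda>x. u (F j x)) (\<lambda>x. u (F j x)) \<le> (4 / 5 * C)\<^sup>2"
proof -
  have "en m (\<lambda>x. u (F j x)) (\<lambda>x. u (F j x)) \<le> (\<Sum>j\<in>I3. en m (\<lambda>x. u (F j x)) (\<lambda>x. u (F j x)))"
    using assms(2) en_nonneg by (intro member_le_sum) auto
  also have "\<dots> \<le> 3 / 5 * C\<^sup>2" using assms(1)[of "Suc m"] by simp
  also have "\<dots> \<le> (4 / 5 * C)\<^sup>2" by (simp add: power2_eq_square)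
  finally show ?thesis .
qed

lemma vertex_oscillation:
  assumes "en 0 u u \<le> C\<^sup>2" "0 \<le> C" "i \<in> I3" "k \<in> I3"
  shows "\<bar>u (a i) - u (a k)\<bar> \<le> C"
proof -
  have *: "(u (a 1) - u (a 2))\<^sup>2 + (u (a 1) - u (a 3))\<^sup>2 + (u (a 2) - u (a 3))\<^sup>2 \<le> C\<^sup>2"
    using assms(1) unfolding en_0 by (simp add: power2_eq_square)
  have "(u (a i) - u (a k))\<^sup>2 \<le> (u (a 1) - u (a 2))\<^sup>2 + (u (a 1) - u (a 3))\<^sup>2 + (u (a 2) - u (a 3))\<^sup>2"
    using assms(3,4) unfolding I3_cases by (auto simp: power2_commute)
  with * have "(u (a i) - u (a k))\<^sup>2 \<le> C\<^sup>2" by linarith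
  then show ?thesis using assms(2) by (simp add: abs_le_square_iff[symmetric])
qed

text \<open>The constant 5 is the sum of the geometric series with ratio 4 / 5, in the form
  \<open>C + 5 * (4 / 5 * C) = 5 * C\<close>.\<close>

lemma oscillation_words:
  assumes "\<And>m. en m u u \<le> C\<^sup>2" "0 \<le> C" "w \<in> words" "i \<in> I3" "k \<in> I3"
  shows "\<bar>u (F_word a w (a i)) - u (a k)\<bar> \<le> 5 * C"
  using assms(1-3,5)
proof (induction w arbitrary: u C k)
  case Nil
  then show ?case using vertex_oscillation[OF Nil.prems(1,2) assms(4) Nil.prems(4)] by simp
next
  case (Cons j w)
  have j: "j \<in> I3" "w \<in> words" using Cons.prems(3) by (auto simp: words_def)
  have "\<bar>u (F j (F_word a w (a i))) - u (F j (a j))\<bar> \<le> 5 * (4 / 5 * C)"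
    using Cons.prems(2) by (intro Cons.IH[of "\<lambda>x. u (F j x)"] en_comp_F_le[OF Cons.prems(1)] j) auto
  moreover have "\<bar>u (a j) - u (a k)\<bar> \<le> C"
    by (rule vertex_oscillation[OF Cons.prems(1,2) j(1) Cons.prems(4)])
  ultimately show ?case by (simp add: F_map_fixed)
qed

lemma oscillation_vertex:
  assumes "continuous_on X u" "\<And>m. en m u u \<le> C\<^sup>2" "0 \<le> C" "x \<in> X" "k \<in> I3"
  shows "\<bar>u x - u (a k)\<bar> \<le> 5 * C"
proof (rule field_le_epsilon)
  fix \<epsilon> :: real assume "\<epsilon> > 0"
  then obtain N where N: "\<And>m w x y. m \<ge> N \<Longrightarrow> w \<in> word_set m \<Longrightarrow> x \<in> X \<Longrightarrow> y \<in> X \<Longrightarrow>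
      \<bar>u (F_word a w x) - u (F_word a w y)\<bar> < \<epsilon>"
    using oscillation_small[OF assms(1)] by blast
  obtain w y where w: "w \<in> word_set N" "y \<in> X" "x = F_word a w y" using cell_of[OF assms(4)] .
  have "\<bar>u x - u (F_word a w (a 1))\<bar> < \<epsilon>"
    unfolding w(3) using N[OF order_refl w(1,2) vertex_in_X[of 1]] by simp
  moreover have "\<bar>u (F_word a w (a 1)) - u (a k)\<bar> \<le> 5 * C"
    using w(1) by (intro oscillation_words assms) (auto simp: word_set_def)
  ultimately show "\<bar>u x - u (a k)\<bar> \<le> 5 * C + \<epsilon>" by linarith
qed

text \<open>A uniform bound that makes families of bounded energy equicontinuous; 10 is twice the
  constant 5 of \<open>oscillation_vertex\<close>, applied inside the cell.\<close>

lemma cell_oscillation: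
  assumes "continuous_on X u" "\<And>m. en m u u \<le> C\<^sup>2" "0 \<le> C" "w \<in> words" "x \<in> X" "y \<in> X"
  shows "\<bar>u (F_word a w x) - u (F_word a w y)\<bar> \<le> 10 * (4 / 5) ^ length w * C"
  using assms(1-4)
proof (induction w arbitrary: u C)
  case Nil
  then show ?case
    using oscillation_vertex[OF Nil.prems(1,2,3) assms(5), of 1] oscillation_vertex[OF Nil.prems(1,2,3) assms(6), of 1]
    by simp
next
  case (Cons j w)
  have j: "j \<in> I3" "w \<in> words" using Cons.prems(4) by (auto simp: words_def)
  have "\<bar>u (F j (F_word a w x)) - u (F j (F_word a w y))\<bar> \<le> 10 * (4 / 5) ^ length w * (4 / 5 * C)"
    using Cons.prems(3) j
    by (intro Cons.IH[of "\<lambda>x. u (F j x)"] en_comp_F_le[OF Cons.prems(2)] continuous_on_comp_F Cons.prems(1)) auto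
  then show ?case by (simp add: mult_ac)
qed

section \<open>Functions defined by extension of vertex values\<close>

text \<open>The value at the midpoint of the edge with end values \<open>x\<close>, \<open>y\<close> and opposite value \<open>z\<close> which the
  eigenvalue equation of the refined graph with eigenvalue \<open>l\<close> dictates.\<close>

definition mid :: "real \<Rightarrow> real \<Rightarrow> real \<Rightarrow> real \<Rightarrow> real" where
  "mid l x y z = ((4 - l) * (x + y) + 2 * z) / ((2 - l) * (5 - l))"

text \<open>\<open>6 - i - j\<close> is the element of \<open>{1, 2, 3}\<close> different from \<open>i\<close> and \<open>j\<close>.\<close>

definition step :: "real \<Rightarrow> nat \<Rightarrow> (nat \<Rightarrow> real) \<Rightarrow> nat \<Rightarrow> real" where
  "step l j q i = (if i = j then q j else mid l (q i) (q j) (q (6 - i - j)))"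

lemma step_swap: "step l i q k = step l k q i"
  by (simp add: step_def mid_def add.commute diff_commute)

text \<open>\<open>L 1\<close> extends the three vertex values to the midpoints and the shifted
  sequence continues inside the cells; after \<open>m\<close> levels the values are interpolated
  affinely. \<open>L 0\<close> is the graph eigenvalue on the starting triangle and enters later
  through \<open>defect\<close>.\<close>

fun approx_ext :: "nat \<Rightarrow> (nat \<Rightarrow> real) \<Rightarrow> (nat \<Rightarrow> real) \<Rightarrow> real^2 \<Rightarrow> real" where
  "approx_ext 0 L q = (\<lambda>x. \<Sum>i\<in>I3. q i * bary a i x)"
| "approx_ext (Suc m) L q = glue (\<lambda>j. approx_ext m (\<lambda>n. L (Suc n)) (step (L 1) j q))"

lemma approx_ext_vertex: "k \<in> I3 \<Longrightarrow> approx_ext m L q (a k) = q k"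
proof (induction m arbitrary: L q k)
  case 0
  have "approx_ext 0 L q (a k) = (\<Sum>i\<in>I3. if i = k then q i else 0)"
    unfolding approx_ext.simps using 0 by (intro sum.cong refl) (auto simp: bary_vertex)
  then show ?case using 0 by simp
next
  case (Suc m)
  have "approx_ext (Suc m) L q (F k (a k)) = approx_ext m (\<lambda>n. L (Suc n)) (step (L 1) k q) (a k)"
    unfolding approx_ext.simps
    by (rule glue_F) (use Suc vertex_in_X step_swap in auto)
  then show ?case using Suc by (simp add: F_map_fixed step_def)
qed

lemma approx_ext_F:
  assumes "j \<in> I3" "x \<in> X"
  shows "approx_ext (Suc m) L q (F j x) = approx_ext m (\<lambda>n. L (Suc n)) (step (L 1) j q) x"
  unfolding approx_ext.simps
  by (rule glue_F) (use assms step_swap in \<open>auto simp: approx_ext_vertex\<close>)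

lemma continuous_approx_ext: "continuous_on X (approx_ext m L q)"
proof (induction m arbitrary: L q)
  case 0
  show ?case by (simp, intro continuous_intros continuous_on_bary)
next
  case (Suc m)
  show ?case
  proof (rule continuous_on_glued)
    fix j assume "j \<in> I3"
    then show "continuous_on X (\<lambda>x. approx_ext (Suc m) L q (F j x))"
      using Suc.IH[of "\<lambda>n. L (Suc n)" "step (L 1) j q"]
      by (subst continuous_on_cong[OF refl approx_ext_F]) auto
  qed
qed

text \<open>The extension with the parameters \<open>L\<close> deviates from harmonic extension by a summable amount.\<close>

definition mild :: "(nat \<Rightarrow> real) \<Rightarrow> real \<Rightarrow> bool" where
  "mild L e \<longleftrightarrow> 0 \<le> e \<and> (\<forall>k\<ge>1. \<forall>x y z B. \<bar>x\<bar> \<le> B \<longrightarrow> \<bar>y\<bar> \<le> B \<longrightarrow> \<bar>z\<bar> \<le> B \<longrightarrow>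
     \<bar>mid (L k) x y z - (2 * x + 2 * y + z) / 5\<bar> \<le> e / 5 ^ k * B)"

lemma mild_shift: "mild L e \<Longrightarrow> mild (\<lambda>n. L (Suc n)) (e / 5)"
  unfolding mild_def
proof (intro conjI allI impI; elim conjE)
  fix k :: nat and x y z B :: real
  assume "\<forall>k\<ge>1. \<forall>x y z B. \<bar>x\<bar> \<le> B \<longrightarrow> \<bar>y\<bar> \<le> B \<longrightarrow> \<bar>z\<bar> \<le> B \<longrightarrow>
     \<bar>mid (L k) x y z - (2 * x + 2 * y + z) / 5\<bar> \<le> e / 5 ^ k * B"
    and "\<bar>x\<bar> \<le> B" "\<bar>y\<bar> \<le> B" "\<bar>z\<bar> \<le> B"
  then have "\<bar>mid (L (Suc k)) x y z - (2 * x + 2 * y + z) / 5\<bar> \<le> e / 5 ^ Suc k * B"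
    by (metis le_add1 plus_1_eq_Suc)
  then show "\<bar>mid (L (Suc k)) x y z - (2 * x + 2 * y + z) / 5\<bar> \<le> e / 5 / 5 ^ k * B" by simp
qed simp

text \<open>Under the harmonic rule the oscillation over the corners shrinks by 3 / 5; each midpoint
  carries an extra error \<open>e / 5 * B\<close>, so two of them enter a difference. The third
  estimate compares the new values with affine interpolation.\<close>

lemma mild_step:
  assumes L: "mild L e" and B: "\<And>i. i \<in> I3 \<Longrightarrow> \<bar>q i\<bar> \<le> B"
    and \<omega>: "\<And>i k. i \<in> I3 \<Longrightarrow> k \<in> I3 \<Longrightarrow> \<bar>q i - q k\<bar> \<le> \<omega>"
    and j: "j \<in> I3"
  shows "i \<in> I3 \<Longrightarrow> \<bar>step (L 1) j q i\<bar> \<le> (1 + e / 5) * B"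
    and "i \<in> I3 \<Longrightarrow> k \<in> I3 \<Longrightarrow> \<bar>step (L 1) j q i - step (L 1) j q k\<bar> \<le> 3 / 5 * \<omega> + 2 * e / 5 * B"
    and "i \<in> I3 \<Longrightarrow> \<bar>step (L 1) j q i - (q i + q j) / 2\<bar> \<le> \<omega> + e / 5 * B"
proof -
  have I: "1 \<in> I3" "2 \<in> I3" "3 \<in> I3" by auto
  have e: "e \<ge> 0" using L by (simp add: mild_def)
  have B0: "B \<ge> 0" using B[OF I(1)] by linarith
  have eB: "e / 5 * B \<ge> 0" using e B0 by simp
  have \<omega>0: "\<omega> \<ge> 0" using \<omega>[OF I(1,1)] by simp
  note B' = I[THEN B] and \<omega>' = \<omega>[OF I(1,2)] \<omega>[OF I(1,3)] \<omega>[OF I(2,3)]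
  have L1: "\<bar>mid (L 1) x y z - (2 * x + 2 * y + z) / 5\<bar> \<le> e / 5 * B" if "\<bar>x\<bar> \<le> B" "\<bar>y\<bar> \<le> B" "\<bar>z\<bar> \<le> B" for x y z
    using L that unfolding mild_def by (metis power_one_right order_refl)
  have m: "\<bar>mid (L 1) (q i) (q j) (q k) - (2 * q i + 2 * q j + q k) / 5\<bar> \<le> e / 5 * B"
    if "i \<in> I3" "k \<in> I3" for i k
    using that j by (intro L1 B)
  have third: "6 - i - j \<in> I3" if "i \<in> I3" "i \<noteq> j" for i
    using that j unfolding I3_cases by auto
  have s: "step (L 1) j q j = q j" by (simp add: step_def)
  have h: "\<exists>k\<in>I3. step (L 1) j q i = mid (L 1) (q i) (q j) (q k) \<and> k = 6 - i - j" if "i \<in> I3" "i \<noteq> j" for i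
    using that third by (auto simp: step_def)
  define d where "d i = step (L 1) j q i - (2 * q i + 2 * q j + q (6 - i - j)) / 5" for i
  have d: "\<bar>d i\<bar> \<le> e / 5 * B" if "i \<in> I3" "i \<noteq> j" for i
    using m[OF that(1) third[OF that]] that by (simp add: d_def step_def)
  have st: "step (L 1) j q i = d i + (2 * q i + 2 * q j + q (6 - i - j)) / 5" for i
    by (simp add: d_def)
  show "\<bar>step (L 1) j q i\<bar> \<le> (1 + e / 5) * B" if i: "i \<in> I3"
  proof (cases "i = j")
    case True
    then show ?thesis using B[OF j] eB by (simp add: s distrib_right)
  next
    case False
    have "\<bar>(2 * q i + 2 * q j + q (6 - i - j)) / 5\<bar> \<le> B"
      using B[OF i] B[OF j] B[OF third[OF i False]] unfolding abs_le_iff by (auto simp: field_simps)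
    then show ?thesis unfolding st distrib_right using d[OF i False] by linarith
  qed
  have key: "\<bar>step (L 1) j q i - q j\<bar> \<le> 3 / 5 * \<omega> + e / 5 * B" if i: "i \<in> I3" for i
  proof (cases "i = j")
    case True
    then show ?thesis using eB \<omega>0 by (simp add: s)
  next
    case False
    have "\<bar>(2 * q i + 2 * q j + q (6 - i - j)) / 5 - q j\<bar> \<le> 3 / 5 * \<omega>"
      using \<omega>[OF i j] \<omega>[OF third[OF i False] j] unfolding abs_le_iff by (auto simp: field_simps)
    then show ?thesis unfolding st using d[OF i False] by linarith
  qed
  show "\<bar>step (L 1) j q i - step (L 1) j q k\<bar> \<le> 3 / 5 * \<omega> + 2 * e / 5 * B" if i: "i \<in> I3" and k: "k \<in> I3"
  proof (cases "i = j \<or> k = j")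
    case True
    then show ?thesis using key[OF i] key[OF k] eB by (auto simp: s)
  next
    case False
    then have ij: "i \<noteq> j" and kj: "k \<noteq> j" by auto
    show ?thesis
    proof (cases "i = k")
      case True
      then show ?thesis using eB \<omega>0 by simp
    next
      case ik: False
      \<comment> \<open>The two midpoints use each other's vertex as the opposite one, so their
        harmonic values differ by only \<open>(q i - q k) / 5\<close>.\<close>
      then have third_eq: "6 - i - j = k" "6 - k - j = i" using i k j ij kj unfolding I3_cases by auto
      have "\<bar>(2 * q i + 2 * q j + q k) / 5 - (2 * q k + 2 * q j + q i) / 5\<bar> \<le> 3 / 5 * \<omega>"
        using \<omega>[OF i k] \<omega>0 unfolding abs_le_iff by (auto simp: field_simps)
      then show ?thesis
        using d[OF i ij] d[OF k kj] unfolding st third_eq by (simp add: field_simps)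
    qed
  qed
  show "\<bar>step (L 1) j q i - (q i + q j) / 2\<bar> \<le> \<omega> + e / 5 * B" if i: "i \<in> I3"
  proof (cases "i = j")
    case True
    then show ?thesis using \<omega>0 eB by (simp add: s)
  next
    case False
    have "\<bar>(2 * q i + 2 * q j + q (6 - i - j)) / 5 - (q i + q j) / 2\<bar> \<le> \<omega>"
      using \<omega>[OF third[OF i False] i] \<omega>[OF third[OF i False] j] \<omega>0
      unfolding abs_le_iff by (auto simp: field_simps)
    then show ?thesis unfolding st using d[OF i False] by linarith
  qed
qed

lemma bary_average_le:
  assumes "x \<in> X" "\<And>i. i \<in> I3 \<Longrightarrow> \<bar>r i\<bar> \<le> C"
  shows "\<bar>\<Sum>i\<in>I3. r i * bary a i x\<bar> \<le> C"
proof -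
  have "\<bar>\<Sum>i\<in>I3. r i * bary a i x\<bar> \<le> (\<Sum>i\<in>I3. \<bar>r i * bary a i x\<bar>)" by (rule sum_abs)
  also have "\<dots> \<le> (\<Sum>i\<in>I3. C * bary a i x)"
    using assms bary_nonneg by (intro sum_mono) (auto simp: abs_mult intro!: mult_right_mono)
  also have "\<dots> = C * (bary a 1 x + bary a 2 x + bary a 3 x)"
    by (simp add: sum_1_3 distrib_left)
  finally show ?thesis by (simp add: sum_bary)
qed

text \<open>The quantity \<open>\<omega> + e exp(e) B\<close> contracts by \<open>4 / 5\<close> when passing to a subcell.\<close>

lemma approx_ext_diff:
  assumes "mild L e" "\<And>i. i \<in> I3 \<Longrightarrow> \<bar>q i\<bar> \<le> B"
    "\<And>i k. i \<in> I3 \<Longrightarrow> k \<in> I3 \<Longrightarrow> \<bar>q i - q k\<bar> \<le> \<omega>" "x \<in> X"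
  shows "\<bar>approx_ext (Suc m) L q x - approx_ext m L q x\<bar> \<le> (4 / 5) ^ m * (\<omega> + e * exp e * B)"
  using assms
proof (induction m arbitrary: L e q B \<omega> x)
  case 0
  obtain j y where y: "j \<in> I3" "y \<in> X" "x = F j y" using X_cases[OF 0(4)] .
  have e: "e \<ge> 0" using 0(1) by (simp add: mild_def)
  have B0: "B \<ge> 0" using 0(2)[of 1] by simp
  have "approx_ext (Suc 0) L q x - approx_ext 0 L q x
      = (\<Sum>i\<in>I3. (step (L 1) j q i - (q i + q j) / 2) * bary a i y)"
  proof -
    have "approx_ext 0 L q x = (\<Sum>i\<in>I3. q i * bary a i y / 2) + (\<Sum>i\<in>I3. if i = j then q i / 2 else 0)"
      unfolding approx_ext.simps y(3) sum.distrib[symmetric] using y(1)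
      by (intro sum.cong refl) (auto simp: bary_F field_simps)
    \<comment> \<open>Barycentric coordinates have sum 1, so the constant \<open>q j / 2\<close> can
      be distributed over the three corners.\<close>
    also have "\<dots> = (\<Sum>i\<in>I3. q i * bary a i y / 2) + q j / 2 * (bary a 1 y + bary a 2 y + bary a 3 y)"
      using y(1) by (simp add: sum_bary)
    also have "\<dots> = (\<Sum>i\<in>I3. (q i + q j) / 2 * bary a i y)"
      by (simp add: sum_1_3 field_simps)
    finally have "approx_ext 0 L q x = \<dots>" .
    moreover have "approx_ext (Suc 0) L q x = (\<Sum>i\<in>I3. step (L 1) j q i * bary a i y)"
      unfolding y(3) approx_ext_F[OF y(1,2)] by simp
    ultimately show ?thesis by (simp add: left_diff_distrib sum_subtractf)
  qed
  also have "\<bar>\<dots>\<bar> \<le> \<omega> + e / 5 * B"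
    by (rule bary_average_le[OF y(2)]) (rule mild_step(3)[OF 0(1-3) y(1)])
  also have "\<dots> \<le> \<omega> + e * exp e * B"
  proof -
    have "e / 5 \<le> e * exp e" using e one_le_exp_iff[of e] mult_left_mono[of 1 "exp e" e] by linarith
    from mult_right_mono[OF this B0] show ?thesis by simp
  qed
  finally show ?case by simp
next
  case (Suc m)
  obtain j y where y: "j \<in> I3" "y \<in> X" "x = F j y" using X_cases[OF Suc.prems(4)] .
  have e: "e \<ge> 0" using Suc.prems(1) by (simp add: mild_def)
  have B0: "B \<ge> 0" using Suc.prems(2)[of 1] by simp
  have \<omega>0: "\<omega> \<ge> 0" using Suc.prems(3)[of 1 1] by simp
  have "\<bar>approx_ext (Suc (Suc m)) L q x - approx_ext (Suc m) L q x\<bar>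
      \<le> (4 / 5) ^ m * ((3 / 5 * \<omega> + 2 * e / 5 * B) + e / 5 * exp (e / 5) * ((1 + e / 5) * B))"
    unfolding y(3) approx_ext_F[OF y(1,2)]
    by (intro Suc.IH mild_shift Suc.prems(1) y(2) mild_step(1,2)[OF Suc.prems(1-3) y(1)]; assumption)
  also have "\<dots> \<le> (4 / 5) ^ m * (4 / 5 * (\<omega> + e * exp e * B))"
  proof (intro mult_left_mono)
    \<comment> \<open>By \<open>1 + x \<le> exp x\<close>: the new sup bound is larger by the factor
      \<open>1 + e / 5\<close>, and since the parameter drops from \<open>e\<close> to
      \<open>e / 5\<close>, the factor \<open>exp e\<close> absorbs this growth at all
      levels.\<close>
    have "exp (e / 5) * (1 + e / 5) \<le> exp (e / 5) * exp (e / 5)"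
      using exp_ge_add_one_self[of "e / 5"] by (intro mult_left_mono) auto
    also have "\<dots> \<le> exp e" using e by (simp flip: exp_add)
    finally have "e / 5 * B * (exp (e / 5) * (1 + e / 5)) \<le> e / 5 * B * exp e"
      using e B0 by (intro mult_left_mono) auto
    moreover have "2 * e / 5 * B * 1 \<le> 2 * e / 5 * B * exp e"
      using e B0 by (intro mult_left_mono) auto
    moreover have "0 \<le> e * B * exp e" using e B0 by simp
    ultimately show "(3 / 5 * \<omega> + 2 * e / 5 * B) + e / 5 * exp (e / 5) * ((1 + e / 5) * B)
        \<le> 4 / 5 * (\<omega> + e * exp e * B)"
      using \<omega>0 by (simp add: algebra_simps add_divide_distrib)
  qed simp
  finally show ?case by (simp only: power_Suc mult_ac)
qed

section \<open>Convergence of the extension algorithm\<close>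

definition ext :: "(nat \<Rightarrow> real) \<Rightarrow> (nat \<Rightarrow> real) \<Rightarrow> real^2 \<Rightarrow> real" where
  "ext L q x = lim (\<lambda>m. approx_ext m L q x)"

lemma vertex_value_bounds:
  fixes q :: "nat \<Rightarrow> real"
  obtains B \<omega> where "\<And>i. i \<in> I3 \<Longrightarrow> \<bar>q i\<bar> \<le> B" "\<And>i k. i \<in> I3 \<Longrightarrow> k \<in> I3 \<Longrightarrow> \<bar>q i - q k\<bar> \<le> \<omega>"
proof
  show *: "\<bar>q i\<bar> \<le> \<bar>q 1\<bar> + \<bar>q 2\<bar> + \<bar>q 3\<bar>" if "i \<in> I3" for i using that unfolding I3_cases by auto
  show "\<bar>q i - q k\<bar> \<le> 2 * (\<bar>q 1\<bar> + \<bar>q 2\<bar> + \<bar>q 3\<bar>)" if "i \<in> I3" "k \<in> I3" for i k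
    using order_trans[OF abs_triangle_ineq4 add_mono[OF *[OF that(1)] *[OF that(2)]]] by (simp only: mult_2)
qed

lemma uniform_limit_ext:
  assumes "mild L e"
  shows "uniform_limit X (\<lambda>m. approx_ext m L q) (ext L q) sequentially"
proof -
  obtain B \<omega> where B: "\<And>i. i \<in> I3 \<Longrightarrow> \<bar>q i\<bar> \<le> B" "\<And>i k. i \<in> I3 \<Longrightarrow> k \<in> I3 \<Longrightarrow> \<bar>q i - q k\<bar> \<le> \<omega>"
    using vertex_value_bounds[of q] by blast
  let ?d = "\<lambda>m x. approx_ext (Suc m) L q x - approx_ext m L q x"
  let ?M = "\<lambda>m. (4 / 5) ^ m * (\<omega> + e * exp e * B)"
  have "uniform_limit X (\<lambda>n x. \<Sum>m<n. ?d m x) (\<lambda>x. \<Sum>m. ?d m x) sequentially"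
  proof (rule Weierstrass_m_test)
    show "norm (?d m x) \<le> ?M m" if "x \<in> X" for m x
      using approx_ext_diff[OF assms B that] by simp
    show "summable ?M" by (intro summable_mult2 summable_geometric) simp
  qed
  then have "uniform_limit X (\<lambda>n x. approx_ext 0 L q x + (\<Sum>m<n. ?d m x))
      (\<lambda>x. approx_ext 0 L q x + (\<Sum>m. ?d m x)) sequentially"
    by (intro uniform_limit_add uniform_limit_const)
  then have ul: "uniform_limit X (\<lambda>n. approx_ext n L q) (\<lambda>x. approx_ext 0 L q x + (\<Sum>m. ?d m x)) sequentially"
  proof -
    have "approx_ext 0 L q x + (\<Sum>m<n. ?d m x) = approx_ext n L q x" for n x
      using sum_lessThan_telescope[of "\<lambda>m. approx_ext m L q x" n] by linarith
    with \<open>uniform_limit X (\<lambda>n x. approx_ext 0 L q x + (\<Sum>m<n. ?d m x)) _ sequentially\<close>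
    show ?thesis by (simp only:)
  qed
  then have "ext L q x = approx_ext 0 L q x + (\<Sum>m. ?d m x)" if "x \<in> X" for x
    unfolding ext_def using tendsto_uniform_limitI[OF ul that] by (intro limI)
  then show ?thesis using ul by (subst uniform_limit_cong'[where g = "\<lambda>n. approx_ext n L q"]) auto
qed

lemma approx_ext_tendsto: "mild L e \<Longrightarrow> x \<in> X \<Longrightarrow> (\<lambda>m. approx_ext m L q x) \<longlonglongrightarrow> ext L q x"
  by (rule tendsto_uniform_limitI[OF uniform_limit_ext])

lemma continuous_ext: "mild L e \<Longrightarrow> continuous_on X (ext L q)"
  by (rule uniform_limit_theorem[OF _ uniform_limit_ext]) (auto simp: continuous_approx_ext)

lemma ext_vertex: "k \<in> I3 \<Longrightarrow> ext L q (a k) = q k"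
  unfolding ext_def by (rule limI) (simp add: approx_ext_vertex del: approx_ext.simps)

lemma ext_F:
  assumes "mild L e" "j \<in> I3" "x \<in> X"
  shows "ext L q (F j x) = ext (\<lambda>n. L (Suc n)) (step (L 1) j q) x"
proof (rule LIMSEQ_unique)
  show "(\<lambda>m. approx_ext (Suc m) L q (F j x)) \<longlonglongrightarrow> ext L q (F j x)"
    using approx_ext_tendsto[OF assms(1) F_in_X[OF assms(2,3)]] by (rule LIMSEQ_Suc)
  show "(\<lambda>m. approx_ext (Suc m) L q (F j x)) \<longlonglongrightarrow> ext (\<lambda>n. L (Suc n)) (step (L 1) j q) x"
    unfolding approx_ext_F[OF assms(2,3)] by (rule approx_ext_tendsto[OF mild_shift[OF assms(1)] assms(3)])
qed

definition decimates :: "(nat \<Rightarrow> real) \<Rightarrow> bool" where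
  "decimates L \<longleftrightarrow> (\<forall>k\<ge>1. L k * (5 - L k) = L (k - 1) \<and> L k \<noteq> 2 \<and> L k \<noteq> 5)"

lemma decimates_shift: "decimates L \<Longrightarrow> decimates (\<lambda>n. L (Suc n))"
  unfolding decimates_def by (metis diff_Suc_1 diff_add_inverse le_add1 le_add_diff_inverse plus_1_eq_Suc Suc_le_mono le_SucI)

text \<open>\<open>(2 - l / 2) q\<^sub>i\<close> minus the other two values. A vertex off the boundary belongs to two cells, and the
  graph equation with eigenvalue \<open>l\<close> says that the two defects there add up to \<open>0\<close>.\<close>

definition defect :: "real \<Rightarrow> (nat \<Rightarrow> real) \<Rightarrow> nat \<Rightarrow> real" where
  "defect l q i = (3 - l / 2) * q i - (q 1 + q 2 + q 3)"

text \<open>Algebraic core of spectral decimation. At an old vertex the refined defect is a multiple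
  of the coarse defect for \<open>l * (5 - l)\<close>; at a new vertex the defects from its two
  cells cancel, which is the equation that \<open>mid\<close> solves.\<close>

lemma mid_identities:
  assumes "l \<noteq> 2" "l \<noteq> 5"
  shows "(3 - l / 2) * x - (x + mid l x y z + mid l x z y)
      = (6 - l) / ((2 - l) * (5 - l)) * ((3 - l * (5 - l) / 2) * x - (x + y + z))"
    and "(3 - l / 2) * mid l x y z - (x + mid l x y z + mid l x z y)
      + ((3 - l / 2) * mid l x y z - (y + mid l x y z + mid l y z x)) = 0"
proof -
  define D where "D = (2 - l) * (5 - l)"
  have D: "D \<noteq> 0" using assms by (simp add: D_def)
  \<comment> \<open>All midpoint values have the denominator \<open>D\<close>; in terms of the
    numerators both claims are polynomial identities.\<close>
  define R N1 N2 N3 where "R = (3 - l * (5 - l) / 2) * x - (x + y + z)" and "N1 = (4 - l) * (x + y) + 2 * z"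
    and "N2 = (4 - l) * (x + z) + 2 * y" and "N3 = (4 - l) * (y + z) + 2 * x"
  have m: "mid l x y z = N1 / D" "mid l x z y = N2 / D" "mid l y z x = N3 / D"
    by (simp_all add: mid_def D_def N1_def N2_def N3_def)
  have "(2 - l / 2) * x * D = N1 + N2 + (6 - l) * R"
    by (simp add: D_def N1_def N2_def R_def field_simps)
  then have "(2 - l / 2) * x = (N1 + N2 + (6 - l) * R) / D" using D by (simp add: eq_divide_eq)
  moreover have "(3 - l / 2) * x = x + (2 - l / 2) * x" by (simp add: algebra_simps)
  ultimately show "(3 - l / 2) * x - (x + mid l x y z + mid l x z y)
      = (6 - l) / ((2 - l) * (5 - l)) * ((3 - l * (5 - l) / 2) * x - (x + y + z))"
    unfolding m D_def[symmetric] R_def[symmetric] by (simp add: add_divide_distrib)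
  have "(x + y) * D = (4 - l) * N1 - N2 - N3"
    by (simp add: D_def N1_def N2_def N3_def field_simps)
  then have "x + y = ((4 - l) * N1 - N2 - N3) / D" using D by (simp add: eq_divide_eq)
  then have xy: "x + y = (4 - l) * (N1 / D) - N2 / D - N3 / D" by (simp add: diff_divide_distrib)
  have eq: "(3 - l / 2) * t - (x + t + r) + ((3 - l / 2) * t - (y + t + s)) = (4 - l) * t - r - s - (x + y)" for t r s
    by (simp add: algebra_simps)
  show "(3 - l / 2) * mid l x y z - (x + mid l x y z + mid l x z y)
      + ((3 - l / 2) * mid l x y z - (y + mid l x y z + mid l y z x)) = 0"
    unfolding m eq xy by simp
qed

lemma mid_commute: "mid l x y z = mid l y x z"
  by (simp add: mid_def add.commute)

lemma step_values:
  "step l j q j = q j"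
  "step l 1 q 2 = mid l (q 1) (q 2) (q 3)" "step l 2 q 1 = mid l (q 1) (q 2) (q 3)"
  "step l 1 q 3 = mid l (q 1) (q 3) (q 2)" "step l 3 q 1 = mid l (q 1) (q 3) (q 2)"
  "step l 2 q 3 = mid l (q 2) (q 3) (q 1)" "step l 3 q 2 = mid l (q 2) (q 3) (q 1)"
  by (simp_all add: step_def mid_commute One_nat_def[symmetric])

lemma defect_step_vertex:
  assumes "l \<noteq> 2" "l \<noteq> 5" "i \<in> I3"
  shows "defect l (step l i q) i = (6 - l) / ((2 - l) * (5 - l)) * defect (l * (5 - l)) q i"
  using assms(3) mid_identities(1)[OF assms(1,2), of "q 1" "q 2" "q 3"]
    mid_identities(1)[OF assms(1,2), of "q 2" "q 1" "q 3"] mid_identities(1)[OF assms(1,2), of "q 3" "q 1" "q 2"]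
  unfolding I3_cases
  by (elim disjE)
    (simp_all only: defect_def step_values mid_commute[of l "q 2" "q 1"] mid_commute[of l "q 3" "q 1"]
      mid_commute[of l "q 3" "q 2"] add_ac)

lemma defect_step_mid:
  assumes "l \<noteq> 2" "l \<noteq> 5"
  shows "defect l (step l 1 q) 2 + defect l (step l 2 q) 1 = 0"
    and "defect l (step l 1 q) 3 + defect l (step l 3 q) 1 = 0"
    and "defect l (step l 2 q) 3 + defect l (step l 3 q) 2 = 0"
  using mid_identities(2)[OF assms, of "q 1" "q 2" "q 3"] mid_identities(2)[OF assms, of "q 1" "q 3" "q 2"]
    mid_identities(2)[OF assms, of "q 2" "q 3" "q 1"]
  by (simp_all only: defect_def step_values mid_commute[of l "q 2" "q 1"] mid_commute[of l "q 3" "q 1"]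
      mid_commute[of l "q 3" "q 2"] add_ac)

text \<open>Accumulated factor of the boundary defects: per level, one factor from
  \<open>defect_step_vertex\<close> and one energy renormalization 5 / 3. For \<open>L = 0\<close>
  each level contributes \<open>5 / 3 * 6 / 10 = 1\<close>.\<close>

fun transfer :: "nat \<Rightarrow> (nat \<Rightarrow> real) \<Rightarrow> real" where
  "transfer 0 L = 1"
| "transfer (Suc m) L = 5 / 3 * ((6 - L 1) / ((2 - L 1) * (5 - L 1))) * transfer m (\<lambda>n. L (Suc n))"

end

context gasket_measure
begin

lemma vertex_average_cong:
  assumes "\<And>x. x \<in> X \<Longrightarrow> f x = g x"
  shows "vertex_average m f = vertex_average m g"
  using assms
proof (induction m arbitrary: f g)
  case 0
  then show ?case using vertex_in_X by (auto intro!: sum.cong)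
next
  case (Suc m)
  show ?case unfolding vertex_average.simps
    by (intro arg_cong2[where f = "(/)"] refl sum.cong Suc.IH) (use Suc.prems F_in_X in auto)
qed

text \<open>Discrete Green formula: the two defects at a midpoint multiply the same value of
  \<open>v\<close> and cancel, so only the three corners remain.\<close>

lemma sum_defect_step:
  assumes "l \<noteq> 2" "l \<noteq> 5"
  shows "(\<Sum>j\<in>I3. \<Sum>i\<in>I3. defect l (step l j q) i * v (F j (a i)))
    = (6 - l) / ((2 - l) * (5 - l)) * (\<Sum>i\<in>I3. defect (l * (5 - l)) q i * v (a i))"
proof -
  have mid: "defect l (step l 2 q) 1 = - defect l (step l 1 q) 2"
    "defect l (step l 3 q) 1 = - defect l (step l 1 q) 3"
    "defect l (step l 3 q) 2 = - defect l (step l 2 q) 3"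
    using defect_step_mid[OF assms, of q] by linarith+
  have I: "1 \<in> I3" "2 \<in> I3" "3 \<in> I3" by auto
  show ?thesis
    unfolding sum_1_3 F_map_fixed F_map_swap[of a 2 1] F_map_swap[of a 3 1] F_map_swap[of a 3 2]
      mid I[THEN defect_step_vertex[OF assms]]
    by (simp only: ring_distribs mult.assoc)
qed

text \<open>The boundary term is the discrete normal derivative; it vanishes when the initial values satisfy
  the equation at each corner of the cell, and is preserved when \<open>L = 0\<close>.\<close>

lemma en_ext:
  assumes "decimates L" "mild L e"
  shows "en m (ext L q) v = 3 / 2 * (5 ^ m * L m) * vertex_average m (\<lambda>x. ext L q x * v x)
    + transfer m L * (\<Sum>i\<in>I3. defect (L 0) q i * v (a i))"
  using assms
proof (induction m arbitrary: L e q v)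
  case 0
  have I: "1 \<in> I3" "2 \<in> I3" "3 \<in> I3" by auto
  show ?case
    unfolding en_0 vertex_average.simps sum_1_3 I[THEN ext_vertex] defect_def transfer.simps
    by (simp add: field_simps)
next
  case (Suc m)
  let ?L = "\<lambda>n. L (Suc n)"
  have L1: "L 1 \<noteq> 2" "L 1 \<noteq> 5" "L 1 * (5 - L 1) = L 0"
    using Suc.prems(1) by (auto simp: decimates_def)
  define A where "A j = vertex_average m (\<lambda>x. ext ?L (step (L 1) j q) x * v (F j x))" for j
  define S where "S j = (\<Sum>i\<in>I3. defect (L 1) (step (L 1) j q) i * v (F j (a i)))" for j
  have "en m (\<lambda>x. ext L q (F j x)) (\<lambda>x. v (F j x)) = 3 / 2 * (5 ^ m * L (Suc m)) * A j + transfer m ?L * S j"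
    if "j \<in> I3" for j
  proof -
    have "en m (\<lambda>x. ext L q (F j x)) (\<lambda>x. v (F j x)) = en m (ext ?L (step (L 1) j q)) (\<lambda>x. v (F j x))"
      by (rule en_cong) (auto simp: ext_F[OF Suc.prems(2) that])
    then show ?thesis
      using Suc.IH[OF decimates_shift[OF Suc.prems(1)] mild_shift[OF Suc.prems(2)]]
      by (simp add: A_def S_def One_nat_def)
  qed
  then have "en (Suc m) (ext L q) v = 5 / 3 * (\<Sum>j\<in>I3. 3 / 2 * (5 ^ m * L (Suc m)) * A j + transfer m ?L * S j)"
    unfolding en.simps(2) by simp
  moreover have "(\<Sum>j\<in>I3. A j) = 3 * vertex_average (Suc m) (\<lambda>x. ext L q x * v x)"
  proof -
    have "A j = vertex_average m (\<lambda>x. ext L q (F j x) * v (F j x))" if "j \<in> I3" for j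
      unfolding A_def by (rule vertex_average_cong) (simp add: ext_F[OF Suc.prems(2) that])
    then show ?thesis by simp
  qed
  moreover have "(\<Sum>j\<in>I3. S j) = (6 - L 1) / ((2 - L 1) * (5 - L 1)) * (\<Sum>i\<in>I3. defect (L 0) q i * v (a i))"
    unfolding S_def sum_defect_step[OF L1(1,2)] L1(3) ..
  ultimately show ?case
    unfolding transfer.simps sum.distrib sum_distrib_left[symmetric]
    by (simp add: distrib_left)
qed

text \<open>The eigenvalue parameter 0 turns \<open>mid\<close> into the harmonic rule
  \<open>(2 * x + 2 * y + z) / 5\<close>.\<close>

definition harmonic :: "(nat \<Rightarrow> real) \<Rightarrow> real^2 \<Rightarrow> real" where
  "harmonic = ext (\<lambda>_. 0)"

lemma mild_0: "mild (\<lambda>_. 0) 0"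
  by (simp add: mild_def mid_def)

lemma harmonic_vertex: "k \<in> I3 \<Longrightarrow> harmonic q (a k) = q k"
  by (simp add: harmonic_def ext_vertex)

text \<open>The energy against \<open>v\<close> is the same at every level and involves only
  boundary values, so membership in \<open>Fdom\<close> follows without estimates.\<close>

lemma en_harmonic: "en m (harmonic q) v = (\<Sum>i\<in>I3. defect 0 q i * v (a i))"
proof -
  have "transfer m (\<lambda>_. 0) = 1" by (induction m) auto
  then show ?thesis
    using en_ext[OF _ mild_0, of m q v] by (simp add: decimates_def harmonic_def)
qed

lemma harmonic_Fdom: "harmonic q \<in> Fdom"
  unfolding Fdom_iff en_harmonic using continuous_ext[OF mild_0] by (auto simp: harmonic_def)

text \<open>Affine interpolation deviates from \<open>q 1\<close> by at most
  \<open>\<omega>\<close>, and the corrections of all levels sum to at most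
  \<open>5 * \<omega>\<close>, the error parameter \<open>e\<close> being 0 for the harmonic
  rule.\<close>

lemma harmonic_oscillation:
  assumes "\<And>i k. i \<in> I3 \<Longrightarrow> k \<in> I3 \<Longrightarrow> \<bar>q i - q k\<bar> \<le> \<omega>" "x \<in> X"
  shows "\<bar>harmonic q x - q 1\<bar> \<le> 6 * \<omega>"
proof -
  obtain B \<omega>' where B: "\<And>i. i \<in> I3 \<Longrightarrow> \<bar>q i\<bar> \<le> B"
    "\<And>i k. i \<in> I3 \<Longrightarrow> k \<in> I3 \<Longrightarrow> \<bar>q i - q k\<bar> \<le> \<omega>'"
    using vertex_value_bounds[of q] by blast
  let ?f = "\<lambda>m. approx_ext m (\<lambda>_. 0) q x"
  have \<omega>: "\<omega> \<ge> 0" using assms(1)[of 1 1] by simp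
  have 1: "\<bar>?f m - ?f 0\<bar> \<le> 5 * \<omega>" for m
  proof -
    have "?f m - ?f 0 = (\<Sum>k<m. ?f (Suc k) - ?f k)" by (rule sum_lessThan_telescope[symmetric])
    also have "\<bar>\<dots>\<bar> \<le> (\<Sum>k<m. \<bar>?f (Suc k) - ?f k\<bar>)" by (rule sum_abs)
    also have "\<dots> \<le> (\<Sum>k<m. (4 / 5) ^ k * \<omega>)"
      using approx_ext_diff[OF mild_0 B(1) assms] by (intro sum_mono) simp
    also have "\<dots> = 5 * (1 - (4 / 5) ^ m) * \<omega>"
      using sum_gp_strict[of "4 / 5 :: real" m] by (simp add: sum_distrib_right[symmetric])
    also have "\<dots> \<le> 5 * \<omega>"
      using mult_right_mono[of "5 * (1 - (4 / 5 :: real) ^ m)" 5 \<omega>] \<omega> by simp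
    finally show ?thesis .
  qed
  have 2: "\<bar>?f 0 - q 1\<bar> \<le> \<omega>"
  proof -
    have "?f 0 - q 1 = (\<Sum>i\<in>I3. (q i - q 1) * bary a i x)"
      using sum_bary[of x] by (simp add: sum_1_3 left_diff_distrib) algebra
    then show ?thesis
      using bary_average_le[OF assms(2), of "\<lambda>i. q i - q 1" \<omega>] assms(1) by simp
  qed
  have le: "\<bar>?f m - q 1\<bar> \<le> 6 * \<omega>" for m
    using 1[of m] 2 by linarith
  have "(\<lambda>m. \<bar>?f m - q 1\<bar>) \<longlonglongrightarrow> \<bar>harmonic q x - q 1\<bar>"
    unfolding harmonic_def by (intro tendsto_intros approx_ext_tendsto[OF mild_0 assms(2)])
  then show ?thesis by (rule LIMSEQ_le_const2) (use le in blast)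
qed

section \<open>Neumann eigenfunctions\<close>

text \<open>Weak form with natural boundary condition: testing also with functions that do not
  vanish at the corners encodes vanishing normal derivatives. The boundary values of
  \<open>u\<close> are left free.\<close>

definition neumann :: "real \<Rightarrow> (real^2 \<Rightarrow> real) set" where
  "neumann \<kappa> = {u \<in> Fdom. \<forall>v\<in>Fdom. energy a u v = \<kappa> * (\<integral>x. u x * v x \<partial>\<mu>)}"

lemma neumann_cong:
  assumes "u \<in> neumann \<kappa>" "\<And>x. x \<in> X \<Longrightarrow> v x = u x"
  shows "v \<in> neumann \<kappa>"
proof -
  have "(\<integral>x. v x * w x \<partial>\<mu>) = (\<integral>x. u x * w x \<partial>\<mu>)" for w
    using assms(2) by (intro Bochner_Integration.integral_cong) auto
  then show ?thesis
    using assms Fdom_cong[of u v] energy_cong[of v u] unfolding neumann_def by auto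
qed

lemma en_zero: "en m (\<lambda>x. 0) v = 0"
  using en_linear[of m "\<lambda>x. 0" 1 "\<lambda>x. 0" v] by simp

lemma zero_Fdom: "(\<lambda>x. 0) \<in> Fdom"
  unfolding Fdom_iff en_zero by auto

lemma energy_zero: "energy a (\<lambda>x. 0) v = 0"
  by (simp add: energy_def graph_energy_eq en_zero)

lemma neumann_zero: "(\<lambda>x. 0) \<in> neumann \<kappa>"
  by (simp add: neumann_def zero_Fdom energy_zero)

text \<open>The weak equation is additive over cells, so Neumann eigenfunctions glue without any
  matching of derivatives; the factor 5 is the quotient of the energy scaling 5 / 3 and the measure
  scaling 1 / 3.\<close>

lemma neumann_glued:
  assumes "\<And>j. j \<in> I3 \<Longrightarrow> (\<lambda>x. u (F j x)) \<in> neumann \<kappa>"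
  shows "u \<in> neumann (5 * \<kappa>)"
proof -
  have u: "u \<in> Fdom" by (rule Fdom_glued) (use assms in \<open>auto simp: neumann_def\<close>)
  have "energy a u v = 5 * \<kappa> * (\<integral>x. u x * v x \<partial>\<mu>)" if v: "v \<in> Fdom" for v
  proof -
    have "energy a u v = 5 / 3 * (\<Sum>j\<in>I3. \<kappa> * (\<integral>x. u (F j x) * v (F j x) \<partial>\<mu>))"
      unfolding energy_self_similar[OF u v]
      using assms Fdom_comp_F[OF v] by (simp add: neumann_def)
    moreover have "(\<integral>x. u x * v x \<partial>\<mu>) = (\<Sum>j\<in>I3. \<integral>x. u (F j x) * v (F j x) \<partial>\<mu>) / 3"
      by (intro integral_self_similar continuous_intros Fdom_continuous u v)
    ultimately show ?thesis
      unfolding sum_distrib_left[symmetric] by (simp only: times_divide_eq_right)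
  qed
  then show ?thesis using u by (simp add: neumann_def)
qed

lemma neumann_glue:
  assumes "\<And>j. j \<in> I3 \<Longrightarrow> g j \<in> neumann \<kappa>" "\<And>i k. i \<in> I3 \<Longrightarrow> k \<in> I3 \<Longrightarrow> g i (a k) = g k (a i)"
  shows "glue g \<in> neumann (5 * \<kappa>)"
proof (rule neumann_glued)
  fix j assume j: "j \<in> I3"
  show "(\<lambda>x. glue g (F j x)) \<in> neumann \<kappa>"
  proof (rule neumann_cong[OF assms(1)[OF j]])
    show "glue g (F j x) = g j x" if "x \<in> X" for x
      by (rule glue_F) (use assms(2) j that in auto)
  qed
qed

lemma glue_vertex:
  assumes "\<And>i k. i \<in> I3 \<Longrightarrow> k \<in> I3 \<Longrightarrow> g i (a k) = g k (a i)" "j \<in> I3"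
  shows "glue g (a j) = g j (a j)"
proof -
  have "glue g (F j (a j)) = g j (a j)"
    by (rule glue_F) (use assms vertex_in_X in auto)
  then show ?thesis by (simp add: F_map_fixed)
qed

text \<open>The deviation of \<open>mid l\<close> from the harmonic rule contains a factor
  \<open>l\<close>, and convergence of \<open>5 ^ m * L m\<close> bounds \<open>L m\<close> by a
  multiple of \<open>1 / 5 ^ m\<close>.\<close>

lemma mild_if_convergent:
  assumes "decimates L" "convergent (\<lambda>m. 5 ^ m * L m)"
  obtains e where "mild L e"
proof -
  obtain C where C: "\<And>m. \<bar>5 ^ m * L m\<bar> \<le> C"
    using convergent_imp_Bseq[OF assms(2)] unfolding Bseq_def by auto
  have Lle: "\<bar>L m\<bar> \<le> C / 5 ^ m" for m
    using C[of m] by (simp add: abs_mult field_simps)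
  have C0: "C \<ge> 0" using C[of 0] by linarith
  have L0: "L \<longlonglongrightarrow> 0"
  proof (rule Lim_null_comparison)
    show "\<forall>\<^sub>F m in sequentially. norm (L m) \<le> C / 5 ^ m" using Lle by simp
    show "(\<lambda>m. C / 5 ^ m) \<longlonglongrightarrow> 0"
      using tendsto_mult_left[OF LIMSEQ_realpow_zero[of "1 / 5"], of C] by (simp add: power_divide)
  qed
  \<comment> \<open>The factor that remains after splitting off \<open>L k\<close> and the bound
    \<open>B\<close>; it converges because \<open>L\<close> tends to 0, hence is bounded over all
    \<open>k\<close>.\<close>
  define r where "r k = (2 * \<bar>9 - 2 * L k\<bar> + \<bar>7 - L k\<bar>) / (5 * \<bar>(2 - L k) * (5 - L k)\<bar>)" for k
  have "r \<longlonglongrightarrow> (2 * \<bar>9 - 2 * 0\<bar> + \<bar>7 - 0\<bar>) / (5 * \<bar>(2 - 0) * (5 - 0)\<bar>)"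
    unfolding r_def by (intro tendsto_intros L0) simp
  then have "Bseq r" by (intro convergent_imp_Bseq) (auto simp: convergent_def)
  then obtain R where R: "\<And>k. \<bar>r k\<bar> \<le> R" unfolding Bseq_def by auto
  have R0: "R \<ge> 0" using R[of 0] by linarith
  have "\<bar>mid (L k) x y z - (2 * x + 2 * y + z) / 5\<bar> \<le> C * R / 5 ^ k * B"
    if k: "k \<ge> 1" and B: "\<bar>x\<bar> \<le> B" "\<bar>y\<bar> \<le> B" "\<bar>z\<bar> \<le> B" for k x y z B
  proof -
    define l where "l = L k"
    define D where "D = (2 - l) * (5 - l)"
    have D: "D \<noteq> 0" using assms(1) k by (auto simp: decimates_def l_def D_def)
    have "mid l x y z - (2 * x + 2 * y + z) / 5 = (5 * ((4 - l) * (x + y) + 2 * z) - D * (2 * x + 2 * y + z)) / (5 * D)"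
      unfolding mid_def D_def[symmetric] using D by (simp add: field_simps)
    also have "5 * ((4 - l) * (x + y) + 2 * z) - D * (2 * x + 2 * y + z) = l * ((9 - 2 * l) * (x + y) + (7 - l) * z)"
      by (simp add: D_def algebra_simps)
    finally have "\<bar>mid l x y z - (2 * x + 2 * y + z) / 5\<bar> = \<bar>l\<bar> * \<bar>(9 - 2 * l) * (x + y) + (7 - l) * z\<bar> / (5 * \<bar>D\<bar>)"
      by (simp add: abs_mult)
    also have "\<dots> \<le> \<bar>l\<bar> * ((2 * \<bar>9 - 2 * l\<bar> + \<bar>7 - l\<bar>) * B) / (5 * \<bar>D\<bar>)"
    proof (intro divide_right_mono mult_left_mono)
      have "\<bar>(9 - 2 * l) * (x + y)\<bar> \<le> \<bar>9 - 2 * l\<bar> * (2 * B)"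
        unfolding abs_mult using B by (intro mult_left_mono) auto
      moreover have "\<bar>(7 - l) * z\<bar> \<le> \<bar>7 - l\<bar> * B"
        unfolding abs_mult using B by (intro mult_left_mono) auto
      ultimately show "\<bar>(9 - 2 * l) * (x + y) + (7 - l) * z\<bar> \<le> (2 * \<bar>9 - 2 * l\<bar> + \<bar>7 - l\<bar>) * B"
        using abs_triangle_ineq[of "(9 - 2 * l) * (x + y)" "(7 - l) * z"] by (simp add: distrib_right)
    qed auto
    also have "\<dots> = \<bar>l\<bar> * r k * B" by (simp add: r_def l_def D_def)
    also have "\<dots> \<le> (C / 5 ^ k) * R * B"
      using Lle[of k] R[of k] B(1) C0 by (intro mult_right_mono mult_mono) (auto simp: l_def r_def)
    finally show ?thesis by (simp add: l_def)
  qed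
  then have "mild L (C * R)" using C0 R0 unfolding mild_def by auto
  then show ?thesis by (rule that)
qed

text \<open>For graph eigenvalue 6 the coefficient \<open>3 - l / 2\<close> in \<open>defect\<close>
  is 0, so vertex values of sum 0 have no defect. The boundary term of \<open>en_ext\<close>
  disappears, and in the limit the weak equation holds even against functions not vanishing at the
  corners.\<close>

lemma six_extension_neumann:
  assumes L: "decimates L" "L 0 = 6" and lim: "(\<lambda>m. 3 / 2 * (5 ^ m * L m)) \<longlonglongrightarrow> \<kappa>"
    and q: "q 1 + q 2 + q 3 = 0"
  shows "ext L q \<in> neumann \<kappa>"
proof -
  have "(\<lambda>m. 2 / 3 * (3 / 2 * (5 ^ m * L m))) \<longlonglongrightarrow> 2 / 3 * \<kappa>" by (intro tendsto_intros lim)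
  then have "(\<lambda>m. 5 ^ m * L m) \<longlonglongrightarrow> 2 / 3 * \<kappa>" by (simp add: mult.commute)
  then have "convergent (\<lambda>m. 5 ^ m * L m)" by (rule convergentI)
  then obtain e where e: "mild L e" using mild_if_convergent[OF L(1)] by blast
  have cont: "continuous_on X (ext L q)" by (rule continuous_ext[OF e])
  have "defect (L 0) q i = 0" for i using L(2) q by (simp add: defect_def)
  then have en: "en m (ext L q) v = 3 / 2 * (5 ^ m * L m) * vertex_average m (\<lambda>x. ext L q x * v x)" for m v
    by (simp add: en_ext[OF L(1) e])
  have conv: "(\<lambda>m. en m (ext L q) v) \<longlonglongrightarrow> \<kappa> * (\<integral>x. ext L q x * v x \<partial>\<mu>)" if "continuous_on X v" for v
    unfolding en by (intro tendsto_mult lim vertex_average_tendsto continuous_intros cont that)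
  have u: "ext L q \<in> Fdom"
    using conv[OF cont] cont by (auto simp: energy_domain_def graph_energy_eq convergent_def)
  then show ?thesis
    using conv energy_eqI[OF u] Fdom_continuous by (auto simp: neumann_def)
qed

text \<open>The element of the eigenbasis attached to the midpoint \<open>F 1 (a 2)\<close>: on the graph of level 2 it is
  \<open>2\<close> there, \<open>-1\<close> at the four neighbours and \<open>1\<close> at the two points opposite to it.\<close>

lemma localized_eigenfunction:
  assumes L: "decimates L" "L 0 = 6" and lim: "(\<lambda>m. 3 / 2 * (5 ^ m * L m)) \<longlonglongrightarrow> \<kappa>"
  obtains h where "h \<in> neumann (25 * \<kappa>)" "\<And>k. k \<in> I3 \<Longrightarrow> h (a k) = 0" "h (F 1 (a 2)) = 2"
proof -
  define tri :: "real \<Rightarrow> real \<Rightarrow> real \<Rightarrow> nat \<Rightarrow> real"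
    where "tri x y z i = (if i = 1 then x else if i = 2 then y else z)" for x y z i
  have tri: "tri x y z 1 = x" "tri x y z 2 = y" "tri x y z 3 = z" for x y z by (auto simp: tri_def)
  define G where "G x y z = ext L (tri x y z)" for x y z
  have GN: "G x y z \<in> neumann \<kappa>" if "x + y + z = 0" for x y z
    unfolding G_def using that by (intro six_extension_neumann[OF L lim]) (simp add: tri)
  have I: "1 \<in> I3" "2 \<in> I3" "3 \<in> I3" by auto
  have Gv: "G x y z (a 1) = x" "G x y z (a 2) = y" "G x y z (a 3) = z" for x y z
    by (simp_all add: G_def I[THEN ext_vertex] tri)
  define pick :: "(real^2 \<Rightarrow> real) \<Rightarrow> (real^2 \<Rightarrow> real) \<Rightarrow> (real^2 \<Rightarrow> real) \<Rightarrow> nat \<Rightarrow> real^2 \<Rightarrow> real"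
    where "pick f g h i = (if i = 1 then f else if i = 2 then g else h)" for f g h i
  have pick: "pick f g h 1 = f" "pick f g h 2 = g" "pick f g h 3 = h" for f g h by (auto simp: pick_def)
  have compat: "pick f g h i (a k) = pick f g h k (a i)"
    if "i \<in> I3" "k \<in> I3" "f (a 2) = g (a 1)" "f (a 3) = h (a 1)" "g (a 3) = h (a 2)" for f g h i k
    using that unfolding I3_cases by (auto simp: pick)
  have glue_pick: "glue (pick f g h) \<in> neumann (5 * \<kappa>')" "glue (pick f g h) (a 1) = f (a 1)"
      "glue (pick f g h) (a 2) = g (a 2)" "glue (pick f g h) (a 3) = h (a 3)" "glue (pick f g h) (F 1 (a 2)) = f (a 2)"
    if "f \<in> neumann \<kappa>'" "g \<in> neumann \<kappa>'" "h \<in> neumann \<kappa>'"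
      "f (a 2) = g (a 1)" "f (a 3) = h (a 1)" "g (a 3) = h (a 2)" for f g h \<kappa>'
  proof -
    note c = compat[OF _ _ that(4-6)]
    show "glue (pick f g h) \<in> neumann (5 * \<kappa>')"
    proof (rule neumann_glue)
      show "pick f g h j \<in> neumann \<kappa>'" for j using that by (simp add: pick_def)
    qed (rule c)
    have "glue (pick f g h) (a j) = pick f g h j (a j)" if "j \<in> I3" for j
      using that by (intro glue_vertex c)
    from I[THEN this] show "glue (pick f g h) (a 1) = f (a 1)" "glue (pick f g h) (a 2) = g (a 2)"
      "glue (pick f g h) (a 3) = h (a 3)" by (simp_all add: pick)
    have "glue (pick f g h) (F 1 (a 2)) = pick f g h 1 (a 2)"
      using I vertex_in_X by (intro glue_F c)
    then show "glue (pick f g h) (F 1 (a 2)) = f (a 2)" by (simp add: pick)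
  qed
  \<comment> \<open>\<open>P2\<close> goes into cell 1 and \<open>P1\<close> into cell 2; they meet
    with value 2 at the common midpoint. Each is glued from three triangles whose vertex values have
    sum 0.\<close>
  define P2 where "P2 = glue (pick (G 0 (-1) 1) (G (-1) 2 (-1)) (G 1 (-1) 0))"
  define P1 where "P1 = glue (pick (G 2 (-1) (-1)) (G (-1) 0 1) (G (-1) 1 0))"
  have P2: "P2 \<in> neumann (5 * \<kappa>)" "P2 (a 1) = 0" "P2 (a 2) = 2" "P2 (a 3) = 0"
    using glue_pick[OF GN[of 0 "-1" 1] GN[of "-1" 2 "-1"] GN[of 1 "-1" 0]] by (simp_all add: P2_def Gv)
  have P1: "P1 \<in> neumann (5 * \<kappa>)" "P1 (a 1) = 2" "P1 (a 2) = 0" "P1 (a 3) = 0"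
    using glue_pick[OF GN[of 2 "-1" "-1"] GN[of "-1" 0 1] GN[of "-1" 1 0]] by (simp_all add: P1_def Gv)
  note h = glue_pick[OF P2(1) P1(1) neumann_zero]
  show ?thesis
  proof
    show "glue (pick P2 P1 (\<lambda>x. 0)) \<in> neumann (25 * \<kappa>)" using h(1) P1 P2 by simp
    show "glue (pick P2 P1 (\<lambda>x. 0)) (F 1 (a 2)) = 2" using h(5) P1 P2 by simp
    show "glue (pick P2 P1 (\<lambda>x. 0)) (a k) = 0" if "k \<in> I3" for k
      using that h(2-4) P1 P2 unfolding I3_cases by auto
  qed
qed

section \<open>Copies of a function in a cell\<close>

text \<open>Copy of \<open>u\<close> in the cell of the word, extended by 0. This is meaningful for
  \<open>u\<close> in \<open>vanishing\<close>, where the zero extension fits at the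
  corners.\<close>

fun place :: "nat list \<Rightarrow> (real^2 \<Rightarrow> real) \<Rightarrow> real^2 \<Rightarrow> real" where
  "place [] u = u"
| "place (j # w) u = glue (\<lambda>i. if i = j then place w u else (\<lambda>x. 0))"

definition vanishing :: "(real^2 \<Rightarrow> real) set" where
  "vanishing = {u. \<forall>k\<in>I3. u (a k) = 0}"

lemma place_Cons_F:
  assumes "place w u \<in> vanishing" "i \<in> I3" "x \<in> X"
  shows "place (j # w) u (F i x) = (if i = j then place w u x else 0)"
proof -
  have "place (j # w) u (F i x) = (\<lambda>i. if i = j then place w u else (\<lambda>x. 0)) i x"
    unfolding place.simps by (rule glue_F) (use assms in \<open>auto simp: vanishing_def\<close>)
  then show ?thesis by simp
qed

lemma place_vanishing: "u \<in> vanishing \<Longrightarrow> place w u \<in> vanishing"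
proof (induction w)
  case (Cons j w)
  then have w: "place w u \<in> vanishing" by simp
  have "place (j # w) u (F k (a k)) = 0" if "k \<in> I3" for k
    using place_Cons_F[OF w that vertex_in_X[OF that]] w that by (auto simp: vanishing_def)
  then show ?case by (simp add: vanishing_def F_map_fixed)
qed simp

lemma place_F:
  assumes "u \<in> vanishing" "i \<in> I3" "x \<in> X"
  shows "place (j # w) u (F i x) = (if i = j then place w u x else 0)"
  by (rule place_Cons_F[OF place_vanishing[OF assms(1)] assms(2,3)])

lemma place_F_word:
  assumes "u \<in> vanishing" "length w = length w'" "w' \<in> words" "x \<in> X"
  shows "place w u (F_word a w' x) = (if w = w' then u x else 0)"
  using assms(2,3)
proof (induction w w' rule: list_induct2)
  case (Cons j w i w')
  then have "i \<in> I3" "w' \<in> words" by (auto simp: words_def)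
  with Cons.IH have "place w u (F_word a w' x) = (if w = w' then u x else 0)" by blast
  with \<open>i \<in> I3\<close> \<open>w' \<in> words\<close> show ?case
    using assms(1,4) by (auto simp: place_F F_word_in_X simp del: place.simps)
qed simp

lemma place_support:
  assumes "u \<in> vanishing" "w \<in> words" "x \<in> X" "place w u x \<noteq> 0"
  shows "x \<in> F_word a w ` X"
proof -
  obtain w' y where w': "w' \<in> word_set (length w)" "y \<in> X" "x = F_word a w' y" using cell_of[OF assms(3)] .
  then have "w' = w" using assms place_F_word[OF assms(1), of w w' y] by (auto simp: word_set_def split: if_splits)
  then show ?thesis using w' by auto
qed

lemma place_Fdom:
  assumes "u \<in> vanishing" "u \<in> Fdom"
  shows "place w u \<in> Fdom"
proof (induction w)
  case (Cons j w)
  show ?case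
  proof (rule Fdom_glued)
    fix i assume i: "i \<in> I3"
    show "(\<lambda>x. place (j # w) u (F i x)) \<in> Fdom"
      by (rule Fdom_cong[of "if i = j then place w u else (\<lambda>x. 0)"])
        (use Cons zero_Fdom in \<open>auto simp: place_F[OF assms(1) i] simp del: place.simps\<close>)
  qed
qed (simp add: assms)

lemma place_neumann:
  assumes "u \<in> vanishing" "u \<in> neumann \<kappa>"
  shows "place w u \<in> neumann (5 ^ length w * \<kappa>)"
proof (induction w)
  case (Cons j w)
  have "place (j # w) u \<in> neumann (5 * (5 ^ length w * \<kappa>))"
  proof (rule neumann_glued)
    fix i assume i: "i \<in> I3"
    show "(\<lambda>x. place (j # w) u (F i x)) \<in> neumann (5 ^ length w * \<kappa>)"
      by (rule neumann_cong[of "if i = j then place w u else (\<lambda>x. 0)"])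
        (use Cons neumann_zero in \<open>auto simp: place_F[OF assms(1) i] simp del: place.simps\<close>)
  qed
  then show ?case by (simp add: mult.assoc del: place.simps)
qed (simp add: assms)

text \<open>Together with \<open>energy_place\<close> this reduces testing by a placed function to
  testing inside one cell. The quotient of the two scalings, \<open>5 ^ length w\<close>, is the
  scaling of eigenvalues.\<close>

lemma integral_place:
  assumes u: "u \<in> vanishing" "u \<in> Fdom" and "w \<in> words" "continuous_on X v"
  shows "(\<integral>x. place w u x * v x \<partial>\<mu>) = (\<integral>x. u x * v (F_word a w x) \<partial>\<mu>) / 3 ^ length w"
  using assms(3,4)
proof (induction w arbitrary: v)
  case (Cons j w)
  then have j: "j \<in> I3" "w \<in> words" by (auto simp: words_def)
  have "(\<integral>x. place (j # w) u x * v x \<partial>\<mu>) = (\<Sum>i\<in>I3. \<integral>x. place (j # w) u (F i x) * v (F i x) \<partial>\<mu>) / 3"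
    by (intro integral_self_similar continuous_on_mult Fdom_continuous place_Fdom u Cons.prems)
  also have "(\<Sum>i\<in>I3. \<integral>x. place (j # w) u (F i x) * v (F i x) \<partial>\<mu>)
      = (\<Sum>i\<in>I3. if i = j then \<integral>x. place w u x * v (F j x) \<partial>\<mu> else 0)"
  proof (rule sum.cong[OF refl])
    fix i assume i: "i \<in> I3"
    have "(\<integral>x. place (j # w) u (F i x) * v (F i x) \<partial>\<mu>) = (\<integral>x. (if i = j then place w u x else 0) * v (F i x) \<partial>\<mu>)"
      by (rule Bochner_Integration.integral_cong) (auto simp: place_F[OF u(1) i] simp del: place.simps)
    then show "(\<integral>x. place (j # w) u (F i x) * v (F i x) \<partial>\<mu>)
        = (if i = j then \<integral>x. place w u x * v (F j x) \<partial>\<mu> else 0)" by simp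
  qed
  also have "\<dots> = (\<integral>x. place w u x * v (F j x) \<partial>\<mu>)" using j by simp
  also have "\<dots> = (\<integral>x. u x * v (F j (F_word a w x)) \<partial>\<mu>) / 3 ^ length w"
    using j Cons.prems by (intro Cons.IH continuous_on_comp_F)
  finally show ?case by simp
qed simp

lemma energy_place:
  assumes u: "u \<in> vanishing" "u \<in> Fdom" and "w \<in> words" "v \<in> Fdom"
  shows "energy a (place w u) v = (5 / 3) ^ length w * energy a u (\<lambda>x. v (F_word a w x))"
  using assms(3,4)
proof (induction w arbitrary: v)
  case (Cons j w)
  then have j: "j \<in> I3" "w \<in> words" by (auto simp: words_def)
  have "energy a (place (j # w) u) v = 5 / 3 * (\<Sum>i\<in>I3. energy a (\<lambda>x. place (j # w) u (F i x)) (\<lambda>x. v (F i x)))"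
    by (intro energy_self_similar place_Fdom u Cons.prems)
  also have "(\<Sum>i\<in>I3. energy a (\<lambda>x. place (j # w) u (F i x)) (\<lambda>x. v (F i x)))
      = (\<Sum>i\<in>I3. if i = j then energy a (place w u) (\<lambda>x. v (F j x)) else 0)"
  proof (rule sum.cong[OF refl])
    fix i assume i: "i \<in> I3"
    have "energy a (\<lambda>x. place (j # w) u (F i x)) (\<lambda>x. v (F i x))
        = energy a (if i = j then place w u else (\<lambda>x. 0)) (\<lambda>x. v (F i x))"
      by (rule energy_cong) (auto simp: place_F[OF u(1) i] simp del: place.simps)
    then show "energy a (\<lambda>x. place (j # w) u (F i x)) (\<lambda>x. v (F i x))
        = (if i = j then energy a (place w u) (\<lambda>x. v (F j x)) else 0)" by (simp add: energy_zero)
  qed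
  also have "\<dots> = energy a (place w u) (\<lambda>x. v (F j x))" using j by simp
  also have "\<dots> = (5 / 3) ^ length w * energy a u (\<lambda>x. v (F j (F_word a w x)))"
    using j Cons.prems by (intro Cons.IH Fdom_comp_F)
  finally show ?case by simp
qed simp

lemma Fdom_comp_F_word: "w \<in> words \<Longrightarrow> u \<in> Fdom \<Longrightarrow> (\<lambda>x. u (F_word a w x)) \<in> Fdom"
proof (induction w arbitrary: u)
  case (Cons j w)
  then show ?case using Fdom_comp_F[of u j] by (auto simp: words_def)
qed simp

section \<open>Density of the form domain\<close>

fun piecewise_harmonic :: "nat \<Rightarrow> (real^2 \<Rightarrow> real) \<Rightarrow> real^2 \<Rightarrow> real" where
  "piecewise_harmonic 0 f = harmonic (\<lambda>i. f (a i))"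
| "piecewise_harmonic (Suc m) f = glue (\<lambda>j. piecewise_harmonic m (\<lambda>x. f (F j x)))"

lemma piecewise_harmonic_vertex: "k \<in> I3 \<Longrightarrow> piecewise_harmonic m f (a k) = f (a k)"
proof (induction m arbitrary: f k)
  case 0
  then show ?case by (simp add: harmonic_vertex)
next
  case (Suc m)
  have "piecewise_harmonic (Suc m) f (a k) = piecewise_harmonic m (\<lambda>x. f (F k x)) (a k)"
    unfolding piecewise_harmonic.simps by (rule glue_vertex) (use Suc F_map_swap in auto)
  then show ?case using Suc by (simp add: F_map_fixed)
qed

lemma piecewise_harmonic_F:
  assumes "j \<in> I3" "x \<in> X"
  shows "piecewise_harmonic (Suc m) f (F j x) = piecewise_harmonic m (\<lambda>x. f (F j x)) x"
  unfolding piecewise_harmonic.simps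
  by (rule glue_F) (use assms F_map_swap in \<open>auto simp: piecewise_harmonic_vertex\<close>)

lemma piecewise_harmonic_Fdom: "piecewise_harmonic m f \<in> Fdom"
proof (induction m arbitrary: f)
  case 0
  then show ?case by (simp add: harmonic_Fdom)
next
  case (Suc m)
  show ?case
    by (rule Fdom_glued, rule Fdom_cong[OF Suc.IH]) (rule piecewise_harmonic_F)
qed

text \<open>The constant 7 is 6 from \<open>harmonic_oscillation\<close> plus 1 for the oscillation
  of \<open>f\<close> on the cell.\<close>

lemma piecewise_harmonic_approx:
  assumes "\<And>w x y. w \<in> word_set m \<Longrightarrow> x \<in> X \<Longrightarrow> y \<in> X \<Longrightarrow> \<bar>f (F_word a w x) - f (F_word a w y)\<bar> \<le> \<omega>" "x \<in> X"
  shows "\<bar>piecewise_harmonic m f x - f x\<bar> \<le> 7 * \<omega>"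
  using assms
proof (induction m arbitrary: f x)
  case 0
  have osc: "\<bar>f x - f y\<bar> \<le> \<omega>" if "x \<in> X" "y \<in> X" for x y using 0(1)[of "[]"] that by simp
  have "\<bar>harmonic (\<lambda>i. f (a i)) x - f (a 1)\<bar> \<le> 6 * \<omega>"
    by (rule harmonic_oscillation) (use 0 osc vertex_in_X in auto)
  then show ?case using osc[OF vertex_in_X[of 1] 0(2)] by simp
next
  case (Suc m)
  obtain j y where y: "j \<in> I3" "y \<in> X" "x = F j y" using X_cases[OF Suc.prems(2)] .
  show ?case unfolding y(3) piecewise_harmonic_F[OF y(1,2)]
  proof (rule Suc.IH[OF _ y(2)])
    fix w x z assume "w \<in> word_set m" "x \<in> X" "z \<in> X"
    then show "\<bar>f (F j (F_word a w x)) - f (F j (F_word a w z))\<bar> \<le> \<omega>"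
      using Suc.prems(1)[of "j # w" x z] y(1) by (simp add: word_set_def words_def)
  qed
qed

lemma L2_norm_le_bound:
  assumes "continuous_on X f" "\<And>x. x \<in> X \<Longrightarrow> \<bar>f x\<bar> \<le> C" "0 \<le> C"
  shows "L2_norm \<mu> f \<le> C"
proof -
  have "(\<integral>x. (f x)\<^sup>2 \<partial>\<mu>) \<le> (\<integral>x. C\<^sup>2 \<partial>\<mu>)"
    using assms by (intro integral_mono L2_integrable_square continuous_L2)
      (auto simp: abs_le_square_iff[symmetric])
  also have "\<dots> = C\<^sup>2" using prob_space by simp
  finally show ?thesis unfolding L2_norm_def using assms(3) by (simp add: real_le_lsqrt)
qed

lemma Fdom0_iff: "u \<in> Fdom0 \<longleftrightarrow> u \<in> Fdom \<and> u \<in> vanishing"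
  by (auto simp: energy_domain0_def vanishing_def)

text \<open>The piecewise harmonic interpolants of \<open>g\<close> keep its zero values at the
  corners, so they lie in \<open>Fdom0\<close>, and they converge uniformly to
  \<open>g\<close>.\<close>

lemma orthogonal_to_vanishing:
  assumes f: "f \<in> L2 \<mu>" and orth: "\<And>v. v \<in> Fdom0 \<Longrightarrow> L2_inner \<mu> f v = 0"
    and g: "continuous_on X g" "g \<in> vanishing"
  shows "L2_inner \<mu> f g = 0"
proof -
  let ?g = "\<lambda>m. piecewise_harmonic m g"
  have cont: "continuous_on X (\<lambda>x. ?g m x - g x)" for m
    by (intro continuous_on_diff Fdom_continuous piecewise_harmonic_Fdom g)
  have lim: "(\<lambda>m. L2_norm \<mu> (\<lambda>x. ?g m x - g x)) \<longlonglongrightarrow> 0"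
  proof (rule LIMSEQ_I)
    fix \<epsilon> :: real assume \<epsilon>: "\<epsilon> > 0"
    obtain N where N: "\<And>m w x y. m \<ge> N \<Longrightarrow> w \<in> word_set m \<Longrightarrow> x \<in> X \<Longrightarrow> y \<in> X \<Longrightarrow>
        \<bar>g (F_word a w x) - g (F_word a w y)\<bar> < \<epsilon> / 8"
      using oscillation_small[OF g(1), of "\<epsilon> / 8"] \<epsilon> by auto
    have "L2_norm \<mu> (\<lambda>x. ?g m x - g x) \<le> 7 * (\<epsilon> / 8)" if "m \<ge> N" for m
      using \<epsilon> N[OF that] by (intro L2_norm_le_bound cont piecewise_harmonic_approx) (auto intro: less_imp_le)
    then show "\<exists>N. \<forall>m\<ge>N. norm (L2_norm \<mu> (\<lambda>x. ?g m x - g x) - 0) < \<epsilon>"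
      using \<epsilon> by (intro exI[of _ N]) (force simp: L2_norm_nonneg)
  qed
  have "(\<lambda>m. L2_inner \<mu> (?g m) f) \<longlonglongrightarrow> L2_inner \<mu> g f"
    by (intro L2_tendsto_inner continuous_L2 Fdom_continuous piecewise_harmonic_Fdom g f lim)
  moreover have "L2_inner \<mu> (?g m) f = 0" for m
    using orth[of "?g m"] g(2) L2_inner_commute[of \<mu> f]
    by (simp add: Fdom0_iff piecewise_harmonic_Fdom vanishing_def piecewise_harmonic_vertex del: piecewise_harmonic.simps)
  ultimately show ?thesis by (simp add: L2_inner_commute[of \<mu> f] LIMSEQ_const_iff)
qed

lemma integral_closed_0:
  assumes f: "f \<in> L2 \<mu>" and orth: "\<And>v. v \<in> Fdom0 \<Longrightarrow> L2_inner \<mu> f v = 0" and C: "closed C"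
  shows "(\<integral>x. f x * indicator C x \<partial>\<mu>) = 0"
proof (cases "C = {}")
  case False
  \<comment> \<open>The first factor decreases to the indicator of \<open>C\<close>; the other three
    make \<open>t n\<close> vanish at the corners of the gasket and tend to 1 elsewhere. The corners
    form a null set.\<close>
  define t where "t n x = max 0 (1 - real n * infdist x C) *
      (min 1 (real n * dist x (a 1)) * min 1 (real n * dist x (a 2)) * min 1 (real n * dist x (a 3)))" for n x
  have cont: "continuous_on X (t n)" for n
    unfolding t_def by (intro continuous_intros)
  have "t n \<in> vanishing" for n
    unfolding vanishing_def t_def atLeastAtMost_1_3 by simp
  then have 0: "(\<integral>x. f x * t n x \<partial>\<mu>) = 0" for n
    using orthogonal_to_vanishing[OF f orth cont] by (simp add: L2_inner_def)
  have fi: "integrable \<mu> f"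
    using L2_integrable_mult[OF f continuous_L2[of "\<lambda>x. 1"]] by simp
  have t01: "\<bar>t n x\<bar> \<le> 1" for n x
  proof -
    have "\<bar>max 0 (1 - real n * infdist x C)\<bar> \<le> 1" by (auto simp: infdist_nonneg)
    moreover have "\<bar>min 1 (real n * dist x y)\<bar> \<le> 1" for y by auto
    ultimately show ?thesis unfolding t_def abs_mult by (intro mult_le_one) auto
  qed
  have lim: "(\<lambda>n. t n x) \<longlonglongrightarrow> indicator C x" if x: "x \<noteq> a 1" "x \<noteq> a 2" "x \<noteq> a 3" for x
  proof -
    have ev1: "\<forall>\<^sub>F n in sequentially. real n * d \<ge> 1" if "d > 0" for d :: real
    proof -
      obtain N where N: "1 / d < real N" using reals_Archimedean2 by blast
      show ?thesis using eventually_ge_at_top[of N]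
      proof eventually_elim
        case (elim n)
        then have "1 / d < real n" using N by linarith
        then show ?case using \<open>d > 0\<close> by (simp add: field_simps)
      qed
    qed
    have "\<forall>\<^sub>F n in sequentially. t n x = indicator C x"
    proof (cases "x \<in> C")
      case True
      have "\<forall>\<^sub>F n in sequentially. real n * dist x (a 1) \<ge> 1 \<and> real n * dist x (a 2) \<ge> 1 \<and> real n * dist x (a 3) \<ge> 1"
        using x by (intro eventually_conj ev1) auto
      then show ?thesis by eventually_elim (use True in \<open>auto simp: t_def\<close>)
    next
      case xC: False
      have "infdist x C > 0"
        using in_closed_iff_infdist_zero[OF C False] xC infdist_nonneg[of x C] by force
      from ev1[OF this] show ?thesis by eventually_elim (use xC in \<open>auto simp: t_def\<close>)
    qed
    then show ?thesis by (rule tendsto_eventually)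
  qed
  have [measurable]: "f \<in> borel_measurable \<mu>" by (rule L2_measurable[OF f])
  have [measurable]: "t n \<in> borel_measurable \<mu>" for n by (rule measurable_continuous[OF cont])
  have Cm: "indicat_real C \<in> borel_measurable \<mu>"
  proof -
    have "indicat_real C \<in> borel_measurable (restrict_space borel X)"
      using C by (intro measurable_restrict_space1) auto
    then show ?thesis using measurable_cong_sets[OF sets_\<mu> refl] by blast
  qed
  note [measurable] = Cm
  have "(\<lambda>n. \<integral>x. f x * t n x \<partial>\<mu>) \<longlonglongrightarrow> (\<integral>x. f x * indicator C x \<partial>\<mu>)"
  proof (rule integral_dominated_convergence[where w = "\<lambda>x. \<bar>f x\<bar>"])
    show "integrable \<mu> (\<lambda>x. \<bar>f x\<bar>)" using fi by simp
    have "AE x in \<mu>. x \<noteq> a 1 \<and> x \<noteq> a 2 \<and> x \<noteq> a 3"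
      using point_null[OF vertex_in_X[of 1]] point_null[OF vertex_in_X[of 2]] point_null[OF vertex_in_X[of 3]]
      by (simp add: AE_conj_iff)
    then show "AE x in \<mu>. (\<lambda>n. f x * t n x) \<longlonglongrightarrow> f x * indicator C x"
      by eventually_elim (intro tendsto_mult tendsto_const lim; blast)
    show "AE x in \<mu>. norm (f x * t n x) \<le> \<bar>f x\<bar>" for n
      using mult_left_mono[OF t01] by (auto simp: abs_mult)
  qed measurable
  then show ?thesis by (simp add: 0 LIMSEQ_const_iff)
qed simp

text \<open>Closed sets are stable under intersection and generate the Borel sets, so vanishing
  integrals extend from closed sets to all Borel sets, and \<open>density_zero\<close>
  applies.\<close>

lemma Fdom0_total:
  assumes f: "f \<in> L2 \<mu>" and orth: "\<And>v. v \<in> Fdom0 \<Longrightarrow> L2_inner \<mu> f v = 0"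
  shows "AE x in \<mu>. f x = 0"
proof (rule density_zero)
  show fi: "integrable \<mu> f"
    using L2_integrable_mult[OF f continuous_L2[of "\<lambda>x. 1"]] by simp
  have int0: "(\<integral>x. f x * indicator B x \<partial>\<mu>) = 0" if "B \<in> sets borel" for B
  proof -
    have mI: "A \<inter> X \<in> sets \<mu>" if "A \<in> sets borel" for A
      unfolding sets_\<mu> sets_restrict_space using that by (auto simp: Int_commute)
    have int: "integrable \<mu> (\<lambda>x. f x * indicator A x)" if "A \<in> sets borel" for A
    proof -
      have "integrable \<mu> (\<lambda>x. f x * indicator (A \<inter> X) x)"
        using integrable_mult_indicator[OF mI[OF that] fi] by (simp add: mult.commute)
      then show ?thesis
        by (rule Bochner_Integration.integrable_cong[THEN iffD1, rotated 2]) (auto simp: indicator_def)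
    qed
    have stable: "Int_stable (Collect closed)" by (auto simp: Int_stable_def)
    have B: "B \<in> sigma_sets UNIV (Collect closed)" using that by (simp add: borel_eq_closed)
    have "Collect closed \<subseteq> Pow (UNIV :: (real^2) set)" by simp
    from stable this B show ?thesis
    proof (induction rule: sigma_sets_induct_disjoint)
      case (basic A)
      then show ?case using integral_closed_0[OF f orth] by simp
    next
      case empty
      then show ?case by simp
    next
      case (compl A)
      have A: "A \<in> sets borel" using compl(1) by (simp add: borel_eq_closed)
      have "(\<integral>x. f x * indicator (UNIV - A) x \<partial>\<mu>) = (\<integral>x. f x * indicator UNIV x - f x * indicator A x \<partial>\<mu>)"
        by (rule Bochner_Integration.integral_cong) (auto simp: indicator_def)
      also have "\<dots> = 0"
        using compl(2) integral_closed_0[OF f orth, of UNIV] int[OF A] fi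
        by (subst Bochner_Integration.integral_diff) auto
      finally show ?case .
    next
      case (union A)
      have A: "A i \<in> sets borel" for i using union(2) by (auto simp: borel_eq_closed)
      have "(\<lambda>n. \<integral>x. (\<Sum>i<n. f x * indicator (A i) x) \<partial>\<mu>) \<longlonglongrightarrow> (\<integral>x. f x * indicator (\<Union>i. A i) x \<partial>\<mu>)"
      proof (rule integral_dominated_convergence[where w = "\<lambda>x. \<bar>f x\<bar>"])
        show "integrable \<mu> (\<lambda>x. \<bar>f x\<bar>)" using fi by simp
        show "(\<lambda>x. f x * indicator (\<Union>i. A i) x) \<in> borel_measurable \<mu>"
          by (intro borel_measurable_integrable int sets.countable_UN'') (auto simp: A)
        show "(\<lambda>x. \<Sum>i<n. f x * indicator (A i) x) \<in> borel_measurable \<mu>" for n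
          by (intro borel_measurable_sum borel_measurable_integrable int A)
        have sums: "(\<lambda>i. indicat_real (A i) x) sums indicator (\<Union>i. A i) x" for x
          using indicator_sums[of A x] union(1) by (auto simp: disjoint_family_on_def)
        show "AE x in \<mu>. (\<lambda>n. \<Sum>i<n. f x * indicator (A i) x) \<longlonglongrightarrow> f x * indicator (\<Union>i. A i) x"
          using sums_mult[OF sums] unfolding sums_def by blast
        have "(\<Sum>i<n. indicat_real (A i) x) \<le> 1" for n x
        proof -
          have "(\<Sum>i<n. indicat_real (A i) x) \<le> (\<Sum>i. indicat_real (A i) x)"
            by (rule sum_le_suminf[OF sums_summable[OF sums]]) auto
          also have "\<dots> = indicator (\<Union>i. A i) x" by (rule sums_unique[OF sums, symmetric])
          also have "\<dots> \<le> (1 :: real)" by (simp add: indicator_def)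
          finally show ?thesis .
        qed
        then have "\<bar>f x\<bar> * \<bar>\<Sum>i<n. indicat_real (A i) x\<bar> \<le> \<bar>f x\<bar> * 1" for n x
          by (intro mult_left_mono) (auto simp: sum_nonneg)
        then show "AE x in \<mu>. norm (\<Sum>i<n. f x * indicator (A i) x) \<le> \<bar>f x\<bar>" for n
          by (simp add: sum_distrib_left[symmetric] abs_mult)
      qed
      moreover have "(\<integral>x. (\<Sum>i<n. f x * indicator (A i) x) \<partial>\<mu>) = 0" for n
        using union(3) by (subst Bochner_Integration.integral_sum) (auto intro: int A)
      ultimately show ?case by (simp add: LIMSEQ_const_iff)
    qed
  qed
  fix A assume "A \<in> sets \<mu>"
  then obtain B where B: "B \<in> sets borel" "A = X \<inter> B" unfolding sets_\<mu> sets_restrict_space by auto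
  have "set_lebesgue_integral \<mu> A f = (\<integral>x. f x * indicator B x \<partial>\<mu>)"
    unfolding set_lebesgue_integral_def
    by (rule Bochner_Integration.integral_cong) (auto simp: B(2) indicator_def)
  then show "set_lebesgue_integral \<mu> A f = 0" using int0[OF B(1)] by simp
qed

end

section \<open>The Dirichlet Laplacian has an eigenbasis\<close>

context gasket_measure
begin

lemma bump_function:
  obtains b where "b \<in> Fdom0" "b (F 1 (a 2)) = 1"
proof -
  \<comment> \<open>\<open>f\<close> is discontinuous, but the interpolation reads only its values
    at the vertices of level 1.\<close>
  define f where "f x = (if x = F 1 (a 2) then 1 else 0 :: real)" for x
  have "f (a k) = 0" if "k \<in> I3" for k
  proof -
    have "a k \<noteq> F 1 (a 2)"
    proof
      assume eq: "a k = F 1 (a 2)"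
      have "bary a 1 (a k) = 1 / 2" unfolding eq by (simp add: bary_F bary_vertex)
      then show False using that by (simp add: bary_vertex split: if_splits)
    qed
    then show ?thesis by (simp add: f_def)
  qed
  then have "piecewise_harmonic (Suc 0) f \<in> Fdom0"
    by (simp add: Fdom0_iff piecewise_harmonic_Fdom vanishing_def piecewise_harmonic_vertex del: piecewise_harmonic.simps)
  moreover have "piecewise_harmonic (Suc 0) f (F 1 (a 2)) = 1"
    using piecewise_harmonic_F[of 1 "a 2" 0 f] piecewise_harmonic_vertex[of 2 0 "\<lambda>x. f (F 1 x)"] vertex_in_X[of 2]
    by (simp add: f_def del: piecewise_harmonic.simps)
  ultimately show ?thesis by (rule that)
qed

lemma en_tendsto:
  assumes "\<And>x. x \<in> X \<Longrightarrow> (\<lambda>n. f n x) \<longlonglongrightarrow> g x"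
  shows "(\<lambda>n. en m (f n) (f n)) \<longlonglongrightarrow> en m g g"
  using assms
proof (induction m arbitrary: f g)
  case 0
  have "a 1 \<in> X" "a 2 \<in> X" "a 3 \<in> X" by (auto intro: vertex_in_X)
  from this[THEN 0] show ?case unfolding en_0 by (intro tendsto_intros)
next
  case (Suc m)
  show ?case unfolding en.simps(2)
    by (intro tendsto_intros Suc.IH) (use Suc.prems F_in_X in blast)
qed

lemma Fdom0_sup_bound:
  assumes "u \<in> Fdom0" "energy a u u \<le> C\<^sup>2" "0 \<le> C" "x \<in> X"
  shows "\<bar>u x\<bar> \<le> 5 * C"
proof -
  have u: "u \<in> Fdom" "u (a 1) = 0" using assms(1) by (auto simp: Fdom0_iff vanishing_def)
  have "en m u u \<le> C\<^sup>2" for m using en_le_energy[OF u(1)] assms(2) order_trans by blast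
  from oscillation_vertex[OF Fdom_continuous[OF u(1)] this assms(3,4), of 1] show ?thesis using u(2) by simp
qed

text \<open>Arzela-Ascoli by hand: values at the countably many points
  \<open>F_word a w (a 1)\<close> converge along a diagonal subsequence, and
  \<open>cell_oscillation\<close> controls all functions between these points uniformly. Lower
  semicontinuity holds because each \<open>en m\<close> involves finitely many points.\<close>

lemma Fdom0_compact:
  assumes s: "\<And>n. s n \<in> Fdom0" and C: "\<And>n. energy a (s n) (s n) \<le> C"
  obtains r :: "nat \<Rightarrow> nat" and v where "strict_mono r" "v \<in> Fdom0"
    "(\<lambda>n. L2_norm \<mu> (\<lambda>x. s (r n) x - v x)) \<longlonglongrightarrow> 0"
    "\<And>B. \<forall>\<^sub>F n in sequentially. energy a (s (r n)) (s (r n)) \<le> B \<Longrightarrow> energy a v v \<le> B"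
proof -
  have sF: "s n \<in> Fdom" and sV: "s n \<in> vanishing" for n using s[of n] by (auto simp: Fdom0_iff)
  have C0: "0 \<le> C" using energy_nonneg[OF sF[of 0]] C[of 0] by linarith
  define K where "K = sqrt C"
  have K: "C = K\<^sup>2" "0 \<le> K" using C0 by (auto simp: K_def)
  have enK: "en m (s n) (s n) \<le> K\<^sup>2" for m n
    using en_le_energy[OF sF[of n], of m] C[of n] K(1) by linarith
  define f where "f n w = (if w \<in> words then s n (F_word a w (a 1)) else 0)" for n w
  have "\<bar>f n w\<bar> \<le> 5 * K" for n w
    using Fdom0_sup_bound[OF s, of n K] C K F_word_in_X vertex_in_X[of 1] by (simp add: f_def)
  from bounded_sequences_convergent_subseq[of f "\<lambda>_. 5 * K", OF this]
  obtain r where r: "strict_mono r" and conv: "\<And>w. convergent (\<lambda>n. f (r n) w)" by blast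
  have "uniformly_Cauchy_on X (\<lambda>n. s (r n))"
  proof (rule uniformly_Cauchy_onI)
    fix \<epsilon> :: real assume \<epsilon>: "\<epsilon> > 0"
    \<comment> \<open>With this \<open>m\<close> every \<open>s n\<close> oscillates by at most
      \<open>\<epsilon> / 4\<close> on each \<open>m\<close>-cell.\<close>
    obtain m where m: "(4 / 5 :: real) ^ m < \<epsilon> / (40 * (K + 1))"
      using real_arch_pow_inv[of "\<epsilon> / (40 * (K + 1))" "4 / 5"] \<epsilon> K(2) by auto
    have small: "10 * (4 / 5) ^ m * K \<le> \<epsilon> / 4"
    proof -
      have "10 * (4 / 5) ^ m * K \<le> 10 * (\<epsilon> / (40 * (K + 1))) * (K + 1)"
        using m K(2) \<epsilon> by (intro mult_mono) auto
      also have "\<dots> = \<epsilon> / 4" using K(2) by (simp add: field_simps)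
      finally show ?thesis .
    qed
    have "\<exists>N. \<forall>n\<ge>N. \<forall>n'\<ge>N. \<bar>f (r n) w - f (r n') w\<bar> < \<epsilon> / 4" for w
      using convergent_Cauchy[OF conv[of w]] \<epsilon> unfolding Cauchy_def dist_real_def
      by (meson zero_less_divide_iff zero_less_numeral)
    then obtain N where N: "\<And>w n n'. n \<ge> N w \<Longrightarrow> n' \<ge> N w \<Longrightarrow> \<bar>f (r n) w - f (r n') w\<bar> < \<epsilon> / 4" by metis
    have close: "\<bar>p - q\<bar> < 4 * e" if "\<bar>p - p'\<bar> \<le> e" "\<bar>q - q'\<bar> \<le> e" "\<bar>p' - q'\<bar> < e" for p q p' q' e :: real
      using that by linarith
    show "\<exists>M. \<forall>x\<in>X. \<forall>n\<ge>M. \<forall>n'\<ge>M. dist (s (r n) x) (s (r n') x) < \<epsilon>"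
    proof (intro exI ballI allI impI)
      fix x n n' assume x: "x \<in> X" and n: "Max (N ` word_set m) \<le> n" "Max (N ` word_set m) \<le> n'"
      obtain w y where w: "w \<in> word_set m" "y \<in> X" "x = F_word a w y" using cell_of[OF x] .
      have "N w \<le> Max (N ` word_set m)" using w(1) by (intro Max_ge) auto
      then have fw: "\<bar>f (r n) w - f (r n') w\<bar> < \<epsilon> / 4" using n by (intro N) auto
      have ww: "w \<in> words" "length w = m" using w(1) by (auto simp: word_set_def)
      have "\<bar>s i x - s i (F_word a w (a 1))\<bar> \<le> \<epsilon> / 4" for i
        using cell_oscillation[OF Fdom_continuous[OF sF] enK K(2) ww(1) w(2) vertex_in_X[of 1], of i] small
        unfolding w(3) ww(2) by simp
      from this[of "r n"] this[of "r n'"]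
      have "\<bar>s (r n) x - s (r n') x\<bar> < 4 * (\<epsilon> / 4)"
        using fw unfolding f_def if_P[OF ww(1)] by (rule close)
      then show "dist (s (r n) x) (s (r n') x) < \<epsilon>" by (simp add: dist_real_def)
    qed
  qed
  then obtain v where v: "uniform_limit X (\<lambda>n. s (r n)) v sequentially"
    using Cauchy_uniformly_convergent uniformly_convergent_on_def by blast
  have v_cont: "continuous_on X v"
    by (rule uniform_limit_theorem[OF _ v]) (auto simp: Fdom_continuous sF)
  have pt: "(\<lambda>n. s (r n) x) \<longlonglongrightarrow> v x" if "x \<in> X" for x
    by (rule tendsto_uniform_limitI[OF v that])
  have en_lim: "(\<lambda>n. en m (s (r n)) (s (r n))) \<longlonglongrightarrow> en m v v" for m
    by (rule en_tendsto[OF pt])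
  have "en m v v \<le> K\<^sup>2" for m
    by (rule LIMSEQ_le_const2[OF en_lim]) (use enK in blast)
  then have vF: "v \<in> Fdom" unfolding Fdom_iff using v_cont by blast
  have "v (a k) = 0" if "k \<in> I3" for k
    using pt[OF vertex_in_X[OF that]] sV that by (simp add: vanishing_def LIMSEQ_const_iff)
  then have v0: "v \<in> Fdom0" using vF by (simp add: Fdom0_iff vanishing_def)
  have "(\<lambda>n. L2_norm \<mu> (\<lambda>x. s (r n) x - v x)) \<longlonglongrightarrow> 0"
  proof (rule LIMSEQ_I)
    fix \<epsilon> :: real assume \<epsilon>: "\<epsilon> > 0"
    then have "\<forall>\<^sub>F n in sequentially. \<forall>x\<in>X. dist (s (r n) x) (v x) < \<epsilon> / 2"
      using uniform_limitD[OF v, of "\<epsilon> / 2"] by simp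
    then obtain N where N: "\<And>n x. n \<ge> N \<Longrightarrow> x \<in> X \<Longrightarrow> \<bar>s (r n) x - v x\<bar> < \<epsilon> / 2"
      unfolding eventually_sequentially dist_real_def by blast
    have "L2_norm \<mu> (\<lambda>x. s (r n) x - v x) \<le> \<epsilon> / 2" if "n \<ge> N" for n
      using N[OF that] \<epsilon> by (intro L2_norm_le_bound continuous_on_diff Fdom_continuous sF v_cont) (auto intro: less_imp_le)
    then show "\<exists>N. \<forall>n\<ge>N. norm (L2_norm \<mu> (\<lambda>x. s (r n) x - v x) - 0) < \<epsilon>"
      using \<epsilon> by (intro exI[of _ N]) (force simp: L2_norm_nonneg)
  qed
  moreover have "energy a v v \<le> B" if B: "\<forall>\<^sub>F n in sequentially. energy a (s (r n)) (s (r n)) \<le> B" for B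
  proof (rule energy_le[OF vF])
    fix m
    show "en m v v \<le> B"
    proof (rule tendsto_upperbound[OF en_lim])
      show "\<forall>\<^sub>F n in sequentially. en m (s (r n)) (s (r n)) \<le> B"
        using B by eventually_elim (use en_le_energy[OF sF] order_trans in blast)
    qed simp
  qed
  ultimately show ?thesis using that[OF r v0] by blast
qed

lemma Fdom0_linear: "u \<in> Fdom0 \<Longrightarrow> v \<in> Fdom0 \<Longrightarrow> (\<lambda>x. u x + c * v x) \<in> Fdom0"
  by (auto simp: Fdom0_iff Fdom_linear vanishing_def)

lemma Fdom0_Fdom: "u \<in> Fdom0 \<Longrightarrow> u \<in> Fdom"
  by (simp add: Fdom0_iff)

lemma Fdom_L2: "u \<in> Fdom \<Longrightarrow> u \<in> L2 \<mu>"
  by (intro continuous_L2 Fdom_continuous)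

text \<open>Copies of one bump in \<open>n\<close> different cells of level \<open>n\<close> are
  independent; \<open>3 ^ n \<ge> n\<close> provides the cells.\<close>

lemma Fdom0_infinite:
  "\<exists>e :: nat \<Rightarrow> real^2 \<Rightarrow> real. (\<forall>i<n. e i \<in> Fdom0) \<and>
    (\<forall>c :: nat \<Rightarrow> real. (AE x in \<mu>. (\<Sum>i<n. c i * e i x) = 0) \<longrightarrow> (\<forall>i<n. c i = 0))"
proof -
  obtain b where b: "b \<in> Fdom0" "b (F 1 (a 2)) = 1" using bump_function .
  have bF: "b \<in> Fdom" "b \<in> vanishing" using b(1) by (auto simp: Fdom0_iff)
  have "n \<le> card (word_set n)" using less_exp[of n] power_mono[of 2 "3::nat" n] by (simp add: card_word_set)
  then obtain g where g: "inj_on g {..<n}" "g ` {..<n} \<subseteq> word_set n"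
    using card_le_inj[of "{..<n}" "word_set n"] by auto
  have gw: "g i \<in> words" "length (g i) = n" if "i < n" for i
    using g(2) that by (auto simp: word_set_def)
  have P: "place w b \<in> Fdom0" for w
    using place_Fdom[OF bF(2,1)] place_vanishing[OF bF(2)] by (simp add: Fdom0_iff)
  show ?thesis
  proof (intro exI[of _ "\<lambda>i. place (g i) b"] conjI allI impI P)
    fix c :: "nat \<Rightarrow> real" and i assume AE: "AE x in \<mu>. (\<Sum>i<n. c i * place (g i) b x) = 0" and i: "i < n"
    define x where "x = F_word a (g i) (F 1 (a 2))"
    have mX: "F 1 (a 2) \<in> X" by (intro F_in_X vertex_in_X) auto
    have "(\<Sum>k<n. c k * place (g k) b x) = 0"
    proof (rule continuous_AE_0[OF _ AE])
      show "continuous_on X (\<lambda>x. \<Sum>k<n. c k * place (g k) b x)"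
        by (intro continuous_intros Fdom_continuous Fdom0_Fdom P)
      show "x \<in> X" unfolding x_def using gw(1)[OF i] mX by (rule F_word_in_X)
    qed
    moreover have "c k * place (g k) b x = (if k = i then c i else 0)" if "k < n" for k
    proof -
      have "place (g k) b x = (if g k = g i then b (F 1 (a 2)) else 0)"
        unfolding x_def using gw[OF i] gw[OF that] by (intro place_F_word bF mX) auto
      moreover have "g k = g i \<longleftrightarrow> k = i" using g(1) i that by (auto simp: inj_on_def)
      ultimately show ?thesis using b(2) by simp
    qed
    ultimately show "c i = 0" using i by simp
  qed
qed

lemma neg_laplacian_eigenbasis:
  obtains \<phi> l where "diagonal_operator \<mu> \<phi> (neg_laplacian a X \<mu>) l" "\<And>n. \<phi> n \<in> Fdom0"
proof -
  interpret Q: compact_form \<mu> Fdom0 "energy a"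
  proof unfold_locales
    show "u \<in> L2 \<mu>" if "u \<in> Fdom0" for u using that by (intro Fdom_L2 Fdom0_Fdom)
    show "(\<lambda>x. u x + c * v x) \<in> Fdom0" if "u \<in> Fdom0" "v \<in> Fdom0" for u v c using that by (rule Fdom0_linear)
    show "energy a u v = energy a v u" for u v by (rule energy_commute)
    show "energy a (\<lambda>x. u x + c * v x) w = energy a u w + c * energy a v w"
      if "u \<in> Fdom0" "v \<in> Fdom0" "w \<in> Fdom0" for u v w c using that by (intro energy_linear Fdom0_Fdom)
    show "0 \<le> energy a u u" if "u \<in> Fdom0" for u using that by (intro energy_nonneg Fdom0_Fdom)
    show "\<exists>(r :: nat \<Rightarrow> nat) v. strict_mono r \<and> v \<in> Fdom0 \<and> (\<lambda>n. L2_norm \<mu> (\<lambda>x. s (r n) x - v x)) \<longlonglongrightarrow> 0 \<and>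
          (\<forall>B. (\<forall>\<^sub>F n in sequentially. energy a (s (r n)) (s (r n)) \<le> B) \<longrightarrow> energy a v v \<le> B)"
      if s: "\<And>n. s n \<in> Fdom0" "\<And>n. energy a (s n) (s n) \<le> C" for s C
    proof -
      obtain r :: "nat \<Rightarrow> nat" and v where "strict_mono r" "v \<in> Fdom0" "(\<lambda>n. L2_norm \<mu> (\<lambda>x. s (r n) x - v x)) \<longlonglongrightarrow> 0"
        "\<And>B. \<forall>\<^sub>F n in sequentially. energy a (s (r n)) (s (r n)) \<le> B \<Longrightarrow> energy a v v \<le> B"
        using Fdom0_compact[of s C] s by blast
      then show ?thesis by blast
    qed
    show "AE x in \<mu>. f x = 0" if "f \<in> L2 \<mu>" "\<And>v. v \<in> Fdom0 \<Longrightarrow> L2_inner \<mu> f v = 0" for f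
      using that by (rule Fdom0_total)
  qed (rule Fdom0_infinite)
  obtain \<phi> l where \<phi>D: "\<And>n. \<phi> n \<in> Fdom0" and \<phi>: "complete_orthonormal_sequence \<mu> \<phi>"
    and eigen: "\<And>n v. v \<in> Fdom0 \<Longrightarrow> energy a (\<phi> n) v = l n * L2_inner \<mu> (\<phi> n) v"
    and top: "filterlim l at_top sequentially"
    using Q.eigenbasis by blast
  interpret \<phi>: complete_orthonormal_sequence \<mu> \<phi> by (rule \<phi>)
  have "diagonal_operator \<mu> \<phi> (neg_laplacian a X \<mu>) l"
  proof unfold_locales
    show "u \<in> L2 \<mu> \<and> g \<in> L2 \<mu>" if "neg_laplacian a X \<mu> u g" for u g
      using that by (simp add: neg_laplacian_def)
    show "\<phi>.coef g n = l n * \<phi>.coef u n" if "neg_laplacian a X \<mu> u g" for u g n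
    proof -
      obtain u' where u': "u' \<in> Fdom0" "AE x in \<mu>. u x = u' x"
          "\<And>v. v \<in> Fdom0 \<Longrightarrow> energy a u' v = (\<integral>x. g x * v x \<partial>\<mu>)" and u: "u \<in> L2 \<mu>"
        using \<open>neg_laplacian a X \<mu> u g\<close> unfolding neg_laplacian_def by blast
      have "\<phi>.coef g n = energy a (\<phi> n) u'"
        using u'(3)[OF \<phi>D] by (simp add: L2_inner_def energy_commute)
      also have "\<dots> = l n * \<phi>.coef u' n" using eigen[OF u'(1)] by (simp add: L2_inner_commute)
      also have "\<phi>.coef u' n = \<phi>.coef u n"
        using u'(2) by (intro L2_inner_AE_cong u \<phi>.in_L2 Q.dom_L2 u'(1)) auto
      finally show ?thesis .
    qed
    show "neg_laplacian a X \<mu> (\<phi> n) (\<lambda>x. l n * \<phi> n x)" for n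
      unfolding neg_laplacian_def
    proof (intro conjI bexI[of _ "\<phi> n"] ballI \<phi>D \<phi>.in_L2 L2_scale)
      show "energy a (\<phi> n) v = (\<integral>x. l n * \<phi> n x * v x \<partial>\<mu>)" if "v \<in> Fdom0" for v
        using eigen[OF that] by (simp add: L2_inner_def mult.assoc)
    qed simp
    show "neg_laplacian a X \<mu> (\<lambda>x. u x + c * v x) (\<lambda>x. g x + c * h x)"
      if u: "neg_laplacian a X \<mu> u g" and v: "neg_laplacian a X \<mu> v h" for u g v h c
    proof -
      obtain u' where u': "u' \<in> Fdom0" "AE x in \<mu>. u x = u' x"
          "\<And>w. w \<in> Fdom0 \<Longrightarrow> energy a u' w = (\<integral>x. g x * w x \<partial>\<mu>)" and uL2: "u \<in> L2 \<mu>" "g \<in> L2 \<mu>"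
        using u unfolding neg_laplacian_def by blast
      obtain v' where v': "v' \<in> Fdom0" "AE x in \<mu>. v x = v' x"
          "\<And>w. w \<in> Fdom0 \<Longrightarrow> energy a v' w = (\<integral>x. h x * w x \<partial>\<mu>)" and vL2: "v \<in> L2 \<mu>" "h \<in> L2 \<mu>"
        using v unfolding neg_laplacian_def by blast
      show ?thesis unfolding neg_laplacian_def
      proof (intro conjI bexI[of _ "\<lambda>x. u' x + c * v' x"] ballI Fdom0_linear u' v' L2_add L2_scale uL2 vL2)
        show "AE x in \<mu>. u x + c * v x = u' x + c * v' x" using u'(2) v'(2) by eventually_elim simp
        fix w assume w: "w \<in> Fdom0"
        have "energy a (\<lambda>x. u' x + c * v' x) w = L2_inner \<mu> g w + c * L2_inner \<mu> h w"
          using energy_linear[OF u'(1)[THEN Fdom0_Fdom] v'(1)[THEN Fdom0_Fdom] Fdom0_Fdom[OF w]] u'(3)[OF w] v'(3)[OF w]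
          by (simp add: L2_inner_def)
        also have "\<dots> = L2_inner \<mu> (\<lambda>x. g x + c * h x) w"
          using uL2 vL2 Q.dom_L2[OF w] by (simp add: L2_inner_add_left L2_scale L2_inner_scale_left)
        finally show "energy a (\<lambda>x. u' x + c * v' x) w = (\<integral>x. (g x + c * h x) * w x \<partial>\<mu>)"
          by (simp add: L2_inner_def)
      qed
    qed
  qed (rule top)
  then show ?thesis using that \<phi>D by blast
qed

end

section \<open>Localization of the eigenspaces\<close>

text \<open>\<open>basis_Fdom0\<close> picks the continuous representatives of the eigenfunctions,
  so that corner values and restrictions to cells can be used as linear conditions.\<close>

locale laplacian_basis = gasket_measure a X \<mu> + diagonal_operator \<mu> \<phi> "neg_laplacian a X \<mu>" l
  for a X \<mu> \<phi> l +
  assumes basis_Fdom0: "\<And>n. \<phi> n \<in> Fdom0"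
begin

abbreviation T where "T \<equiv> neg_laplacian a X \<mu>"

text \<open>The operator provides some continuous representative; two continuous functions equal
  almost everywhere agree on \<open>X\<close>, so the weak equation holds for
  \<open>\<phi> n\<close> itself.\<close>

lemma energy_eigenfunction:
  assumes "v \<in> Fdom0"
  shows "energy a (\<phi> n) v = l n * L2_inner \<mu> (\<phi> n) v"
proof -
  obtain u where u: "u \<in> Fdom0" "AE x in \<mu>. \<phi> n x = u x"
      "\<And>v. v \<in> Fdom0 \<Longrightarrow> energy a u v = (\<integral>x. l n * \<phi> n x * v x \<partial>\<mu>)"
    using op_eigenfunction[of n] unfolding neg_laplacian_def by blast
  have "\<phi> n x = u x" if "x \<in> X" for x
    using continuous_AE_0[of "\<lambda>x. \<phi> n x - u x", OF _ _ that] u(1,2) basis_Fdom0[of n]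
    by (simp add: continuous_on_diff Fdom_continuous Fdom0_Fdom)
  then have "energy a (\<phi> n) v = energy a u v" by (intro energy_cong) auto
  then show ?thesis using u(3)[OF assms] by (simp add: L2_inner_def mult.assoc)
qed

lemma eigenvalue_nonneg: "0 \<le> l n"
  using energy_eigenfunction[OF basis_Fdom0, of n n] energy_nonneg[OF Fdom0_Fdom[OF basis_Fdom0[of n]]]
  by (simp add: orthonormal)

lemma neumann_eigenspace:
  assumes "u \<in> neumann z" "u \<in> vanishing"
  shows "u \<in> eigenspace \<mu> T z"
proof -
  have u: "u \<in> Fdom" "u \<in> L2 \<mu>" using assms(1) by (auto simp: neumann_def Fdom_L2)
  have "neg_laplacian a X \<mu> u (\<lambda>x. z * u x)"
    unfolding neg_laplacian_def
  proof (intro conjI bexI[of _ u] ballI u L2_scale)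
    show "u \<in> Fdom0" using u assms(2) by (simp add: Fdom0_iff)
    show "energy a u v = (\<integral>x. z * u x * v x \<partial>\<mu>)" if "v \<in> Fdom0" for v
      using assms(1) Fdom0_Fdom[OF that] by (simp add: neumann_def mult.assoc)
  qed simp
  then show ?thesis using u by (simp add: eigenspace_def)
qed

lemma inner_place_same:
  assumes "u \<in> vanishing" "u \<in> Fdom" "v \<in> vanishing" "v \<in> Fdom" "w \<in> words"
  shows "L2_inner \<mu> (place w u) (place w v) = L2_inner \<mu> u v / 3 ^ length w"
proof -
  have "L2_inner \<mu> (place w u) (place w v) = (\<integral>x. u x * place w v (F_word a w x) \<partial>\<mu>) / 3 ^ length w"
    unfolding L2_inner_def by (intro integral_place assms Fdom_continuous place_Fdom)
  also have "(\<integral>x. u x * place w v (F_word a w x) \<partial>\<mu>) = L2_inner \<mu> u v"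
    unfolding L2_inner_def
    by (rule Bochner_Integration.integral_cong) (use assms in \<open>auto simp: place_F_word\<close>)
  finally show ?thesis .
qed

lemma inner_place_distinct:
  assumes "u \<in> vanishing" "u \<in> Fdom" "v \<in> vanishing" "v \<in> Fdom" "w \<in> words" "w' \<in> words"
    "length w = length w'" "w \<noteq> w'"
  shows "L2_inner \<mu> (place w u) (place w' v) = 0"
proof -
  have "L2_inner \<mu> (place w u) (place w' v) = (\<integral>x. u x * place w' v (F_word a w x) \<partial>\<mu>) / 3 ^ length w"
    unfolding L2_inner_def by (intro integral_place assms Fdom_continuous place_Fdom)
  also have "(\<integral>x. u x * place w' v (F_word a w x) \<partial>\<mu>) = (\<integral>x. 0 \<partial>\<mu>)"
    by (rule Bochner_Integration.integral_cong) (use assms in \<open>auto simp: place_F_word\<close>)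
  finally show ?thesis by simp
qed

text \<open>The sequence, read from the level of birth, starts with 6 and has limit
  \<open>z / 5 ^ j\<close>. Two levels of gluing give a localized eigenfunction for
  \<open>25 * (z / 5 ^ j)\<close>, and a word of length \<open>j - 2\<close> supplies the remaining
  powers of 5.\<close>

lemma six_series_multiplicity:
  assumes "six_series_eigenvalue a X \<mu> j z" "j \<ge> 2"
  shows "3 ^ (j - 2) \<le> card {n. l n = z}"
proof -
  obtain s where s: "decimation_sequence j s" "s j = 6" "(\<lambda>m. 3 / 2 * (5 ^ m * s m)) \<longlonglongrightarrow> z"
    using assms(1) unfolding six_series_eigenvalue_def by blast
  define L where "L m = s (m + j)" for m
  have L: "decimates L" "L 0 = 6"
    using s(1,2) by (auto simp: decimates_def decimation_sequence_def L_def)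
  have "(\<lambda>m. 3 / 2 * (5 ^ (m + j) * s (m + j)) / 5 ^ j) \<longlonglongrightarrow> z / 5 ^ j"
    by (intro tendsto_divide tendsto_const LIMSEQ_ignore_initial_segment[OF s(3)]) simp
  then have "(\<lambda>m. 3 / 2 * (5 ^ m * L m)) \<longlonglongrightarrow> z / 5 ^ j"
    by (simp add: power_add L_def)
  from localized_eigenfunction[OF L this] obtain h
    where h: "h \<in> neumann (25 * (z / 5 ^ j))" "\<And>k. k \<in> I3 \<Longrightarrow> h (a k) = 0" "h (F 1 (a 2)) = 2" by blast
  have hF: "h \<in> Fdom" and hV: "h \<in> vanishing" using h(1,2) by (auto simp: neumann_def vanishing_def)
  define i where "i = j - 2"
  have i: "j = i + 2" using assms(2) by (simp add: i_def)
  have z: "5 ^ (j - 2) * (25 * (z / 5 ^ j)) = z" by (simp add: i power_add)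
  have "L2_inner \<mu> h h > 0"
  proof (rule ccontr)
    assume "\<not> L2_inner \<mu> h h > 0"
    then have "L2_inner \<mu> h h = 0" using L2_inner_self_nonneg[of \<mu> h] by linarith
    then have "AE x in \<mu>. h x = 0" using L2_inner_self_eq_0_iff[OF Fdom_L2[OF hF]] by simp
    moreover have "F 1 (a 2) \<in> X" by (intro F_in_X vertex_in_X) auto
    ultimately have "h (F 1 (a 2)) = 0" by (rule continuous_AE_0[OF Fdom_continuous[OF hF]])
    then show False using h(3) by simp
  qed
  then have "card (word_set (j - 2)) \<le> card {n. l n = z}"
  proof (intro card_orthogonal_le[where e = "\<lambda>w. place w h"])
    fix w assume w: "w \<in> word_set (j - 2)"
    then have ww: "w \<in> words" "length w = j - 2" by (auto simp: word_set_def)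
    show "place w h \<in> eigenspace \<mu> T z"
      using place_neumann[OF hV h(1), of w] place_vanishing[OF hV, of w] z ww by (intro neumann_eigenspace) auto
    show "L2_inner \<mu> (place w h) (place w h) > 0" if "L2_inner \<mu> h h > 0"
      using that by (simp add: inner_place_same[OF hV hF hV hF ww(1)])
    fix w' assume "w' \<in> word_set (j - 2)" "w \<noteq> w'"
    then show "L2_inner \<mu> (place w h) (place w' h) = 0"
      using ww by (intro inner_place_distinct hV hF) (auto simp: word_set_def)
  qed auto
  then show ?thesis by (simp add: card_word_set)
qed

lemma energy_sum:
  assumes "finite I" "\<And>i. i \<in> I \<Longrightarrow> f i \<in> Fdom" "w \<in> Fdom"
  shows "(\<lambda>x. \<Sum>i\<in>I. c i * f i x) \<in> Fdom \<and>
    energy a (\<lambda>x. \<Sum>i\<in>I. c i * f i x) w = (\<Sum>i\<in>I. c i * energy a (f i) w)"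
  using assms
proof (induction I rule: finite_induct)
  case empty
  then show ?case by (simp add: zero_Fdom energy_zero)
next
  case (insert i I)
  then show ?case
    using Fdom_linear[of "\<lambda>x. \<Sum>i\<in>I. c i * f i x" "f i" "c i"]
      energy_linear[of "\<lambda>x. \<Sum>i\<in>I. c i * f i x" "f i" w "c i"] by (simp add: add.commute)
qed

text \<open>Together with \<open>Fdom0\<close> the three functions \<open>b i\<close> span \<open>Fdom\<close>.\<close>

lemma neumannI:
  assumes u: "u \<in> Fdom"
    and 0: "\<And>v. v \<in> Fdom0 \<Longrightarrow> energy a u v = \<kappa> * L2_inner \<mu> u v"
    and b: "\<And>i. i \<in> I3 \<Longrightarrow> b i \<in> Fdom" "\<And>i k. i \<in> I3 \<Longrightarrow> k \<in> I3 \<Longrightarrow> b i (a k) = (if k = i then 1 else 0)"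
    and eb: "\<And>i. i \<in> I3 \<Longrightarrow> energy a u (b i) = \<kappa> * L2_inner \<mu> u (b i)"
  shows "u \<in> neumann \<kappa>"
proof -
  have "energy a u v = \<kappa> * (\<integral>x. u x * v x \<partial>\<mu>)" if v: "v \<in> Fdom" for v
  proof -
    \<comment> \<open>\<open>s\<close> interpolates the corner values of \<open>v\<close>, so
      \<open>v - s\<close> is an admissible Dirichlet test function.\<close>
    define s where "s x = (\<Sum>i\<in>I3. v (a i) * b i x)" for x
    have s: "s \<in> Fdom" "energy a s u = (\<Sum>i\<in>I3. v (a i) * energy a (b i) u)"
      using energy_sum[of I3 b u "\<lambda>i. v (a i)"] b(1) u unfolding s_def[abs_def] by auto
    have "s (a k) = v (a k)" if "k \<in> I3" for k
    proof -
      have "s (a k) = (\<Sum>i\<in>I3. if k = i then v (a i) else 0)"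
        unfolding s_def using b(2) that by (intro sum.cong) auto
      then show ?thesis using that by simp
    qed
    then have w: "(\<lambda>x. v x + (-1) * s x) \<in> Fdom0"
      using Fdom_linear[OF v s(1), of "-1"] by (simp add: Fdom0_iff vanishing_def)
    have L2: "u \<in> L2 \<mu>" "v \<in> L2 \<mu>" "s \<in> L2 \<mu>" using u v s by (auto intro: Fdom_L2)
    have "energy a u v - energy a u s = \<kappa> * (L2_inner \<mu> u v - L2_inner \<mu> u s)"
      using 0[OF w] energy_linear_right[OF v s(1) u, of "-1"] L2
      by (simp add: L2_inner_diff_right)
    moreover have "energy a u s = \<kappa> * L2_inner \<mu> u s"
    proof -
      have "L2_inner \<mu> u s = (\<Sum>i\<in>I3. v (a i) * L2_inner \<mu> u (b i))"
        unfolding s_def[abs_def] using b(1) L2 by (intro L2_inner_sum_right) (auto intro: Fdom_L2)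
      then show ?thesis
        using s(2) eb by (simp add: energy_commute[of _ u] sum_distrib_left mult_ac)
    qed
    ultimately show ?thesis by (simp add: L2_inner_def[of \<mu> u v] algebra_simps)
  qed
  then show ?thesis using u by (simp add: neumann_def)
qed

text \<open>Membership guarantees that the zero extension of a copy in any cell is a global
  eigenfunction, for the rescaled eigenvalue.\<close>

definition local_space :: "real \<Rightarrow> (real^2 \<Rightarrow> real) set" where
  "local_space \<kappa> = neumann \<kappa> \<inter> vanishing"

definition orthonormal_in :: "real \<Rightarrow> nat \<Rightarrow> (nat \<Rightarrow> real^2 \<Rightarrow> real) \<Rightarrow> bool" where
  "orthonormal_in \<kappa> v e \<longleftrightarrow> (\<forall>i<v. e i \<in> local_space \<kappa>) \<and>
     (\<forall>i<v. \<forall>k<v. L2_inner \<mu> (e i) (e k) = (if i = k then 1 else 0))"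

lemma local_spaceD:
  assumes "u \<in> local_space \<kappa>"
  shows "u \<in> vanishing" "u \<in> Fdom" "u \<in> neumann \<kappa>" "u \<in> L2 \<mu>"
  using assms by (auto simp: local_space_def neumann_def Fdom_L2)

lemma local_space_scale:
  assumes "u \<in> local_space \<kappa>"
  shows "(\<lambda>x. c * u x) \<in> local_space \<kappa>"
proof -
  note u = local_spaceD[OF assms]
  have "(\<lambda>x. 0 + c * u x) \<in> Fdom" by (rule Fdom_linear[OF zero_Fdom u(2)])
  moreover have "energy a (\<lambda>x. 0 + c * u x) v = 0 + c * energy a u v" if "v \<in> Fdom" for v
    using energy_linear[OF zero_Fdom u(2) that, of c] by (simp add: energy_zero)
  ultimately show ?thesis
    using u(1,3) by (simp add: local_space_def neumann_def vanishing_def mult.assoc)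
qed

text \<open>An orthonormal family of the local space, copied into one \<open>N\<close>-cell, is
  orthogonal in the eigenspace of \<open>z\<close>, so its size is bounded. A family of maximal size
  therefore exists, and \<open>v\<close> plays the role of the dimension of
  \<open>local_space \<kappa>\<close>.\<close>

lemma maximal_local_family:
  assumes z: "z = 5 ^ N * \<kappa>"
  obtains v e where "orthonormal_in \<kappa> v e"
    "\<And>u. u \<in> local_space \<kappa> \<Longrightarrow> (\<And>i. i < v \<Longrightarrow> L2_inner \<mu> u (e i) = 0) \<Longrightarrow> L2_inner \<mu> u u = 0"
proof -
  define w where "w = replicate N (1::nat)"
  have w: "w \<in> words" "length w = N" by (auto simp: w_def words_def)
  have bound: "v \<le> card {n. l n = z}" if "orthonormal_in \<kappa> v e" for v e
  proof -
    note e = that[unfolded orthonormal_in_def]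
    have "card {..<v} \<le> card {n. l n = z}"
    proof (rule card_orthogonal_le[where e = "\<lambda>i. place w (e i)"])
      fix i assume "i \<in> {..<v}"
      then have i: "e i \<in> local_space \<kappa>" "i < v" using e by auto
      note ei = local_spaceD[OF i(1)]
      show "place w (e i) \<in> eigenspace \<mu> T z"
        using place_neumann[OF ei(1,3), of w] place_vanishing[OF ei(1)] w z by (intro neumann_eigenspace) auto
      show "L2_inner \<mu> (place w (e i)) (place w (e i)) > 0"
        using e i(2) by (simp add: inner_place_same[OF ei(1,2) ei(1,2) w(1)])
      fix k assume "k \<in> {..<v}" "i \<noteq> k"
      then have k: "e k \<in> local_space \<kappa>" "k < v" using e by auto
      show "L2_inner \<mu> (place w (e i)) (place w (e k)) = 0"
        using e i(2) k(2) \<open>i \<noteq> k\<close> by (simp add: inner_place_same[OF ei(1,2) local_spaceD(1,2)[OF k(1)] w(1)])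
    qed simp
    then show ?thesis by simp
  qed
  let ?S = "{v. \<exists>e. orthonormal_in \<kappa> v e}"
  have fin: "finite ?S" by (rule finite_subset[of _ "{..card {n. l n = z}}"]) (use bound in auto)
  have "0 \<in> ?S" by (simp add: orthonormal_in_def)
  then have "Max ?S \<in> ?S" using fin by (intro Max_in) auto
  moreover define v where "v = Max ?S"
  ultimately obtain e where e: "orthonormal_in \<kappa> v e" by auto
  show ?thesis
  proof (rule that[OF e])
    fix u assume u: "u \<in> local_space \<kappa>" "\<And>i. i < v \<Longrightarrow> L2_inner \<mu> u (e i) = 0"
    show "L2_inner \<mu> u u = 0"
    proof (rule ccontr)
      assume nz: "L2_inner \<mu> u u \<noteq> 0"
      define c where "c = 1 / L2_norm \<mu> u"
      have c: "c * (c * L2_inner \<mu> u u) = 1"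
        using nz by (simp add: c_def L2_norm_power2[symmetric] power2_eq_square)
      have "orthonormal_in \<kappa> (Suc v) (e(v := \<lambda>x. c * u x))"
        using e u(2) local_space_scale[OF u(1), of c] c unfolding orthonormal_in_def
        by (auto simp: less_Suc_eq L2_inner_scale_left L2_inner_scale_right L2_inner_commute[of \<mu> "e _" u])
      then have "Suc v \<le> v" unfolding v_def using fin by (intro Max_ge) auto
      then show False by simp
    qed
  qed
qed

text \<open>Six conditions in each \<open>N\<close>-cell, on the values at the corners and on the tests against \<open>b i\<close>, make
  the restriction to the cell an element of the local space; \<open>v\<close> more make it vanish.\<close>

lemma eigenspace_dim_le:
  assumes z: "z = 5 ^ N * \<kappa>" and e: "orthonormal_in \<kappa> v e"
    and maximal: "\<And>u. u \<in> local_space \<kappa> \<Longrightarrow> (\<And>i. i < v \<Longrightarrow> L2_inner \<mu> u (e i) = 0) \<Longrightarrow> L2_inner \<mu> u u = 0"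
  shows "card {n. l n = z} \<le> 3 ^ N * (v + 6)"
proof (rule ccontr)
  assume less: "\<not> card {n. l n = z} \<le> 3 ^ N * (v + 6)"
  let ?I = "{n. l n = z}" and ?K = "word_set N \<times> {..<v + 6}"
  define b where "b i = harmonic (\<lambda>k. if k = i then 1 else 0)" for i
  have b: "b i \<in> Fdom" "k \<in> I3 \<Longrightarrow> b i (a k) = (if k = i then 1 else 0)" for i k
    by (simp_all add: b_def harmonic_Fdom harmonic_vertex)
  \<comment> \<open>Layout of the equations for \<open>t < v + 6\<close>: first the tests against
    \<open>e\<close>, then the corners \<open>t - v + 1\<close> running from 1 to 3, then the weak
    derivatives with index \<open>t - v - 2\<close>, again from 1 to 3.\<close>
  define A where "A n = (\<lambda>(w, t). if t < v then L2_inner \<mu> (\<lambda>x. \<phi> n (F_word a w x)) (e t)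
    else if t < v + 3 then \<phi> n (F_word a w (a (t - v + 1)))
    else energy a (\<lambda>x. \<phi> n (F_word a w x)) (b (t - v - 2)) - \<kappa> * L2_inner \<mu> (\<lambda>x. \<phi> n (F_word a w x)) (b (t - v - 2)))" for n
  have fin: "finite ?I" by (rule finite_eigenvalues_eq)
  have "card ?K < card ?I" using less by (simp add: card_cartesian_product card_word_set)
  from homogeneous_system_nontrivial_solution[OF fin _ this, of A] obtain c
    where c: "\<exists>n\<in>?I. c n \<noteq> 0" "\<And>k. k \<in> ?K \<Longrightarrow> (\<Sum>n\<in>?I. c n * A n k) = 0" by auto
  define u where "u x = (\<Sum>n\<in>?I. c n * \<phi> n x)" for x
  have \<phi>F: "\<phi> n \<in> Fdom" for n by (rule Fdom0_Fdom[OF basis_Fdom0])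
  have u: "u \<in> Fdom" "\<And>v. v \<in> Fdom \<Longrightarrow> energy a u v = (\<Sum>n\<in>?I. c n * energy a (\<phi> n) v)"
    using energy_sum[OF fin, of \<phi> _ c] \<phi>F unfolding u_def[abs_def] by auto
  have u_inner: "L2_inner \<mu> u f = (\<Sum>n\<in>?I. c n * L2_inner \<mu> (\<phi> n) f)" if "f \<in> L2 \<mu>" for f
    unfolding u_def[abs_def] using that by (intro L2_inner_sum_left) (auto simp: in_L2)
  have u_weak: "energy a u f = z * L2_inner \<mu> u f" if "f \<in> Fdom0" for f
    using that by (simp add: u(2) u_inner Fdom0_Fdom Fdom_L2 energy_eigenfunction sum_distrib_left mult_ac)
  have restr0: "u (F_word a w y) = 0" if w: "w \<in> word_set N" and y: "y \<in> X" for w y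
  proof -
    have ww: "w \<in> words" "length w = N" using w by (auto simp: word_set_def)
    define r where "r n x = \<phi> n (F_word a w x)" for n x
    have rF: "r n \<in> Fdom" for n unfolding r_def[abs_def] by (intro Fdom_comp_F_word ww \<phi>F)
    define uw where "uw x = (\<Sum>n\<in>?I. c n * r n x)" for x
    have uw_eq: "uw x = u (F_word a w x)" for x by (simp add: uw_def u_def r_def)
    have uw: "uw \<in> Fdom" "\<And>f. f \<in> Fdom \<Longrightarrow> energy a uw f = (\<Sum>n\<in>?I. c n * energy a (r n) f)"
      using energy_sum[OF fin, of r _ c] rF unfolding uw_def[abs_def] by auto
    have uw_inner: "L2_inner \<mu> uw f = (\<Sum>n\<in>?I. c n * L2_inner \<mu> (r n) f)" if "f \<in> L2 \<mu>" for f
      unfolding uw_def[abs_def] using that by (intro L2_inner_sum_left) (auto intro: Fdom_L2 rF)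
    have eL2: "e t \<in> L2 \<mu>" if "t < v" for t using e that local_spaceD by (auto simp: orthonormal_in_def)
    have 1: "L2_inner \<mu> uw (e t) = 0" if "t < v" for t
      using c(2)[of "(w, t)"] w that by (simp add: uw_inner eL2 A_def r_def[abs_def])
    have 2: "uw (a k) = 0" if "k \<in> I3" for k
    proof -
      have "\<not> v + (k - 1) < v" "v + (k - 1) < v + 3" "v + (k - 1) - v + 1 = k" using that by auto
      then have "A n (w, v + (k - 1)) = r n (a k)" for n unfolding A_def r_def prod.case by (simp only: if_False if_True)
      moreover have "(w, v + (k - 1)) \<in> ?K" using w that by auto
      ultimately show ?thesis using c(2)[of "(w, v + (k - 1))"] by (simp add: uw_def)
    qed
    have 3: "energy a uw (b k) = \<kappa> * L2_inner \<mu> uw (b k)" if "k \<in> I3" for k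
    proof -
      have "\<not> v + (k + 2) < v" "\<not> v + (k + 2) < v + 3" "v + (k + 2) - v - 2 = k" using that by auto
      then have "A n (w, v + (k + 2)) = energy a (r n) (b k) - \<kappa> * L2_inner \<mu> (r n) (b k)" for n
        unfolding A_def r_def[abs_def] prod.case by (simp only: if_False)
      then have "(\<Sum>n\<in>?I. c n * (energy a (r n) (b k) - \<kappa> * L2_inner \<mu> (r n) (b k))) = 0"
        using c(2)[of "(w, v + (k + 2))"] w that by simp
      then show ?thesis
        by (simp add: uw uw_inner b Fdom_L2 right_diff_distrib sum_subtractf sum_distrib_left mult_ac)
    qed
    have 4: "energy a uw f = \<kappa> * L2_inner \<mu> uw f" if f: "f \<in> Fdom0" for f
    proof -
      have fV: "f \<in> vanishing" "f \<in> Fdom" using f by (auto simp: Fdom0_iff)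
      \<comment> \<open>The equation inside the cell comes from testing \<open>u\<close> with the
        copy of \<open>f\<close>: energies scale by \<open>(5 / 3) ^ N\<close>, integrals by
        \<open>1 / 3 ^ N\<close>, and \<open>z = 5 ^ N * \<kappa>\<close> balances them.\<close>
      have p: "place w f \<in> Fdom0"
        using place_Fdom[OF fV] place_vanishing[OF fV(1)] by (simp add: Fdom0_iff)
      have "(5 / 3) ^ N * energy a f uw = energy a u (place w f)"
        using energy_place[OF fV ww(1) u(1)] unfolding ww(2) energy_commute[of u] uw_eq[abs_def] by simp
      also have "\<dots> = z * L2_inner \<mu> (place w f) u"
        using u_weak[OF p] by (simp add: L2_inner_commute)
      also have "L2_inner \<mu> (place w f) u = L2_inner \<mu> f uw / 3 ^ N"
        using integral_place[OF fV ww(1) Fdom_continuous[OF u(1)]] unfolding ww(2) L2_inner_def uw_eq[abs_def] by simp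
      finally have "(5 / 3) ^ N * energy a f uw = (5 / 3) ^ N * (\<kappa> * L2_inner \<mu> f uw)"
        by (simp add: z power_divide)
      then show ?thesis by (simp add: energy_commute[of uw] L2_inner_commute[of \<mu> uw])
    qed
    have "uw \<in> neumann \<kappa>"
      using uw(1) 4 b 3 by (rule neumannI)
    then have "uw \<in> local_space \<kappa>" using 2 by (simp add: local_space_def vanishing_def)
    from maximal[OF this 1] have "AE x in \<mu>. uw x = 0"
      using L2_inner_self_eq_0_iff[OF Fdom_L2[OF uw(1)]] by simp
    from continuous_AE_0[OF Fdom_continuous[OF uw(1)] this y] show ?thesis by (simp add: uw_eq)
  qed
  have "u x = 0" if x: "x \<in> X" for x
  proof -
    obtain w y where "w \<in> word_set N" "y \<in> X" "x = F_word a w y" using cell_of[OF x] .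
    then show ?thesis using restr0 by simp
  qed
  then have "AE x in \<mu>. u x = 0" by (intro AE_I2) simp
  then have "L2_inner \<mu> u u = 0" using L2_inner_self_eq_0_iff[OF Fdom_L2[OF u(1)]] by simp
  then have "\<forall>n\<in>?I. c n = 0"
    unfolding u_def[abs_def] using fin by (simp add: inner_sum_sum sum_nonneg_eq_0_iff)
  then show False using c(1) by auto
qed

end

section \<open>Weak convergence of the characteristic measures\<close>

lemma card_filter_fibres:
  assumes "finite A" "finite Z" "f ` A \<subseteq> Z"
  shows "card {i \<in> A. P (f i)} = (\<Sum>z\<in>{z \<in> Z. P z}. card {i \<in> A. f i = z})"
proof -
  have "{i \<in> A. P (f i)} = (\<Union>z\<in>{z \<in> Z. P z}. {i \<in> A. f i = z})" using assms(3) by auto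
  then show ?thesis using assms(1,2) by (simp add: card_UN_disjoint disjoint_iff)
qed

context maximal_diagonal_operator
begin

lemma enumerates_spectrum_exists:
  assumes "finite {k. l k \<in> I}"
  obtains \<nu> where "enumerates_spectrum_in M T I (card {k. l k \<in> I}) \<nu>"
proof -
  let ?K = "{k. l k \<in> I}"
  obtain b where b: "bij_betw b {1..card ?K} ?K"
    using ex_bij_betw_nat_finite_1[OF assms] by blast
  define \<nu> where "\<nu> i = l (b i)" for i
  have img: "\<nu> ` {1..card ?K} = range l \<inter> I"
    using b by (auto simp: \<nu>_def bij_betw_def image_image[symmetric])
  have "card {i \<in> {1..card ?K}. \<nu> i = z} = card {k. l k = z}" if "z \<in> I" for z
  proof (rule bij_betw_same_card)
    have "b ` {i \<in> {1..card ?K}. \<nu> i = z} = {k \<in> b ` {1..card ?K}. l k = z}" by (auto simp: \<nu>_def)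
    also have "\<dots> = {k. l k = z}" unfolding bij_betw_imp_surj_on[OF b] using that by auto
    finally show "bij_betw b {i \<in> {1..card ?K}. \<nu> i = z} {k. l k = z}"
      by (intro bij_betw_subset[OF b]) auto
  qed
  then have "enumerates_spectrum_in M T I (card ?K) \<nu>"
    unfolding enumerates_spectrum_in_def spectrum_eq img
    using eigenspace_has_dim is_eigenvalue_iff by auto
  then show ?thesis by (rule that)
qed

lemma card_enumerated:
  assumes fin: "finite {k. l k \<in> I}" and \<nu>: "enumerates_spectrum_in M T I d \<nu>"
  shows "card {i \<in> {1..d}. P (\<nu> i)} = card {k. l k \<in> I \<and> P (l k)}"
proof -
  let ?Z = "\<nu> ` {1..d}"
  have Z: "?Z = range l \<inter> I" using \<nu> by (simp add: enumerates_spectrum_in_def spectrum_eq)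
  have "card {i \<in> {1..d}. \<nu> i = z} = card {k \<in> {k. l k \<in> I}. l k = z}" if "z \<in> ?Z" for z
  proof -
    have "L2_has_dim M (eigenspace M T z) (card {i \<in> {1..d}. \<nu> i = z})"
      using \<nu> that unfolding enumerates_spectrum_in_def by blast
    from L2_has_dim_unique[OF this eigenspace_has_dim] have "card {i \<in> {1..d}. \<nu> i = z} = card {k. l k = z}" .
    also have "{k. l k = z} = {k \<in> {k. l k \<in> I}. l k = z}" using that Z by auto
    finally show ?thesis .
  qed
  moreover have "card {i \<in> {1..d}. P (\<nu> i)} = (\<Sum>z\<in>{z \<in> ?Z. P z}. card {i \<in> {1..d}. \<nu> i = z})"
    by (rule card_filter_fibres) auto
  moreover have "card {k \<in> {k. l k \<in> I}. P (l k)} = (\<Sum>z\<in>{z \<in> ?Z. P z}. card {k \<in> {k. l k \<in> I}. l k = z})"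
    by (rule card_filter_fibres[OF fin finite_imageI[OF finite_atLeastAtMost]]) (use Z in auto)
  ultimately show ?thesis by simp
qed

end

lemma cdf_distr_uniform_count:
  assumes "d > (0::nat)"
  shows "cdf (distr (uniform_count_measure {1..d}) borel x) t = card {i \<in> {1..d}. x i \<le> t} / d"
proof -
  have "cdf (distr (uniform_count_measure {1..d}) borel x) t = measure (uniform_count_measure {1..d}) (x -` {..t} \<inter> {1..d})"
    unfolding cdf_def by (subst measure_distr) (auto simp: space_uniform_count_measure measurable_cong_sets[OF sets_uniform_count_measure_count_space refl])
  also have "\<dots> = card (x -` {..t} \<inter> {1..d}) / d"
    by (subst measure_uniform_count_measure) auto
  also have "x -` {..t} \<inter> {1..d} = {i \<in> {1..d}. x i \<le> t}" by auto
  finally show ?thesis .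
qed

text \<open>Lower bounds suffice because all measures have mass 1: a bound from below to the right
  of \<open>t\<close> is one from above for the distribution function at \<open>t\<close>. Shrinking
  by \<open>\<delta>\<close> is harmless at continuity points, which is where weak convergence is
  tested.\<close>

lemma lower_counts_imp_weak_convergence:
  fixes x :: "nat \<Rightarrow> nat \<Rightarrow> real" and d :: "nat \<Rightarrow> nat" and g :: "real \<Rightarrow> real"
  assumes M0: "real_distribution M0" and conc: "measure M0 {m1..m2} = 1" and d: "\<And>j. d j > 0"
    and lower: "\<And>s1 s2 \<delta> \<epsilon>. \<delta> > 0 \<Longrightarrow> \<epsilon> > 0 \<Longrightarrow>
      \<forall>\<^sub>F j in sequentially. measure M0 {s1 + \<delta>..s2 - \<delta>} - \<epsilon> \<le> card {i \<in> {1..d j}. x j i \<in> {s1..s2}} / d j"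
    and g: "continuous_on UNIV g" "\<And>t. \<bar>g t\<bar> \<le> B"
  shows "(\<lambda>j. (\<Sum>i\<in>{1..d j}. g (x j i)) / d j) \<longlonglongrightarrow> (\<integral>t. g t \<partial>M0)"
proof -
  interpret M0: real_distribution M0 by (rule M0)
  define M where "M j = distr (uniform_count_measure {1..d j}) borel (x j)" for j
  have meas: "x j \<in> measurable (uniform_count_measure {1..d j}) borel" for j
    by (simp add: measurable_cong_sets[OF sets_uniform_count_measure_count_space refl])
  have M: "real_distribution (M j)" for j
  proof -
    interpret U: prob_space "uniform_count_measure {1..d j}"
      using d[of j] by (intro prob_space_uniform_count_measure) auto
    show ?thesis
      unfolding M_def by (rule U.real_distribution_distr) (rule meas)
  qed
  have inter: "measure M0 A = measure M0 (A \<inter> {m1..m2})" if "A \<in> sets borel" for A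
  proof -
    have "AE t in M0. t \<in> {m1..m2}"
      by (rule M0.AE_prob_1) (rule conc)
    then show ?thesis
      using that by (intro M0.finite_measure_eq_AE) (auto elim: eventually_mono)
  qed
  have "weak_conv_m M M0"
    unfolding weak_conv_m_def weak_conv_def
  proof (intro allI impI)
    fix t assume cont: "isCont (cdf M0) t"
    show "(\<lambda>j. cdf (M j) t) \<longlonglongrightarrow> cdf M0 t"
    proof (rule LIMSEQ_I)
      fix \<epsilon> :: real assume \<epsilon>: "\<epsilon> > 0"
      obtain r where r: "r > 0" "\<And>s. dist s t < r \<Longrightarrow> dist (cdf M0 s) (cdf M0 t) < \<epsilon> / 2"
        using cont \<epsilon> unfolding continuous_at_eps_delta by (metis half_gt_zero)
      \<comment> \<open>A third of \<open>r\<close>, as \<open>t + 2 * \<delta>\<close> must stay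
        within the radius of continuity.\<close>
      define \<delta> where "\<delta> = r / 3"
      have \<delta>: "\<delta> > 0" "\<bar>cdf M0 (t - \<delta>) - cdf M0 t\<bar> < \<epsilon> / 2" "\<bar>cdf M0 (t + 2 * \<delta>) - cdf M0 t\<bar> < \<epsilon> / 2"
        using r(1) r(2)[of "t - \<delta>"] r(2)[of "t + 2 * \<delta>"] by (auto simp: \<delta>_def dist_real_def)
      have "\<forall>\<^sub>F j in sequentially. norm (cdf (M j) t - cdf M0 t) < \<epsilon>"
        \<comment> \<open>Shrunk by \<open>\<delta>\<close>, these intervals become
          \<open>{m1..t - \<delta>}\<close> and \<open>{t + 2 * \<delta>..m2}\<close>; the gap
          between \<open>t\<close> and \<open>t + \<delta>\<close> keeps the two counts
          disjoint.\<close>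
        using lower[OF \<delta>(1) half_gt_zero[OF \<epsilon>], of "m1 - \<delta>" t] lower[OF \<delta>(1) half_gt_zero[OF \<epsilon>], of "t + \<delta>" "m2 + \<delta>"]
      proof eventually_elim
        case (elim j)
        have cdfM: "cdf (M j) t = card {i \<in> {1..d j}. x j i \<le> t} / d j"
          unfolding M_def by (rule cdf_distr_uniform_count[OF d])
        have "measure M0 {m1 - \<delta> + \<delta>..t - \<delta>} = cdf M0 (t - \<delta>)"
          unfolding cdf_def by (subst (1 2) inter) (auto intro!: arg_cong[where f = "measure M0"])
        moreover have "real (card {i \<in> {1..d j}. x j i \<in> {m1 - \<delta>..t}}) / d j \<le> cdf (M j) t"
          unfolding cdfM using d[of j] by (intro divide_right_mono) (auto intro!: card_mono)
        ultimately have 1: "cdf M0 (t - \<delta>) - \<epsilon> / 2 \<le> cdf (M j) t"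
          using elim(1) by linarith
        have "measure M0 {t + \<delta> + \<delta>..m2 + \<delta> - \<delta>} \<ge> 1 - cdf M0 (t + 2 * \<delta>)"
        proof -
          have "1 - cdf M0 (t + 2 * \<delta>) = measure M0 {t + 2 * \<delta><..}"
            using M0.prob_compl[of "{..t + 2 * \<delta>}"] by (simp add: cdf_def Compl_eq_Diff_UNIV[symmetric] flip: Compl_atMost)
          also have "\<dots> = measure M0 ({t + 2 * \<delta><..} \<inter> {m1..m2})" by (rule inter) simp
          also have "\<dots> \<le> measure M0 {t + \<delta> + \<delta>..m2 + \<delta> - \<delta>}"
            by (rule M0.finite_measure_mono) auto
          finally show ?thesis .
        qed
        moreover have "real (card {i \<in> {1..d j}. x j i \<in> {t + \<delta>..m2 + \<delta>}}) / d j \<le> 1 - cdf (M j) t"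
        proof -
          have "card {i \<in> {1..d j}. x j i \<in> {t + \<delta>..m2 + \<delta>}} + card {i \<in> {1..d j}. x j i \<le> t}
              = card ({i \<in> {1..d j}. x j i \<in> {t + \<delta>..m2 + \<delta>}} \<union> {i \<in> {1..d j}. x j i \<le> t})"
            using \<delta>(1) by (intro card_Un_disjoint[symmetric]) auto
          also have "\<dots> \<le> card {1..d j}" by (rule card_mono) auto
          finally have "real (card {i \<in> {1..d j}. x j i \<in> {t + \<delta>..m2 + \<delta>}}) \<le> real (d j) - real (card {i \<in> {1..d j}. x j i \<le> t})"
            by simp
          from divide_right_mono[OF this, of "real (d j)"] show ?thesis
            unfolding cdfM using d[of j] by (simp add: diff_divide_distrib)
        qed
        ultimately have 2: "cdf (M j) t \<le> cdf M0 (t + 2 * \<delta>) + \<epsilon> / 2"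
          using elim(2) by linarith
        show ?case using 1 2 \<delta>(2,3) unfolding real_norm_def by linarith
      qed
      then show "\<exists>N. \<forall>j\<ge>N. norm (cdf (M j) t - cdf M0 t) < \<epsilon>" by (simp add: eventually_sequentially)
    qed
  qed
  then have "(\<lambda>j. \<integral>t. g t \<partial>M j) \<longlonglongrightarrow> (\<integral>t. g t \<partial>M0)"
    using g by (intro weak_conv_imp_integral_bdd_continuous_conv[OF M M0, where B = B]) (auto simp: continuous_on_eq_continuous_at)
  moreover have "(\<integral>t. g t \<partial>M j) = (\<Sum>i\<in>{1..d j}. g (x j i)) / d j" for j
    unfolding M_def
    by (subst integral_distr[OF meas]) (use g in \<open>auto simp: integral_uniform_count_measure intro: borel_measurable_continuous_onI\<close>)
  ultimately show ?thesis by simp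
qed

section \<open>Eigenvalues of the perturbed operator\<close>

locale gasket_schrodinger = laplacian_basis a X \<mu> \<phi> l +
  potential_perturbation \<mu> \<phi> "neg_laplacian a X \<mu>" l p chi m1 m2
  for a X \<mu> \<phi> l p chi m1 m2 +
  assumes chi_continuous: "continuous_on X chi"
begin

definition cells_in :: "nat \<Rightarrow> real \<Rightarrow> real \<Rightarrow> nat list set" where
  "cells_in N s1 s2 = {w \<in> word_set N. \<forall>x\<in>X. chi (F_word a w x) \<in> {s1..s2}}"

lemma card_cells_in_le: "card (cells_in N s1 s2) \<le> 3 ^ N"
  unfolding card_word_set[symmetric] by (rule card_mono) (auto simp: cells_in_def)

text \<open>Each cell of \<open>cells_in\<close> carries \<open>v\<close> localized eigenfunctions,
  and by \<open>eigenspace_dim_le\<close> the number \<open>v\<close> falls short of the equal share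
  of the multiplicity per cell by at most 6.\<close>

lemma cells_in_count:
  assumes \<psi>: "maximal_diagonal_operator \<mu> \<psi> H \<eta>"
  shows "card (cells_in N s1 s2) * (card {n. l n = z} / 3 ^ N - 6) \<le> card {k. \<eta> k \<in> {p z + s1..p z + s2}}"
proof -
  define \<kappa> where "\<kappa> = z / 5 ^ N"
  have z: "z = 5 ^ N * \<kappa>" by (simp add: \<kappa>_def)
  obtain v e where e: "orthonormal_in \<kappa> v e" and maximal: "\<And>u. u \<in> local_space \<kappa> \<Longrightarrow>
      (\<And>i. i < v \<Longrightarrow> L2_inner \<mu> u (e i) = 0) \<Longrightarrow> L2_inner \<mu> u u = 0"
    using maximal_local_family[OF z] by blast
  let ?A = "cells_in N s1 s2"
  have fin: "finite ?A" by (simp add: cells_in_def)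
  have W: "w \<in> words" "length w = N" if "w \<in> ?A" for w using that by (auto simp: cells_in_def word_set_def)
  have E: "e t \<in> vanishing" "e t \<in> Fdom" "e t \<in> neumann \<kappa>" if "t < v" for t
    using e that local_spaceD unfolding orthonormal_in_def by blast+
  have ee: "L2_inner \<mu> (e s) (e t) = (if s = t then 1 else 0)" if "s < v" "t < v" for s t
    using e that by (simp add: orthonormal_in_def)
  have "card (?A \<times> {..<v}) \<le> card {k. \<eta> k \<in> {p z + s1..p z + s2}}"
  proof (rule card_localized_le[OF \<psi>, where e = "\<lambda>(w, t). place w (e t)"])
    show "finite (?A \<times> {..<v})" using fin by simp
    fix i assume i: "i \<in> ?A \<times> {..<v}"
    obtain w t where wt: "i = (w, t)" "w \<in> ?A" "t < v" using i by auto
    show "(case i of (w, t) \<Rightarrow> place w (e t)) \<in> eigenspace \<mu> T z"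
      using place_neumann[OF E(1,3)[OF wt(3)], of w] place_vanishing[OF E(1)[OF wt(3)], of w] W[OF wt(2)]
      unfolding wt(1) by (auto simp: z intro: neumann_eigenspace)
    show "L2_inner \<mu> (case i of (w, t) \<Rightarrow> place w (e t)) (case i of (w, t) \<Rightarrow> place w (e t)) > 0"
      unfolding wt(1) using inner_place_same[OF E(1,2) E(1,2) W(1)] wt ee by simp
    show "AE x in \<mu>. (case i of (w, t) \<Rightarrow> place w (e t)) x = 0 \<or> chi x \<in> {s1..s2}"
    proof (rule AE_I2)
      fix x assume "x \<in> space \<mu>"
      then show "(case i of (w, t) \<Rightarrow> place w (e t)) x = 0 \<or> chi x \<in> {s1..s2}"
        using place_support[OF E(1)[OF wt(3)] W(1)[OF wt(2)]] wt(2) unfolding wt(1) by (auto simp: cells_in_def)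
    qed
    fix k assume k: "k \<in> ?A \<times> {..<v}" "i \<noteq> k"
    obtain w' t' where wt': "k = (w', t')" "w' \<in> ?A" "t' < v" using k by auto
    show "L2_inner \<mu> (case i of (w, t) \<Rightarrow> place w (e t)) (case k of (w, t) \<Rightarrow> place w (e t)) = 0"
    proof (cases "w = w'")
      case True
      then have "t \<noteq> t'" using k(2) wt wt' by auto
      then show ?thesis
        unfolding wt(1) wt'(1) prod.case True[symmetric]
        using inner_place_same[OF E(1,2)[OF wt(3)] E(1,2)[OF wt'(3)] W(1)[OF wt(2)]] ee[OF wt(3) wt'(3)] by simp
    next
      case False
      then show ?thesis
        unfolding wt(1) wt'(1) prod.case
        using E[OF wt(3)] E[OF wt'(3)] W[OF wt(2)] W[OF wt'(2)] by (intro inner_place_distinct) auto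
    qed
  qed
  then have "real (card ?A) * real v \<le> card {k. \<eta> k \<in> {p z + s1..p z + s2}}"
    unfolding card_cartesian_product card_lessThan by (metis of_nat_le_iff of_nat_mult)
  moreover have "card {n. l n = z} / 3 ^ N - 6 \<le> v"
  proof -
    have "real (card {n. l n = z}) \<le> real (3 ^ N * (v + 6))"
      using eigenspace_dim_le[OF z e maximal] by (simp only: of_nat_le_iff)
    then show ?thesis by (simp add: field_simps)
  qed
  then have "real (card ?A) * (card {n. l n = z} / 3 ^ N - 6) \<le> real (card ?A) * real v"
    by (rule mult_left_mono) simp
  ultimately show ?thesis by linarith
qed

text \<open>\<open>N\<close> depends on \<open>\<delta>\<close> only: once \<open>chi\<close> varies
  by less than \<open>\<delta>\<close> on \<open>N\<close>-cells, a cell on which it takes a value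
  in the shrunk interval has all its values in \<open>{s1..s2}\<close>.\<close>

lemma measure_le_cells_in:
  assumes "\<delta> > 0"
  obtains N where "\<And>s1 s2. measure \<mu> {x \<in> X. chi x \<in> {s1 + \<delta>..s2 - \<delta>}} \<le> card (cells_in N s1 s2) / 3 ^ N"
proof -
  obtain N where N: "\<And>m w x y. m \<ge> N \<Longrightarrow> w \<in> word_set m \<Longrightarrow> x \<in> X \<Longrightarrow> y \<in> X \<Longrightarrow>
      \<bar>chi (F_word a w x) - chi (F_word a w y)\<bar> < \<delta>"
    using oscillation_small[OF chi_continuous assms] by blast
  show ?thesis
  proof (rule that)
    fix s1 s2
    let ?A = "cells_in N s1 s2"
    have fin: "finite ?A" by (simp add: cells_in_def)
    have W: "w \<in> words" "w \<in> word_set N" if "w \<in> ?A" for w using that by (auto simp: cells_in_def word_set_def)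
    have sub: "{x \<in> X. chi x \<in> {s1 + \<delta>..s2 - \<delta>}} \<subseteq> (\<Union>w\<in>?A. F_word a w ` X)"
    proof
      fix x assume x: "x \<in> {x \<in> X. chi x \<in> {s1 + \<delta>..s2 - \<delta>}}"
      then obtain w y where w: "w \<in> word_set N" "y \<in> X" "x = F_word a w y" using cell_of by blast
      have "chi (F_word a w z) \<in> {s1..s2}" if "z \<in> X" for z
        using N[OF order_refl w(1) that w(2)] x unfolding w(3) by auto
      then show "x \<in> (\<Union>w\<in>?A. F_word a w ` X)" using w by (auto simp: cells_in_def)
    qed
    have "measure \<mu> {x \<in> X. chi x \<in> {s1 + \<delta>..s2 - \<delta>}} \<le> measure \<mu> (\<Union>w\<in>?A. F_word a w ` X)"
      using cell_sets W(1) fin by (intro finite_measure_mono sub sets.finite_UN) auto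
    also have "\<dots> \<le> (\<Sum>w\<in>?A. measure \<mu> (F_word a w ` X))"
      using cell_sets W(1) fin by (intro finite_measure_subadditive_finite) auto
    also have "\<dots> = (\<Sum>w\<in>?A. 1 / 3 ^ N)" by (intro sum.cong refl measure_cell W(2))
    also have "\<dots> = card ?A / 3 ^ N" by simp
    finally show "measure \<mu> {x \<in> X. chi x \<in> {s1 + \<delta>..s2 - \<delta>}} \<le> card ?A / 3 ^ N" .
  qed
qed

lemma cluster_count_lower:
  assumes \<psi>: "maximal_diagonal_operator \<mu> \<psi> H \<eta>"
    and top: "filterlim (\<lambda>j. real (card {n. l n = z j})) at_top sequentially" and "\<delta> > 0" "\<epsilon> > 0"
  shows "\<forall>\<^sub>F j in sequentially. measure \<mu> {x \<in> X. chi x \<in> {s1 + \<delta>..s2 - \<delta>}} - \<epsilon>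
    \<le> card {k. \<eta> k \<in> {p (z j) + m1..p (z j) + m2} \<and> \<eta> k - p (z j) \<in> {s1..s2}} / card {n. l n = z j}"
proof -
  let ?\<mu> = "measure \<mu> {x \<in> X. chi x \<in> {s1 + \<delta>..s2 - \<delta>}}"
  obtain N where "\<And>s1 s2. measure \<mu> {x \<in> X. chi x \<in> {s1 + \<delta>..s2 - \<delta>}} \<le> card (cells_in N s1 s2) / 3 ^ N"
    using measure_le_cells_in[OF assms(3)] by blast
  then have N: "?\<mu> \<le> card (cells_in N s1 s2) / 3 ^ N" .
  \<comment> \<open>Cutting the interval down to the range of \<open>chi\<close> changes no cell and
    puts the counted eigenvalues inside the cluster.\<close>
  define t1 t2 where "t1 = max s1 m1" and "t2 = min s2 m2"
  have cells: "cells_in N s1 s2 = cells_in N t1 t2"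
    using chi_range F_word_in_X by (fastforce simp: cells_in_def t1_def t2_def word_set_def)
  \<comment> \<open>The loss of 6 per cell, at most \<open>6 * 3 ^ N\<close> in all, is then at most
    \<open>\<epsilon>\<close> times the multiplicity; the summand 1 keeps the multiplicity
    positive.\<close>
  have "\<forall>\<^sub>F j in sequentially. real (card {n. l n = z j}) \<ge> 6 * 3 ^ N / \<epsilon> + 1"
    using top unfolding filterlim_at_top by blast
  then show ?thesis
  proof eventually_elim
    case (elim j)
    let ?d = "real (card {n. l n = z j})"
    let ?K = "{k. \<eta> k \<in> {p (z j) + m1..p (z j) + m2} \<and> \<eta> k - p (z j) \<in> {s1..s2}}"
    have "0 \<le> 6 * 3 ^ N / \<epsilon>" using assms(4) by simp
    then have d: "?d > 0" using elim by linarith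
    have K: "?K = {k. \<eta> k \<in> {p (z j) + t1..p (z j) + t2}}" by (auto simp: t1_def t2_def)
    have "6 * 3 ^ N \<le> \<epsilon> * ?d"
    proof -
      have "6 * 3 ^ N / \<epsilon> \<le> ?d" using elim by linarith
      then show ?thesis using assms(4) by (simp add: field_simps)
    qed
    moreover have "6 * real (card (cells_in N t1 t2)) \<le> 6 * 3 ^ N"
    proof -
      have "real (card (cells_in N t1 t2)) \<le> real (3 ^ N)"
        using card_cells_in_le by (rule of_nat_mono)
      then show ?thesis by simp
    qed
    moreover have "?\<mu> * ?d \<le> card (cells_in N t1 t2) / 3 ^ N * ?d"
      using N unfolding cells by (rule mult_right_mono) simp
    moreover have "card (cells_in N t1 t2) / 3 ^ N * ?d - 6 * real (card (cells_in N t1 t2)) \<le> card ?K"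
      using cells_in_count[OF \<psi>, of N t1 t2 "z j"] unfolding K by (simp add: right_diff_distrib)
    ultimately have "(?\<mu> - \<epsilon>) * ?d \<le> card ?K" unfolding left_diff_distrib by linarith
    then show ?case using d by (simp add: pos_le_divide_eq)
  qed
qed

end

section \<open>The limit theorem\<close>

text \<open>Separation from the fixed point \<open>lbar\<close> alone gives growth at least like a
  positive power.\<close>

lemma filterlim_at_top_if_power_separated:
  fixes p :: "real \<Rightarrow> real"
  assumes "c > 0" "\<beta> > 0" "mono_on {lbar..} p"
    and sep: "\<forall>s\<ge>lbar. \<forall>t\<ge>lbar. \<bar>p s - p t\<bar> \<ge> c * \<bar>s - t\<bar> powr \<beta>"
  shows "filterlim p at_top at_top"
  unfolding filterlim_at_top
proof
  fix B
  \<comment> \<open>The maximum with 1 keeps \<open>R\<close> positive, so that the powers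
    \<open>1 / \<beta>\<close> and \<open>\<beta>\<close> cancel.\<close>
  define R where "R = max 1 ((B - p lbar) / c)"
  show "\<forall>\<^sub>F t in at_top. B \<le> p t"
    using eventually_ge_at_top[of "lbar + R powr (1 / \<beta>)"]
  proof eventually_elim
    case (elim t)
    have R: "R \<ge> 1" by (simp add: R_def)
    have t: "lbar \<le> t" using elim powr_ge_zero[of R "1 / \<beta>"] by linarith
    have "R = (R powr (1 / \<beta>)) powr \<beta>" using R assms(2) by (simp add: powr_powr)
    also have "\<dots> \<le> (t - lbar) powr \<beta>" using elim assms(2) by (intro powr_mono2) auto
    finally have "c * R \<le> c * \<bar>t - lbar\<bar> powr \<beta>" using assms(1) t by simp
    also have "\<dots> \<le> \<bar>p t - p lbar\<bar>" using sep[rule_format, of t lbar] t by simp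
    also have "\<dots> = p t - p lbar" using mono_onD[OF assms(3), of lbar t] t by simp
    finally have "c * R \<le> p t - p lbar" .
    moreover have "B - p lbar \<le> c * R"
    proof -
      have "(B - p lbar) / c \<le> R" by (simp add: R_def)
      then show ?thesis using assms(1) by (simp add: field_simps)
    qed
    ultimately show ?case by linarith
  qed
qed

lemma characteristic_measure_integral:
  assumes "continuous_on I f" "\<And>i. i \<in> {1..d} \<Longrightarrow> \<nu> i - c \<in> I"
  shows "(\<integral>t. f t \<partial>characteristic_measure I d \<nu> c) = (\<Sum>i\<in>{1..d}. f (\<nu> i - c)) / (d :: nat)"
proof -
  have "(\<lambda>i. \<nu> i - c) \<in> measurable (uniform_count_measure {1..d}) (restrict_space borel I)"
    using assms(2) by (intro measurable_restrict_space2)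
      (auto simp: space_uniform_count_measure measurable_cong_sets[OF sets_uniform_count_measure_count_space refl])
  then show ?thesis
    unfolding characteristic_measure_def
    using borel_measurable_continuous_on_restrict[OF assms(1)]
    by (subst integral_distr) (auto simp: integral_uniform_count_measure)
qed

theorem theorem17:
  fixes a :: "nat \<Rightarrow> real^2" and X :: "(real^2) set" and \<mu> :: "(real^2) measure"
    and p :: "real \<Rightarrow> real" and chi :: "real^2 \<Rightarrow> real"
    and lbar c \<beta> :: real and lam :: "nat \<Rightarrow> real"
  assumes "\<not> collinear {a 1, a 2, a 3}"
    and "is_gasket a X"
    and "is_gasket_measure a X \<mu>"
    and "continuous_on {0<..} p"
    and "lbar > 0" and "c > 0" and "\<beta> > 0"
    and "mono_on {lbar..} p"
    and "\<forall>s\<ge>lbar. \<forall>t\<ge>lbar. \<bar>p s - p t\<bar> \<ge> c * \<bar>s - t\<bar> powr \<beta>"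
    and "continuous_on X chi"
    and "mono_on {2..} lam"
    and "\<forall>j\<ge>2. six_series_eigenvalue a X \<mu> j (lam j)"
    and "\<exists>A>0. \<exists>b>1. \<forall>j\<ge>2. \<forall>z\<in>spectrum \<mu> (neg_laplacian a X \<mu>) - {lam j}.
           \<bar>z - lam j\<bar> \<ge> A * b ^ j"
  shows "let d = (\<lambda>j. multiplicity_of \<mu> (neg_laplacian a X \<mu>) (lam j)) in
    (\<exists>\<nu>. \<forall>\<^sub>F j in sequentially. is_cluster a X \<mu> p chi (lam j) (d j) (\<nu> j)) \<and>
    (\<forall>\<nu>. (\<forall>\<^sub>F j in sequentially. is_cluster a X \<mu> p chi (lam j) (d j) (\<nu> j)) \<longrightarrow>
      (\<forall>f :: real \<Rightarrow> real. continuous_on (range_interval chi X) f \<longrightarrow>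
        (\<lambda>j. \<integral>t. f t \<partial>characteristic_measure (range_interval chi X) (d j) (\<nu> j) (p (lam j)))
          \<longlonglongrightarrow> (\<integral>x. f (chi x) \<partial>\<mu>)))"
proof -
  interpret G: gasket_measure a X \<mu>
    using assms(1-3) by unfold_locales
  obtain \<phi> l where diag: "diagonal_operator \<mu> \<phi> (neg_laplacian a X \<mu>) l" and dom: "\<And>n. \<phi> n \<in> energy_domain0 a X"
    using G.neg_laplacian_eigenbasis by blast
  interpret L: diagonal_operator \<mu> \<phi> "neg_laplacian a X \<mu>" l by (rule diag)
  interpret L: laplacian_basis a X \<mu> \<phi> l
    by unfold_locales (rule dom)
  define m1 where "m1 = (INF x\<in>X. chi x)"
  define m2 where "m2 = (SUP x\<in>X. chi x)"
  have chi_bounded: "bounded (chi ` X)"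
    by (intro compact_imp_bounded compact_continuous_image assms(10) G.compact_X)
  have chi_m: "chi x \<in> {m1..m2}" if "x \<in> X" for x
    unfolding m1_def m2_def using that bounded_imp_bdd_below[OF chi_bounded] bounded_imp_bdd_above[OF chi_bounded]
    by (auto intro: cINF_lower cSUP_upper)
  have m: "m1 \<le> m2" using G.X_nonempty chi_m by fastforce
  have p_top: "filterlim p at_top at_top"
    by (rule filterlim_at_top_if_power_separated[OF assms(6,7,8,9)])
  interpret H: gasket_schrodinger a X \<mu> \<phi> l p chi m1 m2
  proof unfold_locales
    show "filterlim (\<lambda>n. p (l n)) at_top sequentially"
      by (rule filterlim_compose[OF p_top L.eigenvalues_at_top])
    show "chi \<in> borel_measurable \<mu>" by (rule G.measurable_continuous[OF assms(10)])
    show "chi x \<in> {m1..m2}" if "x \<in> space \<mu>" for x using that chi_m by simp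
    show "continuous_on X chi" by (rule assms(10))
  qed
  obtain \<psi> \<eta> where \<psi>: "maximal_diagonal_operator \<mu> \<psi> H.H \<eta>" using H.H_eigenbasis by blast
  interpret \<psi>: maximal_diagonal_operator \<mu> \<psi> H.H \<eta> by (rule \<psi>)
  define d where "d j = card {n. l n = lam j}" for j
  have d_eq: "multiplicity_of \<mu> (neg_laplacian a X \<mu>) (lam j) = d j" for j
    unfolding d_def by (rule L.multiplicity_eq)
  define I where "I j = {p (lam j) + m1..p (lam j) + m2}" for j
  have fin: "finite {k. \<eta> k \<in> I j}" for j unfolding I_def by (rule \<psi>.finite_eigenvalues_in)
  have is_cluster_iff: "is_cluster a X \<mu> p chi (lam j) n \<nu> \<longleftrightarrow> enumerates_spectrum_in \<mu> H.H (I j) n \<nu>" for j n \<nu>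
    unfolding is_cluster_def schrodinger_op_def I_def m1_def m2_def ..
  have d_ge: "3 ^ (j - 2) \<le> d j" if "j \<ge> 2" for j
    unfolding d_def using assms(12) that by (intro L.six_series_multiplicity) auto
  have d_top: "filterlim (\<lambda>j. real (d j)) at_top sequentially"
  proof (rule filterlim_at_top_mono)
    show "filterlim (\<lambda>j. real (j - 2)) at_top sequentially"
      by (intro filterlim_compose[OF filterlim_real_sequentially] filterlim_minus_const_nat_at_top)
    show "\<forall>\<^sub>F j in sequentially. real (j - 2) \<le> real (d j)"
      using eventually_ge_at_top[of 2]
    proof eventually_elim
      case (elim j)
      have "j - 2 \<le> 3 ^ (j - 2)" using less_exp[of "j - 2"] power_mono[of 2 "3::nat" "j - 2"] by simp
      then show ?case using d_ge[OF elim] by linarith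
    qed
  qed
  \<comment> \<open>The separation is assumed for points of the spectrum; every \<open>l n\<close>
    is one of them.\<close>
  obtain A b where A: "A > 0" "b > 1" "\<And>j n. j \<ge> 2 \<Longrightarrow> l n \<noteq> lam j \<Longrightarrow> A * b ^ j \<le> \<bar>l n - lam j\<bar>"
    using assms(13) L.eigenvalue_in_spectrum by (metis DiffI singletonD)
  have Ab_top: "filterlim (\<lambda>j. A * b ^ j) at_top sequentially"
    using A by (intro filterlim_tendsto_pos_mult_at_top[OF tendsto_const]
        filterlim_at_infinity_imp_filterlim_at_top filterlim_realpow_sequentially_gt1) auto
  have lam_l: "lam j \<in> range l" if "j \<ge> 2" for j
    using assms(12) that L.is_eigenvalue_iff by (auto simp: six_series_eigenvalue_def)
  have lam_top: "filterlim lam at_top sequentially"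
    unfolding filterlim_at_top
  proof
    fix B
    \<comment> \<open>A fixed eigenvalue \<open>l n \<ge> B\<close> serves as a barrier: a
      nonnegative \<open>lam j\<close> below it would be closer to it than the gap
      \<open>A * b ^ j\<close>.\<close>
    obtain n where n: "l n \<ge> B"
      using L.eigenvalues_at_top unfolding filterlim_at_top eventually_sequentially by blast
    have "\<forall>\<^sub>F j in sequentially. A * b ^ j > l n" using Ab_top unfolding filterlim_at_top_dense by blast
    then show "\<forall>\<^sub>F j in sequentially. B \<le> lam j"
      using eventually_ge_at_top[of 2]
    proof eventually_elim
      case (elim j)
      have "lam j \<ge> 0" using lam_l[OF elim(2)] L.eigenvalue_nonneg by auto
      then show ?case using A(3)[OF elim(2), of n] elim(1) n by (cases "l n = lam j") auto
    qed
  qed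
  \<comment> \<open>Eigenvalues beyond \<open>lbar\<close> are handled by the power separation, the
    finitely many others by a bound \<open>P\<close> on the values of \<open>p\<close>, since
    \<open>p (lam j)\<close> tends to infinity.\<close>
  have gap: "\<forall>\<^sub>F j in sequentially. \<forall>n. l n \<noteq> lam j \<longrightarrow> \<gamma> \<le> \<bar>p (l n) - p (lam j)\<bar>" for \<gamma>
  proof -
    define P where "P = (\<Sum>n | l n \<le> lbar. \<bar>p (l n)\<bar>)"
    have P: "\<bar>p (l n)\<bar> \<le> P" if "l n \<le> lbar" for n
      unfolding P_def using that L.finite_eigenvalues_le by (intro member_le_sum) auto
    define R where "R = max 1 (\<gamma> / c) powr (1 / \<beta>)"
    have R: "\<gamma> \<le> c * R powr \<beta>" "R \<ge> 0"
    proof -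
      have "R powr \<beta> = max 1 (\<gamma> / c)" using assms(7) by (simp add: R_def powr_powr)
      moreover have "\<gamma> / c \<le> max 1 (\<gamma> / c)" by simp
      ultimately have "\<gamma> / c \<le> R powr \<beta>" by simp
      then show "\<gamma> \<le> c * R powr \<beta>" using assms(6) by (simp add: field_simps)
    qed (simp add: R_def)
    have "\<forall>\<^sub>F j in sequentially. lam j \<ge> lbar" using lam_top unfolding filterlim_at_top by blast
    moreover have "\<forall>\<^sub>F j in sequentially. p (lam j) \<ge> P + \<gamma>"
      using filterlim_compose[OF p_top lam_top] unfolding filterlim_at_top by blast
    moreover have "\<forall>\<^sub>F j in sequentially. A * b ^ j \<ge> R" using Ab_top unfolding filterlim_at_top by blast
    ultimately show ?thesis
      using eventually_ge_at_top[of 2]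
    proof eventually_elim
      case (elim j)
      show ?case
      proof (intro allI impI)
        fix n assume n: "l n \<noteq> lam j"
        show "\<gamma> \<le> \<bar>p (l n) - p (lam j)\<bar>"
        proof (cases "l n \<le> lbar")
          case True
          then show ?thesis using P[OF True] elim(2) by linarith
        next
          case False
          have "R powr \<beta> \<le> \<bar>l n - lam j\<bar> powr \<beta>"
            using A(3)[OF elim(4) n] elim(3) R(2) assms(7) by (intro powr_mono2) auto
          then have "c * R powr \<beta> \<le> c * \<bar>l n - lam j\<bar> powr \<beta>" using assms(6) by simp
          also have "\<dots> \<le> \<bar>p (l n) - p (lam j)\<bar>" using assms(9) False elim(1) by simp
          finally show ?thesis using R(1) by linarith
        qed
      qed
    qed
  qed
  have card_K: "\<forall>\<^sub>F j in sequentially. card {k. \<eta> k \<in> I j} = d j"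
    \<comment> \<open>Any number exceeding the length \<open>m2 - m1\<close> of the cluster interval
      would serve.\<close>
    using gap[of "m2 - m1 + 1"]
  proof eventually_elim
    case (elim j)
    show ?case unfolding I_def d_def
    proof (rule antisym)
      show "card {k. \<eta> k \<in> {p (lam j) + m1..p (lam j) + m2}} \<le> card {n. l n = lam j}"
        using elim m by (intro H.card_cluster_le[OF \<psi>, of _ "m2 - m1 + 1"]) auto
      show "card {n. l n = lam j} \<le> card {k. \<eta> k \<in> {p (lam j) + m1..p (lam j) + m2}}"
        by (rule H.card_cluster_ge[OF \<psi>])
    qed
  qed
  have "\<exists>\<nu>. \<forall>\<^sub>F j in sequentially. is_cluster a X \<mu> p chi (lam j) (d j) (\<nu> j)"
  proof -
    have "\<forall>j. \<exists>\<nu>. enumerates_spectrum_in \<mu> H.H (I j) (card {k. \<eta> k \<in> I j}) \<nu>"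
      using \<psi>.enumerates_spectrum_exists[OF fin] by metis
    then obtain \<nu> where \<nu>: "\<And>j. enumerates_spectrum_in \<mu> H.H (I j) (card {k. \<eta> k \<in> I j}) (\<nu> j)" by metis
    have "\<forall>\<^sub>F j in sequentially. is_cluster a X \<mu> p chi (lam j) (d j) (\<nu> j)"
      using card_K by eventually_elim (use \<nu> is_cluster_iff in metis)
    then show ?thesis by blast
  qed
  moreover have "(\<lambda>j. \<integral>t. f t \<partial>characteristic_measure (range_interval chi X) (d j) (\<nu> j) (p (lam j)))
      \<longlonglongrightarrow> (\<integral>x. f (chi x) \<partial>\<mu>)"
    if cluster: "\<forall>\<^sub>F j in sequentially. is_cluster a X \<mu> p chi (lam j) (d j) (\<nu> j)"
      and f: "continuous_on (range_interval chi X) f" for \<nu> :: "nat \<Rightarrow> nat \<Rightarrow> real" and f :: "real \<Rightarrow> real"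
  proof -
    have range: "range_interval chi X = {m1..m2}" by (simp add: range_interval_def m1_def m2_def)
    obtain J where J: "\<And>j. j \<ge> J \<Longrightarrow> enumerates_spectrum_in \<mu> H.H (I j) (d j) (\<nu> j)" "J \<ge> 2"
    proof -
      obtain J where "\<And>j. j \<ge> J \<Longrightarrow> is_cluster a X \<mu> p chi (lam j) (d j) (\<nu> j)"
        using cluster unfolding eventually_sequentially by blast
      then show ?thesis using that[of "max J 2"] is_cluster_iff by simp
    qed
    \<comment> \<open>Shifting by \<open>J\<close> leaves only indices at which \<open>\<nu>\<close>
      enumerates a cluster and \<open>d\<close> is positive; what \<open>\<nu>\<close> does earlier
      is arbitrary.\<close>
    define x where "x j i = \<nu> (j + J) i - p (lam (j + J))" for j i
    have x_range: "x j i \<in> {m1..m2}" if "i \<in> {1..d (j + J)}" for j i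
    proof -
      have "\<nu> (j + J) i \<in> I (j + J)"
        using J(1)[of "j + J"] that by (auto simp: enumerates_spectrum_in_def)
      then show ?thesis by (simp add: x_def I_def algebra_simps)
    qed
    \<comment> \<open>Test functions live on \<open>{m1..m2}\<close> only; composing with the
      projection onto this interval gives a bounded continuous function on the line, as weak
      convergence of distributions requires.\<close>
    define g where "g t = f (max m1 (min m2 t))" for t
    have clamp: "max m1 (min m2 t) \<in> {m1..m2}" for t using m by auto
    have g: "continuous_on UNIV g"
      unfolding g_def
      by (rule continuous_on_compose2[OF f[unfolded range]]) (use clamp in \<open>auto intro!: continuous_intros\<close>)
    have "bounded (f ` {m1..m2})"
      by (intro compact_imp_bounded compact_continuous_image f[unfolded range]) simp
    then obtain B where "\<forall>y\<in>f ` {m1..m2}. norm y \<le> B" unfolding bounded_iff by blast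
    then have B: "\<bar>f t\<bar> \<le> B" if "t \<in> {m1..m2}" for t using that by auto
    have gf: "g t = f t" if "t \<in> {m1..m2}" for t using that by (simp add: g_def)
    define M0 where "M0 = distr \<mu> borel chi"
    have M0: "real_distribution M0"
      unfolding M0_def by (intro G.real_distribution_distr H.chi_measurable)
    have measure_M0: "measure M0 S = measure \<mu> {x \<in> X. chi x \<in> S}" if "S \<in> sets borel" for S
    proof -
      have "chi -` S \<inter> X = {x \<in> X. chi x \<in> S}" by auto
      then show ?thesis unfolding M0_def using that by (simp add: measure_distr)
    qed
    have dpos: "d (j + J) > 0" for j
      using d_ge[of "j + J"] J(2) by (intro gr0I) auto
    have "(\<lambda>j. (\<Sum>i\<in>{1..d (j + J)}. g (x j i)) / d (j + J)) \<longlonglongrightarrow> (\<integral>t. g t \<partial>M0)"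
    proof (rule lower_counts_imp_weak_convergence[OF M0 _ dpos _ g])
      have "{x \<in> X. chi x \<in> {m1..m2}} = space \<mu>" using chi_m by auto
      then show "measure M0 {m1..m2} = 1" using G.prob_space by (simp only: measure_M0 borel_closed closed_atLeastAtMost)
      show "\<bar>g t\<bar> \<le> B" for t unfolding g_def using B clamp by blast
      fix s1 s2 \<delta> \<epsilon> :: real assume \<delta>: "\<delta> > 0" "\<epsilon> > 0"
      have "\<forall>\<^sub>F j in sequentially. measure M0 {s1 + \<delta>..s2 - \<delta>} - \<epsilon>
          \<le> card {k. \<eta> k \<in> I j \<and> \<eta> k - p (lam j) \<in> {s1..s2}} / d j"
        using H.cluster_count_lower[OF \<psi> d_top[unfolded d_def] \<delta>, of s1 s2]
        by (simp only: I_def d_def measure_M0 borel_closed closed_atLeastAtMost)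
      then have "\<forall>\<^sub>F j in sequentially. measure M0 {s1 + \<delta>..s2 - \<delta>} - \<epsilon>
          \<le> card {k. \<eta> k \<in> I (j + J) \<and> \<eta> k - p (lam (j + J)) \<in> {s1..s2}} / d (j + J)"
        by (rule eventually_sequentially_seg[THEN iffD2])
      then show "\<forall>\<^sub>F j in sequentially. measure M0 {s1 + \<delta>..s2 - \<delta>} - \<epsilon>
          \<le> card {i \<in> {1..d (j + J)}. x j i \<in> {s1..s2}} / d (j + J)"
      proof eventually_elim
        case (elim j)
        have "card {i \<in> {1..d (j + J)}. x j i \<in> {s1..s2}} = card {k. \<eta> k \<in> I (j + J) \<and> \<eta> k - p (lam (j + J)) \<in> {s1..s2}}"
          unfolding x_def by (rule \<psi>.card_enumerated[OF fin J(1)]) simp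
        then show ?case using elim by simp
      qed
    qed
    moreover have "(\<integral>t. g t \<partial>M0) = (\<integral>x. f (chi x) \<partial>\<mu>)"
    proof -
      have "(\<integral>t. g t \<partial>M0) = (\<integral>x. g (chi x) \<partial>\<mu>)"
        unfolding M0_def using g by (intro integral_distr H.chi_measurable borel_measurable_continuous_onI)
      also have "\<dots> = (\<integral>x. f (chi x) \<partial>\<mu>)"
        by (rule Bochner_Integration.integral_cong) (auto simp: gf chi_m simp del: atLeastAtMost_iff)
      finally show ?thesis .
    qed
    moreover have "(\<integral>t. f t \<partial>characteristic_measure (range_interval chi X) (d (j + J)) (\<nu> (j + J)) (p (lam (j + J))))
        = (\<Sum>i\<in>{1..d (j + J)}. g (x j i)) / d (j + J)" for j
    proof -
      have "(\<integral>t. f t \<partial>characteristic_measure (range_interval chi X) (d (j + J)) (\<nu> (j + J)) (p (lam (j + J))))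
          = (\<Sum>i\<in>{1..d (j + J)}. f (x j i)) / d (j + J)"
        unfolding x_def by (rule characteristic_measure_integral[OF f]) (use x_range range in \<open>simp add: x_def\<close>)
      also have "(\<Sum>i\<in>{1..d (j + J)}. f (x j i)) = (\<Sum>i\<in>{1..d (j + J)}. g (x j i))"
        by (intro sum.cong refl gf[symmetric] x_range)
      finally show ?thesis .
    qed
    ultimately have "(\<lambda>j. \<integral>t. f t \<partial>characteristic_measure (range_interval chi X) (d (j + J)) (\<nu> (j + J)) (p (lam (j + J))))
        \<longlonglongrightarrow> (\<integral>x. f (chi x) \<partial>\<mu>)" by simp
    then show ?thesis by (rule LIMSEQ_offset)
  qed
  ultimately show ?thesis unfolding d_eq Let_def by blast
qed

end
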